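(* Let $\Lambda$ be an action operad. 1. There is an inclusion 2-functor $i:\Lambda\text{-}\mathbf{MonCat}\to\mathrm{Wk}\text{-}\Lambda\text{-}\mathbf{MonCat}$ from $\Lambda$-monoidal categories to weak $\Lambda$-monoidal categories, the image of which consists of those weak $\Lambda$-monoidal categories for which the underlying monoidal category is strict. 2. Every weak $\Lambda$-monoidal category is equivalent, in the 2-category $\mathrm{Wk}\text{-}\Lambda\text{-}\mathbf{MonCat}$, to one in the image of $i$.
   Context: $\mathbb N\ni 0$; $e_n$ is the identity of $\Lambda(n)$; permutations compose as functions. A (non-symmetric) operad $O$ in sets: sets $O(n)$ ($n\in\mathbb N$), $\mathrm{id}\in O(1)$, functions $\mu:O(n)\times O(k_1)\times\cdots\times O(k_n)\to O(k_1+\cdots+k_n)$, unital and associative in the usual sense; maps preserve $\mathrm{id}$ and $\mu$. The operad $\Sigma$ of symmetric groups has $\mu(\sigma;\tau_1,\dots,\tau_n)=\delta(\sigma)\cdot\beta(\tau_1,\dots,\tau_n)$, with $\beta$ the block sum of the permutations $\tau_i\in\Sigma_{k_i}$ and $\delta(\sigma)=\delta_{n;k_1,\dots,k_n}(\sigma)$ sending $k_1+\cdots+k_{i-1}+a$ ($1\le a\le k_i$) to $(\sum_{\sigma(i')<\sigma(i)}k_{i'})+a$. An action operad $(\Lambda,\pi)$: an operad $\Lambda$ in sets with a group structure on each $\Lambda(n)$ and a map of operads $\pi:\Lambda\to\Sigma$ whose components are group homomorphisms, such that, writing $g(i)=\pi_n(g)(i)$ and $g^{-1}(i)=\pi_n(g)^{-1}(i)$,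 $\mu(g';f_1',\dots,f_n')\mu(g;f_1,\dots,f_n)=\mu(g'g;f'_{g(1)}f_1,\dots,f'_{g(n)}f_n)$ for $g,g'\in\Lambda(n)$, $f_i\in\Lambda(k_i)$, $f_i'\in\Lambda(k_{g^{-1}(i)})$. Put $\beta(g_1,\dots,g_n)=\mu(e_n;g_1,\dots,g_n)$ and $\delta_{n;k_1,\dots,k_n}(g)=\mu(g;e_{k_1},\dots,e_{k_n})$. $\Lambda$-monoidal categories. $E\Lambda$ is the operad in $\mathbf{Cat}$ where $E\Lambda(n)$ has object set $\Lambda(n)$ and exactly one morphism between any two objects, operad structure as in $\Lambda$ on objects, right $\Lambda(n)$-action by right multiplication. $\underline{E\Lambda}$ is the 2-monad on $\mathbf{Cat}$, $\underline{E\Lambda}(X)=\coprod_nE\Lambda(n)\otimes_{\Lambda(n)}X^n$ (the coequalizer identifying $(p\cdot g,\underline x)$ with $(p,g\cdot\underline x)$, where $g\cdot(x_1,\dots,x_n)=(x_{g^{-1}(1)},\dots,x_{g^{-1}(n)})$), with unit $x\mapsto[e_1;x]$ and multiplication induced by operad multiplication. $\Lambda\text{-}\mathbf{MonCat}$ is the 2-category of strict $\underline{E\Lambda}$-algebras, strict morphisms and algebra 2-cells. Such an algebra $X$ has a strict tensor product given on objects by the images of $[e_n;x_1,\dots,x_n]$, and for $g\in\Lambda(n)$ the unique isomorphism $e_n\cong g$ in $E\Lambda(n)$ gives an isomorphism $[g]:x_1\otimes\cdots\otimes x_n\to x_{g^{-1}(1)}\otimes\cdots\otimes x_{g^{-1}(n)}$,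 since $[g;x_1,\dots,x_n]=[e_n;x_{g^{-1}(1)},\dots,x_{g^{-1}(n)}]$; the inclusion regards $X$ with this structure. Weak $\Lambda$-monoidal categories. In a monoidal category write $\underline{x_1\cdots x_n}$ for the standard association: $\underline{\emptyset}=I$, $\underline{x}=x$, $\underline{x_1\cdots x_{n+1}}=x_1\otimes\underline{x_2\cdots x_{n+1}}$. A weak $\Lambda$-monoidal category is a monoidal category $M$ with, for every $g\in\Lambda(n)$, an isomorphism $[g]:\underline{x_1\cdots x_n}\cong\underline{x_{g^{-1}(1)}\cdots x_{g^{-1}(n)}}$ natural in $x_1,\dots,x_n$, such that: (1) $[h]\circ[g]=[hg]$ for $g,h\in\Lambda(n)$; (2) for $h_i\in\Lambda(k_i)$ ($1\le i\le n$) and objects $x_{ij}$ ($1\le i\le n$, $1\le j\le k_i$), $[\beta(h_1,\dots,h_n)]$ on the list $x_{11},\dots,x_{nk_n}$ equals the composite of the unique coherence reassociation to $\underline{\underline{x_{11}\cdots x_{1k_1}}\cdots\underline{x_{n1}\cdots x_{nk_n}}}$, the standardly associated tensor product of $[h_1],\dots,[h_n]$, and the unique coherence reassociation back to standard association; (3) for $g\in\Lambda(n)$, natural numbers $k_1,\dots,k_n$ and objects $x_{ij}$ ($1\le i\le n$, $1\le j\le k_i$), $[\delta_{n;k_1,\dots,k_n}(g)]$ on $x_{11},\dots,x_{nk_n}$ equals the composite of the coherence reassociation to $\underline{y_1\cdots y_n}$, where $y_i=\underline{x_{i1}\cdots x_{ik_i}}$, the map $[g]$ for $y_1,\dots,y_n$,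 and the coherence reassociation of $\underline{y_{g^{-1}(1)}\cdots y_{g^{-1}(n)}}$ to standard association. A weak $\Lambda$-monoidal functor is a (strong) monoidal functor $F:M\to N$ such that for all $g\in\Lambda(n)$ and $x_1,\dots,x_n\in M$, $F_n\circ[g]=F[g]\circ F_n$, where $F_n:\underline{Fx_1\cdots Fx_n}\cong F(\underline{x_1\cdots x_n})$ is the canonical isomorphism induced by the monoidal constraints. $\mathrm{Wk}\text{-}\Lambda\text{-}\mathbf{MonCat}$ is the 2-category of weak $\Lambda$-monoidal categories, weak $\Lambda$-monoidal functors and monoidal transformations. *)

theory Defs
  imports
    "HOL-Algebra.Group"
    "HOL-Combinatorics.Permutations"
    "HOL-Library.FuncSet"
    "HOL-Library.Infinite_Typeclass"
begin

section \<open>Action operads\<close>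

text \<open>
  The sets \<open>Op n\<close> may overlap for different \<open>n\<close> (for instance the identity function lies in every
  symmetric group), so the multiplication takes the arities \<open>k\<^sub>1, \<dots>, k\<^sub>n\<close> as its first argument:
  \<open>mu ks g fs\<close> is \<open>\<mu>(g; f\<^sub>1, \<dots>, f\<^sub>n)\<close> with \<open>g \<in> Op n\<close> and \<open>f\<^sub>i \<in> Op k\<^sub>i\<close>, where \<open>n\<close> is the length of
  \<open>ks\<close>.  Lists, hence also permutations, are indexed from \<open>0\<close>.
\<close>

locale operad =
  fixes Op :: "nat \<Rightarrow> 'a set"
    and opid :: 'a
    and mu :: "nat list \<Rightarrow> 'a \<Rightarrow> 'a list \<Rightarrow> 'a"
  assumes opid_closed: "opid \<in> Op 1"
    and mu_closed: "\<lbrakk>g \<in> Op (length ks); list_all2 (\<lambda>f k. f \<in> Op k) fs ks\<rbrakk>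
        \<Longrightarrow> mu ks g fs \<in> Op (sum_list ks)"
    and unit_right: "g \<in> Op n \<Longrightarrow> mu (replicate n 1) g (replicate n opid) = g"
    and unit_left: "g \<in> Op n \<Longrightarrow> mu [n] opid [g] = g"
    and mu_assoc: "\<lbrakk>f \<in> Op n; length gs = n; length hss = n; length lss = n;
          \<And>i. i < n \<Longrightarrow> gs ! i \<in> Op (length (lss ! i));
          \<And>i. i < n \<Longrightarrow> list_all2 (\<lambda>h l. h \<in> Op l) (hss ! i) (lss ! i)\<rbrakk>
        \<Longrightarrow> mu (concat lss) (mu (map length lss) f gs) (concat hss) =
            mu (map sum_list lss) f (map (\<lambda>i. mu (lss ! i) (gs ! i) (hss ! i)) [0..<n])"

definition operad_map ::
  "(nat \<Rightarrow> 'a set) \<Rightarrow> 'a \<Rightarrow> (nat list \<Rightarrow> 'a \<Rightarrow> 'a list \<Rightarrow> 'a) \<Rightarrow>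
   (nat \<Rightarrow> 'b set) \<Rightarrow> 'b \<Rightarrow> (nat list \<Rightarrow> 'b \<Rightarrow> 'b list \<Rightarrow> 'b) \<Rightarrow>
   (nat \<Rightarrow> 'a \<Rightarrow> 'b) \<Rightarrow> bool" where
  "operad_map Op1 id1 mu1 Op2 id2 mu2 \<phi> \<longleftrightarrow>
     (\<forall>n. \<phi> n \<in> Op1 n \<rightarrow> Op2 n) \<and>
     \<phi> 1 id1 = id2 \<and>
     (\<forall>ks g fs. g \<in> Op1 (length ks) \<longrightarrow> list_all2 (\<lambda>f k. f \<in> Op1 k) fs ks \<longrightarrow>
        \<phi> (sum_list ks) (mu1 ks g fs) = mu2 ks (\<phi> (length ks) g) (map2 \<phi> ks fs))"

definition symgrp :: "nat \<Rightarrow> (nat \<Rightarrow> nat) monoid" where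
  "symgrp n = \<lparr>carrier = {\<sigma>. \<sigma> permutes {..<n}}, monoid.mult = (\<circ>), one = id\<rparr>"

text \<open>
  For blocks of lengths \<open>ks\<close>, a position \<open>m < sum_list ks\<close> is uniquely
  \<open>block_start ks i + a\<close> with \<open>a < ks ! i\<close>; then \<open>i = block ks m\<close> and \<open>a = block_pos ks m\<close>.
\<close>

definition block_start :: "nat list \<Rightarrow> nat \<Rightarrow> nat" where
  "block_start ks i = sum_list (take i ks)"

definition block :: "nat list \<Rightarrow> nat \<Rightarrow> nat" where
  "block ks m = (LEAST i. m < block_start ks (Suc i))"

definition block_pos :: "nat list \<Rightarrow> nat \<Rightarrow> nat" where
  "block_pos ks m = m - block_start ks (block ks m)"

definition sym_beta :: "nat list \<Rightarrow> (nat \<Rightarrow> nat) list \<Rightarrow> nat \<Rightarrow> nat" where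
  "sym_beta ks \<tau>s m =
     (if m < sum_list ks
      then block_start ks (block ks m) + (\<tau>s ! block ks m) (block_pos ks m)
      else m)"

definition sym_delta :: "nat list \<Rightarrow> (nat \<Rightarrow> nat) \<Rightarrow> nat \<Rightarrow> nat" where
  "sym_delta ks \<sigma> m =
     (if m < sum_list ks
      then (\<Sum>i | i < length ks \<and> \<sigma> i < \<sigma> (block ks m). ks ! i) + block_pos ks m
      else m)"

definition sym_mu :: "nat list \<Rightarrow> (nat \<Rightarrow> nat) \<Rightarrow> (nat \<Rightarrow> nat) list \<Rightarrow> nat \<Rightarrow> nat" where
  "sym_mu ks \<sigma> \<tau>s = sym_delta ks \<sigma> \<circ> sym_beta ks \<tau>s"

record 'g action_operad_data =
  grp :: "nat \<Rightarrow> 'g monoid"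
  aid :: 'g
  amu :: "nat list \<Rightarrow> 'g \<Rightarrow> 'g list \<Rightarrow> 'g"
  perm :: "nat \<Rightarrow> 'g \<Rightarrow> nat \<Rightarrow> nat"

abbreviation el :: "('g, 'z) action_operad_data_scheme \<Rightarrow> nat \<Rightarrow> 'g set" where
  "el L n \<equiv> carrier (grp L n)"

abbreviation eL :: "('g, 'z) action_operad_data_scheme \<Rightarrow> nat \<Rightarrow> 'g" where
  "eL L n \<equiv> one (grp L n)"

text \<open>
  The left action on lists: entry \<open>i\<close> of \<open>lact L g xs\<close> is entry \<open>\<pi>(g)\<inverse>(i)\<close> of \<open>xs\<close>.
\<close>

definition lact :: "('g, 'z) action_operad_data_scheme \<Rightarrow> 'g \<Rightarrow> 'x list \<Rightarrow> 'x list" where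
  "lact L g xs = permute_list (inv_into UNIV (perm L (length xs) g)) xs"

locale action_operad =
  operad "el L" "aid L" "amu L" for L :: "'g action_operad_data" +
  assumes grp: "group (grp L n)"
    and perm_operad_map:
      "operad_map (el L) (aid L) (amu L) (\<lambda>n. carrier (symgrp n)) id sym_mu (perm L)"
    and perm_hom: "perm L n \<in> hom (grp L n) (symgrp n)"
    and interchange:
      "\<lbrakk>n = length ks; g \<in> el L n; g' \<in> el L n;
        list_all2 (\<lambda>f k. f \<in> el L k) fs ks;
        list_all2 (\<lambda>f k. f \<in> el L k) fs' (lact L g ks)\<rbrakk>
       \<Longrightarrow> amu L (lact L g ks) g' fs' \<otimes>\<^bsub>grp L (sum_list ks)\<^esub> amu L ks g fs =
           amu L ks (g' \<otimes>\<^bsub>grp L n\<^esub> g)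
             (map (\<lambda>i. fs' ! perm L n g i \<otimes>\<^bsub>grp L (ks ! i)\<^esub> fs ! i) [0..<n])"

definition beta :: "('g, 'z) action_operad_data_scheme \<Rightarrow> nat list \<Rightarrow> 'g list \<Rightarrow> 'g" where
  "beta L ks hs = amu L ks (eL L (length ks)) hs"

definition delta :: "('g, 'z) action_operad_data_scheme \<Rightarrow> nat list \<Rightarrow> 'g \<Rightarrow> 'g" where
  "delta L ks g = amu L ks g (map (eL L) ks)"


section \<open>Categories, functors, transformations\<close>

text \<open>
  Categories are small with explicit carriers.  All structure maps are required to be extensional
  (\<open>\<rightarrow>\<^sub>E\<close>: equal to \<open>undefined\<close> off their domain), so that equality of HOL values is equality
  of categories, functors, etc.  The 2-categories below consist of the categories carried by two
  fixed types of objects and arrows; these play the role of a universe, and have to be infinite for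
  the universe to be closed under strictification.
\<close>

record ('o, 'a) cat =
  obj :: "'o set"
  arr :: "'a set"
  src :: "'a \<Rightarrow> 'o"
  tgt :: "'a \<Rightarrow> 'o"
  ide :: "'o \<Rightarrow> 'a"
  cmp :: "'a \<times> 'a \<Rightarrow> 'a"

abbreviation cat_comp :: "'a \<Rightarrow> ('o, 'a, 'z) cat_scheme \<Rightarrow> 'a \<Rightarrow> 'a"
    ("(_ \<cdot>\<^bsub>_\<^esub>/ _)" [56, 0, 55] 55) where
  "g \<cdot>\<^bsub>C\<^esub> f \<equiv> cmp C (g, f)"

definition composable :: "('o, 'a, 'z) cat_scheme \<Rightarrow> ('a \<times> 'a) set" where
  "composable C = {(g, f). g \<in> arr C \<and> f \<in> arr C \<and> src C g = tgt C f}"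

definition homset :: "('o, 'a, 'z) cat_scheme \<Rightarrow> 'o \<Rightarrow> 'o \<Rightarrow> 'a set" where
  "homset C x y = {f \<in> arr C. src C f = x \<and> tgt C f = y}"

locale category =
  fixes C :: "('o, 'a, 'z) cat_scheme"
  assumes src_type: "src C \<in> arr C \<rightarrow>\<^sub>E obj C"
    and tgt_type: "tgt C \<in> arr C \<rightarrow>\<^sub>E obj C"
    and ide_type: "ide C \<in> obj C \<rightarrow>\<^sub>E arr C"
    and cmp_type: "cmp C \<in> composable C \<rightarrow>\<^sub>E arr C"
    and ide_homset: "x \<in> obj C \<Longrightarrow> ide C x \<in> homset C x x"
    and cmp_homset: "\<lbrakk>f \<in> homset C x y; g \<in> homset C y z\<rbrakk> \<Longrightarrow> g \<cdot>\<^bsub>C\<^esub> f \<in> homset C x z"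
    and cmp_assoc: "\<lbrakk>f \<in> homset C w x; g \<in> homset C x y; h \<in> homset C y z\<rbrakk>
        \<Longrightarrow> (h \<cdot>\<^bsub>C\<^esub> g) \<cdot>\<^bsub>C\<^esub> f = h \<cdot>\<^bsub>C\<^esub> (g \<cdot>\<^bsub>C\<^esub> f)"
    and cmp_ide_right: "f \<in> homset C x y \<Longrightarrow> f \<cdot>\<^bsub>C\<^esub> ide C x = f"
    and cmp_ide_left: "f \<in> homset C x y \<Longrightarrow> ide C y \<cdot>\<^bsub>C\<^esub> f = f"

definition inverse_arrows :: "('o, 'a, 'z) cat_scheme \<Rightarrow> 'a \<Rightarrow> 'a \<Rightarrow> bool" where
  "inverse_arrows C f g \<longleftrightarrow>
     f \<in> arr C \<and> g \<in> arr C \<and> src C g = tgt C f \<and> tgt C g = src C f \<and>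
     g \<cdot>\<^bsub>C\<^esub> f = ide C (src C f) \<and> f \<cdot>\<^bsub>C\<^esub> g = ide C (tgt C f)"

definition iso_arr :: "('o, 'a, 'z) cat_scheme \<Rightarrow> 'a \<Rightarrow> bool" where
  "iso_arr C f \<longleftrightarrow> (\<exists>g. inverse_arrows C f g)"

definition prod_cat ::
  "('o, 'a, 'z) cat_scheme \<Rightarrow> ('p, 'b, 'y) cat_scheme \<Rightarrow> ('o \<times> 'p, 'a \<times> 'b) cat" where
  "prod_cat C D =
     \<lparr>obj = obj C \<times> obj D,
      arr = arr C \<times> arr D,
      src = restrict (\<lambda>(f, g). (src C f, src D g)) (arr C \<times> arr D),
      tgt = restrict (\<lambda>(f, g). (tgt C f, tgt D g)) (arr C \<times> arr D),
      ide = restrict (\<lambda>(x, y). (ide C x, ide D y)) (obj C \<times> obj D),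
      cmp = restrict (\<lambda>((f', g'), (f, g)). (f' \<cdot>\<^bsub>C\<^esub> f, g' \<cdot>\<^bsub>D\<^esub> g))
              {((f', g'), (f, g)). (f', f) \<in> composable C \<and> (g', g) \<in> composable D}\<rparr>"

record ('o, 'a, 'p, 'b) fctr =
  fobj :: "'o \<Rightarrow> 'p"
  farr :: "'a \<Rightarrow> 'b"

locale cat_functor = dom: category C + cod: category D
  for C :: "('o, 'a, 'z) cat_scheme" and D :: "('p, 'b, 'y) cat_scheme" +
  fixes F :: "('o, 'a, 'p, 'b, 'm) fctr_scheme"
  assumes fobj_type: "fobj F \<in> obj C \<rightarrow>\<^sub>E obj D"
    and farr_type: "farr F \<in> arr C \<rightarrow>\<^sub>E arr D"
    and farr_homset: "f \<in> homset C x y \<Longrightarrow> farr F f \<in> homset D (fobj F x) (fobj F y)"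
    and farr_ide: "x \<in> obj C \<Longrightarrow> farr F (ide C x) = ide D (fobj F x)"
    and farr_cmp: "\<lbrakk>f \<in> homset C x y; g \<in> homset C y z\<rbrakk>
        \<Longrightarrow> farr F (g \<cdot>\<^bsub>C\<^esub> f) = farr F g \<cdot>\<^bsub>D\<^esub> farr F f"

definition fid :: "('o, 'a, 'z) cat_scheme \<Rightarrow> ('o, 'a, 'o, 'a) fctr" where
  "fid C = \<lparr>fobj = (\<lambda>x\<in>obj C. x), farr = (\<lambda>f\<in>arr C. f)\<rparr>"

text \<open>\<open>fcomp C G F\<close> is \<open>G \<circ> F\<close>, where \<open>C\<close> is the domain of \<open>F\<close>.\<close>

definition fcomp ::
  "('o, 'a, 'z) cat_scheme \<Rightarrow> ('p, 'b, 'q, 'c, 'm) fctr_scheme \<Rightarrow>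
   ('o, 'a, 'p, 'b, 'n) fctr_scheme \<Rightarrow> ('o, 'a, 'q, 'c) fctr" where
  "fcomp C G F = \<lparr>fobj = compose (obj C) (fobj G) (fobj F),
                  farr = compose (arr C) (farr G) (farr F)\<rparr>"

locale nat_trans = dom_functor: cat_functor C D F + cod_functor: cat_functor C D G
  for C :: "('o, 'a, 'z) cat_scheme" and D :: "('p, 'b, 'y) cat_scheme"
    and F :: "('o, 'a, 'p, 'b, 'm) fctr_scheme" and G :: "('o, 'a, 'p, 'b, 'n) fctr_scheme" +
  fixes t :: "'o \<Rightarrow> 'b"
  assumes component_type: "t \<in> obj C \<rightarrow>\<^sub>E arr D"
    and component_homset: "x \<in> obj C \<Longrightarrow> t x \<in> homset D (fobj F x) (fobj G x)"
    and naturality: "f \<in> homset C x y \<Longrightarrow> t y \<cdot>\<^bsub>D\<^esub> farr F f = farr G f \<cdot>\<^bsub>D\<^esub> t x"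

definition nt_id ::
  "('o, 'a, 'z) cat_scheme \<Rightarrow> ('p, 'b, 'y) cat_scheme \<Rightarrow>
   ('o, 'a, 'p, 'b, 'm) fctr_scheme \<Rightarrow> 'o \<Rightarrow> 'b" where
  "nt_id C D F = (\<lambda>x\<in>obj C. ide D (fobj F x))"

definition nt_vcomp ::
  "('o, 'a, 'z) cat_scheme \<Rightarrow> ('p, 'b, 'y) cat_scheme \<Rightarrow>
   ('o \<Rightarrow> 'b) \<Rightarrow> ('o \<Rightarrow> 'b) \<Rightarrow> 'o \<Rightarrow> 'b" where
  "nt_vcomp C D s t = (\<lambda>x\<in>obj C. s x \<cdot>\<^bsub>D\<^esub> t x)"

text \<open>
  \<open>nt_hcomp C E F' G s t\<close> is the horizontal composite \<open>s * t : G \<circ> F \<Rightarrow> G' \<circ> F'\<close> of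
  \<open>t : F \<Rightarrow> F' : C \<rightarrow> D\<close> and \<open>s : G \<Rightarrow> G' : D \<rightarrow> E\<close>.
\<close>

definition nt_hcomp ::
  "('o, 'a, 'z) cat_scheme \<Rightarrow> ('q, 'c, 'y) cat_scheme \<Rightarrow>
   ('o, 'a, 'p, 'b, 'm) fctr_scheme \<Rightarrow> ('p, 'b, 'q, 'c, 'n) fctr_scheme \<Rightarrow>
   ('p \<Rightarrow> 'c) \<Rightarrow> ('o \<Rightarrow> 'b) \<Rightarrow> 'o \<Rightarrow> 'c" where
  "nt_hcomp C E F' G s t = (\<lambda>x\<in>obj C. s (fobj F' x) \<cdot>\<^bsub>E\<^esub> farr G (t x))"


section \<open>2-categories\<close>

text \<open>
  Cells are indexed by their boundaries: \<open>cell1 K A B\<close> are the 1-cells \<open>A \<rightarrow> B\<close> and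
  \<open>cell2 K A B f g\<close> the 2-cells \<open>f \<Rightarrow> g : A \<rightarrow> B\<close>; the same HOL value may occur with several
  boundaries.  Accordingly all operations take boundary data as arguments:
  \<open>comp1 K A B C g f\<close> is \<open>g \<circ> f\<close> for \<open>f : A \<rightarrow> B\<close>, \<open>g : B \<rightarrow> C\<close>; \<open>vcomp K A B s t\<close> is \<open>s \<circ> t\<close>;
  \<open>hcomp K A B C f f' g g' s t\<close> is \<open>s * t\<close> for \<open>t : f \<Rightarrow> f' : A \<rightarrow> B\<close>, \<open>s : g \<Rightarrow> g' : B \<rightarrow> C\<close>.
\<close>

record ('c, 'f, 't) two_cat =
  cell0 :: "'c set"
  cell1 :: "'c \<Rightarrow> 'c \<Rightarrow> 'f set"
  cell2 :: "'c \<Rightarrow> 'c \<Rightarrow> 'f \<Rightarrow> 'f \<Rightarrow> 't set"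
  id1 :: "'c \<Rightarrow> 'f"
  comp1 :: "'c \<Rightarrow> 'c \<Rightarrow> 'c \<Rightarrow> 'f \<Rightarrow> 'f \<Rightarrow> 'f"
  id2 :: "'c \<Rightarrow> 'c \<Rightarrow> 'f \<Rightarrow> 't"
  vcomp :: "'c \<Rightarrow> 'c \<Rightarrow> 't \<Rightarrow> 't \<Rightarrow> 't"
  hcomp :: "'c \<Rightarrow> 'c \<Rightarrow> 'c \<Rightarrow> 'f \<Rightarrow> 'f \<Rightarrow> 'f \<Rightarrow> 'f \<Rightarrow> 't \<Rightarrow> 't \<Rightarrow> 't"

locale two_category =
  fixes K :: "('c, 'f, 't) two_cat"
  assumes id1_cell: "A \<in> cell0 K \<Longrightarrow> id1 K A \<in> cell1 K A A"
    and comp1_cell: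
      "\<lbrakk>A \<in> cell0 K; B \<in> cell0 K; C \<in> cell0 K; f \<in> cell1 K A B; g \<in> cell1 K B C\<rbrakk>
       \<Longrightarrow> comp1 K A B C g f \<in> cell1 K A C"
    and comp1_assoc:
      "\<lbrakk>A \<in> cell0 K; B \<in> cell0 K; C \<in> cell0 K; D \<in> cell0 K;
        f \<in> cell1 K A B; g \<in> cell1 K B C; h \<in> cell1 K C D\<rbrakk>
       \<Longrightarrow> comp1 K A B D (comp1 K B C D h g) f = comp1 K A C D h (comp1 K A B C g f)"
    and comp1_id_right:
      "\<lbrakk>A \<in> cell0 K; B \<in> cell0 K; f \<in> cell1 K A B\<rbrakk> \<Longrightarrow> comp1 K A A B f (id1 K A) = f"
    and comp1_id_left:
      "\<lbrakk>A \<in> cell0 K; B \<in> cell0 K; f \<in> cell1 K A B\<rbrakk> \<Longrightarrow> comp1 K A B B (id1 K B) f = f"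
    and id2_cell:
      "\<lbrakk>A \<in> cell0 K; B \<in> cell0 K; f \<in> cell1 K A B\<rbrakk> \<Longrightarrow> id2 K A B f \<in> cell2 K A B f f"
    and vcomp_cell:
      "\<lbrakk>A \<in> cell0 K; B \<in> cell0 K; f \<in> cell1 K A B; g \<in> cell1 K A B; h \<in> cell1 K A B;
        t \<in> cell2 K A B f g; s \<in> cell2 K A B g h\<rbrakk>
       \<Longrightarrow> vcomp K A B s t \<in> cell2 K A B f h"
    and vcomp_assoc:
      "\<lbrakk>A \<in> cell0 K; B \<in> cell0 K;
        f \<in> cell1 K A B; g \<in> cell1 K A B; h \<in> cell1 K A B; k \<in> cell1 K A B;
        t \<in> cell2 K A B f g; s \<in> cell2 K A B g h; r \<in> cell2 K A B h k\<rbrakk>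
       \<Longrightarrow> vcomp K A B (vcomp K A B r s) t = vcomp K A B r (vcomp K A B s t)"
    and vcomp_id_right:
      "\<lbrakk>A \<in> cell0 K; B \<in> cell0 K; f \<in> cell1 K A B; g \<in> cell1 K A B; t \<in> cell2 K A B f g\<rbrakk>
       \<Longrightarrow> vcomp K A B t (id2 K A B f) = t"
    and vcomp_id_left:
      "\<lbrakk>A \<in> cell0 K; B \<in> cell0 K; f \<in> cell1 K A B; g \<in> cell1 K A B; t \<in> cell2 K A B f g\<rbrakk>
       \<Longrightarrow> vcomp K A B (id2 K A B g) t = t"
    and hcomp_cell:
      "\<lbrakk>A \<in> cell0 K; B \<in> cell0 K; C \<in> cell0 K;
        f \<in> cell1 K A B; f' \<in> cell1 K A B; g \<in> cell1 K B C; g' \<in> cell1 K B C;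
        t \<in> cell2 K A B f f'; s \<in> cell2 K B C g g'\<rbrakk>
       \<Longrightarrow> hcomp K A B C f f' g g' s t
             \<in> cell2 K A C (comp1 K A B C g f) (comp1 K A B C g' f')"
    and hcomp_id2:
      "\<lbrakk>A \<in> cell0 K; B \<in> cell0 K; C \<in> cell0 K; f \<in> cell1 K A B; g \<in> cell1 K B C\<rbrakk>
       \<Longrightarrow> hcomp K A B C f f g g (id2 K B C g) (id2 K A B f) = id2 K A C (comp1 K A B C g f)"
    and hcomp_vcomp:
      "\<lbrakk>A \<in> cell0 K; B \<in> cell0 K; C \<in> cell0 K;
        f \<in> cell1 K A B; f' \<in> cell1 K A B; f'' \<in> cell1 K A B;
        g \<in> cell1 K B C; g' \<in> cell1 K B C; g'' \<in> cell1 K B C;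
        t \<in> cell2 K A B f f'; t' \<in> cell2 K A B f' f'';
        s \<in> cell2 K B C g g'; s' \<in> cell2 K B C g' g''\<rbrakk>
       \<Longrightarrow> hcomp K A B C f f'' g g'' (vcomp K B C s' s) (vcomp K A B t' t) =
           vcomp K A C (hcomp K A B C f' f'' g' g'' s' t') (hcomp K A B C f f' g g' s t)"
    and hcomp_assoc:
      "\<lbrakk>A \<in> cell0 K; B \<in> cell0 K; C \<in> cell0 K; D \<in> cell0 K;
        f \<in> cell1 K A B; f' \<in> cell1 K A B; g \<in> cell1 K B C; g' \<in> cell1 K B C;
        h \<in> cell1 K C D; h' \<in> cell1 K C D;
        t \<in> cell2 K A B f f'; s \<in> cell2 K B C g g'; r \<in> cell2 K C D h h'\<rbrakk>
       \<Longrightarrow> hcomp K A B D f f' (comp1 K B C D h g) (comp1 K B C D h' g')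
             (hcomp K B C D g g' h h' r s) t =
           hcomp K A C D (comp1 K A B C g f) (comp1 K A B C g' f') h h'
             r (hcomp K A B C f f' g g' s t)"
    and hcomp_id_right:
      "\<lbrakk>A \<in> cell0 K; B \<in> cell0 K; f \<in> cell1 K A B; f' \<in> cell1 K A B; t \<in> cell2 K A B f f'\<rbrakk>
       \<Longrightarrow> hcomp K A A B (id1 K A) (id1 K A) f f' t (id2 K A A (id1 K A)) = t"
    and hcomp_id_left:
      "\<lbrakk>A \<in> cell0 K; B \<in> cell0 K; f \<in> cell1 K A B; f' \<in> cell1 K A B; t \<in> cell2 K A B f f'\<rbrakk>
       \<Longrightarrow> hcomp K A B B f f' (id1 K B) (id1 K B) (id2 K B B (id1 K B)) t = t"

record ('c, 'f, 't, 'd, 'g, 'u) two_fctr =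
  tf0 :: "'c \<Rightarrow> 'd"
  tf1 :: "'c \<Rightarrow> 'c \<Rightarrow> 'f \<Rightarrow> 'g"
  tf2 :: "'c \<Rightarrow> 'c \<Rightarrow> 'f \<Rightarrow> 'f \<Rightarrow> 't \<Rightarrow> 'u"

locale two_functor = dom: two_category K + cod: two_category N
  for K :: "('c, 'f, 't) two_cat" and N :: "('d, 'g, 'u) two_cat" +
  fixes J :: "('c, 'f, 't, 'd, 'g, 'u) two_fctr"
  assumes tf0_cell: "A \<in> cell0 K \<Longrightarrow> tf0 J A \<in> cell0 N"
    and tf1_cell:
      "\<lbrakk>A \<in> cell0 K; B \<in> cell0 K; f \<in> cell1 K A B\<rbrakk>
       \<Longrightarrow> tf1 J A B f \<in> cell1 N (tf0 J A) (tf0 J B)"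
    and tf2_cell:
      "\<lbrakk>A \<in> cell0 K; B \<in> cell0 K; f \<in> cell1 K A B; g \<in> cell1 K A B; t \<in> cell2 K A B f g\<rbrakk>
       \<Longrightarrow> tf2 J A B f g t \<in> cell2 N (tf0 J A) (tf0 J B) (tf1 J A B f) (tf1 J A B g)"
    and tf1_id1: "A \<in> cell0 K \<Longrightarrow> tf1 J A A (id1 K A) = id1 N (tf0 J A)"
    and tf1_comp1:
      "\<lbrakk>A \<in> cell0 K; B \<in> cell0 K; C \<in> cell0 K; f \<in> cell1 K A B; g \<in> cell1 K B C\<rbrakk>
       \<Longrightarrow> tf1 J A C (comp1 K A B C g f) =
           comp1 N (tf0 J A) (tf0 J B) (tf0 J C) (tf1 J B C g) (tf1 J A B f)"
    and tf2_id2: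
      "\<lbrakk>A \<in> cell0 K; B \<in> cell0 K; f \<in> cell1 K A B\<rbrakk>
       \<Longrightarrow> tf2 J A B f f (id2 K A B f) = id2 N (tf0 J A) (tf0 J B) (tf1 J A B f)"
    and tf2_vcomp:
      "\<lbrakk>A \<in> cell0 K; B \<in> cell0 K; f \<in> cell1 K A B; g \<in> cell1 K A B; h \<in> cell1 K A B;
        t \<in> cell2 K A B f g; s \<in> cell2 K A B g h\<rbrakk>
       \<Longrightarrow> tf2 J A B f h (vcomp K A B s t) =
           vcomp N (tf0 J A) (tf0 J B) (tf2 J A B g h s) (tf2 J A B f g t)"
    and tf2_hcomp:
      "\<lbrakk>A \<in> cell0 K; B \<in> cell0 K; C \<in> cell0 K;
        f \<in> cell1 K A B; f' \<in> cell1 K A B; g \<in> cell1 K B C; g' \<in> cell1 K B C;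
        t \<in> cell2 K A B f f'; s \<in> cell2 K B C g g'\<rbrakk>
       \<Longrightarrow> tf2 J A C (comp1 K A B C g f) (comp1 K A B C g' f')
             (hcomp K A B C f f' g g' s t) =
           hcomp N (tf0 J A) (tf0 J B) (tf0 J C)
             (tf1 J A B f) (tf1 J A B f') (tf1 J B C g) (tf1 J B C g')
             (tf2 J B C g g' s) (tf2 J A B f f' t)"

text \<open>A 2-functor that is injective on 0-, 1- and 2-cells, i.e. exhibits a sub-2-category.\<close>

locale inclusion_two_functor = two_functor +
  assumes tf0_inj: "inj_on (tf0 J) (cell0 K)"
    and tf1_inj: "\<lbrakk>A \<in> cell0 K; B \<in> cell0 K\<rbrakk> \<Longrightarrow> inj_on (tf1 J A B) (cell1 K A B)"
    and tf2_inj: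
      "\<lbrakk>A \<in> cell0 K; B \<in> cell0 K; f \<in> cell1 K A B; g \<in> cell1 K A B\<rbrakk>
       \<Longrightarrow> inj_on (tf2 J A B f g) (cell2 K A B f g)"

definition iso_cell1 :: "('c, 'f, 't) two_cat \<Rightarrow> 'c \<Rightarrow> 'c \<Rightarrow> 'f \<Rightarrow> 'f \<Rightarrow> bool" where
  "iso_cell1 K A B f g \<longleftrightarrow>
     (\<exists>s \<in> cell2 K A B f g. \<exists>t \<in> cell2 K A B g f.
        vcomp K A B t s = id2 K A B f \<and> vcomp K A B s t = id2 K A B g)"

definition equivalent :: "('c, 'f, 't) two_cat \<Rightarrow> 'c \<Rightarrow> 'c \<Rightarrow> bool" where
  "equivalent K A B \<longleftrightarrow>
     A \<in> cell0 K \<and> B \<in> cell0 K \<and>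
     (\<exists>f \<in> cell1 K A B. \<exists>g \<in> cell1 K B A.
        iso_cell1 K A A (comp1 K A B A g f) (id1 K A) \<and>
        iso_cell1 K B B (comp1 K B A B f g) (id1 K B))"


section \<open>The 2-monad and its strict algebras\<close>

type_synonym ('g, 'o) oorb = "('g \<times> 'o list) set"
type_synonym ('g, 'a) aorb = "(('g \<times> 'g) \<times> 'a list) set"

text \<open>
  An object of \<open>E\<Lambda>(n) \<times> X\<^sup>n\<close> is a pair \<open>(p, xs)\<close>; a morphism is a pair \<open>((p, q), fs)\<close>, where \<open>(p, q)\<close>
  stands for the unique morphism \<open>p \<rightarrow> q\<close> of \<open>E\<Lambda>(n)\<close>.  The coproduct over \<open>n\<close> is left implicit,
  since \<open>n\<close> is the length of the list.  The relations \<open>oorel\<close> and \<open>aorel\<close> relate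
  \<open>(p \<cdot> g, xs)\<close> to \<open>(p, g \<cdot> xs)\<close>, on objects and on morphisms respectively; they are already
  equivalence relations because \<open>\<Lambda>(n)\<close> is a group.
\<close>

definition opre :: "('g, 'y) action_operad_data_scheme \<Rightarrow> 'o set \<Rightarrow> ('g \<times> 'o list) set" where
  "opre L A = {(p, xs). xs \<in> lists A \<and> p \<in> el L (length xs)}"

definition apre :: "('g, 'y) action_operad_data_scheme \<Rightarrow> 'a set \<Rightarrow> (('g \<times> 'g) \<times> 'a list) set" where
  "apre L A = {((p, q), fs). fs \<in> lists A \<and> p \<in> el L (length fs) \<and> q \<in> el L (length fs)}"

definition oorel ::
  "('g, 'y) action_operad_data_scheme \<Rightarrow> 'o set \<Rightarrow> (('g \<times> 'o list) \<times> ('g \<times> 'o list)) set" where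
  "oorel L A =
     {((p \<otimes>\<^bsub>grp L (length xs)\<^esub> g, xs), (p, lact L g xs)) | p g xs.
        xs \<in> lists A \<and> p \<in> el L (length xs) \<and> g \<in> el L (length xs)}"

definition aorel ::
  "('g, 'y) action_operad_data_scheme \<Rightarrow> 'a set \<Rightarrow>
   ((('g \<times> 'g) \<times> 'a list) \<times> (('g \<times> 'g) \<times> 'a list)) set" where
  "aorel L A =
     {(((p \<otimes>\<^bsub>grp L (length fs)\<^esub> g, q \<otimes>\<^bsub>grp L (length fs)\<^esub> g), fs), ((p, q), lact L g fs)) | p q g fs.
        fs \<in> lists A \<and> p \<in> el L (length fs) \<and> q \<in> el L (length fs) \<and> g \<in> el L (length fs)}"

abbreviation ocls ::
  "('g, 'y) action_operad_data_scheme \<Rightarrow> ('o, 'a, 'z) cat_scheme \<Rightarrow> 'g \<Rightarrow> 'o list \<Rightarrow> ('g, 'o) oorb"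
  where "ocls L X p xs \<equiv> oorel L (obj X) `` {(p, xs)}"

abbreviation acls ::
  "('g, 'y) action_operad_data_scheme \<Rightarrow> ('o, 'a, 'z) cat_scheme \<Rightarrow> 'g \<Rightarrow> 'g \<Rightarrow> 'a list \<Rightarrow> ('g, 'a) aorb"
  where "acls L X p q fs \<equiv> aorel L (arr X) `` {((p, q), fs)}"

text \<open>
  \<open>\<Lambda>(n)\<close> acts freely on the objects of \<open>E\<Lambda>(n) \<times> X\<^sup>n\<close>, so the coequalizer in \<open>\<^bold>C\<^bold>a\<^bold>t\<close> has as objects and
  morphisms the orbits of objects and morphisms: orbits of morphisms that are composable as such have
  composable representatives, whose composite lies in a single orbit.  Operations on orbits are
  written as unions over representatives.
\<close>

definition EL ::
  "('g, 'y) action_operad_data_scheme \<Rightarrow> ('o, 'a, 'z) cat_scheme \<Rightarrow> (('g, 'o) oorb, ('g, 'a) aorb) cat" where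
  "EL L X =
     (let Ob = opre L (obj X) // oorel L (obj X);
          A = apre L (arr X) // aorel L (arr X);
          s = (\<lambda>c\<in>A. \<Union>((p, q), fs)\<in>c. ocls L X p (map (src X) fs));
          t = (\<lambda>c\<in>A. \<Union>((p, q), fs)\<in>c. ocls L X q (map (tgt X) fs))
      in \<lparr>obj = Ob, arr = A, src = s, tgt = t,
          ide = (\<lambda>c\<in>Ob. \<Union>(p, xs)\<in>c. acls L X p p (map (ide X) xs)),
          cmp = restrict
            (\<lambda>(d, c). \<Union>{acls L X p r (map2 (\<lambda>g f. g \<cdot>\<^bsub>X\<^esub> f) gs fs) | p q r gs fs.
                ((q, r), gs) \<in> d \<and> ((p, q), fs) \<in> c \<and> map (src X) gs = map (tgt X) fs})
            {(d, c). d \<in> A \<and> c \<in> A \<and> s d = t c}\<rparr>)"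

definition EL_map ::
  "('g, 'y) action_operad_data_scheme \<Rightarrow> ('o, 'a, 'z) cat_scheme \<Rightarrow> ('p, 'b, 'w) cat_scheme \<Rightarrow>
   ('o, 'a, 'p, 'b, 'm) fctr_scheme \<Rightarrow>
   (('g, 'o) oorb, ('g, 'a) aorb, ('g, 'p) oorb, ('g, 'b) aorb) fctr" where
  "EL_map L X Y F =
     \<lparr>fobj = (\<lambda>c\<in>obj (EL L X). \<Union>(p, xs)\<in>c. ocls L Y p (map (fobj F) xs)),
      farr = (\<lambda>c\<in>arr (EL L X). \<Union>((p, q), fs)\<in>c. acls L Y p q (map (farr F) fs))\<rparr>"

definition EL_trans ::
  "('g, 'y) action_operad_data_scheme \<Rightarrow> ('o, 'a, 'z) cat_scheme \<Rightarrow> ('p, 'b, 'w) cat_scheme \<Rightarrow>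
   ('o \<Rightarrow> 'b) \<Rightarrow> ('g, 'o) oorb \<Rightarrow> ('g, 'b) aorb" where
  "EL_trans L X Y t = (\<lambda>c\<in>obj (EL L X). \<Union>(p, xs)\<in>c. acls L Y p p (map t xs))"

definition EL_unit ::
  "('g, 'y) action_operad_data_scheme \<Rightarrow> ('o, 'a, 'z) cat_scheme \<Rightarrow>
   ('o, 'a, ('g, 'o) oorb, ('g, 'a) aorb) fctr" where
  "EL_unit L X =
     \<lparr>fobj = (\<lambda>x\<in>obj X. ocls L X (eL L 1) [x]),
      farr = (\<lambda>f\<in>arr X. acls L X (eL L 1) (eL L 1) [f])\<rparr>"

text \<open>
  On objects: \<open>[p; [q\<^sub>1; xs\<^sub>1], \<dots>, [q\<^sub>n; xs\<^sub>n]] \<mapsto> [\<mu>(p; q\<^sub>1, \<dots>, q\<^sub>n); xs\<^sub>1 \<dots> xs\<^sub>n]\<close>.  Here \<open>cs\<close> is the list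
  of inner orbits, and \<open>ds\<close> in \<open>listset cs\<close> is a choice of one representative of each.
\<close>

definition EL_mult ::
  "('g, 'y) action_operad_data_scheme \<Rightarrow> ('o, 'a, 'z) cat_scheme \<Rightarrow>
   (('g, ('g, 'o) oorb) oorb, ('g, ('g, 'a) aorb) aorb, ('g, 'o) oorb, ('g, 'a) aorb) fctr" where
  "EL_mult L X =
     \<lparr>fobj = (\<lambda>c\<in>obj (EL L (EL L X)). \<Union>(p, cs)\<in>c. \<Union>ds\<in>listset cs.
        ocls L X (amu L (map (\<lambda>(q, xs). length xs) ds) p (map fst ds)) (concat (map snd ds))),
      farr = (\<lambda>c\<in>arr (EL L (EL L X)). \<Union>((p, p'), cs)\<in>c. \<Union>ds\<in>listset cs.
        acls L X (amu L (map (\<lambda>(q, fs). length fs) ds) p (map (\<lambda>((q, q'), fs). q) ds))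
                 (amu L (map (\<lambda>(q, fs). length fs) ds) p' (map (\<lambda>((q, q'), fs). q') ds))
                 (concat (map snd ds)))\<rparr>"

record ('o, 'a, 'g) el_alg = "('o, 'a) cat" +
  alg :: "(('g, 'o) oorb, ('g, 'a) aorb, 'o, 'a) fctr"

locale el_algebra = category X + structure_map: cat_functor "EL L X" X "alg X"
  for L :: "'g action_operad_data" and X :: "('o, 'a, 'g) el_alg" +
  assumes alg_unit: "fcomp X (alg X) (EL_unit L X) = fid X"
    and alg_mult: "fcomp (EL L (EL L X)) (alg X) (EL_map L (EL L X) X (alg X)) =
                   fcomp (EL L (EL L X)) (alg X) (EL_mult L X)"

locale el_strict_morphism =
  dom_alg: el_algebra L X + cod_alg: el_algebra L Y + cat_functor X Y F
  for L :: "'g action_operad_data" and X Y :: "('o, 'a, 'g) el_alg"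
    and F :: "('o, 'a, 'o, 'a) fctr" +
  assumes commutes: "fcomp (EL L X) F (alg X) = fcomp (EL L X) (alg Y) (EL_map L X Y F)"

locale el_two_cell =
  dom_mor: el_strict_morphism L X Y F + cod_mor: el_strict_morphism L X Y G + nat_trans X Y F G t
  for L :: "'g action_operad_data" and X Y :: "('o, 'a, 'g) el_alg"
    and F G :: "('o, 'a, 'o, 'a) fctr" and t :: "'o \<Rightarrow> 'a" +
  assumes two_cell_commutes:
    "c \<in> obj (EL L X) \<Longrightarrow> t (fobj (alg X) c) = farr (alg Y) (EL_trans L X Y t c)"

definition LMonCat ::
  "'g action_operad_data \<Rightarrow> (('o, 'a, 'g) el_alg, ('o, 'a, 'o, 'a) fctr, 'o \<Rightarrow> 'a) two_cat" where
  "LMonCat L =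
     \<lparr>cell0 = {X. el_algebra L X},
      cell1 = (\<lambda>X Y. {F. el_strict_morphism L X Y F}),
      cell2 = (\<lambda>X Y F G. {t. el_two_cell L X Y F G t}),
      id1 = fid,
      comp1 = (\<lambda>X Y Z G F. fcomp X G F),
      id2 = nt_id,
      vcomp = nt_vcomp,
      hcomp = (\<lambda>X Y Z F F' G G' s t. nt_hcomp X Z F' G s t)\<rparr>"


section \<open>Monoidal categories\<close>

record ('o, 'a) mon_cat = "('o, 'a) cat" +
  tens :: "('o \<times> 'o, 'a \<times> 'a, 'o, 'a) fctr"
  munit :: 'o
  massoc :: "'o \<times> 'o \<times> 'o \<Rightarrow> 'a"
  lunit :: "'o \<Rightarrow> 'a"
  runit :: "'o \<Rightarrow> 'a"

abbreviation tens_obj :: "'o \<Rightarrow> ('o, 'a, 'z) mon_cat_scheme \<Rightarrow> 'o \<Rightarrow> 'o"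
    ("(_ \<odot>\<^bsub>_\<^esub>/ _)" [66, 0, 65] 65) where
  "x \<odot>\<^bsub>M\<^esub> y \<equiv> fobj (tens M) (x, y)"

abbreviation tens_arr :: "'a \<Rightarrow> ('o, 'a, 'z) mon_cat_scheme \<Rightarrow> 'a \<Rightarrow> 'a"
    ("(_ \<star>\<^bsub>_\<^esub>/ _)" [66, 0, 65] 65) where
  "f \<star>\<^bsub>M\<^esub> g \<equiv> farr (tens M) (f, g)"

locale monoidal_category = category M + tensor: cat_functor "prod_cat M M" M "tens M"
  for M :: "('o, 'a, 'z) mon_cat_scheme" +
  assumes munit_obj: "munit M \<in> obj M"
    and massoc_type: "massoc M \<in> obj M \<times> obj M \<times> obj M \<rightarrow>\<^sub>E arr M"
    and lunit_type: "lunit M \<in> obj M \<rightarrow>\<^sub>E arr M"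
    and runit_type: "runit M \<in> obj M \<rightarrow>\<^sub>E arr M"
    and massoc_homset: "\<lbrakk>x \<in> obj M; y \<in> obj M; z \<in> obj M\<rbrakk>
        \<Longrightarrow> massoc M (x, y, z) \<in> homset M ((x \<odot>\<^bsub>M\<^esub> y) \<odot>\<^bsub>M\<^esub> z) (x \<odot>\<^bsub>M\<^esub> (y \<odot>\<^bsub>M\<^esub> z))"
    and lunit_homset: "x \<in> obj M \<Longrightarrow> lunit M x \<in> homset M (munit M \<odot>\<^bsub>M\<^esub> x) x"
    and runit_homset: "x \<in> obj M \<Longrightarrow> runit M x \<in> homset M (x \<odot>\<^bsub>M\<^esub> munit M) x"
    and massoc_iso: "\<lbrakk>x \<in> obj M; y \<in> obj M; z \<in> obj M\<rbrakk> \<Longrightarrow> iso_arr M (massoc M (x, y, z))"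
    and lunit_iso: "x \<in> obj M \<Longrightarrow> iso_arr M (lunit M x)"
    and runit_iso: "x \<in> obj M \<Longrightarrow> iso_arr M (runit M x)"
    and massoc_natural:
      "\<lbrakk>f \<in> homset M x x'; g \<in> homset M y y'; h \<in> homset M z z'\<rbrakk>
       \<Longrightarrow> massoc M (x', y', z') \<cdot>\<^bsub>M\<^esub> ((f \<star>\<^bsub>M\<^esub> g) \<star>\<^bsub>M\<^esub> h) =
           (f \<star>\<^bsub>M\<^esub> (g \<star>\<^bsub>M\<^esub> h)) \<cdot>\<^bsub>M\<^esub> massoc M (x, y, z)"
    and lunit_natural:
      "f \<in> homset M x x'
       \<Longrightarrow> lunit M x' \<cdot>\<^bsub>M\<^esub> (ide M (munit M) \<star>\<^bsub>M\<^esub> f) = f \<cdot>\<^bsub>M\<^esub> lunit M x"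
    and runit_natural:
      "f \<in> homset M x x'
       \<Longrightarrow> runit M x' \<cdot>\<^bsub>M\<^esub> (f \<star>\<^bsub>M\<^esub> ide M (munit M)) = f \<cdot>\<^bsub>M\<^esub> runit M x"
    and pentagon:
      "\<lbrakk>w \<in> obj M; x \<in> obj M; y \<in> obj M; z \<in> obj M\<rbrakk>
       \<Longrightarrow> (ide M w \<star>\<^bsub>M\<^esub> massoc M (x, y, z)) \<cdot>\<^bsub>M\<^esub> massoc M (w, x \<odot>\<^bsub>M\<^esub> y, z) \<cdot>\<^bsub>M\<^esub>
             (massoc M (w, x, y) \<star>\<^bsub>M\<^esub> ide M z) =
           massoc M (w, x, y \<odot>\<^bsub>M\<^esub> z) \<cdot>\<^bsub>M\<^esub> massoc M (w \<odot>\<^bsub>M\<^esub> x, y, z)"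
    and triangle:
      "\<lbrakk>x \<in> obj M; y \<in> obj M\<rbrakk>
       \<Longrightarrow> (ide M x \<star>\<^bsub>M\<^esub> lunit M y) \<cdot>\<^bsub>M\<^esub> massoc M (x, munit M, y) = runit M x \<star>\<^bsub>M\<^esub> ide M y"

definition strict_monoidal :: "('o, 'a, 'z) mon_cat_scheme \<Rightarrow> bool" where
  "strict_monoidal M \<longleftrightarrow>
     (\<forall>x\<in>obj M. \<forall>y\<in>obj M. \<forall>z\<in>obj M.
        (x \<odot>\<^bsub>M\<^esub> y) \<odot>\<^bsub>M\<^esub> z = x \<odot>\<^bsub>M\<^esub> (y \<odot>\<^bsub>M\<^esub> z) \<and>
        massoc M (x, y, z) = ide M (x \<odot>\<^bsub>M\<^esub> (y \<odot>\<^bsub>M\<^esub> z))) \<and>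
     (\<forall>x\<in>obj M. munit M \<odot>\<^bsub>M\<^esub> x = x \<and> lunit M x = ide M x) \<and>
     (\<forall>x\<in>obj M. x \<odot>\<^bsub>M\<^esub> munit M = x \<and> runit M x = ide M x)"

text \<open>The standard association \<open>x\<^sub>1 \<otimes> (x\<^sub>2 \<otimes> (\<dots> \<otimes> x\<^sub>n))\<close> of objects and of arrows.\<close>

fun std_obj :: "('o, 'a, 'z) mon_cat_scheme \<Rightarrow> 'o list \<Rightarrow> 'o" where
  "std_obj M [] = munit M"
| "std_obj M [x] = x"
| "std_obj M (x # y # xs) = x \<odot>\<^bsub>M\<^esub> std_obj M (y # xs)"

fun std_arr :: "('o, 'a, 'z) mon_cat_scheme \<Rightarrow> 'a list \<Rightarrow> 'a" where
  "std_arr M [] = ide M (munit M)"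
| "std_arr M [f] = f"
| "std_arr M (f # g # fs) = f \<star>\<^bsub>M\<^esub> std_arr M (g # fs)"

text \<open>
  Coherence isomorphisms are indexed by formal bracketings rather than by their source and target
  objects, since different bracketings may accidentally have equal values in \<open>M\<close>.
  \<open>coherence M s t c\<close> says that \<open>c\<close> is obtained from instances of the associativity and unit
  constraints by composition, tensor product and inversion along the bracketings from \<open>s\<close> to \<open>t\<close>.
  By Mac Lane's coherence theorem there is exactly one such \<open>c\<close> whenever \<open>s\<close> and \<open>t\<close> have the same
  sequence of leaves.
\<close>

datatype 'o brk = Leaf 'o | Unit | Tens "'o brk" "'o brk"

fun brk_val :: "('o, 'a, 'z) mon_cat_scheme \<Rightarrow> 'o brk \<Rightarrow> 'o" where
  "brk_val M (Leaf x) = x"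
| "brk_val M Unit = munit M"
| "brk_val M (Tens s t) = brk_val M s \<odot>\<^bsub>M\<^esub> brk_val M t"

inductive coherence :: "('o, 'a, 'z) mon_cat_scheme \<Rightarrow> 'o brk \<Rightarrow> 'o brk \<Rightarrow> 'a \<Rightarrow> bool"
  for M :: "('o, 'a, 'z) mon_cat_scheme" where
  coh_id: "set_brk t \<subseteq> obj M \<Longrightarrow> coherence M t t (ide M (brk_val M t))"
| coh_assoc: "\<lbrakk>set_brk r \<subseteq> obj M; set_brk s \<subseteq> obj M; set_brk t \<subseteq> obj M\<rbrakk>
    \<Longrightarrow> coherence M (Tens (Tens r s) t) (Tens r (Tens s t))
          (massoc M (brk_val M r, brk_val M s, brk_val M t))"
| coh_lunit: "set_brk t \<subseteq> obj M \<Longrightarrow> coherence M (Tens Unit t) t (lunit M (brk_val M t))"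
| coh_runit: "set_brk t \<subseteq> obj M \<Longrightarrow> coherence M (Tens t Unit) t (runit M (brk_val M t))"
| coh_comp: "\<lbrakk>coherence M r s c; coherence M s t d\<rbrakk> \<Longrightarrow> coherence M r t (d \<cdot>\<^bsub>M\<^esub> c)"
| coh_tens: "\<lbrakk>coherence M s t c; coherence M s' t' c'\<rbrakk>
    \<Longrightarrow> coherence M (Tens s s') (Tens t t') (c \<star>\<^bsub>M\<^esub> c')"
| coh_inv: "\<lbrakk>coherence M s t c; inverse_arrows M c d\<rbrakk> \<Longrightarrow> coherence M t s d"

fun std_brk :: "'o brk list \<Rightarrow> 'o brk" where
  "std_brk [] = Unit"
| "std_brk [t] = t"
| "std_brk (t # u # ts) = Tens t (std_brk (u # ts))"

definition flat_brk :: "'o list \<Rightarrow> 'o brk" where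
  "flat_brk xs = std_brk (map Leaf xs)"

definition nested_brk :: "'o list list \<Rightarrow> 'o brk" where
  "nested_brk xss = std_brk (map flat_brk xss)"

record ('o, 'a) mon_fctr = "('o, 'a, 'o, 'a) fctr" +
  mf2 :: "'o \<times> 'o \<Rightarrow> 'a"
  mf0 :: 'a

locale monoidal_functor =
  dom_mon: monoidal_category M + cod_mon: monoidal_category N + cat_functor M N F
  for M :: "('o, 'a, 'z) mon_cat_scheme" and N :: "('o, 'a, 'y) mon_cat_scheme"
    and F :: "('o, 'a) mon_fctr" +
  assumes mf2_type: "mf2 F \<in> obj M \<times> obj M \<rightarrow>\<^sub>E arr N"
    and mf2_homset: "\<lbrakk>x \<in> obj M; y \<in> obj M\<rbrakk>
        \<Longrightarrow> mf2 F (x, y) \<in> homset N (fobj F x \<odot>\<^bsub>N\<^esub> fobj F y) (fobj F (x \<odot>\<^bsub>M\<^esub> y))"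
    and mf0_homset: "mf0 F \<in> homset N (munit N) (fobj F (munit M))"
    and mf2_iso: "\<lbrakk>x \<in> obj M; y \<in> obj M\<rbrakk> \<Longrightarrow> iso_arr N (mf2 F (x, y))"
    and mf0_iso: "iso_arr N (mf0 F)"
    and mf2_natural:
      "\<lbrakk>f \<in> homset M x x'; g \<in> homset M y y'\<rbrakk>
       \<Longrightarrow> mf2 F (x', y') \<cdot>\<^bsub>N\<^esub> (farr F f \<star>\<^bsub>N\<^esub> farr F g) = farr F (f \<star>\<^bsub>M\<^esub> g) \<cdot>\<^bsub>N\<^esub> mf2 F (x, y)"
    and mf_assoc:
      "\<lbrakk>x \<in> obj M; y \<in> obj M; z \<in> obj M\<rbrakk>
       \<Longrightarrow> farr F (massoc M (x, y, z)) \<cdot>\<^bsub>N\<^esub> mf2 F (x \<odot>\<^bsub>M\<^esub> y, z) \<cdot>\<^bsub>N\<^esub>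
             (mf2 F (x, y) \<star>\<^bsub>N\<^esub> ide N (fobj F z)) =
           mf2 F (x, y \<odot>\<^bsub>M\<^esub> z) \<cdot>\<^bsub>N\<^esub> (ide N (fobj F x) \<star>\<^bsub>N\<^esub> mf2 F (y, z)) \<cdot>\<^bsub>N\<^esub>
             massoc N (fobj F x, fobj F y, fobj F z)"
    and mf_lunit:
      "x \<in> obj M \<Longrightarrow>
         farr F (lunit M x) \<cdot>\<^bsub>N\<^esub> mf2 F (munit M, x) \<cdot>\<^bsub>N\<^esub> (mf0 F \<star>\<^bsub>N\<^esub> ide N (fobj F x)) =
         lunit N (fobj F x)"
    and mf_runit:
      "x \<in> obj M \<Longrightarrow>
         farr F (runit M x) \<cdot>\<^bsub>N\<^esub> mf2 F (x, munit M) \<cdot>\<^bsub>N\<^esub> (ide N (fobj F x) \<star>\<^bsub>N\<^esub> mf0 F) =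
         runit N (fobj F x)"

text \<open>The canonical isomorphism from the tensor product of \<open>F x\<^sub>1, \<dots>, F x\<^sub>n\<close> to \<open>F\<close> of that of
  \<open>x\<^sub>1, \<dots>, x\<^sub>n\<close>.\<close>

fun mfn ::
  "('o, 'a, 'z) mon_cat_scheme \<Rightarrow> ('o, 'a, 'y) mon_cat_scheme \<Rightarrow> ('o, 'a) mon_fctr \<Rightarrow> 'o list \<Rightarrow> 'a"
  where
  "mfn M N F [] = mf0 F"
| "mfn M N F [x] = ide N (fobj F x)"
| "mfn M N F (x # y # xs) =
     mf2 F (x, std_obj M (y # xs)) \<cdot>\<^bsub>N\<^esub> (ide N (fobj F x) \<star>\<^bsub>N\<^esub> mfn M N F (y # xs))"

definition mf_id :: "('o, 'a, 'z) mon_cat_scheme \<Rightarrow> ('o, 'a) mon_fctr" where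
  "mf_id M = \<lparr>fobj = fobj (fid M), farr = farr (fid M),
     mf2 = restrict (\<lambda>(x, y). ide M (x \<odot>\<^bsub>M\<^esub> y)) (obj M \<times> obj M),
     mf0 = ide M (munit M)\<rparr>"

text \<open>\<open>mf_comp M P G F\<close> is \<open>G \<circ> F\<close>, where \<open>M\<close> is the domain of \<open>F\<close> and \<open>P\<close> the codomain of \<open>G\<close>.\<close>

definition mf_comp ::
  "('o, 'a, 'z) mon_cat_scheme \<Rightarrow> ('o, 'a, 'y) mon_cat_scheme \<Rightarrow>
   ('o, 'a) mon_fctr \<Rightarrow> ('o, 'a) mon_fctr \<Rightarrow> ('o, 'a) mon_fctr" where
  "mf_comp M P G F = \<lparr>fobj = fobj (fcomp M G F), farr = farr (fcomp M G F),
     mf2 = restrict (\<lambda>(x, y). farr G (mf2 F (x, y)) \<cdot>\<^bsub>P\<^esub> mf2 G (fobj F x, fobj F y)) (obj M \<times> obj M),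
     mf0 = farr G (mf0 F) \<cdot>\<^bsub>P\<^esub> mf0 G\<rparr>"

locale monoidal_transformation =
  dom_mf: monoidal_functor M N F + cod_mf: monoidal_functor M N G + nat_trans M N F G t
  for M :: "('o, 'a, 'z) mon_cat_scheme" and N :: "('o, 'a, 'y) mon_cat_scheme"
    and F G :: "('o, 'a) mon_fctr" and t :: "'o \<Rightarrow> 'a" +
  assumes tensor_compat:
      "\<lbrakk>x \<in> obj M; y \<in> obj M\<rbrakk>
       \<Longrightarrow> t (x \<odot>\<^bsub>M\<^esub> y) \<cdot>\<^bsub>N\<^esub> mf2 F (x, y) = mf2 G (x, y) \<cdot>\<^bsub>N\<^esub> (t x \<star>\<^bsub>N\<^esub> t y)"
    and unit_compat: "t (munit M) \<cdot>\<^bsub>N\<^esub> mf0 F = mf0 G"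


section \<open>Weak \<open>\<Lambda>\<close>-monoidal categories\<close>

text \<open>\<open>wact M (g, xs)\<close> is the isomorphism \<open>[g]\<close> at the objects \<open>xs\<close>.\<close>

record ('o, 'a, 'g) wk_mon_cat = "('o, 'a) mon_cat" +
  wact :: "'g \<times> 'o list \<Rightarrow> 'a"

locale weak_L_monoidal_category = monoidal_category M
  for L :: "'g action_operad_data" and M :: "('o, 'a, 'g) wk_mon_cat" +
  assumes wact_type: "wact M \<in> opre L (obj M) \<rightarrow>\<^sub>E arr M"
    and wact_homset: "\<lbrakk>xs \<in> lists (obj M); g \<in> el L (length xs)\<rbrakk>
        \<Longrightarrow> wact M (g, xs) \<in> homset M (std_obj M xs) (std_obj M (lact L g xs))"
    and wact_iso: "\<lbrakk>xs \<in> lists (obj M); g \<in> el L (length xs)\<rbrakk> \<Longrightarrow> iso_arr M (wact M (g, xs))"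
    and wact_natural: "\<lbrakk>fs \<in> lists (arr M); g \<in> el L (length fs)\<rbrakk>
        \<Longrightarrow> wact M (g, map (tgt M) fs) \<cdot>\<^bsub>M\<^esub> std_arr M fs =
            std_arr M (lact L g fs) \<cdot>\<^bsub>M\<^esub> wact M (g, map (src M) fs)"
    and wact_comp: "\<lbrakk>xs \<in> lists (obj M); g \<in> el L (length xs); h \<in> el L (length xs)\<rbrakk>
        \<Longrightarrow> wact M (h, lact L g xs) \<cdot>\<^bsub>M\<^esub> wact M (g, xs) =
            wact M (h \<otimes>\<^bsub>grp L (length xs)\<^esub> g, xs)"
    and wact_beta:
      "\<lbrakk>xss \<in> lists (lists (obj M)); list_all2 (\<lambda>h xs. h \<in> el L (length xs)) hs xss;
        coherence M (flat_brk (concat xss)) (nested_brk xss) c;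
        coherence M (nested_brk (map2 (lact L) hs xss)) (flat_brk (concat (map2 (lact L) hs xss))) c'\<rbrakk>
       \<Longrightarrow> wact M (beta L (map length xss) hs, concat xss) =
           c' \<cdot>\<^bsub>M\<^esub> std_arr M (map2 (\<lambda>h xs. wact M (h, xs)) hs xss) \<cdot>\<^bsub>M\<^esub> c"
    and wact_delta:
      "\<lbrakk>xss \<in> lists (lists (obj M)); g \<in> el L (length xss);
        coherence M (flat_brk (concat xss)) (nested_brk xss) c;
        coherence M (nested_brk (lact L g xss)) (flat_brk (concat (lact L g xss))) c'\<rbrakk>
       \<Longrightarrow> wact M (delta L (map length xss) g, concat xss) =
           c' \<cdot>\<^bsub>M\<^esub> wact M (g, map (std_obj M) xss) \<cdot>\<^bsub>M\<^esub> c"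

locale weak_L_monoidal_functor =
  dom_wk: weak_L_monoidal_category L M + cod_wk: weak_L_monoidal_category L N +
  monoidal_functor M N F
  for L :: "'g action_operad_data" and M N :: "('o, 'a, 'g) wk_mon_cat"
    and F :: "('o, 'a) mon_fctr" +
  assumes mfn_wact: "\<lbrakk>xs \<in> lists (obj M); g \<in> el L (length xs)\<rbrakk>
      \<Longrightarrow> mfn M N F (lact L g xs) \<cdot>\<^bsub>N\<^esub> wact N (g, map (fobj F) xs) =
          farr F (wact M (g, xs)) \<cdot>\<^bsub>N\<^esub> mfn M N F xs"

definition WkLMonCat ::
  "'g action_operad_data \<Rightarrow> (('o, 'a, 'g) wk_mon_cat, ('o, 'a) mon_fctr, 'o \<Rightarrow> 'a) two_cat" where
  "WkLMonCat L =
     \<lparr>cell0 = {M. weak_L_monoidal_category L M},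
      cell1 = (\<lambda>M N. {F. weak_L_monoidal_functor L M N F}),
      cell2 = (\<lambda>M N F G. {t. weak_L_monoidal_functor L M N F \<and> weak_L_monoidal_functor L M N G \<and>
                             monoidal_transformation M N F G t}),
      id1 = mf_id,
      comp1 = (\<lambda>M N P G F. mf_comp M P G F),
      id2 = nt_id,
      vcomp = nt_vcomp,
      hcomp = (\<lambda>M N P F F' G G' s t. nt_hcomp M P F' G s t)\<rparr>"


section \<open>The inclusion\<close>

definition alg_tens :: "'g action_operad_data \<Rightarrow> ('o, 'a, 'g) el_alg \<Rightarrow> ('o \<times> 'o, 'a \<times> 'a, 'o, 'a) fctr" where
  "alg_tens L X =
     \<lparr>fobj = restrict (\<lambda>(x, y). fobj (alg X) (ocls L X (eL L 2) [x, y])) (obj X \<times> obj X),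
      farr = restrict (\<lambda>(f, g). farr (alg X) (acls L X (eL L 2) (eL L 2) [f, g])) (arr X \<times> arr X)\<rparr>"

definition incl0 :: "'g action_operad_data \<Rightarrow> ('o, 'a, 'g) el_alg \<Rightarrow> ('o, 'a, 'g) wk_mon_cat" where
  "incl0 L X =
     (let T = fobj (alg_tens L X)
      in \<lparr>obj = obj X, arr = arr X, src = src X, tgt = tgt X, ide = ide X, cmp = cmp X,
          tens = alg_tens L X,
          munit = fobj (alg X) (ocls L X (eL L 0) []),
          massoc = restrict (\<lambda>(x, y, z). ide X (T (x, T (y, z)))) (obj X \<times> obj X \<times> obj X),
          lunit = (\<lambda>x\<in>obj X. ide X x),
          runit = (\<lambda>x\<in>obj X. ide X x),
          wact = restrict (\<lambda>(g, xs). farr (alg X) (acls L X (eL L (length xs)) g (map (ide X) xs)))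
                   (opre L (obj X))\<rparr>)"

definition incl1 ::
  "'g action_operad_data \<Rightarrow> ('o, 'a, 'g) el_alg \<Rightarrow> ('o, 'a, 'g) el_alg \<Rightarrow>
   ('o, 'a, 'o, 'a) fctr \<Rightarrow> ('o, 'a) mon_fctr" where
  "incl1 L X Y F =
     \<lparr>fobj = fobj F, farr = farr F,
      mf2 = restrict (\<lambda>(x, y). ide Y (fobj F x \<odot>\<^bsub>incl0 L Y\<^esub> fobj F y)) (obj X \<times> obj X),
      mf0 = ide Y (munit (incl0 L Y))\<rparr>"

definition incl ::
  "'g action_operad_data \<Rightarrow>
   (('o, 'a, 'g) el_alg, ('o, 'a, 'o, 'a) fctr, 'o \<Rightarrow> 'a,
    ('o, 'a, 'g) wk_mon_cat, ('o, 'a) mon_fctr, 'o \<Rightarrow> 'a) two_fctr" where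
  "incl L = \<lparr>tf0 = incl0 L, tf1 = incl1 L, tf2 = (\<lambda>X Y F G t. t)\<rparr>"

end

theory Submission
  imports Defs
begin

text \<open>
  Every orbit in the free algebra has a unique representative whose (source) operad element is the
  identity.  Hence an algebra amounts to operations \<open>A\<close> on lists of objects and \<open>B g\<close> on lists of
  arrows, the images of \<open>[e; xs]\<close> and of \<open>[e \<rightarrow> g; fs]\<close>, and the 2-monad axioms become identities
  between them.  Then \<open>[g]\<close> is \<open>B g\<close> on identities; conversely \<open>A\<close> is the tensor product
      and \<open>B g fs\<close> is
  \<open>[g]\<close> after the tensor product of \<open>fs\<close>.  As all coherence arrows of a strict monoidal category
      are
  identities, this identifies algebras with strict weak \<open>\<Lambda>\<close>-monoidal categories.

  A weak \<open>\<Lambda>\<close>-monoidal category is strictified by taking lists of objects, with the arrows between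
  their tensor products.  For lists \<open>xss\<close> of such objects \<open>[g]\<close> is defined to be \<open>[\<delta>(g)]\<close> at the
  concatenation of \<open>xss\<close>, so that conditions (1)--(3) reduce to \<open>\<delta>(h) \<delta>(g) = \<delta>(h g)\<close>,
  \<open>\<delta>(\<beta>(hs)) = \<beta>(\<delta>(hs))\<close> and \<open>\<delta>(\<delta>(g)) = \<delta>(g)\<close>.  Only the evident reassociations of concatenated
  lists are used, and Mac Lane's coherence theorem is not needed.
\<close>

section \<open>Blocks and permutations\<close>

text \<open>Conditions (2) and (3) speak of arbitrary coherence arrows \<open>c\<close>,
  \<open>c'\<close>. For a given \<open>M\<close> they are instantiated at the explicit
  reassociation \<open>nest\<close> and its inverse; as goals they arise only for strict categories
  (images of algebras and the strictification), where induction over \<open>coherence\<close> shows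
  that \<open>c\<close> and \<open>c'\<close> are identities. Interchange gives \<mu>(g; fs) =
  \<delta>(g) \<beta>(fs), so (2) and (3) together determine [\<mu>(g; fs)], which is what the
  multiplication axiom of an algebra asks for. Defining [g] on lists as [\<delta>(g)] at the
  concatenation is condition (3) of \<open>M\<close> read backwards: it is the choice for which
  evaluating lists to their tensor products preserves [g]. Equality of categories and functors is
  equality of records with extensional fields, so the comparison of algebras with strict categories
  is proved on the nose. The strictification has to live in the types that carry \<open>M\<close>;
  lists of objects and arrows with endpoints are therefore encoded injectively, which is where the
  infinity of both types enters.\<close>

lemma block_start_Suc: "i < length ks \<Longrightarrow> block_start ks (Suc i) = block_start ks i + ks ! i"
  by (simp add: block_start_def take_Suc_conv_app_nth)

lemma block_start_mono: "i \<le> j \<Longrightarrow> block_start ks i \<le> block_start ks j"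
  unfolding block_start_def
  by (metis add.commute le_add2 le_iff_add sum_list_append take_add)

lemma block_start_add_less:
  assumes "i < length ks" "a < ks ! i"
  shows "block_start ks i + a < sum_list ks"
proof -
  have "block_start ks (Suc i) \<le> block_start ks (length ks)"
    using assms by (intro block_start_mono) simp
  then show ?thesis
    using assms block_start_Suc[of i ks] by (simp add: block_start_def)
qed

lemma block_eq:
  assumes "i < length ks" "a < ks ! i"
  shows "block ks (block_start ks i + a) = i"
  unfolding block_def
proof (rule Least_equality)
  show "block_start ks i + a < block_start ks (Suc i)"
    using assms by (simp add: block_start_Suc)
next
  fix j assume j: "block_start ks i + a < block_start ks (Suc j)"
  show "i \<le> j"
  proof (rule ccontr)
    assume "\<not> i \<le> j"
    then have "block_start ks (Suc j) \<le> block_start ks i" by (intro block_start_mono) simp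
    with j show False by simp
  qed
qed

lemma block_pos_eq:
  "i < length ks \<Longrightarrow> a < ks ! i \<Longrightarrow> block_pos ks (block_start ks i + a) = a"
  by (simp add: block_pos_def block_eq)

lemma nth_concat_block:
  "i < length xss \<Longrightarrow> a < length (xss ! i) \<Longrightarrow>
   concat xss ! (block_start (map length xss) i + a) = xss ! i ! a"
proof (induction xss arbitrary: i)
  case (Cons xs xss)
  then show ?case
    by (cases i) (auto simp: block_start_def nth_append)
qed simp

text \<open>Existence half of the block decomposition of positions; uniqueness is
  \<open>block_eq\<close> together with \<open>block_pos_eq\<close>.\<close>

lemma block_cases:
  assumes "m < sum_list ks"
  obtains i a where "i < length ks" "a < ks ! i" "m = block_start ks i + a"
proof -
  have "m < sum_list ks \<Longrightarrow> \<exists>i a. i < length ks \<and> a < ks ! i \<and> m = block_start ks i + a"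
  proof (induction ks arbitrary: m)
    case (Cons k ks)
    show ?case
    proof (cases "m < k")
      case True
      then show ?thesis by (intro exI[of _ 0] exI[of _ m]) (simp add: block_start_def)
    next
      case False
      with Cons.prems have "m - k < sum_list ks" by simp
      from Cons.IH[OF this] obtain i a where
        "i < length ks" "a < ks ! i" "m - k = block_start ks i + a" by blast
      with False show ?thesis
        by (intro exI[of _ "Suc i"] exI[of _ a]) (simp add: block_start_def)
    qed
  qed simp
  with assms that show ?thesis by blast
qed

text \<open>The action uses the inverse permutation, so entry \<open>i\<close> lands at position
  \<open>\<sigma> i\<close>. In this form later index computations never have to evaluate an
  inverse.\<close>

lemma nth_permute_list_inv:
  assumes "\<sigma> permutes {..<length xs}" "i < length xs"
  shows "permute_list (inv_into UNIV \<sigma>) xs ! \<sigma> i = xs ! i"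
proof -
  have "\<sigma> i < length xs" using assms permutes_in_image[OF assms(1), of i] by simp
  then show ?thesis
    using assms permutes_inverses[OF assms(1)]
    by (simp add: permute_list_nth permutes_inv)
qed

text \<open>Identifies the sum in \<open>sym_delta\<close>: the blocks that precede block
  \<open>i\<close> after the rearrangement are those with \<open>\<sigma> j < \<sigma> i\<close>,
  and the sum of their lengths is reindexed along \<open>\<sigma>\<close>.\<close>

lemma block_start_permuted:
  assumes \<sigma>: "\<sigma> permutes {..<length ks}" and i: "i < length ks"
  shows "block_start (permute_list (inv_into UNIV \<sigma>) ks) (\<sigma> i) =
    (\<Sum>j | j < length ks \<and> \<sigma> j < \<sigma> i. ks ! j)"
proof -
  let ?p = "permute_list (inv_into UNIV \<sigma>) ks"
  have si: "\<sigma> i < length ks" using permutes_in_image[OF \<sigma>, of i] i by simp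
  have "block_start ?p (\<sigma> i) = (\<Sum>l<\<sigma> i. ?p ! l)"
    using si by (simp add: block_start_def sum_list_sum_nth atLeast0LessThan min_def)
  also have "\<dots> = (\<Sum>j | j < length ks \<and> \<sigma> j < \<sigma> i. ?p ! \<sigma> j)"
  proof (rule sum.reindex_cong[of \<sigma>])
    show "inj_on \<sigma> {j. j < length ks \<and> \<sigma> j < \<sigma> i}"
      using permutes_inj[OF \<sigma>] by (rule inj_on_subset) simp
    show "{..<\<sigma> i} = \<sigma> ` {j. j < length ks \<and> \<sigma> j < \<sigma> i}"
    proof (intro equalityI subsetI)
      fix l assume l: "l \<in> {..<\<sigma> i}"
      have "inv_into UNIV \<sigma> l < length ks"
        using permutes_in_image[OF permutes_inv[OF \<sigma>], of l] l si by simp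
      then show "l \<in> \<sigma> ` {j. j < length ks \<and> \<sigma> j < \<sigma> i}"
        using l permutes_inverses[OF \<sigma>]
        by (intro image_eqI[of _ _ "inv_into UNIV \<sigma> l"]) simp_all
    qed auto
  qed simp
  also have "\<dots> = (\<Sum>j | j < length ks \<and> \<sigma> j < \<sigma> i. ks ! j)"
    by (rule sum.cong) (simp_all add: nth_permute_list_inv[OF \<sigma>])
  finally show ?thesis .
qed

text \<open>Every position has the form \<open>\<sigma> i\<close>, so a permuted list is recognized
  by its entries there.\<close>

lemma permute_list_inv_unique:
  assumes "\<sigma> permutes {..<length xs}" "length ys = length xs"
    and "\<And>i. i < length xs \<Longrightarrow> ys ! \<sigma> i = xs ! i"
  shows "permute_list (inv_into UNIV \<sigma>) xs = ys"
proof (rule nth_equalityI)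
  fix j assume j: "j < length (permute_list (inv_into UNIV \<sigma>) xs)"
  then have "inv_into UNIV \<sigma> j < length xs"
    using permutes_in_image[OF permutes_inv[OF assms(1)], of j] by simp
  then show "permute_list (inv_into UNIV \<sigma>) xs ! j = ys ! j"
    using assms(3)[of "inv_into UNIV \<sigma> j"] j permutes_inverses[OF assms(1)]
    by (simp add: permute_list_nth permutes_inv assms(1))
qed (simp add: assms)

text \<open>The block sum permutes inside the blocks and the \<delta>-part moves whole blocks, so on
  a concatenation the inner permutations act on the inner lists and \<open>\<sigma>\<close> on the
  list of lists. That the product is a permutation is assumed here; \<open>lact_amu\<close> obtains
  it from \<pi> taking values in the symmetric groups.\<close>

lemma permute_list_sym_mu:
  assumes \<sigma>: "\<sigma> permutes {..<length xss}" and len: "length \<tau>s = length xss"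
    and \<tau>: "\<And>i. i < length xss \<Longrightarrow> \<tau>s ! i permutes {..<length (xss ! i)}"
    and mu: "sym_mu (map length xss) \<sigma> \<tau>s permutes {..<sum_list (map length xss)}"
  shows "permute_list (inv_into UNIV (sym_mu (map length xss) \<sigma> \<tau>s)) (concat xss) =
    concat (permute_list (inv_into UNIV \<sigma>) (map2 (\<lambda>\<tau>. permute_list (inv_into UNIV \<tau>)) \<tau>s xss))"
    (is "_ = concat ?zss")
proof (rule permute_list_inv_unique)
  let ?ks = "map length xss"
  let ?wss = "map2 (\<lambda>\<tau>. permute_list (inv_into UNIV \<tau>)) \<tau>s xss"
  have lw: "map length ?wss = ?ks" using len by (auto intro!: nth_equalityI)
  have lz: "map length ?zss = permute_list (inv_into UNIV \<sigma>) ?ks"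
    using \<sigma> len lw by (subst permute_list_map[symmetric]) (simp_all add: permutes_inv)
  show "sym_mu ?ks \<sigma> \<tau>s permutes {..<length (concat xss)}"
    using mu by (simp add: length_concat)
  \<comment> \<open>Both lengths are sums of block lengths, and the two lists of block lengths agree
    as multisets.\<close>
  show "length (concat ?zss) = length (concat xss)"
  proof -
    have "mset (map length ?zss) = mset ?ks"
      unfolding lz using \<sigma> by (subst mset_permute_list) (simp_all add: permutes_inv)
    then show ?thesis by (simp only: length_concat flip: sum_mset_sum_list)
  qed
  fix m assume "m < length (concat xss)"
  then obtain i a where i: "i < length xss" and a: "a < length (xss ! i)"
    and m: "m = block_start ?ks i + a"
    by (metis block_cases length_concat length_map nth_map)
  have ta: "(\<tau>s ! i) a < length (xss ! i)"
    using permutes_in_image[OF \<tau>[OF i], of a] a by simp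
  have "sym_beta ?ks \<tau>s m = block_start ?ks i + (\<tau>s ! i) a"
    using i a block_start_add_less[of i ?ks a] by (simp add: m sym_beta_def block_eq block_pos_eq)
  \<comment> \<open>\<open>sym_beta\<close> stays inside block \<open>i\<close>, so
    \<open>sym_delta\<close> reads off the block index \<open>i\<close> and the new offset
    \<open>(\<tau>s ! i) a\<close>.\<close>
  then have s: "sym_mu ?ks \<sigma> \<tau>s m = block_start (map length ?zss) (\<sigma> i) + (\<tau>s ! i) a"
    using i ta block_start_add_less[of i ?ks "(\<tau>s ! i) a"] block_start_permuted[of \<sigma> ?ks i] \<sigma>
    by (simp add: sym_mu_def sym_delta_def block_eq block_pos_eq lz)
  have zi: "?zss ! \<sigma> i = permute_list (inv_into UNIV (\<tau>s ! i)) (xss ! i)"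
    using nth_permute_list_inv[of \<sigma> ?wss i] \<sigma> len i by simp
  have si: "\<sigma> i < length ?zss" using permutes_in_image[OF \<sigma>, of i] i len by simp
  have "concat ?zss ! sym_mu ?ks \<sigma> \<tau>s m = ?zss ! \<sigma> i ! (\<tau>s ! i) a"
    unfolding s using si zi ta by (intro nth_concat_block) simp_all
  also have "\<dots> = xss ! i ! a"
    unfolding zi using nth_permute_list_inv[OF \<tau>[OF i] a] .
  also have "\<dots> = concat xss ! m"
    unfolding m using nth_concat_block[OF i a] by simp
  finally show "concat ?zss ! sym_mu ?ks \<sigma> \<tau>s m = concat xss ! m" .
qed

section \<open>The action of an action operad on lists\<close>

context action_operad
begin

sublocale grp: group "grp L n" for n by (rule grp)

lemma el_e [simp]: "eL L n \<in> el L n" by (rule grp.one_closed)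

abbreviation mult :: "nat \<Rightarrow> 'g \<Rightarrow> 'g \<Rightarrow> 'g" where
  "mult n g h \<equiv> g \<otimes>\<^bsub>grp L n\<^esub> h"

abbreviation inver :: "nat \<Rightarrow> 'g \<Rightarrow> 'g" where
  "inver n g \<equiv> m_inv (grp L n) g"

lemma perm_permutes: "g \<in> el L n \<Longrightarrow> perm L n g permutes {..<n}"
  using perm_hom[of n] by (auto simp: hom_def symgrp_def)

lemma perm_mult: "g \<in> el L n \<Longrightarrow> h \<in> el L n \<Longrightarrow> perm L n (mult n g h) = perm L n g \<circ> perm L n h"
  using perm_hom[of n] by (auto simp: hom_def symgrp_def)

text \<open>\<pi>(e) is idempotent because e e = e, and an injective idempotent map is the
  identity.\<close>

lemma perm_e [simp]: "perm L n (eL L n) = id"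
proof
  fix i
  have "perm L n (eL L n) (perm L n (eL L n) i) = perm L n (eL L n) i"
    using fun_cong[OF perm_mult[of "eL L n" n "eL L n"], of i] by simp
  then show "perm L n (eL L n) i = id i"
    using permutes_inj[OF perm_permutes[OF el_e, of n]] by (simp add: inj_eq)
qed

lemma length_lact [simp]: "length (lact L g xs) = length xs"
  by (simp add: lact_def)

lemma lact_e [simp]: "n = length xs \<Longrightarrow> lact L (eL L n) xs = xs"
  by (simp add: lact_def)

lemma perm_less [simp]: "g \<in> el L n \<Longrightarrow> perm L n g i < n \<longleftrightarrow> i < n"
  using permutes_in_image[OF perm_permutes, of g n i] by simp

lemma nth_lact_perm:
  "g \<in> el L n \<Longrightarrow> n = length xs \<Longrightarrow> i < n \<Longrightarrow> lact L g xs ! perm L n g i = xs ! i"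
  by (simp add: lact_def nth_permute_list_inv perm_permutes)

lemma lact_eqI:
  assumes "g \<in> el L (length xs)" "length ys = length xs"
    and "\<And>i. i < length xs \<Longrightarrow> ys ! perm L (length xs) g i = xs ! i"
  shows "lact L g xs = ys"
  unfolding lact_def using assms by (intro permute_list_inv_unique perm_permutes)

lemma set_lact [simp]: "g \<in> el L (length xs) \<Longrightarrow> set (lact L g xs) = set xs"
  by (simp add: lact_def permutes_inv perm_permutes)

lemma sum_list_lact [simp]:
  fixes ks :: "nat list"
  assumes "g \<in> el L (length ks)"
  shows "sum_list (lact L g ks) = sum_list ks"
proof -
  have "mset (lact L g ks) = mset ks"
    using assms by (simp add: lact_def permutes_inv perm_permutes)
  then show ?thesis by (simp flip: sum_mset_sum_list)
qed

lemma lact_in_lists [simp]: "g \<in> el L (length xs) \<Longrightarrow> lact L g xs \<in> lists A \<longleftrightarrow> xs \<in> lists A"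
  by (simp add: in_lists_conv_set)

lemma lact_map [simp]: "g \<in> el L (length xs) \<Longrightarrow> lact L g (map f xs) = map f (lact L g xs)"
  by (simp add: lact_def permute_list_map permutes_inv perm_permutes)

text \<open>The inverse inside \<open>lact\<close> makes this a left action: entry \<open>i\<close>
  moves to \<open>perm L n h i\<close> and from there to
  \<open>perm L n g (perm L n h i)\<close>.\<close>

lemma lact_mult:
  assumes "g \<in> el L n" "h \<in> el L n" "n = length xs"
  shows "lact L g (lact L h xs) = lact L (mult n g h) xs"
  using assms
  by (intro lact_eqI[symmetric]) (simp_all add: perm_mult nth_lact_perm)

lemma lact_inver_left [simp]:
  "g \<in> el L n \<Longrightarrow> n = length xs \<Longrightarrow> lact L (inver n g) (lact L g xs) = xs"
  by (simp add: lact_mult[of _ "length xs"])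

lemma lact_inver_right [simp]:
  "g \<in> el L n \<Longrightarrow> n = length xs \<Longrightarrow> lact L g (lact L (inver n g) xs) = xs"
  by (simp add: lact_mult[of _ "length xs"])

lemma lact_inj: "g \<in> el L (length xs) \<Longrightarrow> length ys = length xs \<Longrightarrow> lact L g xs = lact L g ys \<longleftrightarrow> xs =
    ys"
  by (metis lact_inver_left)

lemma lact_map2:
  assumes "g \<in> el L (length xs)" "length ys = length xs"
  shows "lact L g (map2 f xs ys) = map2 f (lact L g xs) (lact L g ys)"
  using assms by (intro lact_eqI) (simp_all add: nth_lact_perm)

abbreviation els :: "'g list \<Rightarrow> nat list \<Rightarrow> bool" where
  "els fs ks \<equiv> list_all2 (\<lambda>f k. f \<in> el L k) fs ks"

lemma lact_list_all2 [simp]: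
  assumes "g \<in> el L (length xs)" "length ys = length xs"
  shows "list_all2 P (lact L g xs) (lact L g ys) \<longleftrightarrow> list_all2 P xs ys"
  using assms unfolding lact_def
  by (simp add: list_all2_permute_list_iff permutes_inv perm_permutes)

lemma els_e [simp]: "els (map (eL L) ks) ks"
  by (simp add: list_all2_conv_all_nth)

lemma perm_amu:
  assumes "g \<in> el L (length ks)" "els fs ks"
  shows "perm L (sum_list ks) (amu L ks g fs) =
      sym_mu ks (perm L (length ks) g) (map2 (perm L) ks fs)"
  using perm_operad_map assms by (simp add: operad_map_def)

text \<open>\<pi> is a map of operads, so the action of a product is computed by
  \<open>permute_list_sym_mu\<close> in the symmetric groups. Every later formula for permuting a
  concatenated list comes from here.\<close>

lemma lact_amu:
  assumes g: "g \<in> el L (length xss)" and fs: "els fs (map length xss)"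
  shows "lact L (amu L (map length xss) g fs) (concat xss) =
      concat (lact L g (map2 (lact L) fs xss))"
proof -
  let ?ks = "map length xss"
  have len: "length fs = length xss" using fs by (simp add: list_all2_conv_all_nth)
  have mu: "amu L ?ks g fs \<in> el L (sum_list ?ks)" using g fs by (intro mu_closed) simp_all
  have m2: "map2 (\<lambda>\<tau>. permute_list (inv_into UNIV \<tau>)) (map2 (perm L) ?ks fs) xss =
      map2 (lact L) fs xss"
    using len by (intro nth_equalityI) (simp_all add: lact_def)
  have "sym_mu ?ks (perm L (length xss) g) (map2 (perm L) ?ks fs) permutes {..<sum_list ?ks}"
    using perm_permutes[OF mu] g fs by (simp add: perm_amu)
  then have "permute_list (inv_into UNIV (sym_mu ?ks (perm L (length xss) g) (map2 (perm L) ?ks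
      fs))) (concat xss)
     = concat (permute_list (inv_into UNIV (perm L (length xss) g)) (map2 (lact L) fs xss))"
    using g fs len m2
    by (subst permute_list_sym_mu) (simp_all add: perm_permutes list_all2_conv_all_nth)
  then show ?thesis
    using g fs len by (simp add: lact_def length_concat perm_amu)
qed

abbreviation mults :: "nat list \<Rightarrow> 'g list \<Rightarrow> 'g list \<Rightarrow> 'g list" where
  "mults ks vs fs \<equiv> map (\<lambda>i. mult (ks ! i) (vs ! i) (fs ! i)) [0..<length ks]"

text \<open>The interchange axiom with the second family of operad elements given as
  \<open>lact L g vs\<close>. Indexing \<open>vs\<close> by the original blocks removes the
  permutation from the right-hand side, which becomes an entrywise product.\<close>

lemma amu_interchange:
  assumes g: "g \<in> el L n" and u: "u \<in> el L n" and n: "n = length ks" and fs: "els fs ks"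
      and vs: "els vs ks"
  shows "mult (sum_list ks) (amu L (lact L g ks) u (lact L g vs)) (amu L ks g fs) =
    amu L ks (mult n u g) (mults ks vs fs)"
proof -
  have len: "length vs = length ks" using vs by (simp add: list_all2_conv_all_nth)
  have "map (\<lambda>i. mult (ks ! i) (lact L g vs ! perm L n g i) (fs ! i)) [0..<n] = mults ks vs fs"
    using nth_lact_perm[OF g, of vs] n len by simp
  then show ?thesis
    using interchange[OF n g u fs, of "lact L g vs"] g vs n len by (simp only: lact_list_all2)
qed

text \<open>By interchange, as in the Eckmann-Hilton argument.\<close>

lemma aid_eq: "aid L = eL L 1"
proof -
  have 1: "aid L \<in> el L 1" by (rule opid_closed)
  have "mult 1 (amu L [1] (aid L) [eL L 1]) (amu L [1] (eL L 1) [aid L]) =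
      amu L [1] (aid L) [aid L]"
    using amu_interchange[of "eL L 1" 1 "aid L" "[1]" "[aid L]" "[eL L 1]"] 1 by simp
  moreover have "amu L [1] (eL L 1) [aid L] = eL L 1" using unit_right[of "eL L 1" 1] by simp
  ultimately show ?thesis using unit_left[of "aid L" 1] unit_left[of "eL L 1" 1] 1 by simp
qed

lemma mults_e_right [simp]: "els fs ks \<Longrightarrow> mults ks fs (map (eL L) ks) = fs"
  by (rule nth_equalityI) (simp_all add: list_all2_conv_all_nth)

lemma mults_e_left [simp]: "els fs ks \<Longrightarrow> mults ks (map (eL L) ks) fs = fs"
  by (rule nth_equalityI) (simp_all add: list_all2_conv_all_nth)

lemma delta_closed [simp]: "g \<in> el L (length ks) \<Longrightarrow> n = sum_list ks \<Longrightarrow> delta L ks g \<in> el L n"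
  unfolding delta_def by (simp add: mu_closed)

lemma beta_closed [simp]: "els fs ks \<Longrightarrow> n = sum_list ks \<Longrightarrow> beta L ks fs \<in> el L n"
  unfolding beta_def by (simp add: mu_closed)

text \<open>By interchange the product is idempotent, and a group has only one idempotent.\<close>

lemma amu_e: 
  assumes n: "n = length ks" shows "amu L ks (eL L n) (map (eL L) ks) = eL L (sum_list ks)"
proof -
  let ?m = "amu L ks (eL L n) (map (eL L) ks)"
  have m: "?m \<in> el L (sum_list ks)" using n by (intro mu_closed) simp_all
  have "mult (sum_list ks) ?m ?m = ?m"
    using amu_interchange[of "eL L n" n "eL L n" ks "map (eL L) ks" "map (eL L) ks"] n by simp
  then show ?thesis using m by (metis grp.r_cancel_one)
qed

text \<open>Interchange with identities in all blocks. The left factor sees the block lengths after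
  \<open>h\<close> has permuted them, so \<delta> is multiplicative only in this twisted
  sense.\<close>

lemma delta_mult:
  assumes "g \<in> el L n" "h \<in> el L n" "n = length ks"
  shows "mult (sum_list ks) (delta L (lact L h ks) g) (delta L ks h) = delta L ks (mult n g h)"
  using amu_interchange[of h n g ks "map (eL L) ks" "map (eL L) ks"] assms
  by (simp add: delta_def)

text \<open>Interchange for (e_n; fs) followed by (g; e, ..., e). It lifts the defining formula of
  the multiplication of \<Sigma> to \<Lambda> and explains why conditions (2) and (3) control the
  whole operad multiplication.\<close>

lemma amu_eq_delta_beta:
  assumes "g \<in> el L n" "els fs ks" "n = length ks"
  shows "amu L ks g fs = mult (sum_list ks) (delta L ks g) (beta L ks fs)"
  using amu_interchange[of "eL L n" n g ks fs "map (eL L) ks"] assms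
  by (simp add: delta_def beta_def)

lemma lact_beta:
  assumes "els fs (map length xss)"
  shows "lact L (beta L (map length xss) fs) (concat xss) = concat (map2 (lact L) fs xss)"
proof -
  have "length fs = length xss" using assms by (simp add: list_all2_conv_all_nth)
  then show ?thesis using lact_amu[of "eL L (length xss)" xss fs] assms by (simp add: beta_def)
qed

lemma lact_delta:
  assumes "g \<in> el L (length xss)"
  shows "lact L (delta L (map length xss) g) (concat xss) = concat (lact L g xss)"
proof -
  have "map2 (lact L) (map (eL L) (map length xss)) xss = xss"
    by (rule nth_equalityI) simp_all
  then show ?thesis
    using lact_amu[of g xss "map (eL L) (map length xss)"] assms
        by (simp add: delta_def del: map_map)
qed

text \<open>For blocks of length one the identities are operadic units by \<open>aid_eq\<close>, so
  this is the right unit axiom. It makes [g] on singleton lists in the strictification agree with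
  [g] in \<open>M\<close>.\<close>

lemma delta_ones:
  assumes "g \<in> el L n" shows "delta L (replicate n 1) g = g"
  using unit_right[OF assms] by (simp add: delta_def aid_eq)

text \<open>Operad associativity with identities at the middle and inner levels;
  \<open>amu_e\<close> collapses each inner product to an identity. This becomes condition (3) for
  the strictification.\<close>

lemma delta_delta:
  assumes g: "g \<in> el L (length lss)"
  shows "delta L (concat lss) (delta L (map length lss) g) = delta L (map sum_list lss) g"
proof -
  have 1: "amu L (lss ! i) (eL L (length (lss ! i))) (map (eL L) (lss ! i)) =
      eL L (sum_list (lss ! i))" for i
    by (rule amu_e) simp
  have "delta L (concat lss) (delta L (map length lss) g) =
    amu L (concat lss) (amu L (map length lss) g (map (\<lambda>ls. eL L (length ls)) lss)) (concat (map
        (map (eL L)) lss))"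
    by (simp add: delta_def map_concat comp_def)
  also have "\<dots> = amu L (map sum_list lss) g
      (map (\<lambda>i. amu L (lss ! i) (map (\<lambda>ls. eL L (length ls)) lss ! i) (map (map (eL L)) lss ! i))
          [0..<length lss])"
    using g by (intro mu_assoc) (simp_all add: list_all2_conv_all_nth)
  also have "map (\<lambda>i. amu L (lss ! i) (map (\<lambda>ls. eL L (length ls)) lss ! i) (map (map (eL L)) lss
      ! i)) [0..<length lss]
     = map (eL L) (map sum_list lss)"
    by (rule nth_equalityI) (simp_all add: 1)
  finally show ?thesis by (simp add: delta_def)
qed

text \<open>Operad associativity with an identity outside and identities inside. This becomes
  condition (2) for the strictification.\<close>

lemma delta_beta:
  assumes hs: "els hs (map length lss)"
  shows "delta L (concat lss) (beta L (map length lss) hs) =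
      beta L (map sum_list lss) (map2 (delta L) lss hs)"
proof -
  have len: "length hs = length lss" using hs by (simp add: list_all2_conv_all_nth)
  have "delta L (concat lss) (beta L (map length lss) hs) =
    amu L (concat lss) (amu L (map length lss) (eL L (length lss)) hs) (concat (map (map (eL L))
        lss))"
    by (simp add: delta_def beta_def map_concat comp_def)
  also have "\<dots> = amu L (map sum_list lss) (eL L (length lss))
      (map (\<lambda>i. amu L (lss ! i) (hs ! i) (map (map (eL L)) lss ! i)) [0..<length lss])"
    using hs len by (intro mu_assoc) (simp_all add: list_all2_conv_all_nth)
  also have "map (\<lambda>i. amu L (lss ! i) (hs ! i) (map (map (eL L)) lss ! i)) [0..<length lss]
     = map2 (delta L) lss hs"
    using len by (intro nth_equalityI) (simp_all add: delta_def)
  finally show ?thesis by (simp add: beta_def)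
qed

lemma lact_Nil [simp]: "lact L g [] = []"
  by (simp add: lact_def)

end

section \<open>Categories and functors\<close>

context category
begin

lemma src_obj [simp]: "f \<in> arr C \<Longrightarrow> src C f \<in> obj C" using src_type by auto
lemma tgt_obj [simp]: "f \<in> arr C \<Longrightarrow> tgt C f \<in> obj C" using tgt_type by auto
lemma ide_arr [simp]: "x \<in> obj C \<Longrightarrow> ide C x \<in> arr C" using ide_type by auto
lemma src_ide [simp]: "x \<in> obj C \<Longrightarrow> src C (ide C x) = x" using ide_homset by (simp add: homset_def)
lemma tgt_ide [simp]: "x \<in> obj C \<Longrightarrow> tgt C (ide C x) = x" using ide_homset by (simp add: homset_def)

lemma arr_homset: "f \<in> arr C \<Longrightarrow> f \<in> homset C (src C f) (tgt C f)" by (simp add: homset_def)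

lemma cmp_arr [simp]: "g \<in> arr C \<Longrightarrow> f \<in> arr C \<Longrightarrow> src C g = tgt C f \<Longrightarrow> g \<cdot>\<^bsub>C\<^esub> f \<in> arr C"
  using cmp_homset[OF arr_homset, of f g "tgt C g"] by (simp add: homset_def)
lemma src_cmp [simp]: "g \<in> arr C \<Longrightarrow> f \<in> arr C \<Longrightarrow> src C g = tgt C f \<Longrightarrow> src C (g \<cdot>\<^bsub>C\<^esub> f) = src C f"
  using cmp_homset[OF arr_homset, of f g "tgt C g"] by (simp add: homset_def)
lemma tgt_cmp [simp]: "g \<in> arr C \<Longrightarrow> f \<in> arr C \<Longrightarrow> src C g = tgt C f \<Longrightarrow> tgt C (g \<cdot>\<^bsub>C\<^esub> f) = tgt C g"
  using cmp_homset[OF arr_homset, of f g "tgt C g"] by (simp add: homset_def)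
lemma assoc: "h \<in> arr C \<Longrightarrow> g \<in> arr C \<Longrightarrow> f \<in> arr C \<Longrightarrow> src C h = tgt C g \<Longrightarrow> src C g = tgt C f \<Longrightarrow>
    (h \<cdot>\<^bsub>C\<^esub> g) \<cdot>\<^bsub>C\<^esub> f = h \<cdot>\<^bsub>C\<^esub> (g \<cdot>\<^bsub>C\<^esub> f)"
  by (rule cmp_assoc) (auto simp: homset_def)
lemma ide_right [simp]: "f \<in> arr C \<Longrightarrow> src C f = x \<Longrightarrow> f \<cdot>\<^bsub>C\<^esub> ide C x = f"
  by (rule cmp_ide_right[OF homset_def[THEN equalityD2, THEN subsetD]]) simp
lemma ide_left [simp]: "f \<in> arr C \<Longrightarrow> tgt C f = y \<Longrightarrow> ide C y \<cdot>\<^bsub>C\<^esub> f = f"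
  by (rule cmp_ide_left[OF homset_def[THEN equalityD2, THEN subsetD]]) simp

lemma src_lists: "fs \<in> lists (arr C) \<Longrightarrow> map (src C) fs \<in> lists (obj C)"
  by (auto simp: in_lists_conv_set)
lemma tgt_lists: "fs \<in> lists (arr C) \<Longrightarrow> map (tgt C) fs \<in> lists (obj C)"
  by (auto simp: in_lists_conv_set)
lemma ide_lists: "xs \<in> lists (obj C) \<Longrightarrow> map (ide C) xs \<in> lists (arr C)"
  by (auto simp: in_lists_conv_set)
lemma map_src_ide: "xs \<in> lists (obj C) \<Longrightarrow> map (src C \<circ> ide C) xs = xs"
  by (rule map_idI) (auto simp: in_lists_conv_set)
lemma map_tgt_ide: "xs \<in> lists (obj C) \<Longrightarrow> map (tgt C \<circ> ide C) xs = xs"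
  by (rule map_idI) (auto simp: in_lists_conv_set)

end

text \<open>Replaces hom sets by equations between \<open>src\<close> and \<open>tgt\<close>, the
  form in which the constructed categories are checked.\<close>

lemma categoryI:
  assumes "src C \<in> arr C \<rightarrow>\<^sub>E obj C" "tgt C \<in> arr C \<rightarrow>\<^sub>E obj C" "ide C \<in> obj C \<rightarrow>\<^sub>E arr C"
    and "cmp C \<in> extensional (composable C)"
    and "\<And>x. x \<in> obj C \<Longrightarrow> src C (ide C x) = x \<and> tgt C (ide C x) = x"
    and cmp: "\<And>g f. g \<in> arr C \<Longrightarrow> f \<in> arr C \<Longrightarrow> src C g = tgt C f \<Longrightarrow>
      g \<cdot>\<^bsub>C\<^esub> f \<in> arr C \<and> src C (g \<cdot>\<^bsub>C\<^esub> f) = src C f \<and> tgt C (g \<cdot>\<^bsub>C\<^esub> f) = tgt C g"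
    and "\<And>f. f \<in> arr C \<Longrightarrow> f \<cdot>\<^bsub>C\<^esub> ide C (src C f) = f"
    and "\<And>f. f \<in> arr C \<Longrightarrow> ide C (tgt C f) \<cdot>\<^bsub>C\<^esub> f = f"
    and "\<And>h g f. h \<in> arr C \<Longrightarrow> g \<in> arr C \<Longrightarrow> f \<in> arr C \<Longrightarrow> src C h = tgt C g \<Longrightarrow> src C g = tgt C f \<Longrightarrow>
      (h \<cdot>\<^bsub>C\<^esub> g) \<cdot>\<^bsub>C\<^esub> f = h \<cdot>\<^bsub>C\<^esub> (g \<cdot>\<^bsub>C\<^esub> f)"
  shows "category C"
proof
  have "\<And>p. p \<in> composable C \<Longrightarrow> cmp C p \<in> arr C"
    using cmp by (auto simp: composable_def)
  with assms(4) show "cmp C \<in> composable C \<rightarrow>\<^sub>E arr C"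
    by (simp add: PiE_def)
qed (use assms in \<open>auto simp: homset_def\<close>)

context cat_functor
begin

lemma fobj_obj [simp]: "x \<in> obj C \<Longrightarrow> fobj F x \<in> obj D" using fobj_type by auto
lemma farr_arr [simp]: "f \<in> arr C \<Longrightarrow> farr F f \<in> arr D" using farr_type by auto
lemma src_farr [simp]: "f \<in> arr C \<Longrightarrow> src D (farr F f) = fobj F (src C f)"
  using farr_homset[OF dom.arr_homset, of f] by (simp add: homset_def)
lemma tgt_farr [simp]: "f \<in> arr C \<Longrightarrow> tgt D (farr F f) = fobj F (tgt C f)"
  using farr_homset[OF dom.arr_homset, of f] by (simp add: homset_def)
lemma farr_comp: "g \<in> arr C \<Longrightarrow> f \<in> arr C \<Longrightarrow> src C g = tgt C f \<Longrightarrow>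
    farr F (g \<cdot>\<^bsub>C\<^esub> f) = farr F g \<cdot>\<^bsub>D\<^esub> farr F f"
  by (rule farr_cmp) (auto simp: homset_def)

lemma fobj_lists: "xs \<in> lists (obj C) \<Longrightarrow> map (fobj F) xs \<in> lists (obj D)"
  by (auto simp: in_lists_conv_set)
lemma farr_lists: "fs \<in> lists (arr C) \<Longrightarrow> map (farr F) fs \<in> lists (arr D)"
  by (auto simp: in_lists_conv_set)

end

lemma cat_functorI:
  assumes "category C" "category D"
    and "fobj F \<in> obj C \<rightarrow>\<^sub>E obj D" "farr F \<in> arr C \<rightarrow>\<^sub>E arr D"
    and "\<And>f. f \<in> arr C \<Longrightarrow> src D (farr F f) = fobj F (src C f)"
    and "\<And>f. f \<in> arr C \<Longrightarrow> tgt D (farr F f) = fobj F (tgt C f)"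
    and "\<And>x. x \<in> obj C \<Longrightarrow> farr F (ide C x) = ide D (fobj F x)"
    and "\<And>g f. g \<in> arr C \<Longrightarrow> f \<in> arr C \<Longrightarrow> src C g = tgt C f \<Longrightarrow>
      farr F (g \<cdot>\<^bsub>C\<^esub> f) = farr F g \<cdot>\<^bsub>D\<^esub> farr F f"
  shows "cat_functor C D F"
proof -
  interpret C: category C by fact
  interpret D: category D by fact
  show ?thesis
    by unfold_locales (use assms in \<open>auto simp: homset_def\<close>)
qed

text \<open>Structure maps are \<open>undefined\<close> off their carriers, so agreement on the
  carriers is equality of HOL values; the 2-monad laws and injectivity of the inclusion are stated
  with that equality.\<close>

lemma fctr_eqI:
  fixes F G :: "('o, 'a, 'p, 'b) fctr"
  assumes "fobj F \<in> extensional A" "fobj G \<in> extensional A" "farr F \<in> extensional B"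
      "farr G \<in> extensional B"
    and "\<And>x. x \<in> A \<Longrightarrow> fobj F x = fobj G x" "\<And>f. f \<in> B \<Longrightarrow> farr F f = farr G f"
  shows "F = G"
  using extensionalityI[OF assms(1,2,5)] extensionalityI[OF assms(3,4,6)] by simp

section \<open>Orbits in normal form\<close>

context action_operad
begin

text \<open>\<open>OC A xs\<close> is the orbit of \<open>(e, xs)\<close>, and \<open>AC A g fs\<close> is the orbit of \<open>((e, g), fs)\<close>.\<close>

definition OC :: "'x set \<Rightarrow> 'x list \<Rightarrow> ('g, 'x) oorb" where
  "OC A xs = {(q, ys). (q, ys) \<in> opre L A \<and> lact L q ys = xs}"

definition AC :: "'x set \<Rightarrow> 'g \<Rightarrow> 'x list \<Rightarrow> ('g, 'x) aorb" where
  "AC A g fs = {((p, q), hs). ((p, q), hs) \<in> apre L A \<and> mult (length hs) q (inver (length hs) p) =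
      g \<and> lact L p hs = fs}"

text \<open>Moving \<open>g\<close> across the pair does not change \<open>lact L p xs\<close>, and
  this list is a complete invariant of the orbit.\<close>

lemma oorel_iff:
  "((p, xs), (q, ys)) \<in> oorel L A \<longleftrightarrow>
    (p, xs) \<in> opre L A \<and> (q, ys) \<in> opre L A \<and> lact L p xs = lact L q ys"
proof
  assume "((p, xs), (q, ys)) \<in> oorel L A"
  then show "(p, xs) \<in> opre L A \<and> (q, ys) \<in> opre L A \<and> lact L p xs = lact L q ys"
    by (auto simp: oorel_def opre_def lact_mult simp del: in_lists_conv_set)
next
  assume *: "(p, xs) \<in> opre L A \<and> (q, ys) \<in> opre L A \<and> lact L p xs = lact L q ys"
  let ?n = "length xs"
  have n: "length ys = ?n" using * by (metis length_lact)
  have pq: "p \<in> el L ?n" "q \<in> el L ?n" "xs \<in> lists A" using * n by (auto simp: opre_def)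
  \<comment> \<open>The relation requires \<open>p\<close> to be \<open>q\<close> times the moved
    element, which forces this choice.\<close>
  let ?g = "mult ?n (inver ?n q) p"
  have "ys = lact L ?g xs"
    using * pq n by (simp flip: lact_mult)
  moreover have "p = mult ?n q ?g"
    using pq by (simp flip: grp.m_assoc)
  ultimately show "((p, xs), (q, ys)) \<in> oorel L A"
    using pq unfolding oorel_def by (intro CollectI exI[of _ q] exI[of _ ?g] exI[of _ xs]) simp
qed

text \<open>Right multiplication by a common \<open>g\<close> cancels in \<open>q\<close> times the
  inverse of \<open>p\<close>; together with the list moved by \<open>p\<close> this is a complete
  invariant.\<close>

lemma aorel_iff:
  "(((p, q), xs), ((p', q'), ys)) \<in> aorel L A \<longleftrightarrow>
    ((p, q), xs) \<in> apre L A \<and> ((p', q'), ys) \<in> apre L A \<and> lact L p xs = lact L p' ys \<and>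
    mult (length xs) q (inver (length xs) p) = mult (length xs) q' (inver (length xs) p')"
proof
  assume "(((p, q), xs), ((p', q'), ys)) \<in> aorel L A"
  then obtain g where *: "p' \<in> el L (length xs)" "q' \<in> el L (length xs)" "g \<in> el L (length xs)"
      "xs \<in> lists A"
    "p = mult (length xs) p' g" "q = mult (length xs) q' g" "ys = lact L g xs"
    by (auto simp: aorel_def)
  have "mult (length xs) q (inver (length xs) p) =
      mult (length xs) q' (mult (length xs) (mult (length xs) g (inver (length xs) g)) (inver
      (length xs) p'))"
    using *(1-4) unfolding *(5,6) by (simp only: grp.inv_mult_group grp.m_assoc grp.m_closed
        grp.inv_closed)
  with * show "((p, q), xs) \<in> apre L A \<and> ((p', q'), ys) \<in> apre L A \<and> lact L p xs = lact L p' ys \<and>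
    mult (length xs) q (inver (length xs) p) = mult (length xs) q' (inver (length xs) p')"
    by (simp add: apre_def lact_mult del: in_lists_conv_set)
next
  assume *: "((p, q), xs) \<in> apre L A \<and> ((p', q'), ys) \<in> apre L A \<and> lact L p xs = lact L p' ys \<and>
    mult (length xs) q (inver (length xs) p) = mult (length xs) q' (inver (length xs) p')"
  let ?n = "length xs"
  have n: "length ys = ?n" using * by (metis length_lact)
  have pq: "p \<in> el L ?n" "q \<in> el L ?n" "p' \<in> el L ?n" "q' \<in> el L ?n" "xs \<in> lists A" using * n
      by (auto simp: apre_def)
  let ?g = "mult ?n (inver ?n p') p"
  have "ys = lact L ?g xs"
    using * pq n by (simp flip: lact_mult)
  moreover have "p = mult ?n p' ?g"
    using pq by (simp flip: grp.m_assoc)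
  moreover have "q = mult ?n q' ?g"
  proof -
    have "q = mult ?n (mult ?n q (inver ?n p)) p" using pq by (simp add: grp.m_assoc)
    also have "\<dots> = mult ?n (mult ?n q' (inver ?n p')) p" using * by simp
    finally show ?thesis using pq by (simp add: grp.m_assoc)
  qed
  ultimately show "(((p, q), xs), ((p', q'), ys)) \<in> aorel L A"
    using pq unfolding aorel_def by (intro CollectI exI[of _ p'] exI[of _ q'] exI[of _ ?g] exI[of
        _ xs]) simp
qed

lemma opre_iff [simp]: "(p, xs) \<in> opre L A \<longleftrightarrow> xs \<in> lists A \<and> p \<in> el L (length xs)"
  by (simp add: opre_def)

lemma apre_iff [simp]: "((p, q), xs) \<in> apre L A \<longleftrightarrow> xs \<in> lists A \<and> p \<in> el L (length xs) \<and>
    q \<in> el L (length xs)"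
  by (simp add: apre_def)

lemma oorel_class [simp]:
  "xs \<in> lists A \<Longrightarrow> p \<in> el L (length xs) \<Longrightarrow> oorel L A `` {(p, xs)} = OC A (lact L p xs)"
  by (auto simp: OC_def oorel_iff simp del: in_lists_conv_set)

lemma aorel_class [simp]:
  assumes "xs \<in> lists A" "p \<in> el L (length xs)" "q \<in> el L (length xs)"
  shows "aorel L A `` {((p, q), xs)} = AC A (mult (length xs) q (inver (length xs) p)) (lact L p
      xs)"
  using assms by (auto simp: AC_def aorel_iff simp del: in_lists_conv_set) (metis length_lact)+

lemma OC_elim:
  assumes "(q, ys) \<in> OC A xs"
  shows "ys \<in> lists A" "q \<in> el L (length ys)" "lact L q ys = xs" "length ys = length xs"
  using assms by (auto simp: OC_def)

lemma AC_elim: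
  assumes "((p, q), hs) \<in> AC A g fs"
  shows "hs \<in> lists A" "p \<in> el L (length fs)" "q \<in> el L (length fs)" "lact L p hs = fs"
      "length hs = length fs"
    "mult (length fs) q (inver (length fs) p) = g" "q = mult (length fs) g p"
proof -
  show *: "hs \<in> lists A" "p \<in> el L (length fs)" "q \<in> el L (length fs)" "lact L p hs = fs"
      "length hs = length fs"
    "mult (length fs) q (inver (length fs) p) = g"
    using assms by (auto simp: AC_def)
  show "q = mult (length fs) g p" using *(2,3,6) grp.inv_solve_right'
      by (metis grp.m_closed grp.inv_closed)
qed

lemma e_in_OC: "xs \<in> lists A \<Longrightarrow> (eL L (length xs), xs) \<in> OC A xs"
  by (simp add: OC_def)

lemma e_in_AC: "fs \<in> lists A \<Longrightarrow> g \<in> el L (length fs) \<Longrightarrow> ((eL L (length fs), g), fs) \<in> AC A g fs"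
  by (simp add: AC_def)

lemma OC_inj [simp]: "xs \<in> lists A \<Longrightarrow> OC A xs = OC A ys \<longleftrightarrow> xs = ys"
  using e_in_OC[of xs A] OC_elim(3)[of "eL L (length xs)" xs A ys] by auto

lemma AC_inj [simp]:
  "fs \<in> lists A \<Longrightarrow> g \<in> el L (length fs) \<Longrightarrow> AC A g fs = AC A h hs \<longleftrightarrow> g = h \<and> fs = hs"
  using e_in_AC[of fs A g] AC_elim(4,6)[of "eL L (length fs)" g fs A h hs] by auto

text \<open>Operations on orbits are unions over representatives. A union is evaluated by exhibiting
  one representative and showing that all of them give the same value.\<close>

lemma UN_const: "a \<in> S \<Longrightarrow> (\<And>b. b \<in> S \<Longrightarrow> f b = c) \<Longrightarrow> (\<Union>b\<in>S. f b) = c"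
  by blast

definition EOb :: "'x set \<Rightarrow> ('g, 'x) oorb set" where "EOb A = OC A ` lists A"
definition EAr :: "'x set \<Rightarrow> ('g, 'x) aorb set" where
  "EAr A = {AC A g fs | g fs. fs \<in> lists A \<and> g \<in> el L (length fs)}"

lemma EAr_cases:
  assumes "c \<in> EAr A" obtains g fs where "fs \<in> lists A" "g \<in> el L (length fs)" "c = AC A g fs"
  using assms by (auto simp: EAr_def)

lemma AC_EAr [simp]: "fs \<in> lists A \<Longrightarrow> g \<in> el L (length fs) \<Longrightarrow> AC A g fs \<in> EAr A"
  by (auto simp: EAr_def)

lemma OC_EOb [simp]: "xs \<in> lists A \<Longrightarrow> OC A xs \<in> EOb A"
  by (auto simp: EOb_def)

lemma quotient_oorel: "opre L A // oorel L A = EOb A"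
proof (intro equalityI subsetI)
  fix c assume "c \<in> opre L A // oorel L A"
  then obtain p xs where "(p, xs) \<in> opre L A" "c = oorel L A `` {(p, xs)}"
      by (auto simp: quotient_def)
  then show "c \<in> EOb A" by (simp del: in_lists_conv_set)
next
  fix c assume "c \<in> EOb A"
  then obtain xs where xs: "xs \<in> lists A" "c = OC A xs" by (auto simp: EOb_def)
  then have "c = oorel L A `` {(eL L (length xs), xs)}" by simp
  then show "c \<in> opre L A // oorel L A" using xs by (simp add: quotientI del: oorel_class)
qed

lemma quotient_aorel: "apre L A // aorel L A = EAr A"
proof (intro equalityI subsetI)
  fix c assume "c \<in> apre L A // aorel L A"
  then obtain p q xs where "((p, q), xs) \<in> apre L A" "c = aorel L A `` {((p, q), xs)}"
      by (auto simp: quotient_def)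
  then show "c \<in> EAr A" by (simp del: in_lists_conv_set)
next
  fix c assume "c \<in> EAr A"
  then obtain g fs where xs: "fs \<in> lists A" "g \<in> el L (length fs)" "c = AC A g fs"
      by (auto simp: EAr_def)
  then have "c = aorel L A `` {((eL L (length fs), g), fs)}" by simp
  then show "c \<in> apre L A // aorel L A" using xs by (simp add: quotientI del: aorel_class)
qed

lemma obj_EL [simp]: "obj (EL L X) = EOb (obj X)"
  by (simp add: EL_def Let_def quotient_oorel)

lemma arr_EL [simp]: "arr (EL L X) = EAr (arr X)"
  by (simp add: EL_def Let_def quotient_aorel)

end

lemma (in action_operad) lact_zip:
  assumes "g \<in> el L (length xs)" "length ys = length xs"
  shows "lact L g (zip xs ys) = zip (lact L g xs) (lact L g ys)"
  using lact_map2[OF assms, of Pair] by simp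

section \<open>The category structure of the free algebra in normal form\<close>

locale operad_cat = action_operad L + category X
  for L :: "'g action_operad_data" and X :: "('o, 'a, 'z) cat_scheme"
begin

abbreviation "OX \<equiv> OC (obj X)"
abbreviation "AX \<equiv> AC (arr X)"

lemma src_EL [simp]:
  assumes "fs \<in> lists (arr X)" "g \<in> el L (length fs)"
  shows "src (EL L X) (AX g fs) = OX (map (src X) fs)"
proof -
  have "src (EL L X) (AX g fs) = (\<Union>((p, q), hs)\<in>AX g fs. ocls L X p (map (src X) hs))"
    using assms by (simp add: EL_def Let_def quotient_aorel)
  also have "\<dots> = OX (map (src X) fs)"
  proof (rule UN_const[OF e_in_AC[OF assms]], clarify)
    fix p q hs assume "((p, q), hs) \<in> AX g fs"
    note * = AC_elim[OF this]
    show "ocls L X p (map (src X) hs) = OX (map (src X) fs)"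
      using * src_lists[OF *(1)] by simp
  qed
  finally show ?thesis .
qed

lemma tgt_EL [simp]:
  assumes "fs \<in> lists (arr X)" "g \<in> el L (length fs)"
  shows "tgt (EL L X) (AX g fs) = OX (lact L g (map (tgt X) fs))"
proof -
  have "tgt (EL L X) (AX g fs) = (\<Union>((p, q), hs)\<in>AX g fs. ocls L X q (map (tgt X) hs))"
    using assms by (simp add: EL_def Let_def quotient_aorel)
  also have "\<dots> = OX (lact L g (map (tgt X) fs))"
  proof (rule UN_const[OF e_in_AC[OF assms]], clarify)
    fix p q hs assume "((p, q), hs) \<in> AX g fs"
    note * = AC_elim[OF this]
    \<comment> \<open>In every representative \<open>q = g p\<close>, by \<open>AC_elim\<close>, and
      \<open>p\<close> carries \<open>hs\<close> to \<open>fs\<close>.\<close>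
    have "lact L q hs = lact L g fs"
      using lact_mult[of g "length hs" p hs] * assms by simp
    then show "ocls L X q (map (tgt X) hs) = OX (lact L g (map (tgt X) fs))"
      using * assms tgt_lists[OF *(1)] by simp
  qed
  finally show ?thesis .
qed

lemma ide_EL [simp]:
  assumes "xs \<in> lists (obj X)"
  shows "ide (EL L X) (OX xs) = AX (eL L (length xs)) (map (ide X) xs)"
proof -
  have "ide (EL L X) (OX xs) = (\<Union>(p, ys)\<in>OX xs. acls L X p p (map (ide X) ys))"
    using assms by (simp add: EL_def Let_def quotient_oorel)
  also have "\<dots> = AX (eL L (length xs)) (map (ide X) xs)"
  proof (rule UN_const[OF e_in_OC[OF assms]], clarify)
    fix p ys assume "(p, ys) \<in> OX xs"
    note * = OC_elim[OF this]
    show "acls L X p p (map (ide X) ys) = AX (eL L (length xs)) (map (ide X) xs)"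
      using * ide_lists[OF *(1)] by simp
  qed
  finally show ?thesis .
qed

lemma map2_cmp_lists:
  assumes "gs \<in> lists (arr X)" "fs \<in> lists (arr X)" "map (src X) gs = map (tgt X) fs"
  shows "map2 (\<lambda>g f. g \<cdot>\<^bsub>X\<^esub> f) gs fs \<in> lists (arr X)" "length gs = length fs"
    "map (src X) (map2 (\<lambda>g f. g \<cdot>\<^bsub>X\<^esub> f) gs fs) = map (src X) fs"
    "map (tgt X) (map2 (\<lambda>g f. g \<cdot>\<^bsub>X\<^esub> f) gs fs) = map (tgt X) gs"
proof -
  show len: "length gs = length fs" using assms(3) by (metis length_map)
  have *: "gs ! i \<in> arr X" "fs ! i \<in> arr X" "src X (gs ! i) = tgt X (fs ! i)" if "i < length fs"
      for i
    using that len assms by (auto simp: in_lists_conv_set) (metis nth_map)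
  show "map2 (\<lambda>g f. g \<cdot>\<^bsub>X\<^esub> f) gs fs \<in> lists (arr X)"
    using * len by (auto simp: in_lists_conv_set set_zip)
  show "map (src X) (map2 (\<lambda>g f. g \<cdot>\<^bsub>X\<^esub> f) gs fs) = map (src X) fs"
    "map (tgt X) (map2 (\<lambda>g f. g \<cdot>\<^bsub>X\<^esub> f) gs fs) = map (tgt X) gs"
    using * len by (auto intro!: nth_equalityI)
qed

text \<open>The target of the first arrow has been permuted by \<open>g\<close>, so a composable
  second arrow has a normal form whose list is \<open>lact L g gs\<close> with \<open>gs\<close>
  composable with \<open>fs\<close> entry by entry.\<close>

lemma cmp_EL [simp]:
  assumes fs: "fs \<in> lists (arr X)" "g \<in> el L (length fs)" and gs: "gs \<in> lists (arr X)"
    and h: "h \<in> el L (length fs)" and eq: "map (src X) gs = map (tgt X) fs"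
  shows "AX h (lact L g gs) \<cdot>\<^bsub>EL L X\<^esub> AX g fs = AX (mult (length fs) h g) (map2 (\<lambda>g f. g \<cdot>\<^bsub>X\<^esub>
      f) gs fs)"
proof -
  let ?n = "length fs" let ?d = "AX h (lact L g gs)" let ?c = "AX g fs"
  let ?S = "{acls L X p r (map2 (\<lambda>g f. g \<cdot>\<^bsub>X\<^esub> f) gs' fs') | p q r gs' fs'.
     ((q, r), gs') \<in> ?d \<and> ((p, q), fs') \<in> ?c \<and> map (src X) gs' = map (tgt X) fs'}"
  let ?s = "AX (mult ?n h g) (map2 (\<lambda>g f. g \<cdot>\<^bsub>X\<^esub> f) gs fs)"
  have len: "length gs = ?n" using eq by (metis length_map)
  have gs': "lact L g gs \<in> lists (arr X)" using gs fs len by simp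
  have st: "src (EL L X) ?d = tgt (EL L X) ?c"
    using fs gs' h len eq by (simp flip: lact_map)
  have "cmp (EL L X) (?d, ?c) = \<Union>?S"
    using fs gs' h st len by (simp add: EL_def Let_def quotient_aorel)
  also have "?S = {?s}"
  proof -
    have "s = ?s" if "s \<in> ?S" for s
    proof -
      from that obtain p q r gs' fs' where s: "s = acls L X p r (map2 (\<lambda>g f. g \<cdot>\<^bsub>X\<^esub> f) gs' fs')"
        and d: "((q, r), gs') \<in> ?d" and c: "((p, q), fs') \<in> ?c" and e: "map (src X) gs' =
            map (tgt X) fs'" by blast
      note d = AC_elim[OF d] note c = AC_elim[OF c]
      have lg: "length gs' = ?n" "length fs' = ?n" using c d len by simp_all
      \<comment> \<open>The representatives share the middle element \<open>q\<close>, with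
        \<open>q = g p\<close> and \<open>r = h q\<close>.\<close>
      have "r = mult ?n (mult ?n h g) p" using c d h fs len by (simp add: grp.m_assoc)
      then have rp: "mult ?n r (inver ?n p) = mult ?n h g" using c d h fs len
          by (simp add: grp.m_assoc)
      have "lact L g (lact L p gs') = lact L g gs"
        using c d len lg fs by (simp add: lact_mult)
      then have "lact L p gs' = gs"
        using fs len lg by (subst (asm) lact_inj) auto
      then have l: "lact L p (map2 (\<lambda>g f. g \<cdot>\<^bsub>X\<^esub> f) gs' fs') = map2 (\<lambda>g f. g \<cdot>\<^bsub>X\<^esub> f) gs fs"
        using c lg len by (subst lact_map2) simp_all
      show "s = ?s"
        unfolding s using c d lg len l rp map2_cmp_lists[OF d(1) c(1) e] by simp
    qed
    moreover have "\<exists>s. s \<in> ?S"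
    proof -
      \<comment> \<open>Nonemptiness: the representative of the second orbit that starts at
        \<open>g\<close> matches the normal form ((e, g), fs) of the first.\<close>
      have "((g, mult ?n h g), gs) \<in> ?d"
        using gs h fs len by (simp add: AC_def grp.m_assoc)
      with e_in_AC[OF fs] eq show ?thesis by blast
    qed
    ultimately show ?thesis by blast
  qed
  finally show ?thesis by simp
qed

text \<open>Acting by the inverse of \<open>g\<close> on the list of the second arrow aligns it with
  \<open>fs\<close>; thus every composable pair has the shape treated by
  \<open>cmp_EL\<close>.\<close>

lemma EL_composable_cases:
  assumes "d \<in> EAr (arr X)" "c \<in> EAr (arr X)" "src (EL L X) d = tgt (EL L X) c"
  obtains fs g gs h where "fs \<in> lists (arr X)" "g \<in> el L (length fs)" "gs \<in> lists (arr X)"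
    "h \<in> el L (length fs)" "map (src X) gs = map (tgt X) fs" "length gs = length fs"
    "c = AX g fs" "d = AX h (lact L g gs)"
proof -
  from assms obtain fs g gs' h where *: "fs \<in> lists (arr X)" "g \<in> el L (length fs)"
    "c = AX g fs" "gs' \<in> lists (arr X)" "h \<in> el L (length gs')" "d = AX h gs'"
    by (metis EAr_cases)
  then have eq: "map (src X) gs' = lact L g (map (tgt X) fs)"
    using assms(3) src_lists tgt_lists by simp
  then have len: "length gs' = length fs" by (metis length_lact length_map)
  let ?gs = "lact L (inver (length fs) g) gs'"
  have "lact L g ?gs = gs'" using * len by simp
  moreover have "map (src X) ?gs = map (tgt X) fs"
    using * len eq by (simp flip: lact_map)
  ultimately show thesis
    using * len by (intro that[of fs g ?gs h]) simp_all
qed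

lemma category_EL: "category (EL L X)"
proof (rule categoryI)
  show "src (EL L X) \<in> arr (EL L X) \<rightarrow>\<^sub>E obj (EL L X)"
  proof (rule PiE_I)
    fix c assume "c \<in> arr (EL L X)" then show "src (EL L X) c \<in> obj (EL L X)"
      by (simp, elim EAr_cases) (simp add: src_lists)
  next
    fix c assume "c \<notin> arr (EL L X)" then show "src (EL L X) c = undefined"
      by (simp add: EL_def Let_def quotient_aorel)
  qed
  show "tgt (EL L X) \<in> arr (EL L X) \<rightarrow>\<^sub>E obj (EL L X)"
  proof (rule PiE_I)
    fix c assume "c \<in> arr (EL L X)" then show "tgt (EL L X) c \<in> obj (EL L X)"
      by (simp, elim EAr_cases) (simp add: tgt_lists del: lact_map)
  next
    fix c assume "c \<notin> arr (EL L X)" then show "tgt (EL L X) c = undefined"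
      by (simp add: EL_def Let_def quotient_aorel)
  qed
  show "ide (EL L X) \<in> obj (EL L X) \<rightarrow>\<^sub>E arr (EL L X)"
  proof (rule PiE_I)
    fix c assume "c \<in> obj (EL L X)" then show "ide (EL L X) c \<in> arr (EL L X)"
      unfolding obj_EL EOb_def by (elim imageE) (simp add: ide_lists)
  next
    fix c assume "c \<notin> obj (EL L X)" then show "ide (EL L X) c = undefined"
      by (simp add: EL_def Let_def quotient_oorel)
  qed
  show "cmp (EL L X) \<in> extensional (composable (EL L X))"
    by (simp add: EL_def Let_def composable_def)
next
  fix c assume "c \<in> obj (EL L X)"
  then show "src (EL L X) (ide (EL L X) c) = c \<and> tgt (EL L X) (ide (EL L X) c) = c"
    unfolding obj_EL EOb_def by (elim imageE) (simp add: ide_lists map_src_ide map_tgt_ide)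
next
  fix d c assume "d \<in> arr (EL L X)" "c \<in> arr (EL L X)" "src (EL L X) d = tgt (EL L X) c"
  then obtain fs g gs h where *: "fs \<in> lists (arr X)" "g \<in> el L (length fs)" "gs \<in> lists (arr X)"
    "h \<in> el L (length fs)" "map (src X) gs = map (tgt X) fs" "length gs = length fs"
    "c = AX g fs" "d = AX h (lact L g gs)"
    unfolding arr_EL by (rule EL_composable_cases)
  have l: "lact L (mult (length fs) h g) (map (tgt X) gs) = lact L h (map (tgt X) (lact L g gs))"
    using * by (simp flip: lact_mult)
  show "d \<cdot>\<^bsub>EL L X\<^esub> c \<in> arr (EL L X) \<and> src (EL L X) (d \<cdot>\<^bsub>EL L X\<^esub> c) = src (EL L X) c \<and>
      tgt (EL L X) (d \<cdot>\<^bsub>EL L X\<^esub> c) = tgt (EL L X) d"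
    using * map2_cmp_lists[OF *(3,1,5)] l by (simp del: lact_map map_map)
next
  fix c assume "c \<in> arr (EL L X)"
  then obtain fs g where *: "fs \<in> lists (arr X)" "g \<in> el L (length fs)" "c = AX g fs"
    unfolding arr_EL by (rule EAr_cases)
  have fs: "map2 (\<lambda>g f. g \<cdot>\<^bsub>X\<^esub> f) fs (map (ide X \<circ> src X) fs) = fs"
    "map2 (\<lambda>g f. g \<cdot>\<^bsub>X\<^esub> f) (map (ide X \<circ> tgt X) fs) fs = fs"
    using *(1) by (auto intro!: nth_equalityI simp: in_lists_conv_set)
  show "c \<cdot>\<^bsub>EL L X\<^esub> ide (EL L X) (src (EL L X) c) = c"
    using * cmp_EL[of "map (ide X) (map (src X) fs)" "eL L (length fs)" fs g] fs
      ide_lists[OF src_lists[OF *(1)]] map_tgt_ide[OF src_lists[OF *(1)]] src_lists[OF *(1)]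
    by (simp add: comp_assoc)
  have m: "map (src X \<circ> (ide X \<circ> tgt X)) fs = map (tgt X) fs"
    using *(1) by (auto simp: in_lists_conv_set)
  show "ide (EL L X) (tgt (EL L X) c) \<cdot>\<^bsub>EL L X\<^esub> c = c"
    using * cmp_EL[of fs g "map (ide X) (map (tgt X) fs)" "eL L (length fs)"] fs
      ide_lists[OF tgt_lists[OF *(1)]] m tgt_lists[OF *(1)]
    by (simp del: lact_map add: lact_map[symmetric])
next
  fix c2 c1 c assume c: "c2 \<in> arr (EL L X)" "c1 \<in> arr (EL L X)" "c \<in> arr (EL L X)"
    "src (EL L X) c2 = tgt (EL L X) c1" "src (EL L X) c1 = tgt (EL L X) c"
  from c(2,3,5) obtain fs g gs h where *: "fs \<in> lists (arr X)" "g \<in> el L (length fs)"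
      "gs \<in> lists (arr X)"
    "h \<in> el L (length fs)" "map (src X) gs = map (tgt X) fs" "length gs = length fs"
    "c = AX g fs" "c1 = AX h (lact L g gs)"
    unfolding arr_EL by (rule EL_composable_cases)
  from c(1) obtain ks k where k: "ks \<in> lists (arr X)" "k \<in> el L (length ks)" "c2 = AX k ks"
    unfolding arr_EL by (rule EAr_cases)
  have "map (src X) ks = lact L h (map (tgt X) (lact L g gs))"
    using c(4) k * src_lists[OF k(1)] by (simp del: lact_map)
  then have eq: "map (src X) ks = lact L (mult (length fs) h g) (map (tgt X) gs)"
    using * by (simp flip: lact_mult)
  then have len: "length ks = length fs" using * by (metis length_lact length_map)
  let ?m = "mult (length fs) h g"
  \<comment> \<open>The first two arrows together permute by \<open>?m\<close>; undoing it makes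
    \<open>ks'\<close>, \<open>gs\<close> and \<open>fs\<close> composable entry by entry, so
    associativity in \<open>X\<close> applies pointwise.\<close>
  define ks' where "ks' = lact L (inver (length fs) ?m) ks"
  have ks': "ks = lact L ?m ks'" "map (src X) ks' = map (tgt X) gs" "ks' \<in> lists (arr X)"
      "length ks' = length fs"
    using k * len eq unfolding ks'_def by (simp_all add: lact_map[symmetric] del: lact_map)
  have ks2: "ks = lact L h (lact L g ks')" using ks' * by (simp add: lact_mult)
  let ?M = "map2 (\<lambda>g f. g \<cdot>\<^bsub>X\<^esub> f)"
  note m1 = map2_cmp_lists[OF *(3,1,5)] and m2 = map2_cmp_lists[OF ks'(3) *(3) ks'(2)]
  have "?M (?M ks' gs) fs = ?M ks' (?M gs fs)"
  proof (rule nth_equalityI)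
    fix i assume "i < length (?M (?M ks' gs) fs)"
    then have i: "i < length fs" by simp
    then have "src X (ks' ! i) = tgt X (gs ! i)" "src X (gs ! i) = tgt X (fs ! i)"
      using *(5,6) ks'(2,4) by (metis nth_map)+
    moreover have "ks' ! i \<in> arr X" "gs ! i \<in> arr X" "fs ! i \<in> arr X"
      using i * ks' by (auto simp: in_lists_conv_set)
    ultimately show "?M (?M ks' gs) fs ! i = ?M ks' (?M gs fs) ! i"
      using i *(6) ks'(4) by (simp add: assoc)
  qed (use *(6) ks'(4) in simp)
  moreover have "c2 \<cdot>\<^bsub>EL L X\<^esub> c1 = AX (mult (length fs) k h) (lact L g (?M ks' gs))"
  proof -
    have "map (src X) (lact L g ks') = map (tgt X) (lact L g gs)"
      using * ks' by (simp flip: lact_map)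
    then show ?thesis
      using * k len ks'(2-4) ks2 cmp_EL[of "lact L g gs" h "lact L g ks'" k]
      by (simp add: lact_zip)
  qed
  moreover have "c1 \<cdot>\<^bsub>EL L X\<^esub> c = AX ?m (?M gs fs)"
    using * by simp
  ultimately show "(c2 \<cdot>\<^bsub>EL L X\<^esub> c1) \<cdot>\<^bsub>EL L X\<^esub> c = c2 \<cdot>\<^bsub>EL L X\<^esub> (c1 \<cdot>\<^bsub>EL L X\<^esub> c)"
    using * k(2,3) len ks' m1 m2 cmp_EL[of "?M gs fs" ?m ks' k] cmp_EL[of fs g "?M ks' gs"
        "mult (length fs) k h"]
    by (simp add: grp.m_assoc)
qed

end

sublocale operad_cat \<subseteq> EL: category "EL L X" by (rule category_EL)

lemma in_listset_iff: "ds \<in> listset As \<longleftrightarrow> list_all2 (\<in>) ds As"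
  by (induction As arbitrary: ds) (auto simp: set_Cons_def list_all2_Cons2)

text \<open>Supplies a choice of representatives of the inner orbits, without which the union in
  \<open>EL_mult\<close> would be empty.\<close>

lemma listset_nonempty: "(\<And>c. c \<in> set cs \<Longrightarrow> c \<noteq> {}) \<Longrightarrow> \<exists>ds. ds \<in> listset cs"
proof (induction cs)
  case (Cons c cs)
  then obtain ds d where "ds \<in> listset cs" "d \<in> c" by (metis all_not_in_conv list.set_intros)
  then show ?case by (auto simp: set_Cons_def)
qed simp

lemma concat_in_lists: "xss \<in> lists (lists A) \<Longrightarrow> concat xss \<in> lists A"
  by (auto simp: in_lists_conv_set)

lemma map_in_lists: "xs \<in> lists A \<Longrightarrow> (\<And>x. x \<in> A \<Longrightarrow> f x \<in> B) \<Longrightarrow> map f xs \<in> lists B"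
  by (auto simp: in_lists_conv_set)

lemma nth_in_lists: "xs \<in> lists A \<Longrightarrow> i < length xs \<Longrightarrow> xs ! i \<in> A"
  by (auto simp: in_lists_conv_set)

lemma listsI_nth: "(\<And>i. i < length xs \<Longrightarrow> xs ! i \<in> A) \<Longrightarrow> xs \<in> lists A"
  by (auto simp: in_lists_conv_set in_set_conv_nth)

section \<open>Functors, 2-cells, unit and multiplication of the 2-monad in normal form\<close>

context action_operad
begin

lemma EL_map_obj [simp]:
  assumes "xs \<in> lists (obj X)" "\<And>x. x \<in> obj X \<Longrightarrow> fobj F x \<in> obj Y"
  shows "fobj (EL_map L X Y F) (OC (obj X) xs) = OC (obj Y) (map (fobj F) xs)"
proof -
  have "fobj (EL_map L X Y F) (OC (obj X) xs) =
      (\<Union>(p, ys)\<in>OC (obj X) xs. ocls L Y p (map (fobj F) ys))"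
    using assms(1) by (simp add: EL_map_def)
  also have "\<dots> = OC (obj Y) (map (fobj F) xs)"
  proof (rule UN_const[OF e_in_OC[OF assms(1)]], clarify)
    fix p ys assume "(p, ys) \<in> OC (obj X) xs"
    note * = OC_elim[OF this]
    have "map (fobj F) ys \<in> lists (obj Y)" using map_in_lists[OF *(1)] assms(2) .
    then show "ocls L Y p (map (fobj F) ys) = OC (obj Y) (map (fobj F) xs)" using * by simp
  qed
  finally show ?thesis .
qed

lemma EL_map_arr [simp]:
  assumes "fs \<in> lists (arr X)" "g \<in> el L (length fs)" "\<And>f. f \<in> arr X \<Longrightarrow> farr F f \<in> arr Y"
  shows "farr (EL_map L X Y F) (AC (arr X) g fs) = AC (arr Y) g (map (farr F) fs)"
proof -
  have "farr (EL_map L X Y F) (AC (arr X) g fs) =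
      (\<Union>((p, q), hs)\<in>AC (arr X) g fs. acls L Y p q (map (farr F) hs))"
    using assms(1,2) by (simp add: EL_map_def)
  also have "\<dots> = AC (arr Y) g (map (farr F) fs)"
  proof (rule UN_const[OF e_in_AC[OF assms(1,2)]], clarify)
    fix p q hs assume "((p, q), hs) \<in> AC (arr X) g fs"
    note * = AC_elim[OF this]
    have "map (farr F) hs \<in> lists (arr Y)" using map_in_lists[OF *(1)] assms(3) .
    then show "acls L Y p q (map (farr F) hs) = AC (arr Y) g (map (farr F) fs)" using * by simp
  qed
  finally show ?thesis .
qed

lemma EL_trans [simp]:
  assumes "xs \<in> lists (obj X)" "\<And>x. x \<in> obj X \<Longrightarrow> t x \<in> arr Y"
  shows "EL_trans L X Y t (OC (obj X) xs) = AC (arr Y) (eL L (length xs)) (map t xs)"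
proof -
  have "EL_trans L X Y t (OC (obj X) xs) = (\<Union>(p, ys)\<in>OC (obj X) xs. acls L Y p p (map t ys))"
    using assms(1) by (simp add: EL_trans_def)
  also have "\<dots> = AC (arr Y) (eL L (length xs)) (map t xs)"
  proof (rule UN_const[OF e_in_OC[OF assms(1)]], clarify)
    fix p ys assume "(p, ys) \<in> OC (obj X) xs"
    note * = OC_elim[OF this]
    have "map t ys \<in> lists (arr Y)" using map_in_lists[OF *(1)] assms(2) .
    then show "acls L Y p p (map t ys) = AC (arr Y) (eL L (length xs)) (map t xs)" using * by simp
  qed
  finally show ?thesis .
qed

lemma EL_unit_obj [simp]: "x \<in> obj X \<Longrightarrow> fobj (EL_unit L X) x = OC (obj X) [x]"
  by (simp add: EL_unit_def)

lemma EL_unit_arr [simp]: "f \<in> arr X \<Longrightarrow> farr (EL_unit L X) f = AC (arr X) (eL L 1) [f]"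
  by (simp add: EL_unit_def)

lemma EOb_nonempty:
  assumes "c \<in> EOb A" shows "c \<noteq> {}"
proof -
  from assms obtain xs where "xs \<in> lists A" "c = OC A xs" unfolding EOb_def by (elim imageE)
  with e_in_OC[of xs A] show ?thesis by fastforce
qed

lemma EAr_nonempty:
  assumes "c \<in> EAr A" shows "c \<noteq> {}"
proof -
  from assms obtain g fs where "fs \<in> lists A" "g \<in> el L (length fs)" "c = AC A g fs"
      by (rule EAr_cases)
  with e_in_AC[of fs A g] show ?thesis by fastforce
qed

lemma map_OC_inj: "xss \<in> lists (lists A) \<Longrightarrow> map (OC A) xss = map (OC A) yss \<longleftrightarrow> xss = yss"
proof (induction xss arbitrary: yss)
  case (Cons xs xss)
  then show ?case by (cases yss) simp_all
qed auto

text \<open>For arbitrary representatives, the inner elements \<open>qs\<close> bring the inner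
  lists to normal form \<open>zss\<close>, and \<open>p\<close> carries \<open>zss\<close> to
  \<open>xss\<close>; \<open>lact_amu\<close> says that the product of \<open>p\<close> and
  \<open>qs\<close> does both at once on the concatenation.\<close>

lemma EL_mult_obj [simp]:
  assumes "xss \<in> lists (lists (obj X))"
  shows "fobj (EL_mult L X) (OC (EOb (obj X)) (map (OC (obj X)) xss)) = OC (obj X) (concat xss)"
proof -
  let ?c = "OC (EOb (obj X)) (map (OC (obj X)) xss)"
  have cs: "map (OC (obj X)) xss \<in> lists (EOb (obj X))"
    using map_in_lists[OF assms] OC_EOb .
  let ?f = "\<lambda>(p, cs). \<Union>ds\<in>listset cs. ocls L X (amu L (map (\<lambda>(q, xs). length xs) ds) p (map fst
      ds)) (concat (map snd ds))"
  have "fobj (EL_mult L X) ?c = (\<Union>d\<in>?c. ?f d)"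
    using cs by (simp add: EL_mult_def)
  also have "\<dots> = OC (obj X) (concat xss)"
  proof (rule UN_const[OF e_in_OC[OF cs]], clarify)
    fix p cs assume "(p, cs) \<in> ?c"
    note c = OC_elim[OF this]
    have "\<exists>ds. ds \<in> listset cs"
      by (intro listset_nonempty EOb_nonempty[where A =
          "obj X"]) (use c(1) in \<open>simp add: in_lists_conv_set\<close>)
    then obtain ds0 where ds0: "ds0 \<in> listset cs" ..
    show "(\<Union>ds\<in>listset cs. ocls L X (amu L (map (\<lambda>(q, xs). length xs) ds) p (map fst ds)) (concat
        (map snd ds)))
      = OC (obj X) (concat xss)"
    proof (rule UN_const[OF ds0])
      fix ds assume "ds \<in> listset cs"
      then have len: "length ds = length cs" and ds: "\<And>i. i < length cs \<Longrightarrow> ds ! i \<in> cs ! i"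
        by (auto simp: in_listset_iff list_all2_conv_all_nth)
      define qs where "qs = map fst ds"
      define yss where "yss = map snd ds"
      define zss where "zss = map2 (lact L) qs yss"
      have lens: "length qs = length cs" "length yss = length cs" "length zss = length cs"
        using len by (simp_all add: qs_def yss_def zss_def)
      have i: "yss ! i \<in> lists (obj X)" "qs ! i \<in> el L (length (yss ! i))" "cs ! i =
          OC (obj X) (zss ! i)"
        if "i < length cs" for i
      proof -
        from nth_in_lists[OF c(1) that] obtain zs where zs: "zs \<in> lists (obj X)" "cs ! i =
            OC (obj X) zs"
          unfolding EOb_def by blast
        have "(qs ! i, yss ! i) \<in> OC (obj X) zs" using ds[OF that] zs that len
            by (simp add: qs_def yss_def)
        note o = OC_elim[OF this]
        show "yss ! i \<in> lists (obj X)" "qs ! i \<in> el L (length (yss ! i))" by (fact o)+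
        show "cs ! i = OC (obj X) (zss ! i)" using o(3) zs that lens by (simp add: zss_def)
      qed
      have cs: "cs = map (OC (obj X)) zss"
        using i(3) lens by (intro nth_equalityI) simp_all
      have yss: "yss \<in> lists (lists (obj X))"
        by (rule listsI_nth) (use i(1) lens in simp)
      have els: "els qs (map length yss)"
        using i(2) lens by (simp add: list_all2_conv_all_nth)
      have zss: "zss ! i \<in> lists (obj X)" if "i < length cs" for i
        using i(1,2)[OF that] that lens by (simp add: zss_def)
      have p: "p \<in> el L (length zss)" using c(2) lens by simp
      have "map (OC (obj X)) (lact L p zss) = map (OC (obj X)) xss"
        using c(3) p unfolding cs by simp
      \<comment> \<open>The outer orbit only compares lists of inner orbits; injectivity of
        \<open>OC\<close> on lists recovers the lists themselves.\<close>
      then have l: "lact L p zss = xss"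
        using map_OC_inj[OF assms] by metis
      have len2: "map (\<lambda>(q, xs). length xs) ds = map length yss" by (auto simp: yss_def)
      have "amu L (map length yss) p qs \<in> el L (sum_list (map length yss))"
        using els p lens by (intro mu_closed) simp_all
      then have "ocls L X (amu L (map length yss) p qs) (concat yss) =
          OC (obj X) (lact L (amu L (map length yss) p qs) (concat yss))"
        using concat_in_lists[OF yss] by (simp add: length_concat)
      also have "lact L (amu L (map length yss) p qs) (concat yss) = concat xss"
        using lact_amu[of p yss qs] p els l lens by (simp add: zss_def)
      finally show "ocls L X (amu L (map (\<lambda>(q, xs). length xs) ds) p (map fst ds)) (concat (map
          snd ds)) =
          OC (obj X) (concat xss)" unfolding len2 qs_def[symmetric] yss_def[symmetric] .
    qed
  qed
  finally show ?thesis .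
qed

lemma map2_AC_in_lists:
  assumes "fss \<in> lists (lists A)" "els vs (map length fss)"
  shows "map2 (AC A) vs fss \<in> lists (EAr A)"
proof (rule listsI_nth)
  fix i assume "i < length (map2 (AC A) vs fss)"
  then show "map2 (AC A) vs fss ! i \<in> EAr A"
    using assms(2) nth_in_lists[OF assms(1), of i]
        by (auto simp: list_all2_conv_all_nth intro!: AC_EAr)
qed

text \<open>A representative has p' = u p outside and q'_i = w_i q_i inside, with \<open>p\<close>
  carrying \<open>ws\<close> to \<open>vs\<close>. Interchange turns this into \<mu>(p'; qs') =
  \<mu>(u; vs) \<mu>(p; qs), so the invariant of the resulting orbit is \<mu>(u; vs) whatever the
  representatives are.\<close>

lemma EL_mult_arr [simp]:
  assumes fss: "fss \<in> lists (lists (arr X))" and u: "u \<in> el L (length fss)"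
      and vs: "els vs (map length fss)"
  shows "farr (EL_mult L X) (AC (EAr (arr X)) u (map2 (AC (arr X)) vs fss)) =
     AC (arr X) (amu L (map length fss) u vs) (concat fss)"
proof -
  let ?A = "arr X"
  let ?c = "AC (EAr ?A) u (map2 (AC ?A) vs fss)"
  have lvs: "length vs = length fss" and vsi: "\<And>i. i < length fss \<Longrightarrow>
      vs ! i \<in> el L (length (fss ! i))"
    using vs by (auto simp: list_all2_conv_all_nth)
  have cs: "map2 (AC ?A) vs fss \<in> lists (EAr ?A)" using map2_AC_in_lists[OF fss vs] .
  have u': "u \<in> el L (length (map2 (AC ?A) vs fss))" using u lvs by simp
  let ?f = "\<lambda>((p, p'), cs). \<Union>ds\<in>listset cs.
        acls L X (amu L (map (\<lambda>(q, fs). length fs) ds) p (map (\<lambda>((q, q'), fs). q) ds))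
                 (amu L (map (\<lambda>(q, fs). length fs) ds) p' (map (\<lambda>((q, q'), fs). q') ds))
                 (concat (map snd ds))"
  have "farr (EL_mult L X) ?c = (\<Union>d\<in>?c. ?f d)"
    using cs u' by (simp add: EL_mult_def)
  also have "\<dots> = AC ?A (amu L (map length fss) u vs) (concat fss)"
  proof (rule UN_const[OF e_in_AC[OF cs u']], clarify)
    fix p p' cs assume "((p, p'), cs) \<in> ?c"
    note c = AC_elim[OF this]
    have n: "length cs = length fss" using c(5) lvs by simp
    have "\<exists>ds. ds \<in> listset cs"
      by (intro listset_nonempty EAr_nonempty[where A =
          "arr X"]) (use c(1) in \<open>simp add: in_lists_conv_set\<close>)
    then obtain ds0 where ds0: "ds0 \<in> listset cs" ..
    show "(\<Union>ds\<in>listset cs.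
        acls L X (amu L (map (\<lambda>(q, fs). length fs) ds) p (map (\<lambda>((q, q'), fs). q) ds))
                 (amu L (map (\<lambda>(q, fs). length fs) ds) p' (map (\<lambda>((q, q'), fs). q') ds))
                 (concat (map snd ds))) = AC ?A (amu L (map length fss) u vs) (concat fss)"
    proof (rule UN_const[OF ds0])
      fix ds assume "ds \<in> listset cs"
      then have len: "length ds = length fss" and ds: "\<And>i. i < length fss \<Longrightarrow> ds ! i \<in> cs ! i"
        using n by (auto simp: in_listset_iff list_all2_conv_all_nth)
      define qs where "qs = map (\<lambda>((q, q'), fs). q) ds"
      define qs' where "qs' = map (\<lambda>((q, q'), fs). q') ds"
      define hss where "hss = map snd ds"
      define gss where "gss = map2 (lact L) qs hss"
      \<comment> \<open>The operad elements of the inner normal forms, still in the order before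
        \<open>p\<close> acts.\<close>
      define ws where "ws = map (\<lambda>i. mult (length (hss ! i)) (qs' ! i) (inver (length (hss ! i))
          (qs ! i))) [0..<length fss]"
      have lens: "length qs = length fss" "length qs' = length fss" "length hss = length fss"
        "length gss = length fss" "length ws = length fss"
        using len by (simp_all add: qs_def qs'_def hss_def gss_def ws_def)
      have i: "hss ! i \<in> lists ?A" "qs ! i \<in> el L (length (hss ! i))"
          "qs' ! i \<in> el L (length (hss ! i))"
          "cs ! i = AC ?A (ws ! i) (gss ! i)"
        if "i < length fss" for i
      proof -
        from that n have "i < length cs" by simp
        from nth_in_lists[OF c(1) this] obtain k ks where ks: "ks \<in> lists ?A" "cs ! i =
            AC ?A k ks"
          by (rule EAr_cases)
        have "((qs ! i, qs' ! i), hss ! i) \<in> AC ?A k ks" using ds[OF that] ks that len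
          by (cases "ds ! i") (auto simp: qs_def qs'_def hss_def)
        note o = AC_elim[OF this]
        show "hss ! i \<in> lists ?A" "qs ! i \<in> el L (length (hss ! i))"
            "qs' ! i \<in> el L (length (hss ! i))"
          using o by simp_all
        show "cs ! i = AC ?A (ws ! i) (gss ! i)" using o(4-6) ks that lens
            by (simp add: ws_def gss_def)
      qed
      have ws: "ws ! i \<in> el L (length (gss ! i))" "gss ! i \<in> lists ?A" "length (gss ! i) =
          length (hss ! i)"
        if "i < length fss" for i
        using i(1-3)[OF that] that lens by (simp_all add: ws_def gss_def)
      have cs: "cs = map2 (AC ?A) ws gss"
        using i(4) n lens by (intro nth_equalityI) simp_all
      have p: "p \<in> el L (length fss)" using c(2) lvs by simp
      have eq: "map2 (AC ?A) (lact L p ws) (lact L p gss) = map2 (AC ?A) vs fss"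
        using c(4) p lens unfolding cs by (subst (asm) lact_map2) simp_all
      have g1: "lact L p gss \<in> lists (lists ?A)"
        using p listsI_nth[of gss "lists ?A"] ws(2) lens by simp
      have g2: "els (lact L p ws) (lact L p (map length gss))"
      proof -
        have "els ws (map length gss)" using ws(1) lens by (simp add: list_all2_conv_all_nth)
        then show ?thesis using lact_list_all2[of p ws "map length gss"] p lens
            by (simp del: lact_map)
      qed
      have "lact L p ws ! i = vs ! i \<and> lact L p gss ! i = fss ! i"
        if i: "i < length fss" for i
      proof -
        have a: "AC ?A (lact L p ws ! i) (lact L p gss ! i) = AC ?A (vs ! i) (fss ! i)"
          using arg_cong[OF eq, of "\<lambda>xs. xs ! i"] i lens lvs by simp
        have b: "lact L p gss ! i \<in> lists ?A"
          using nth_in_lists[OF g1] i lens by simp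
        have c: "lact L p ws ! i \<in> el L (length (lact L p gss ! i))"
          using list_all2_nthD[OF g2, of i] i lens p by simp
        show ?thesis using a AC_inj[OF b c, of "vs ! i" "fss ! i"] by simp
      qed
      then have l: "lact L p ws = vs" "lact L p gss = fss"
        using lens lvs by (auto intro!: nth_equalityI)
      let ?ks = "map length hss"
      have ks: "?ks = map length gss"
        using ws(3) lens by (intro nth_equalityI) simp_all
      have lks: "lact L p ?ks = map length fss"
        unfolding ks using p lens l by simp
      have els: "els qs ?ks" "els qs' ?ks" "els ws ?ks"
        using i ws lens by (simp_all add: list_all2_conv_all_nth)
      \<comment> \<open>Entrywise q'_i = w_i q_i, which puts the right-hand side of interchange in
        the required form.\<close>
      have qs': "mults ?ks ws qs = qs'"
        using i lens by (intro nth_equalityI) (simp_all add: ws_def grp.m_assoc)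
      have "mult (length fss) u p = p'" using c(7) lvs by simp
      moreover have "length fss = length ?ks" using lens by simp
      ultimately have A: "mult (sum_list ?ks) (amu L (map length fss) u vs) (amu L ?ks p qs) =
          amu L ?ks p' qs'"
        using amu_interchange[OF p u _ els(1,3)] unfolding lks l qs' by metis
      have cl: "amu L ?ks p qs \<in> el L (sum_list ?ks)" "amu L ?ks p' qs' \<in> el L (sum_list ?ks)"
        "amu L (map length fss) u vs \<in> el L (sum_list ?ks)"
      proof -
        show "amu L ?ks p qs \<in> el L (sum_list ?ks)" "amu L ?ks p' qs' \<in> el L (sum_list ?ks)"
          using mu_closed[OF _ els(1), of p] mu_closed[OF _ els(2), of p'] p c(3) lens lvs
              by simp_all
        have "sum_list ?ks = sum_list (map length fss)"
          using lks p lens by (metis length_map sum_list_lact)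
        then show "amu L (map length fss) u vs \<in> el L (sum_list ?ks)"
          using u vs mu_closed[of u "map length fss" vs] by simp
      qed
      have hss: "concat hss \<in> lists ?A"
        by (rule concat_in_lists, rule listsI_nth) (use i(1) lens in simp)
      have B: "mult (sum_list ?ks) (amu L ?ks p' qs') (inver (sum_list ?ks) (amu L ?ks p qs)) =
          amu L (map length fss) u vs"
        using cl by (simp add: grp.m_assoc flip: A)
      have C: "lact L (amu L ?ks p qs) (concat hss) = concat fss"
        using lact_amu[of p hss qs] p lens els l by (simp add: gss_def)
      have len2: "map (\<lambda>(q, xs). length xs) ds = ?ks" by (auto simp: hss_def)
      show "acls L X (amu L (map (\<lambda>(q, fs). length fs) ds) p (map (\<lambda>((q, q'), fs). q) ds))
                 (amu L (map (\<lambda>(q, fs). length fs) ds) p' (map (\<lambda>((q, q'), fs). q') ds))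
                 (concat (map snd ds)) = AC ?A (amu L (map length fss) u vs) (concat fss)"
        unfolding len2 qs_def[symmetric] qs'_def[symmetric] hss_def[symmetric]
        using cl hss B C by (simp add: length_concat)
    qed
  qed
  finally show ?thesis .
qed

end

section \<open>Algebras in normal form\<close>

text \<open>The assumptions up to \<open>B_cmp\<close> express functoriality of the structure map,
  the two \<open>_single\<close> ones the unit law, and the two \<open>_concat\<close> ones the
  multiplication law.\<close>

locale nf_algebra = operad_cat L X
  for L :: "'g action_operad_data" and X :: "('o, 'a, 'z) cat_scheme" +
  fixes A :: "'o list \<Rightarrow> 'o" and B :: "'g \<Rightarrow> 'a list \<Rightarrow> 'a"
  assumes A_obj: "xs \<in> lists (obj X) \<Longrightarrow> A xs \<in> obj X"
    and B_arr: "fs \<in> lists (arr X) \<Longrightarrow> g \<in> el L (length fs) \<Longrightarrow> B g fs \<in> arr X"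
    and src_B: "fs \<in> lists (arr X) \<Longrightarrow> g \<in> el L (length fs) \<Longrightarrow> src X (B g fs) = A (map (src X) fs)"
    and tgt_B: "fs \<in> lists (arr X) \<Longrightarrow> g \<in> el L (length fs) \<Longrightarrow> tgt X (B g fs) =
        A (lact L g (map (tgt X) fs))"
    and B_ide: "xs \<in> lists (obj X) \<Longrightarrow> B (eL L (length xs)) (map (ide X) xs) = ide X (A xs)"
    and B_cmp: "\<lbrakk>fs \<in> lists (arr X); gs \<in> lists (arr X); map (src X) gs = map (tgt X) fs;
        g \<in> el L (length fs); h \<in> el L (length fs)\<rbrakk>
      \<Longrightarrow> B (h \<otimes>\<^bsub>grp L (length fs)\<^esub> g) (map2 (\<lambda>g f. g \<cdot>\<^bsub>X\<^esub> f) gs fs) = B h (lact L g gs) \<cdot>\<^bsub>X\<^esub>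
          B g fs"
    and A_single: "x \<in> obj X \<Longrightarrow> A [x] = x"
    and B_single: "f \<in> arr X \<Longrightarrow> B (eL L 1) [f] = f"
    and A_concat: "xss \<in> lists (lists (obj X)) \<Longrightarrow> A (map A xss) = A (concat xss)"
    and B_concat: "\<lbrakk>fss \<in> lists (lists (arr X)); u \<in> el L (length fss);
        list_all2 (\<lambda>v fs. v \<in> el L (length fs)) vs fss\<rbrakk>
      \<Longrightarrow> B u (map2 B vs fss) = B (amu L (map length fss) u vs) (concat fss)"

context action_operad
begin

lemma els_map_length: "els vs (map length fss) \<longleftrightarrow> list_all2 (\<lambda>v fs. v \<in> el L (length fs)) vs fss"
  by (simp add: list.rel_map)

lemma lists_EOb_cases:
  assumes "cs \<in> lists (EOb A)" obtains xss where "xss \<in> lists (lists A)" "cs = map (OC A) xss"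
  using assms unfolding EOb_def lists_image by (elim imageE)

lemma lists_EAr_cases:
  assumes "cs \<in> lists (EAr A)"
  obtains vs fss where "fss \<in> lists (lists A)" "list_all2 (\<lambda>v fs. v \<in> el L (length fs)) vs fss"
    "cs = map2 (AC A) vs fss" "length cs = length fss"
proof -
  from assms have "\<exists>vs fss. fss \<in> lists (lists A) \<and>
      list_all2 (\<lambda>v fs. v \<in> el L (length fs)) vs fss \<and>
      cs = map2 (AC A) vs fss \<and> length cs = length fss"
  proof (induction cs)
    case (Cons c cs)
    then obtain vs fss where *: "fss \<in> lists (lists A)"
        "list_all2 (\<lambda>v fs. v \<in> el L (length fs)) vs fss"
      "cs = map2 (AC A) vs fss" "length cs = length fss" by (elim exE conjE)
    from Cons obtain g fs where **: "fs \<in> lists A" "g \<in> el L (length fs)" "c = AC A g fs"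
        by (elim EAr_cases)
    show ?case
      by (rule exI[of _ "g # vs"], rule exI[of _ "fs # fss"]) (use * ** in simp)
  qed simp
  then show thesis by (elim exE conjE that)
qed

lemma el_algebra_nf:
  assumes "el_algebra L X"
  shows "nf_algebra L X (\<lambda>xs. fobj (alg X) (OC (obj X) xs)) (\<lambda>g fs. farr (alg X) (AC (arr X) g
      fs))"
proof -
  interpret el_algebra L X by fact
  interpret X: operad_cat L X by unfold_locales
  have [simp]: "xs \<in> lists (obj X) \<Longrightarrow> fobj (alg X) (OC (obj X) xs) \<in> obj X" for xs
    by (rule structure_map.fobj_obj) simp
  have [simp]: "fs \<in> lists (arr X) \<Longrightarrow> g \<in> el L (length fs) \<Longrightarrow>
      farr (alg X) (AC (arr X) g fs) \<in> arr X" for g fs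
    by (rule structure_map.farr_arr) simp
  show ?thesis
  proof
    fix xs assume xs: "xs \<in> lists (obj X)"
    then show "fobj (alg X) (OC (obj X) xs) \<in> obj X" by simp
    show "farr (alg X) (AC (arr X) (eL L (length xs)) (map (ide X) xs)) =
        ide X (fobj (alg X) (OC (obj X) xs))"
      using structure_map.farr_ide[of "OC (obj X) xs"] xs by simp
  next
    fix fs g assume fs: "fs \<in> lists (arr X)" "g \<in> el L (length fs)"
    then show "farr (alg X) (AC (arr X) g fs) \<in> arr X" by simp
    show "src X (farr (alg X) (AC (arr X) g fs)) = fobj (alg X) (OC (obj X) (map (src X) fs))"
      using fs by simp
    show "tgt X (farr (alg X) (AC (arr X) g fs)) =
        fobj (alg X) (OC (obj X) (lact L g (map (tgt X) fs)))"
      using fs by (simp del: lact_map)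
  next
    fix fs gs g h assume *: "fs \<in> lists (arr X)" "gs \<in> lists (arr X)" "map (src X) gs =
        map (tgt X) fs"
      "g \<in> el L (length fs)" "h \<in> el L (length fs)"
    note l = X.map2_cmp_lists(2)[OF *(2,1,3)]
    have "farr (alg X) (AC (arr X) h (lact L g gs) \<cdot>\<^bsub>EL L X\<^esub> AC (arr X) g fs) =
      farr (alg X) (AC (arr X) h (lact L g gs)) \<cdot>\<^bsub>X\<^esub> farr (alg X) (AC (arr X) g fs)"
      using * l by (intro structure_map.farr_comp) (simp_all flip: lact_map)
    then show "farr (alg X) (AC (arr X) (mult (length fs) h g) (map2 (\<lambda>g f. g \<cdot>\<^bsub>X\<^esub> f) gs fs)) =
      farr (alg X) (AC (arr X) h (lact L g gs)) \<cdot>\<^bsub>X\<^esub> farr (alg X) (AC (arr X) g fs)"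
      using * by simp
  next
    fix x assume "x \<in> obj X" then show "fobj (alg X) (OC (obj X) [x]) = x"
      using fun_cong[OF arg_cong[OF alg_unit, of fobj], of x]
          by (simp add: fcomp_def fid_def compose_def)
  next
    fix f assume "f \<in> arr X" then show "farr (alg X) (AC (arr X) (eL L 1) [f]) = f"
      using fun_cong[OF arg_cong[OF alg_unit, of farr], of f]
          by (simp add: fcomp_def fid_def compose_def)
  next
    fix xss assume xss: "xss \<in> lists (lists (obj X))"
    have cs: "map (OC (obj X)) xss \<in> lists (EOb (obj X))" using map_in_lists[OF xss OC_EOb] .
    have "fobj (EL_map L (EL L X) X (alg X)) (OC (obj (EL L X)) (map (OC (obj X)) xss)) =
       OC (obj X) (map (fobj (alg X)) (map (OC (obj X)) xss))"
      using cs by (intro EL_map_obj) simp_all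
    then show "fobj (alg X) (OC (obj X) (map (\<lambda>xs. fobj (alg X) (OC (obj X) xs)) xss)) =
        fobj (alg X) (OC (obj X) (concat xss))"
      using fun_cong[OF arg_cong[OF alg_mult, of fobj], of "OC (EOb (obj X)) (map (OC (obj X))
          xss)"] cs xss
      by (simp add: fcomp_def compose_def comp_def)
  next
    fix fss u vs assume *: "fss \<in> lists (lists (arr X))" "u \<in> el L (length fss)"
       "list_all2 (\<lambda>v fs. v \<in> el L (length fs)) vs fss"
    have cs: "map2 (AC (arr X)) vs fss \<in> lists (EAr (arr X))"
      using * by (intro map2_AC_in_lists) (simp_all add: els_map_length)
    have l: "length vs = length fss" using *(3) by (rule list_all2_lengthD)
    have "farr (EL_map L (EL L X) X (alg X)) (AC (arr (EL L X)) u (map2 (AC (arr X)) vs fss)) =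
       AC (arr X) u (map (farr (alg X)) (map2 (AC (arr X)) vs fss))"
      using cs l * by (intro EL_map_arr) simp_all
    moreover have "map (farr (alg X)) (map2 (AC (arr X)) vs fss) =
        map2 (\<lambda>g fs. farr (alg X) (AC (arr X) g fs)) vs fss"
      by (simp add: comp_def case_prod_beta)
    ultimately show "farr (alg X) (AC (arr X) u (map2 (\<lambda>g fs. farr (alg X) (AC (arr X) g fs)) vs
        fss)) =
      farr (alg X) (AC (arr X) (amu L (map length fss) u vs) (concat fss))"
      using fun_cong[OF arg_cong[OF alg_mult, of farr], of "AC (EAr (arr X)) u (map2 (AC (arr X))
          vs fss)"] cs * l
      by (simp add: fcomp_def compose_def els_map_length del: map_map)
  qed
qed

lemma fcomp_eqI:
  assumes "\<And>x. x \<in> obj C \<Longrightarrow> fobj G (fobj F x) = fobj G' (fobj F' x)"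
    and "\<And>f. f \<in> arr C \<Longrightarrow> farr G (farr F f) = farr G' (farr F' f)"
  shows "fcomp C G F = fcomp C G' F'"
  unfolding fcomp_def using assms by (auto simp: compose_def restrict_def fun_eq_iff)

text \<open>Every object and arrow of the free algebra, and of its second iterate, has a normal
  form, so the functor equations reduce to the assumptions of \<open>nf_algebra\<close>. The
  \<open>extensional\<close> hypotheses supply the rest of the functor typing.\<close>

lemma nf_el_algebra:
  assumes nf: "nf_algebra L X (\<lambda>xs. fobj (alg X) (OC (obj X) xs)) (\<lambda>g fs. farr (alg X) (AC (arr X)
      g fs))"
    and ext: "fobj (alg X) \<in> extensional (EOb (obj X))" "farr (alg X) \<in> extensional (EAr (arr X))"
  shows "el_algebra L X"
proof -
  interpret nf_algebra L X "\<lambda>xs. fobj (alg X) (OC (obj X) xs)"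
      "\<lambda>g fs. farr (alg X) (AC (arr X) g fs)" by fact
  interpret F: cat_functor "EL L X" X "alg X"
  proof (rule cat_functorI)
    show "fobj (alg X) \<in> obj (EL L X) \<rightarrow>\<^sub>E obj X"
    proof (rule PiE_I)
      fix c assume "c \<in> obj (EL L X)" then show "fobj (alg X) c \<in> obj X"
        unfolding obj_EL EOb_def by (elim imageE) (simp add: A_obj)
    qed (use ext in \<open>simp add: extensional_def\<close>)
    show "farr (alg X) \<in> arr (EL L X) \<rightarrow>\<^sub>E arr X"
    proof (rule PiE_I)
      fix c assume "c \<in> arr (EL L X)" then show "farr (alg X) c \<in> arr X"
        unfolding arr_EL by (elim EAr_cases) (simp add: B_arr)
    qed (use ext in \<open>simp add: extensional_def\<close>)
  next
    fix c assume "c \<in> arr (EL L X)"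
    then obtain fs g where *: "fs \<in> lists (arr X)" "g \<in> el L (length fs)" "c = AC (arr X) g fs"
      unfolding arr_EL by (rule EAr_cases)
    then show "src X (farr (alg X) c) = fobj (alg X) (src (EL L X) c)"
      "tgt X (farr (alg X) c) = fobj (alg X) (tgt (EL L X) c)"
      using src_B tgt_B by (simp_all del: lact_map)
  next
    fix c assume "c \<in> obj (EL L X)"
    then show "farr (alg X) (ide (EL L X) c) = ide X (fobj (alg X) c)"
      unfolding obj_EL EOb_def by (elim imageE) (simp add: B_ide)
  next
    fix d c assume "d \<in> arr (EL L X)" "c \<in> arr (EL L X)" "src (EL L X) d = tgt (EL L X) c"
    then obtain fs g gs h where *: "fs \<in> lists (arr X)" "g \<in> el L (length fs)"
        "gs \<in> lists (arr X)"
      "h \<in> el L (length fs)" "map (src X) gs = map (tgt X) fs" "length gs = length fs"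
      "c = AX g fs" "d = AX h (lact L g gs)"
      unfolding arr_EL by (rule EL_composable_cases)
    then show "farr (alg X) (d \<cdot>\<^bsub>EL L X\<^esub> c) = farr (alg X) d \<cdot>\<^bsub>X\<^esub> farr (alg X) c"
      using B_cmp[OF *(1,3,5,2,4)] by simp
  qed unfold_locales
  show ?thesis
  proof
    have "fcomp X (alg X) (EL_unit L X) = fcomp X (fid X) (fid X)"
      by (rule fcomp_eqI) (simp_all add: fid_def A_single B_single[unfolded One_nat_def])
    also have "\<dots> = fid X" by (simp add: fcomp_def fid_def compose_def restrict_def fun_eq_iff)
    finally show "fcomp X (alg X) (EL_unit L X) = fid X" .
    show "fcomp (EL L (EL L X)) (alg X) (EL_map L (EL L X) X (alg X)) =
        fcomp (EL L (EL L X)) (alg X) (EL_mult L X)"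
    proof (rule fcomp_eqI)
      fix c assume "c \<in> obj (EL L (EL L X))"
      then obtain cs where cs: "cs \<in> lists (EOb (obj X))" "c = OC (EOb (obj X)) cs"
        unfolding obj_EL by (subst (asm) EOb_def) (elim imageE)
      from cs(1) obtain xss where xss: "xss \<in> lists (lists (obj X))" "cs = map (OC (obj X)) xss"
        by (rule lists_EOb_cases)
      have "fobj (EL_map L (EL L X) X (alg X)) (OC (obj (EL L X)) cs) =
          OC (obj X) (map (fobj (alg X)) cs)"
        using cs by (intro EL_map_obj) simp_all
      then show "fobj (alg X) (fobj (EL_map L (EL L X) X (alg X)) c) =
          fobj (alg X) (fobj (EL_mult L X) c)"
        using cs xss A_concat[OF xss(1)] by (simp add: comp_def)
    next
      fix c assume "c \<in> arr (EL L (EL L X))"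
      then obtain u cs where cs: "cs \<in> lists (EAr (arr X))" "u \<in> el L (length cs)" "c =
          AC (EAr (arr X)) u cs"
        unfolding arr_EL by (rule EAr_cases)
      from cs(1) obtain vs fss where *: "fss \<in> lists (lists (arr X))"
          "list_all2 (\<lambda>v fs. v \<in> el L (length fs)) vs fss"
        "cs = map2 (AC (arr X)) vs fss" "length cs = length fss"
        by (rule lists_EAr_cases)
      have "farr (EL_map L (EL L X) X (alg X)) (AC (arr (EL L X)) u cs) =
          AC (arr X) u (map (farr (alg X)) cs)"
        using cs by (intro EL_map_arr) simp_all
      moreover have "map (farr (alg X)) cs = map2 (\<lambda>g fs. farr (alg X) (AC (arr X) g fs)) vs fss"
        using * by (simp add: comp_def case_prod_beta)
      ultimately have "farr (alg X) (farr (EL_map L (EL L X) X (alg X)) c) =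
        farr (alg X) (AC (arr X) (amu L (map length fss) u vs) (concat fss))"
        using cs * B_concat[OF *(1) _ *(2), of u] by (simp del: map_map)
      moreover have "farr (EL_mult L X) c = AC (arr X) (amu L (map length fss) u vs) (concat fss)"
        unfolding cs(3) *(3) using * cs(2) by (intro EL_mult_arr) (simp_all add: els_map_length)
      ultimately show "farr (alg X) (farr (EL_map L (EL L X) X (alg X)) c) =
          farr (alg X) (farr (EL_mult L X) c)"
        by simp
    qed
  qed
qed

text \<open>Both sides of \<open>commutes\<close> are restricted to the carriers of the free
  algebra, where normal forms exhaust all arguments.\<close>

lemma el_strict_morphism_iff:
  assumes X: "el_algebra L X" and Y: "el_algebra L Y"
  shows "el_strict_morphism L X Y F \<longleftrightarrow> cat_functor X Y F \<and>
    (\<forall>xs \<in> lists (obj X). fobj F (fobj (alg X) (OC (obj X) xs)) =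
        fobj (alg Y) (OC (obj Y) (map (fobj F) xs))) \<and>
    (\<forall>fs \<in> lists (arr X). \<forall>g \<in> el L (length fs).
       farr F (farr (alg X) (AC (arr X) g fs)) = farr (alg Y) (AC (arr Y) g (map (farr F) fs)))"
    (is "_ \<longleftrightarrow> _ \<and> ?O \<and> ?A")
proof -
  have "fcomp (EL L X) F (alg X) = fcomp (EL L X) (alg Y) (EL_map L X Y F) \<longleftrightarrow> ?O \<and> ?A"
      if F: "cat_functor X Y F"
  proof -
    interpret F: cat_functor X Y F by fact
    show ?thesis
    proof (intro iffI conjI ballI)
      assume eq: "fcomp (EL L X) F (alg X) = fcomp (EL L X) (alg Y) (EL_map L X Y F)"
      fix xs assume "xs \<in> lists (obj X)"
      then show "fobj F (fobj (alg X) (OC (obj X) xs)) =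
          fobj (alg Y) (OC (obj Y) (map (fobj F) xs))"
        using fun_cong[OF arg_cong[OF eq, of fobj], of "OC (obj X) xs"]
            by (simp add: fcomp_def compose_def)
    next
      assume eq: "fcomp (EL L X) F (alg X) = fcomp (EL L X) (alg Y) (EL_map L X Y F)"
      fix fs g assume "fs \<in> lists (arr X)" "g \<in> el L (length fs)"
      then show "farr F (farr (alg X) (AC (arr X) g fs)) =
          farr (alg Y) (AC (arr Y) g (map (farr F) fs))"
        using fun_cong[OF arg_cong[OF eq, of farr], of "AC (arr X) g fs"]
            by (simp add: fcomp_def compose_def)
    next
      assume *: "?O \<and> ?A"
      show "fcomp (EL L X) F (alg X) = fcomp (EL L X) (alg Y) (EL_map L X Y F)"
      proof (rule fcomp_eqI)
        fix c assume "c \<in> obj (EL L X)"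
        then obtain xs where "xs \<in> lists (obj X)" "c = OC (obj X) xs"
          unfolding obj_EL EOb_def by (elim imageE)
        then show "fobj F (fobj (alg X) c) = fobj (alg Y) (fobj (EL_map L X Y F) c)"
          using * by simp
      next
        fix c assume "c \<in> arr (EL L X)"
        then obtain fs g where "fs \<in> lists (arr X)" "g \<in> el L (length fs)" "c = AC (arr X) g fs"
          unfolding arr_EL by (rule EAr_cases)
        then show "farr F (farr (alg X) c) = farr (alg Y) (farr (EL_map L X Y F) c)"
          using * by simp
      qed
    qed
  qed
  then show ?thesis
    using X Y by (auto simp: el_strict_morphism_def el_strict_morphism_axioms_def)
qed

lemma el_two_cell_iff:
  assumes F: "el_strict_morphism L X Y F" and G: "el_strict_morphism L X Y G"
  shows "el_two_cell L X Y F G t \<longleftrightarrow> nat_trans X Y F G t \<and>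
    (\<forall>xs \<in> lists (obj X). t (fobj (alg X) (OC (obj X) xs)) =
        farr (alg Y) (AC (arr Y) (eL L (length xs)) (map t xs)))"
proof -
  have "(\<forall>c \<in> obj (EL L X). t (fobj (alg X) c) = farr (alg Y) (EL_trans L X Y t c)) \<longleftrightarrow>
    (\<forall>xs \<in> lists (obj X). t (fobj (alg X) (OC (obj X) xs)) =
        farr (alg Y) (AC (arr Y) (eL L (length xs)) (map t xs)))"
    if "nat_trans X Y F G t"
  proof -
    interpret nat_trans X Y F G t by fact
    have [simp]: "x \<in> obj X \<Longrightarrow> t x \<in> arr Y" for x using component_type by (rule PiE_mem)
    show ?thesis by (simp add: EOb_def)
  qed
  then show ?thesis
    using F G by (auto simp: el_two_cell_def el_two_cell_axioms_def)
qed

end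

section \<open>Isomorphisms\<close>

text \<open>A choice that is meaningful for isomorphisms, where \<open>inv_arr_eq\<close> shows it
  to be the unique inverse.\<close>

definition inv_arr :: "('o, 'a, 'z) cat_scheme \<Rightarrow> 'a \<Rightarrow> 'a" where
  "inv_arr C f = (SOME g. inverse_arrows C f g)"

context category
begin

lemma iso_inverse: "iso_arr C f \<Longrightarrow> inverse_arrows C f (inv_arr C f)"
  unfolding iso_arr_def inv_arr_def by (elim exE) (rule someI)

lemma iso_simps:
  assumes "iso_arr C f"
  shows "f \<in> arr C" "inv_arr C f \<in> arr C" "src C (inv_arr C f) = tgt C f" "tgt C (inv_arr C f) =
      src C f"
    "inv_arr C f \<cdot>\<^bsub>C\<^esub> f = ide C (src C f)" "f \<cdot>\<^bsub>C\<^esub> inv_arr C f = ide C (tgt C f)"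
  using iso_inverse[OF assms] by (simp_all add: inverse_arrows_def)

lemma iso_ide: "x \<in> obj C \<Longrightarrow> iso_arr C (ide C x)"
  unfolding iso_arr_def inverse_arrows_def by (intro exI[of _ "ide C x"]) simp

lemma iso_inv_left:
  "iso_arr C f \<Longrightarrow> g \<in> arr C \<Longrightarrow> tgt C g = src C f \<Longrightarrow> inv_arr C f \<cdot>\<^bsub>C\<^esub> (f \<cdot>\<^bsub>C\<^esub> g) = g"
  by (simp add: iso_simps flip: assoc)

lemma iso_inv_right:
  "iso_arr C f \<Longrightarrow> g \<in> arr C \<Longrightarrow> tgt C g = tgt C f \<Longrightarrow> f \<cdot>\<^bsub>C\<^esub> (inv_arr C f \<cdot>\<^bsub>C\<^esub> g) = g"
  by (simp add: iso_simps flip: assoc)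

lemma iso_cancel_left:
  assumes "iso_arr C f" "g \<in> arr C" "h \<in> arr C" "tgt C g = src C f" "tgt C h = src C f"
  shows "f \<cdot>\<^bsub>C\<^esub> g = f \<cdot>\<^bsub>C\<^esub> h \<longleftrightarrow> g = h"
  using iso_inv_left[OF assms(1)] assms by metis

lemma iso_cancel_right:
  assumes "iso_arr C f" "g \<in> arr C" "h \<in> arr C" "src C g = tgt C f" "src C h = tgt C f"
  shows "g \<cdot>\<^bsub>C\<^esub> f = h \<cdot>\<^bsub>C\<^esub> f \<longleftrightarrow> g = h"
proof
  assume "g \<cdot>\<^bsub>C\<^esub> f = h \<cdot>\<^bsub>C\<^esub> f"
  then have "(g \<cdot>\<^bsub>C\<^esub> f) \<cdot>\<^bsub>C\<^esub> inv_arr C f = (h \<cdot>\<^bsub>C\<^esub> f) \<cdot>\<^bsub>C\<^esub> inv_arr C f" by simp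
  then show "g = h" using assms by (simp add: assoc iso_simps)
qed simp

lemma iso_cmp:
  assumes "iso_arr C f" "iso_arr C g" "src C g = tgt C f"
  shows "iso_arr C (g \<cdot>\<^bsub>C\<^esub> f)"
  unfolding iso_arr_def inverse_arrows_def
  using assms
  by (intro exI[of _ "inv_arr C f \<cdot>\<^bsub>C\<^esub> inv_arr C g"]) (simp add: iso_simps assoc iso_inv_left
      iso_inv_right)

lemma inv_arr_eq:
  assumes "inverse_arrows C f g" shows "inv_arr C f = g"
proof -
  have f: "iso_arr C f" using assms by (auto simp: iso_arr_def)
  have "inv_arr C f = inv_arr C f \<cdot>\<^bsub>C\<^esub> (f \<cdot>\<^bsub>C\<^esub> g)"
    using assms f by (simp add: inverse_arrows_def iso_simps)
  also have "\<dots> = g" using assms f by (intro iso_inv_left) (simp_all add: inverse_arrows_def)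
  finally show ?thesis .
qed

lemma inv_ide: "x \<in> obj C \<Longrightarrow> inv_arr C (ide C x) = ide C x"
  by (rule inv_arr_eq) (simp add: inverse_arrows_def)

end

section \<open>Products and monoidal categories\<close>

lemma prod_cat_simps [simp]:
  "obj (prod_cat C D) = obj C \<times> obj D" "arr (prod_cat C D) = arr C \<times> arr D"
  "f \<in> arr C \<Longrightarrow> g \<in> arr D \<Longrightarrow> src (prod_cat C D) (f, g) = (src C f, src D g)"
  "f \<in> arr C \<Longrightarrow> g \<in> arr D \<Longrightarrow> tgt (prod_cat C D) (f, g) = (tgt C f, tgt D g)"
  "x \<in> obj C \<Longrightarrow> y \<in> obj D \<Longrightarrow> ide (prod_cat C D) (x, y) = (ide C x, ide D y)"
  "\<lbrakk>f \<in> arr C; g \<in> arr D; f' \<in> arr C; g' \<in> arr D; src C f' = tgt C f; src D g' = tgt D g\<rbrakk>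
    \<Longrightarrow> (f', g') \<cdot>\<^bsub>prod_cat C D\<^esub> (f, g) = (f' \<cdot>\<^bsub>C\<^esub> f, g' \<cdot>\<^bsub>D\<^esub> g)"
  by (simp_all add: prod_cat_def composable_def)

lemma category_prod_cat:
  assumes "category C" "category D" shows "category (prod_cat C D)"
proof -
  interpret C: category C by fact
  interpret D: category D by fact
  show ?thesis
  proof (rule categoryI)
    show "cmp (prod_cat C D) \<in> extensional (composable (prod_cat C D))"
      unfolding extensional_def
      by (auto simp: prod_cat_def composable_def)
  next
    fix g f assume "g \<in> arr (prod_cat C D)" "f \<in> arr (prod_cat C D)" "src (prod_cat C D) g =
        tgt (prod_cat C D) f"
    then show "g \<cdot>\<^bsub>prod_cat C D\<^esub> f \<in> arr (prod_cat C D) \<and> src (prod_cat C D) (g \<cdot>\<^bsub>prod_cat C D\<^esub>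
        f) = src (prod_cat C D) f \<and>
        tgt (prod_cat C D) (g \<cdot>\<^bsub>prod_cat C D\<^esub> f) = tgt (prod_cat C D) g"
      by (cases f, cases g) simp
  next
    fix h g f assume "h \<in> arr (prod_cat C D)" "g \<in> arr (prod_cat C D)" "f \<in> arr (prod_cat C D)"
      "src (prod_cat C D) h = tgt (prod_cat C D) g" "src (prod_cat C D) g = tgt (prod_cat C D) f"
    then show "(h \<cdot>\<^bsub>prod_cat C D\<^esub> g) \<cdot>\<^bsub>prod_cat C D\<^esub> f = h \<cdot>\<^bsub>prod_cat C D\<^esub> (g \<cdot>\<^bsub>prod_cat C D\<^esub> f)"
      by (cases f, cases g, cases h) (simp add: C.assoc D.assoc)
  qed (auto simp: PiE_def extensional_def, auto simp: prod_cat_def)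
qed

context monoidal_category
begin

lemma tens_obj [simp]: "x \<in> obj M \<Longrightarrow> y \<in> obj M \<Longrightarrow> x \<odot>\<^bsub>M\<^esub> y \<in> obj M"
  using tensor.fobj_obj[of "(x, y)"] by simp
lemma tens_arr [simp]: "f \<in> arr M \<Longrightarrow> g \<in> arr M \<Longrightarrow> f \<star>\<^bsub>M\<^esub> g \<in> arr M"
  using tensor.farr_arr[of "(f, g)"] by simp
lemma src_tens [simp]: "f \<in> arr M \<Longrightarrow> g \<in> arr M \<Longrightarrow> src M (f \<star>\<^bsub>M\<^esub> g) = src M f \<odot>\<^bsub>M\<^esub> src M g"
  using tensor.src_farr[of "(f, g)"] by simp
lemma tgt_tens [simp]: "f \<in> arr M \<Longrightarrow> g \<in> arr M \<Longrightarrow> tgt M (f \<star>\<^bsub>M\<^esub> g) = tgt M f \<odot>\<^bsub>M\<^esub> tgt M g"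
  using tensor.tgt_farr[of "(f, g)"] by simp
lemma tens_ide [simp]: "x \<in> obj M \<Longrightarrow> y \<in> obj M \<Longrightarrow> ide M x \<star>\<^bsub>M\<^esub> ide M y = ide M (x \<odot>\<^bsub>M\<^esub> y)"
  using tensor.farr_ide[of "(x, y)"] by simp
lemma tens_cmp: "\<lbrakk>f \<in> arr M; g \<in> arr M; f' \<in> arr M; g' \<in> arr M; src M f' = tgt M f; src M g' =
    tgt M g\<rbrakk>
    \<Longrightarrow> (f' \<star>\<^bsub>M\<^esub> g') \<cdot>\<^bsub>M\<^esub> (f \<star>\<^bsub>M\<^esub> g) = (f' \<cdot>\<^bsub>M\<^esub> f) \<star>\<^bsub>M\<^esub> (g' \<cdot>\<^bsub>M\<^esub> g)"
  using tensor.farr_comp[of "(f', g')" "(f, g)"] by simp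

declare munit_obj [simp]

lemma massoc_simps [simp]:
  assumes "x \<in> obj M" "y \<in> obj M" "z \<in> obj M"
  shows "massoc M (x, y, z) \<in> arr M" "src M (massoc M (x, y, z)) = (x \<odot>\<^bsub>M\<^esub> y) \<odot>\<^bsub>M\<^esub> z"
    "tgt M (massoc M (x, y, z)) = x \<odot>\<^bsub>M\<^esub> (y \<odot>\<^bsub>M\<^esub> z)"
  using massoc_homset[OF assms] by (simp_all add: homset_def)

lemma lunit_simps [simp]:
  assumes "x \<in> obj M"
  shows "lunit M x \<in> arr M" "src M (lunit M x) = munit M \<odot>\<^bsub>M\<^esub> x" "tgt M (lunit M x) = x"
  using lunit_homset[OF assms] by (simp_all add: homset_def)

lemma runit_simps [simp]:
  assumes "x \<in> obj M"
  shows "runit M x \<in> arr M" "src M (runit M x) = x \<odot>\<^bsub>M\<^esub> munit M" "tgt M (runit M x) = x"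
  using runit_homset[OF assms] by (simp_all add: homset_def)

lemma massoc_nat: "f \<in> arr M \<Longrightarrow> g \<in> arr M \<Longrightarrow> h \<in> arr M \<Longrightarrow>
    massoc M (tgt M f, tgt M g, tgt M h) \<cdot>\<^bsub>M\<^esub> ((f \<star>\<^bsub>M\<^esub> g) \<star>\<^bsub>M\<^esub> h) =
           (f \<star>\<^bsub>M\<^esub> (g \<star>\<^bsub>M\<^esub> h)) \<cdot>\<^bsub>M\<^esub> massoc M (src M f, src M g, src M h)"
  by (rule massoc_natural) (rule arr_homset, assumption)+

lemma lunit_nat: "f \<in> arr M \<Longrightarrow> lunit M (tgt M f) \<cdot>\<^bsub>M\<^esub> (ide M (munit M) \<star>\<^bsub>M\<^esub> f) = f \<cdot>\<^bsub>M\<^esub>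
    lunit M (src M f)"
  by (rule lunit_natural) (rule arr_homset)

lemma runit_nat: "f \<in> arr M \<Longrightarrow> runit M (tgt M f) \<cdot>\<^bsub>M\<^esub> (f \<star>\<^bsub>M\<^esub> ide M (munit M)) = f \<cdot>\<^bsub>M\<^esub>
    runit M (src M f)"
  by (rule runit_natural) (rule arr_homset)

lemma inverse_tens:
  assumes "inverse_arrows M f g" "inverse_arrows M f' g'"
  shows "inverse_arrows M (f \<star>\<^bsub>M\<^esub> f') (g \<star>\<^bsub>M\<^esub> g')"
  using assms by (simp add: inverse_arrows_def tens_cmp)

lemma iso_tens: "iso_arr M f \<Longrightarrow> iso_arr M g \<Longrightarrow> iso_arr M (f \<star>\<^bsub>M\<^esub> g)"
  using inverse_tens unfolding iso_arr_def by blast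

end


lemma std_obj_Cons: "xs \<noteq> [] \<Longrightarrow> std_obj M (x # xs) = x \<odot>\<^bsub>M\<^esub> std_obj M xs"
  by (cases xs) simp_all

lemma std_arr_Cons: "fs \<noteq> [] \<Longrightarrow> std_arr M (f # fs) = f \<star>\<^bsub>M\<^esub> std_arr M fs"
  by (cases fs) simp_all

context monoidal_category
begin

lemma std_obj_in [simp]: "xs \<in> lists (obj M) \<Longrightarrow> std_obj M xs \<in> obj M"
proof (induction xs)
  case (Cons x xs)
  then show ?case by (cases "xs = []") (simp_all add: std_obj_Cons)
qed simp

lemma std_arr_simps:
  assumes "fs \<in> lists (arr M)"
  shows "std_arr M fs \<in> arr M" "src M (std_arr M fs) = std_obj M (map (src M) fs)"
    "tgt M (std_arr M fs) = std_obj M (map (tgt M) fs)"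
proof -
  have "std_arr M fs \<in> arr M \<and> src M (std_arr M fs) = std_obj M (map (src M) fs) \<and>
    tgt M (std_arr M fs) = std_obj M (map (tgt M) fs)"
    using assms
  proof (induction fs)
    case (Cons f fs)
    then show ?case by (cases "fs = []") (simp_all add: std_arr_Cons std_obj_Cons)
  qed simp
  then show "std_arr M fs \<in> arr M" "src M (std_arr M fs) = std_obj M (map (src M) fs)"
    "tgt M (std_arr M fs) = std_obj M (map (tgt M) fs)" by simp_all
qed

lemma std_arr_ide: "xs \<in> lists (obj M) \<Longrightarrow> std_arr M (map (ide M) xs) = ide M (std_obj M xs)"
proof (induction xs)
  case (Cons x xs)
  then show ?case by (cases "xs = []") (simp_all add: std_arr_Cons std_obj_Cons)
qed simp

lemma std_arr_cmp:
  "\<lbrakk>gs \<in> lists (arr M); fs \<in> lists (arr M); map (src M) gs = map (tgt M) fs\<rbrakk>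
   \<Longrightarrow> std_arr M (map2 (\<lambda>g f. g \<cdot>\<^bsub>M\<^esub> f) gs fs) = std_arr M gs \<cdot>\<^bsub>M\<^esub> std_arr M fs"
proof (induction fs arbitrary: gs)
  case (Cons f fs)
  then obtain g gs' where gs: "gs = g # gs'" by (cases gs) auto
  then have l: "length gs' = length fs" using Cons.prems(3) by (auto dest: map_eq_imp_length_eq)
  show ?case
  proof (cases "fs = []")
    case False
    moreover from this l have "gs' \<noteq> []" "zip gs' fs \<noteq> []" by (cases gs'; cases fs; simp)+
    moreover have "std_arr M (map2 (\<lambda>g f. g \<cdot>\<^bsub>M\<^esub> f) gs' fs) = std_arr M gs' \<cdot>\<^bsub>M\<^esub> std_arr M fs"
      using Cons gs by (intro Cons.IH) simp_all
    moreover have "src M (std_arr M gs') = tgt M (std_arr M fs)"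
      using Cons.prems gs by (simp add: std_arr_simps)
    ultimately show ?thesis
      using Cons.prems gs by (simp add: std_arr_Cons tens_cmp std_arr_simps)
  qed (use Cons gs l in simp)
qed simp

end

section \<open>Coherence\<close>

lemma std_brk_Cons: "ts \<noteq> [] \<Longrightarrow> std_brk (t # ts) = Tens t (std_brk ts)"
  by (cases ts) simp_all

lemma flat_brk_simps: "flat_brk [] = Unit" "flat_brk [x] = Leaf x" "xs \<noteq> [] \<Longrightarrow> flat_brk (x # xs) =
    Tens (Leaf x) (flat_brk xs)"
  by (simp_all add: flat_brk_def std_brk_Cons)

lemma nested_brk_simps: "nested_brk [] = Unit" "nested_brk [xs] = flat_brk xs"
  "xss \<noteq> [] \<Longrightarrow> nested_brk (xs # xss) = Tens (flat_brk xs) (nested_brk xss)"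
  by (simp_all add: nested_brk_def std_brk_Cons)

lemma brk_val_flat [simp]: "brk_val M (flat_brk xs) = std_obj M xs"
proof (induction xs)
  case (Cons x xs)
  then show ?case by (cases "xs = []") (simp_all add: flat_brk_simps std_obj_Cons)
qed (simp add: flat_brk_simps)

lemma set_flat_brk [simp]: "set_brk (flat_brk xs) = set xs"
proof (induction xs)
  case (Cons x xs)
  then show ?case by (cases "xs = []") (simp_all add: flat_brk_simps)
qed (simp add: flat_brk_simps)

lemma brk_val_nested [simp]: "brk_val M (nested_brk xss) = std_obj M (map (std_obj M) xss)"
proof (induction xss)
  case (Cons xs xss)
  then show ?case by (cases "xss = []") (simp_all add: nested_brk_simps std_obj_Cons)
qed (simp add: nested_brk_simps)

lemma set_nested_brk [simp]: "set_brk (nested_brk xss) = set (concat xss)"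
proof (induction xss)
  case (Cons xs xss)
  then show ?case by (cases "xss = []") (simp_all add: nested_brk_simps)
qed (simp add: nested_brk_simps)

text \<open>The canonical reassociations of two standard bracketings, and of a list of them, into one.\<close>

fun phi :: "('o, 'a, 'z) mon_cat_scheme \<Rightarrow> 'o list \<Rightarrow> 'o list \<Rightarrow> 'a" where
  "phi M [] ys = lunit M (std_obj M ys)"
| "phi M [x] [] = runit M x"
| "phi M [x] (y # ys) = ide M (x \<odot>\<^bsub>M\<^esub> std_obj M (y # ys))"
| "phi M (x # y # xs) ys =
    (ide M x \<star>\<^bsub>M\<^esub> phi M (y # xs) ys) \<cdot>\<^bsub>M\<^esub> massoc M (x, std_obj M (y # xs), std_obj M ys)"

fun nest :: "('o, 'a, 'z) mon_cat_scheme \<Rightarrow> 'o list list \<Rightarrow> 'a" where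
  "nest M [] = ide M (munit M)"
| "nest M [xs] = ide M (std_obj M xs)"
| "nest M (xs # ys # yss) =
    phi M xs (concat (ys # yss)) \<cdot>\<^bsub>M\<^esub> (ide M (std_obj M xs) \<star>\<^bsub>M\<^esub> nest M (ys # yss))"

lemma phi_Cons: "xs \<noteq> [] \<Longrightarrow> phi M (x # xs) ys =
    (ide M x \<star>\<^bsub>M\<^esub> phi M xs ys) \<cdot>\<^bsub>M\<^esub> massoc M (x, std_obj M xs, std_obj M ys)"
  by (cases xs) simp_all

lemma nest_Cons: "yss \<noteq> [] \<Longrightarrow> nest M (xs # yss) =
    phi M xs (concat yss) \<cdot>\<^bsub>M\<^esub> (ide M (std_obj M xs) \<star>\<^bsub>M\<^esub> nest M yss)"
  by (cases yss) simp_all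

context monoidal_category
begin

text \<open>Exhibits \<open>phi\<close> as a formal coherence arrow between bracketings; its typing
  and invertibility then follow from \<open>coherence_iso\<close>.\<close>

lemma coherence_phi:
  "xs \<in> lists (obj M) \<Longrightarrow> ys \<in> lists (obj M) \<Longrightarrow>
    coherence M (Tens (flat_brk xs) (flat_brk ys)) (flat_brk (xs @ ys)) (phi M xs ys)"
proof (induction xs)
  case Nil
  then show ?case using coh_lunit[of "flat_brk ys" M] by (auto simp: flat_brk_simps(1))
next
  case (Cons x xs)
  then have IH: "coherence M (Tens (flat_brk xs) (flat_brk ys)) (flat_brk (xs @ ys)) (phi M xs
      ys)" by simp
  have ys: "set ys \<subseteq> obj M" and xs: "set xs \<subseteq> obj M" and x: "x \<in> obj M" using Cons.prems by auto
  show ?case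
  proof (cases "xs = []")
    case True
    show ?thesis
    proof (cases ys)
      case Nil
      then show ?thesis using True x coh_runit[of "Leaf x" M] by (simp add: flat_brk_simps)
    next
      case (Cons y ys')
      then show ?thesis using True x ys coh_id[of "Tens (Leaf x) (flat_brk ys)" M]
          by (simp add: flat_brk_simps(2,3))
    qed
  next
    case False
    have "coherence M (Tens (Tens (Leaf x) (flat_brk xs)) (flat_brk ys)) (Tens (Leaf x) (Tens
        (flat_brk xs) (flat_brk ys)))
       (massoc M (x, std_obj M xs, std_obj M ys))"
      using coh_assoc[of "Leaf x" M "flat_brk xs" "flat_brk ys"] x xs ys by simp
    moreover have "coherence M (Tens (Leaf x) (Tens (flat_brk xs) (flat_brk ys))) (Tens (Leaf x)
        (flat_brk (xs @ ys)))
       (ide M x \<star>\<^bsub>M\<^esub> phi M xs ys)"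
      using coh_tens[OF coh_id[of "Leaf x" M] IH] x by simp
    ultimately show ?thesis using False by (simp add: flat_brk_simps(3) phi_Cons coh_comp)
  qed
qed

text \<open>This membership is what permits \<open>nest\<close> and its inverse to be inserted for
  \<open>c'\<close> and \<open>c\<close> in \<open>wact_beta\<close> and
  \<open>wact_delta\<close>.\<close>

lemma coherence_nest:
  "xss \<in> lists (lists (obj M)) \<Longrightarrow> coherence M (nested_brk xss) (flat_brk (concat xss)) (nest M
      xss)"
proof (induction xss)
  case Nil
  then show ?case using coh_id[of Unit M] by (simp add: nested_brk_simps(1) flat_brk_simps(1))
next
  case (Cons xs xss)
  then have IH: "coherence M (nested_brk xss) (flat_brk (concat xss)) (nest M xss)" by simp
  have xs: "xs \<in> lists (obj M)" and xss: "xss \<in> lists (lists (obj M))" using Cons.prems by auto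
  have i: "coherence M (flat_brk xs) (flat_brk xs) (ide M (std_obj M xs))"
    using coh_id[of "flat_brk xs" M] xs by auto
  show ?case
  proof (cases "xss = []")
    case False
    then show ?thesis
      using coh_comp[OF coh_tens[OF i IH] coherence_phi[OF xs concat_in_lists[OF xss]]]
      by (simp add: nested_brk_simps(3) nest_Cons)
  qed (use i in \<open>simp add: nested_brk_simps(2)\<close>)
qed

lemma brk_val_obj: "set_brk t \<subseteq> obj M \<Longrightarrow> brk_val M t \<in> obj M"
  by (induction t) auto

text \<open>Rule induction on the generators: constraints are isomorphisms between the values of
  their bracketings, and composition, tensor and inversion preserve this.\<close>

lemma coherence_iso:
  "coherence M s t c \<Longrightarrow> set_brk s \<subseteq> obj M \<and> set_brk t \<subseteq> obj M \<and> iso_arr M c \<and>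
     src M c = brk_val M s \<and> tgt M c = brk_val M t"
proof (induction rule: coherence.induct)
  case (coh_inv s t c d)
  then show ?case by (auto simp: inverse_arrows_def iso_arr_def)
next
  case (coh_comp r s c t d)
  then show ?case by (simp add: iso_cmp iso_simps(1))
next
  case (coh_tens s t c s' t' c')
  then show ?case by (simp add: iso_tens iso_simps(1))
qed (auto simp: brk_val_obj iso_ide massoc_iso lunit_iso runit_iso iso_cmp iso_tens dest:
    iso_simps(1))

lemma coherence_inv_arr: "coherence M s t c \<Longrightarrow> coherence M t s (inv_arr M c)"
  using coherence_iso iso_inverse coh_inv by metis

lemma phi_simps [simp]:
  assumes "xs \<in> lists (obj M)" "ys \<in> lists (obj M)"
  shows "phi M xs ys \<in> arr M" "src M (phi M xs ys) = std_obj M xs \<odot>\<^bsub>M\<^esub> std_obj M ys"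
    "tgt M (phi M xs ys) = std_obj M (xs @ ys)" "iso_arr M (phi M xs ys)"
  using coherence_iso[OF coherence_phi[OF assms]] by (auto dest: iso_simps(1))

lemma nest_simps [simp]:
  assumes "xss \<in> lists (lists (obj M))"
  shows "nest M xss \<in> arr M" "src M (nest M xss) = std_obj M (map (std_obj M) xss)"
    "tgt M (nest M xss) = std_obj M (concat xss)" "iso_arr M (nest M xss)"
  using coherence_iso[OF coherence_nest[OF assms]] by (auto dest: iso_simps(1))

text \<open>All generators are identities here, and composition, tensor product and inversion of
  identities give identities. So a strict category satisfies uniqueness of coherence arrows by a
  direct induction.\<close>

lemma coherence_strict:
  assumes "coherence M s t c" and S: "strict_monoidal M"
  shows "brk_val M s = brk_val M t \<and> c = ide M (brk_val M s)"
  using assms(1)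
proof (induction rule: coherence.induct)
  case (coh_comp r s c t d)
  then have "brk_val M t \<in> obj M" using coherence_iso brk_val_obj by blast
  then show ?case using coh_comp by simp
next
  case (coh_tens s t c s' t' c')
  then have "brk_val M t \<in> obj M" "brk_val M t' \<in> obj M" using coherence_iso brk_val_obj by blast+
  then show ?case using coh_tens by simp
next
  case (coh_inv s t c d)
  then have "brk_val M s \<in> obj M" using coherence_iso brk_val_obj by blast
  then show ?case using coh_inv by (auto simp: inverse_arrows_def)
qed (use S in \<open>auto simp: strict_monoidal_def brk_val_obj\<close>)

lemma strict_nest:
  assumes "strict_monoidal M" "xss \<in> lists (lists (obj M))"
  shows "nest M xss = ide M (std_obj M (concat xss))" "std_obj M (map (std_obj M) xss) =
      std_obj M (concat xss)"
  using coherence_strict[OF coherence_nest[OF assms(2)] assms(1)] by simp_all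

end

section \<open>Strict weak monoidal categories are algebras\<close>

text \<open>With identity constraints the naturality squares become associativity and unit laws for
  the tensor product of arrows, which is why these appear as hypotheses; pentagon and triangle
  become equations between identities.\<close>

lemma strict_monoidal_categoryI:
  fixes M :: "('o, 'a, 'z) mon_cat_scheme"
  assumes cat: "category M"
    and tobj: "fobj (tens M) \<in> obj M \<times> obj M \<rightarrow>\<^sub>E obj M"
    and tarr: "farr (tens M) \<in> arr M \<times> arr M \<rightarrow>\<^sub>E arr M"
    and st: "\<And>f g. f \<in> arr M \<Longrightarrow> g \<in> arr M \<Longrightarrow>
      src M (f \<star>\<^bsub>M\<^esub> g) = src M f \<odot>\<^bsub>M\<^esub> src M g \<and> tgt M (f \<star>\<^bsub>M\<^esub> g) = tgt M f \<odot>\<^bsub>M\<^esub> tgt M g"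
    and tide: "\<And>x y. x \<in> obj M \<Longrightarrow> y \<in> obj M \<Longrightarrow> ide M x \<star>\<^bsub>M\<^esub> ide M y = ide M (x \<odot>\<^bsub>M\<^esub> y)"
    and tcmp: "\<And>f g f' g'. \<lbrakk>f \<in> arr M; g \<in> arr M; f' \<in> arr M; g' \<in> arr M; src M f' =
        tgt M f; src M g' = tgt M g\<rbrakk>
      \<Longrightarrow> (f' \<cdot>\<^bsub>M\<^esub> f) \<star>\<^bsub>M\<^esub> (g' \<cdot>\<^bsub>M\<^esub> g) = (f' \<star>\<^bsub>M\<^esub> g') \<cdot>\<^bsub>M\<^esub> (f \<star>\<^bsub>M\<^esub> g)"
    and unit: "munit M \<in> obj M"
    and massoc: "massoc M = restrict (\<lambda>(x, y, z). ide M (x \<odot>\<^bsub>M\<^esub> (y \<odot>\<^bsub>M\<^esub>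
        z))) (obj M \<times> obj M \<times> obj M)"
    and lunit: "lunit M = (\<lambda>x\<in>obj M. ide M x)" and runit: "runit M = (\<lambda>x\<in>obj M. ide M x)"
    and oassoc: "\<And>x y z. x \<in> obj M \<Longrightarrow> y \<in> obj M \<Longrightarrow> z \<in> obj M \<Longrightarrow> (x \<odot>\<^bsub>M\<^esub> y) \<odot>\<^bsub>M\<^esub> z = x \<odot>\<^bsub>M\<^esub> (y \<odot>\<^bsub>M\<^esub>
        z)"
    and aassoc: "\<And>f g h. f \<in> arr M \<Longrightarrow> g \<in> arr M \<Longrightarrow> h \<in> arr M \<Longrightarrow> (f \<star>\<^bsub>M\<^esub> g) \<star>\<^bsub>M\<^esub> h = f \<star>\<^bsub>M\<^esub> (g \<star>\<^bsub>M\<^esub>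
        h)"
    and ounit: "\<And>x. x \<in> obj M \<Longrightarrow> munit M \<odot>\<^bsub>M\<^esub> x = x \<and> x \<odot>\<^bsub>M\<^esub> munit M = x"
    and aunit: "\<And>f. f \<in> arr M \<Longrightarrow> ide M (munit M) \<star>\<^bsub>M\<^esub> f = f \<and> f \<star>\<^bsub>M\<^esub> ide M (munit M) = f"
  shows "monoidal_category M \<and> strict_monoidal M"
proof
  interpret category M by fact
  show "strict_monoidal M"
    using oassoc ounit by (simp add: strict_monoidal_def massoc lunit runit)
next
  interpret category M by fact
  have [simp]: "x \<odot>\<^bsub>M\<^esub> y \<in> obj M" if "x \<in> obj M" "y \<in> obj M" for x y using tobj that by auto
  have [simp]: "f \<star>\<^bsub>M\<^esub> g \<in> arr M" if "f \<in> arr M" "g \<in> arr M" for f g using tarr that by auto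
  interpret T: cat_functor "prod_cat M M" M "tens M"
    by (rule cat_functorI) (use cat tobj tarr st tide tcmp in \<open>auto simp: category_prod_cat\<close>)
  show "monoidal_category M"
    by unfold_locales
      (use unit oassoc aassoc ounit aunit tide st in
        \<open>auto simp: massoc lunit runit homset_def iso_ide split: if_splits\<close>)
qed

locale weak_op = action_operad L + weak_L_monoidal_category L M
  for L :: "'g action_operad_data" and M :: "('o, 'a, 'g) wk_mon_cat"
begin

lemma wact_simps [simp]:
  assumes "xs \<in> lists (obj M)" "g \<in> el L (length xs)"
  shows "wact M (g, xs) \<in> arr M" "src M (wact M (g, xs)) = std_obj M xs"
    "tgt M (wact M (g, xs)) = std_obj M (lact L g xs)"
  using wact_homset[OF assms] by (simp_all add: homset_def)

text \<open>[e] [e] = [e] by condition (1), and [e] is invertible, so one factor cancels.\<close>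

lemma wact_e [simp]:
  assumes "xs \<in> lists (obj M)" "n = length xs"
  shows "wact M (eL L n, xs) = ide M (std_obj M xs)"
proof -
  let ?w = "wact M (eL L n, xs)"
  have "?w \<cdot>\<^bsub>M\<^esub> ?w = ?w \<cdot>\<^bsub>M\<^esub> ide M (std_obj M xs)"
    using wact_comp[of xs "eL L n" "eL L n"] assms by simp
  then show ?thesis
    using wact_iso[of xs "eL L n"] assms by (subst (asm) iso_cancel_left) simp_all
qed

lemma map2_wact:
  assumes "xss \<in> lists (lists (obj M))" "list_all2 (\<lambda>h xs. h \<in> el L (length xs)) hs xss"
  shows "map2 (\<lambda>h xs. wact M (h, xs)) hs xss \<in> lists (arr M)"
    "map (src M) (map2 (\<lambda>h xs. wact M (h, xs)) hs xss) = map (std_obj M) xss"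
    "map (tgt M) (map2 (\<lambda>h xs. wact M (h, xs)) hs xss) = map (std_obj M) (map2 (lact L) hs xss)"
    "map2 (lact L) hs xss \<in> lists (lists (obj M))"
  using assms(2,1) by (induction rule: list_all2_induct) simp_all

text \<open>The axiom holds for any coherence arrows with the stated endpoints; the inverse of
  \<open>nest\<close> and \<open>nest\<close> itself are chosen once and for all.\<close>

lemma wact_beta_nest:
  assumes "xss \<in> lists (lists (obj M))" "list_all2 (\<lambda>h xs. h \<in> el L (length xs)) hs xss"
  shows "wact M (beta L (map length xss) hs, concat xss) =
    nest M (map2 (lact L) hs xss) \<cdot>\<^bsub>M\<^esub> std_arr M (map2 (\<lambda>h xs. wact M (h, xs)) hs xss) \<cdot>\<^bsub>M\<^esub>
        inv_arr M (nest M xss)"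
  by (rule wact_beta) (use assms map2_wact(4)[OF assms] in \<open>simp_all add: coherence_nest
      coherence_inv_arr\<close>)

lemma wact_delta_nest:
  assumes "xss \<in> lists (lists (obj M))" "g \<in> el L (length xss)"
  shows "wact M (delta L (map length xss) g, concat xss) =
    nest M (lact L g xss) \<cdot>\<^bsub>M\<^esub> wact M (g, map (std_obj M) xss) \<cdot>\<^bsub>M\<^esub> inv_arr M (nest M xss)"
  by (rule wact_delta) (use assms in \<open>simp_all add: coherence_nest coherence_inv_arr\<close>)

end

locale strict_weak_op = weak_op + assumes strict: "strict_monoidal M"
begin

lemma std_obj_concat: "xss \<in> lists (lists (obj M)) \<Longrightarrow> std_obj M (map (std_obj M) xss) =
    std_obj M (concat xss)"
  by (rule strict_nest(2)[OF strict])

lemma std_obj_map_lists: "xss \<in> lists (lists (obj M)) \<Longrightarrow> map (std_obj M) xss \<in> lists (obj M)"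
  by (erule map_in_lists) simp

lemma wact_beta_strict:
  assumes "xss \<in> lists (lists (obj M))" "list_all2 (\<lambda>h xs. h \<in> el L (length xs)) hs xss"
  shows "wact M (beta L (map length xss) hs, concat xss) =
      std_arr M (map2 (\<lambda>h xs. wact M (h, xs)) hs xss)"
  using wact_beta_nest[OF assms] strict_nest[OF strict assms(1)] map2_wact[OF assms]
    strict_nest[OF strict map2_wact(4)[OF assms]] concat_in_lists[OF assms(1)]
  by (simp add: inv_ide std_arr_simps del: map_map)

lemma wact_delta_strict:
  assumes "xss \<in> lists (lists (obj M))" "g \<in> el L (length xss)"
  shows "wact M (delta L (map length xss) g, concat xss) = wact M (g, map (std_obj M) xss)"
proof -
  have l: "lact L g xss \<in> lists (lists (obj M))" using assms by simp
  show ?thesis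
    using wact_delta_nest[OF assms] strict_nest[OF strict assms(1)] assms std_obj_map_lists[OF
        assms(1)]
      strict_nest[OF strict l] concat_in_lists[OF assms(1)] concat_in_lists[OF l]
    by (simp add: inv_ide)
qed

text \<open>\<open>strict_monoidal\<close> constrains objects and constraints only. Strictness on
  arrows comes from naturality of the identity constraints, used for all three of
  \<open>massoc\<close>, \<open>lunit\<close> and \<open>runit\<close> in the binary case.\<close>

lemma std_arr_concat:
  "fss \<in> lists (lists (arr M)) \<Longrightarrow> std_arr M (map (std_arr M) fss) = std_arr M (concat fss)"
proof -
  have app: "std_arr M (fs @ gs) = std_arr M fs \<star>\<^bsub>M\<^esub> std_arr M gs" if "fs \<in> lists (arr M)"
      "gs \<in> lists (arr M)" for fs gs
    using that
  proof (induction fs)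
    case Nil
    have "std_arr M gs \<in> arr M" "src M (std_arr M gs) \<in> obj M" "tgt M (std_arr M gs) \<in> obj M"
      using Nil by (simp_all add: std_arr_simps src_lists tgt_lists)
    then show ?case using lunit_nat[of "std_arr M gs"] strict by (simp add: strict_monoidal_def)
  next
    case (Cons f fs)
    show ?case
    proof (cases "fs = []")
      case True
      show ?thesis
      proof (cases "gs = []")
        case True
        have f: "f \<in> arr M" using Cons by simp
        show ?thesis using True \<open>fs = []\<close> f runit_nat[OF f] strict
            by (simp add: strict_monoidal_def)
      qed (use True in \<open>simp add: std_arr_Cons\<close>)
    next
      case False
      have a: "f \<in> arr M" "std_arr M fs \<in> arr M" "std_arr M gs \<in> arr M"
        using Cons by (simp_all add: std_arr_simps)
      have "(f \<star>\<^bsub>M\<^esub> std_arr M fs) \<star>\<^bsub>M\<^esub> std_arr M gs = f \<star>\<^bsub>M\<^esub> (std_arr M fs \<star>\<^bsub>M\<^esub> std_arr M gs)"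
        using massoc_nat[OF a] a strict by (simp add: strict_monoidal_def)
      then show ?thesis using False Cons by (simp add: std_arr_Cons)
    qed
  qed
  assume "fss \<in> lists (lists (arr M))"
  then show ?thesis
  proof (induction fss)
    case (Cons fs fss)
    then have c: "concat fss \<in> lists (arr M)" by (intro concat_in_lists) simp
    show ?case
    proof (cases "fss = []")
      case False
      then show ?thesis using Cons c by (simp add: std_arr_Cons app)
    qed simp
  qed simp
qed

text \<open>Forced by functoriality: (e -> g; fs) is (e -> g; identities of the targets) after (e ->
  e; fs).\<close>

definition Bw :: "'a \<Rightarrow> 'c list \<Rightarrow> 'c" where
  "Bw g fs = wact M (g, map (tgt M) fs) \<cdot>\<^bsub>M\<^esub> std_arr M fs"

lemma Bw_simps [simp]:
  assumes "fs \<in> lists (arr M)" "g \<in> el L (length fs)"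
  shows "Bw g fs \<in> arr M" "src M (Bw g fs) = std_obj M (map (src M) fs)"
    "tgt M (Bw g fs) = std_obj M (lact L g (map (tgt M) fs))"
  using assms tgt_lists[OF assms(1)] by (simp_all add: Bw_def std_arr_simps del: lact_map)

text \<open>Naturality moves [g] past the tensor product of \<open>gs\<close>; then [h] and [g]
  combine by condition (1) and the two tensor products by functoriality.\<close>

lemma Bw_cmp:
  assumes "fs \<in> lists (arr M)" "gs \<in> lists (arr M)" "map (src M) gs = map (tgt M) fs"
        "g \<in> el L (length fs)" "h \<in> el L (length fs)"
  shows "Bw (mult (length fs) h g) (map2 (\<lambda>g f. g \<cdot>\<^bsub>M\<^esub> f) gs fs) = Bw h (lact L g gs) \<cdot>\<^bsub>M\<^esub>
      Bw g fs"
proof -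
  interpret operad_cat L M by unfold_locales
  note m = map2_cmp_lists[OF assms(2,1,3)]
  have l: "lact L g gs \<in> lists (arr M)" using assms m(2) by simp
  have t: "map (tgt M) fs \<in> lists (obj M)" "map (tgt M) gs \<in> lists (obj M)"
    "map (tgt M) (lact L g gs) \<in> lists (obj M)"
    by (rule tgt_lists, fact)+
  \<comment> \<open>Naturality of [g] in \<open>gs\<close>, whose sources are the targets of
    \<open>fs\<close>.\<close>
  have n: "std_arr M (lact L g gs) \<cdot>\<^bsub>M\<^esub> wact M (g, map (tgt M) fs) =
      wact M (g, map (tgt M) gs) \<cdot>\<^bsub>M\<^esub> std_arr M gs"
    using wact_natural[of gs g] assms m(2) by simp
  have ls: "map (src M) (lact L g gs) = lact L g (map (tgt M) fs)"
    using assms m(2) by (simp flip: lact_map)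
  have lt: "map (tgt M) (lact L g gs) = lact L g (map (tgt M) gs)"
    using assms m(2) by simp
  have "Bw h (lact L g gs) \<cdot>\<^bsub>M\<^esub> Bw g fs =
    wact M (h, map (tgt M) (lact L g gs)) \<cdot>\<^bsub>M\<^esub> (std_arr M (lact L g gs) \<cdot>\<^bsub>M\<^esub>
        wact M (g, map (tgt M) fs)) \<cdot>\<^bsub>M\<^esub> std_arr M fs"
    using assms l t m(2) ls unfolding Bw_def
    by (simp add: assoc std_arr_simps lt del: lact_map)
  also have "\<dots> = (wact M (h, lact L g (map (tgt M) gs)) \<cdot>\<^bsub>M\<^esub> wact M (g, map (tgt M) gs)) \<cdot>\<^bsub>M\<^esub>
      std_arr M gs \<cdot>\<^bsub>M\<^esub> std_arr M fs"
    unfolding n lt using assms t m(2) by (simp add: assoc std_arr_simps del: lact_map)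
  also have "\<dots> = Bw (mult (length fs) h g) (map2 (\<lambda>g f. g \<cdot>\<^bsub>M\<^esub> f) gs fs)"
    using assms t m wact_comp[OF t(2), of g h] std_arr_cmp[OF assms(2,1,3)]
    by (simp add: Bw_def del: lact_map map_map)
  finally show ?thesis ..
qed

text \<open>Uses all conditions: (3) rewrites the outer [u] as [\<delta>(u)], (2) the tensor product
  of the inner isomorphisms as [\<beta>(vs)], and (1) with \<open>amu_eq_delta_beta\<close> combines
  them into [\<mu>(u; vs)].\<close>

lemma Bw_concat:
  assumes fss: "fss \<in> lists (lists (arr M))" and u: "u \<in> el L (length fss)"
    and vs: "list_all2 (\<lambda>v fs. v \<in> el L (length fs)) vs fss"
  shows "Bw u (map2 Bw vs fss) = Bw (amu L (map length fss) u vs) (concat fss)"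
proof -
  let ?ks = "map length fss"
  define xss where "xss = map (map (tgt M)) fss"
  have xss: "xss \<in> lists (lists (obj M))"
    unfolding xss_def by (rule map_in_lists[OF fss]) (rule tgt_lists)
  have ks: "map length xss = ?ks" "length xss = length fss" by (simp_all add: xss_def comp_def)
  have vs': "list_all2 (\<lambda>v xs. v \<in> el L (length xs)) vs xss" using vs
      by (simp add: xss_def list.rel_map)
  note w = map2_wact[OF xss vs']
  have els: "els vs ?ks" using vs by (simp add: els_map_length)
  have sl: "map (std_arr M) fss \<in> lists (arr M)"
      by (rule map_in_lists[OF fss]) (rule std_arr_simps)
  have len: "length vs = length fss" using vs by (rule list_all2_lengthD)
  have t: "map (tgt M) (map2 Bw vs fss) = map (std_obj M) (map2 (lact L) vs xss)"
  proof (rule nth_equalityI)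
    fix i assume "i < length (map (tgt M) (map2 Bw vs fss))"
    then have i: "i < length fss" by simp
    then show "map (tgt M) (map2 Bw vs fss) ! i = map (std_obj M) (map2 (lact L) vs xss) ! i"
      using len nth_in_lists[OF fss i] list_all2_nthD2[OF vs i]
          by (simp add: xss_def del: lact_map)
  qed (simp add: xss_def)
  have tt: "map (tgt M) (map (std_arr M) fss) = map (std_obj M) xss"
    using fss by (simp add: xss_def in_lists_conv_set[of fss] std_arr_simps)
  have s: "map2 Bw vs fss = map2 (\<lambda>g f. g \<cdot>\<^bsub>M\<^esub>
      f) (map2 (\<lambda>h xs. wact M (h, xs)) vs xss) (map (std_arr M) fss)"
    using len by (intro nth_equalityI) (simp_all add: xss_def Bw_def)
  have c: "map (tgt M) (concat fss) = concat xss" by (simp add: xss_def map_concat)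
  have lw: "map2 (lact L) vs xss \<in> lists (lists (obj M))" by fact
  have ml: "map length (map2 (lact L) vs xss) = ?ks"
    using len by (intro nth_equalityI) (simp_all add: xss_def)
  have cl: "concat (map2 (lact L) vs xss) = lact L (beta L ?ks vs) (concat xss)"
    using lact_beta[of vs xss] els ks by simp
  have "sum_list ?ks = length (concat xss)" "length (concat fss) = length (concat xss)"
    by (simp_all add: length_concat ks comp_def xss_def)
  note ls = this
  have b: "beta L ?ks vs \<in> el L (length (concat xss))"
      "delta L ?ks u \<in> el L (length (concat xss))"
    using els u ls by simp_all
  have cx: "concat xss \<in> lists (obj M)" using xss by (rule concat_in_lists)
  have cf: "concat fss \<in> lists (arr M)" using fss by (rule concat_in_lists)
  have "Bw u (map2 Bw vs fss) = wact M (u, map (std_obj M) (map2 (lact L) vs xss)) \<cdot>\<^bsub>M\<^esub>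
      (std_arr M (map2 (\<lambda>h xs. wact M (h, xs)) vs xss) \<cdot>\<^bsub>M\<^esub> std_arr M (map (std_arr M) fss))"
    unfolding Bw_def[of u] t unfolding s using w sl tt by (subst std_arr_cmp) simp_all
  \<comment> \<open>From here on everything lives over the concatenated list, where condition (1)
    applies.\<close>
  also have "\<dots> = wact M (delta L ?ks u, concat (map2 (lact L) vs xss)) \<cdot>\<^bsub>M\<^esub>
      (wact M (beta L ?ks vs, concat xss) \<cdot>\<^bsub>M\<^esub> std_arr M (concat fss))"
    using wact_delta_strict[OF lw, of u] wact_beta_strict[OF xss vs'] std_arr_concat[OF fss] u len
        ks ml
    by (simp del: map_map)
  also have "\<dots> = wact M (mult (sum_list ?ks) (delta L ?ks u) (beta L ?ks vs), concat xss) \<cdot>\<^bsub>M\<^esub>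
      std_arr M (concat fss)"
    unfolding cl using b cx cf c ls wact_comp[OF cx b]
    by (simp add: std_arr_simps del: map_map flip: assoc)
  also have "mult (sum_list ?ks) (delta L ?ks u) (beta L ?ks vs) = amu L ?ks u vs"
    using u els by (subst amu_eq_delta_beta[of u "length fss"]) simp_all
  finally show ?thesis unfolding Bw_def[of "amu L ?ks u vs"] c .
qed

end

text \<open>By \<open>coherence_strict\<close> the arrows \<open>c\<close> and \<open>c'\<close>
  disappear from conditions (2) and (3), leaving plain equations. Invertibility of [g] is derived
  from the values at e and at composites.\<close>

lemma (in action_operad) strict_weakI:
  fixes M :: "('o, 'a, 'g) wk_mon_cat"
  assumes M: "monoidal_category M" and S: "strict_monoidal M"
    and ext: "wact M \<in> extensional (opre L (obj M))"
    and w: "\<And>xs g. \<lbrakk>xs \<in> lists (obj M); g \<in> el L (length xs)\<rbrakk> \<Longrightarrow> wact M (g, xs) \<in> arr M \<and>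
      src M (wact M (g, xs)) = std_obj M xs \<and> tgt M (wact M (g, xs)) = std_obj M (lact L g xs)"
    and e: "\<And>xs. xs \<in> lists (obj M) \<Longrightarrow> wact M (eL L (length xs), xs) = ide M (std_obj M xs)"
    and natural: "\<And>fs g. \<lbrakk>fs \<in> lists (arr M); g \<in> el L (length fs)\<rbrakk>
        \<Longrightarrow> wact M (g, map (tgt M) fs) \<cdot>\<^bsub>M\<^esub> std_arr M fs = std_arr M (lact L g fs) \<cdot>\<^bsub>M\<^esub>
            wact M (g, map (src M) fs)"
    and comp: "\<And>xs g h. \<lbrakk>xs \<in> lists (obj M); g \<in> el L (length xs); h \<in> el L (length xs)\<rbrakk>
        \<Longrightarrow> wact M (h, lact L g xs) \<cdot>\<^bsub>M\<^esub> wact M (g, xs) = wact M (mult (length xs) h g, xs)"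
    and beta: "\<And>xss hs. \<lbrakk>xss \<in> lists (lists (obj M)); list_all2 (\<lambda>h xs. h \<in> el L (length xs)) hs
        xss\<rbrakk>
        \<Longrightarrow> wact M (beta L (map length xss) hs, concat xss) =
            std_arr M (map2 (\<lambda>h xs. wact M (h, xs)) hs xss)"
    and delta: "\<And>xss g. \<lbrakk>xss \<in> lists (lists (obj M)); g \<in> el L (length xss)\<rbrakk>
        \<Longrightarrow> wact M (delta L (map length xss) g, concat xss) = wact M (g, map (std_obj M) xss)"
  shows "weak_L_monoidal_category L M"
proof -
  interpret monoidal_category M by fact
  have wl: "map2 (\<lambda>h xs. wact M (h, xs)) hs xss \<in> lists (arr M) \<and>
    map (src M) (map2 (\<lambda>h xs. wact M (h, xs)) hs xss) = map (std_obj M) xss \<and>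
    map (tgt M) (map2 (\<lambda>h xs. wact M (h, xs)) hs xss) = map (std_obj M) (map2 (lact L) hs xss)"
    if "list_all2 (\<lambda>h xs. h \<in> el L (length xs)) hs xss" "xss \<in> lists (lists (obj M))" for hs xss
    using that by (induction rule: list_all2_induct) (simp_all add: w)
  show ?thesis
  proof
    show "wact M \<in> opre L (obj M) \<rightarrow>\<^sub>E arr M"
    proof (rule PiE_I)
      fix p assume "p \<in> opre L (obj M)"
      then show "wact M p \<in> arr M" using w by (cases p) (simp del: in_lists_conv_set)
    qed (rule extensional_arb[OF ext])
  next
    fix xs g assume a: "xs \<in> lists (obj M)" "g \<in> el L (length xs)"
    then show "wact M (g, xs) \<in> homset M (std_obj M xs) (std_obj M (lact L g xs))"
      using w by (simp add: homset_def)
    have i: "inver (length xs) g \<in> el L (length xs)" using a by simp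
    have l: "lact L g xs \<in> lists (obj M)" "inver (length xs) g \<in> el L (length (lact L g xs))"
        using a by simp_all
    \<comment> \<open>The inverse is the isomorphism of the inverse group element at the permuted
      list.\<close>
    show "iso_arr M (wact M (g, xs))"
      unfolding iso_arr_def inverse_arrows_def
      using w[OF a] w[OF l] comp[OF a i] comp[OF l, of g] e[OF a(1)] e[OF l(1)] a
      by (intro exI[of _ "wact M (inver (length xs) g, lact L g xs)"]) simp
  next
    fix xss hs c c'
    assume a: "xss \<in> lists (lists (obj M))" "list_all2 (\<lambda>h xs. h \<in> el L (length xs)) hs xss"
      and c: "coherence M (flat_brk (concat xss)) (nested_brk xss) c"
      and c': "coherence M (nested_brk (map2 (lact L) hs xss)) (flat_brk (concat (map2 (lact L) hs
          xss))) c'"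
    have "std_arr M (map2 (\<lambda>h xs. wact M (h, xs)) hs xss) \<in> arr M"
      "src M (std_arr M (map2 (\<lambda>h xs. wact M (h, xs)) hs xss)) = std_obj M (map (std_obj M) xss)"
      "tgt M (std_arr M (map2 (\<lambda>h xs. wact M (h, xs)) hs xss)) =
          std_obj M (map (std_obj M) (map2 (lact L) hs xss))"
      using wl[OF a(2,1)] by (simp_all add: std_arr_simps del: map_map)
    then show "wact M (beta L (map length xss) hs, concat xss) =
           c' \<cdot>\<^bsub>M\<^esub> std_arr M (map2 (\<lambda>h xs. wact M (h, xs)) hs xss) \<cdot>\<^bsub>M\<^esub> c"
      using coherence_strict[OF c S] coherence_strict[OF c' S] beta[OF a] by simp
  next
    fix xss g c c'
    assume a: "xss \<in> lists (lists (obj M))" "g \<in> el L (length xss)"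
      and c: "coherence M (flat_brk (concat xss)) (nested_brk xss) c"
      and c': "coherence M (nested_brk (lact L g xss)) (flat_brk (concat (lact L g xss))) c'"
    have "map (std_obj M) xss \<in> lists (obj M)" using a(1) by (rule map_in_lists) simp
    then show "wact M (delta L (map length xss) g, concat xss) =
           c' \<cdot>\<^bsub>M\<^esub> wact M (g, map (std_obj M) xss) \<cdot>\<^bsub>M\<^esub> c"
      using coherence_strict[OF c S] coherence_strict[OF c' S] delta[OF a] w[of "map (std_obj M)
          xss" g] a by simp
  qed (use natural comp in blast)+
qed

section \<open>From algebras to strict weak \<Lambda>-monoidal categories\<close>

context nf_algebra
begin

abbreviation BE :: "'a list \<Rightarrow> 'a" where "BE fs \<equiv> B (eL L (length fs)) fs"

text \<open>\<open>B_concat\<close> with identities throughout; \<open>amu_e\<close> makes the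
  resulting operad element an identity again.\<close>

lemma BE_concat:
  assumes "fss \<in> lists (lists (arr X))"
  shows "BE (map BE fss) = BE (concat fss)"
proof -
  let ?vs = "map (eL L) (map length fss)"
  have "map BE fss = map2 B ?vs fss" by (rule nth_equalityI) simp_all
  moreover have "B (eL L (length fss)) (map2 B ?vs fss) =
      B (amu L (map length fss) (eL L (length fss)) ?vs) (concat fss)"
    using assms by (intro B_concat) (simp_all add: list_all2_conv_all_nth)
  ultimately show ?thesis using amu_e[of "length fss" "map length fss"]
      by (simp add: length_concat)
qed

text \<open>The partition \<open>[[f], fs]\<close> in \<open>BE_concat\<close>, with the singleton
  absorbed by \<open>B_single\<close>. Comparing it with the partition in \<open>BE_snoc\<close>
  yields associativity, and an empty \<open>fs\<close> yields the unit laws.\<close>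

lemma BE_Cons: "f \<in> arr X \<Longrightarrow> fs \<in> lists (arr X) \<Longrightarrow> BE [f, BE fs] = BE (f # fs)"
  using BE_concat[of "[[f], fs]"] B_single[of f] by simp

lemma BE_snoc: "f \<in> arr X \<Longrightarrow> fs \<in> lists (arr X) \<Longrightarrow> BE [BE fs, f] = BE (fs @ [f])"
  using BE_concat[of "[fs, [f]]"] B_single[of f] by simp

lemma A_Cons: "x \<in> obj X \<Longrightarrow> xs \<in> lists (obj X) \<Longrightarrow> A [x, A xs] = A (x # xs)"
  using A_concat[of "[[x], xs]"] A_single[of x] by simp

lemma A_snoc: "x \<in> obj X \<Longrightarrow> xs \<in> lists (obj X) \<Longrightarrow> A [A xs, x] = A (xs @ [x])"
  using A_concat[of "[xs, [x]]"] A_single[of x] by simp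

lemma BE_simps:
  assumes "fs \<in> lists (arr X)"
  shows "BE fs \<in> arr X" "src X (BE fs) = A (map (src X) fs)" "tgt X (BE fs) = A (map (tgt X) fs)"
  using assms by (simp_all add: B_arr src_B tgt_B)

text \<open>Iterating the binary operation reproduces the n-ary one by \<open>A_Cons\<close>. The
  category \<open>M\<close> is left general since only its tensor product and unit on objects
  matter.\<close>

lemma std_obj_eq_A:
  assumes "\<And>x y. x \<in> obj X \<Longrightarrow> y \<in> obj X \<Longrightarrow> x \<odot>\<^bsub>M\<^esub> y = A [x, y]" "munit M = A []"
      "xs \<in> lists (obj X)"
  shows "std_obj M xs = A xs"
  using assms(3)
proof (induction xs)
  case (Cons x xs)
  then show ?case by (cases "xs = []") (simp_all add: std_obj_Cons assms(1) A_single A_obj A_Cons)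
qed (simp add: assms(2))

lemma std_arr_eq_BE:
  assumes "\<And>f g. f \<in> arr X \<Longrightarrow> g \<in> arr X \<Longrightarrow> f \<star>\<^bsub>M\<^esub> g = BE [f, g]" "ide M (munit M) = BE []"
      "fs \<in> lists (arr X)"
  shows "std_arr M fs = BE fs"
  using assms(3)
proof (induction fs)
  case (Cons f fs)
  then show ?case
    using BE_Cons[of f fs] B_single[of f]
    by (cases "fs = []") (simp_all add: std_arr_Cons assms(1) BE_simps)
qed (use assms(2) in simp)

end

context action_operad
begin

text \<open>In the last equation the arity 2 appears as \<open>length [f, g]\<close>, so that the
  tensor product of arrows is literally an instance of \<open>BE\<close>.\<close>

lemma incl0_simps:
  "obj (incl0 L X) = obj X" "arr (incl0 L X) = arr X" "src (incl0 L X) = src X" "tgt (incl0 L X) =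
      tgt X"
  "ide (incl0 L X) = ide X" "cmp (incl0 L X) = cmp X" "tens (incl0 L X) = alg_tens L X"
  "munit (incl0 L X) = fobj (alg X) (OC (obj X) [])"
  "x \<in> obj X \<Longrightarrow> y \<in> obj X \<Longrightarrow> fobj (alg_tens L X) (x, y) = fobj (alg X) (OC (obj X) [x, y])"
  "f \<in> arr X \<Longrightarrow> g \<in> arr X \<Longrightarrow> farr (alg_tens L X) (f, g) =
      farr (alg X) (AC (arr X) (eL L (length [f, g])) [f, g])"
  by (simp_all add: incl0_def Let_def alg_tens_def numeral_2_eq_2)

text \<open>The category axioms see only the six fields of \<open>cat\<close>, so they pass between
  the record extensions for algebras and for weak monoidal categories.\<close>

lemma category_cong:
  assumes "category C" "obj D = obj C" "arr D = arr C" "src D = src C" "tgt D = tgt C" "ide D =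
      ide C" "cmp D = cmp C"
  shows "category D"
  using assms unfolding category_def composable_def homset_def by simp

lemma incl0_wact:
  assumes "category X" "xs \<in> lists (obj X)" "g \<in> el L (length xs)"
  shows "wact (incl0 L X) (g, xs) = farr (alg X) (AC (arr X) g (map (ide X) xs))"
proof -
  interpret category X by fact
  show ?thesis using assms ide_lists[OF assms(2)] by (simp add: incl0_def Let_def)
qed

text \<open>Both bracketings of three factors equal the ternary operation, and tensoring with the
  unit is a partition with one empty block. Functoriality of the tensor product is
  \<open>B_cmp\<close> and \<open>B_ide\<close> in arity two.\<close>

lemma incl0_monoidal:
  assumes "el_algebra L X"
  shows "monoidal_category (incl0 L X)" "strict_monoidal (incl0 L X)"
    and "xs \<in> lists (obj X) \<Longrightarrow> std_obj (incl0 L X) xs = fobj (alg X) (OC (obj X) xs)"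
    and "fs \<in> lists (arr X) \<Longrightarrow> std_arr (incl0 L X) fs =
        farr (alg X) (AC (arr X) (eL L (length fs)) fs)"
proof -
  let ?M = "incl0 L X"
  interpret nf_algebra L X "\<lambda>xs. fobj (alg X) (OC (obj X) xs)"
      "\<lambda>g fs. farr (alg X) (AC (arr X) g fs)"
    by (rule el_algebra_nf) fact
  note [simp] = incl0_simps
  have M: "monoidal_category ?M \<and> strict_monoidal ?M"
  proof (rule strict_monoidal_categoryI)
    show "category ?M" by (rule category_cong[of X]) (simp_all, unfold_locales)
    show "fobj (tens ?M) \<in> obj ?M \<times> obj ?M \<rightarrow>\<^sub>E obj ?M"
    proof (rule PiE_I)
      fix p assume "p \<in> obj ?M \<times> obj ?M" then show "fobj (tens ?M) p \<in> obj ?M"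
          by (cases p) (simp add: A_obj)
    next
      fix p assume "p \<notin> obj ?M \<times> obj ?M" then show "fobj (tens ?M) p = undefined"
          by (simp add: alg_tens_def)
    qed
    show "farr (tens ?M) \<in> arr ?M \<times> arr ?M \<rightarrow>\<^sub>E arr ?M"
    proof (rule PiE_I)
      fix p assume "p \<in> arr ?M \<times> arr ?M" then show "farr (tens ?M) p \<in> arr ?M"
          by (cases p) (simp add: B_arr)
    next
      fix p assume "p \<notin> arr ?M \<times> arr ?M" then show "farr (tens ?M) p = undefined"
          by (simp add: alg_tens_def)
    qed
    show "munit ?M \<in> obj ?M" using A_obj[of "[]"] by simp
    show "massoc ?M = restrict (\<lambda>(x, y, z). ide ?M (x \<odot>\<^bsub>?M\<^esub> (y \<odot>\<^bsub>?M\<^esub>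
        z))) (obj ?M \<times> obj ?M \<times> obj ?M)"
      "lunit ?M = (\<lambda>x\<in>obj ?M. ide ?M x)" "runit ?M = (\<lambda>x\<in>obj ?M. ide ?M x)"
      by (simp_all add: incl0_def Let_def)
  next
    fix f g assume "f \<in> arr ?M" "g \<in> arr ?M"
    then show "src ?M (f \<star>\<^bsub>?M\<^esub> g) = src ?M f \<odot>\<^bsub>?M\<^esub> src ?M g \<and> tgt ?M (f \<star>\<^bsub>?M\<^esub> g) = tgt ?M f \<odot>\<^bsub>?M\<^esub>
        tgt ?M g"
      using src_B[of "[f, g]"] tgt_B[of "[f, g]"] by simp
  next
    fix x y assume "x \<in> obj ?M" "y \<in> obj ?M"
    then show "ide ?M x \<star>\<^bsub>?M\<^esub> ide ?M y = ide ?M (x \<odot>\<^bsub>?M\<^esub> y)"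
      using B_ide[of "[x, y]"] by simp
  next
    fix f g f' g' assume "f \<in> arr ?M" "g \<in> arr ?M" "f' \<in> arr ?M" "g' \<in> arr ?M" "src ?M f' =
        tgt ?M f" "src ?M g' = tgt ?M g"
    then show "(f' \<cdot>\<^bsub>?M\<^esub> f) \<star>\<^bsub>?M\<^esub> (g' \<cdot>\<^bsub>?M\<^esub> g) = (f' \<star>\<^bsub>?M\<^esub> g') \<cdot>\<^bsub>?M\<^esub> (f \<star>\<^bsub>?M\<^esub> g)"
      using B_cmp[of "[f, g]" "[f', g']" "eL L 2" "eL L 2"] by (simp add: numeral_2_eq_2)
  next
    fix x y z assume "x \<in> obj ?M" "y \<in> obj ?M" "z \<in> obj ?M"
    then show "(x \<odot>\<^bsub>?M\<^esub> y) \<odot>\<^bsub>?M\<^esub> z = x \<odot>\<^bsub>?M\<^esub> (y \<odot>\<^bsub>?M\<^esub> z)"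
      using A_Cons[of x "[y, z]"] A_snoc[of z "[x, y]"] A_obj[of "[x, y]"] A_obj[of "[y, z]"]
          by simp
  next
    fix f g h assume "f \<in> arr ?M" "g \<in> arr ?M" "h \<in> arr ?M"
    then show "(f \<star>\<^bsub>?M\<^esub> g) \<star>\<^bsub>?M\<^esub> h = f \<star>\<^bsub>?M\<^esub> (g \<star>\<^bsub>?M\<^esub> h)"
      using BE_Cons[of f "[g, h]"] BE_snoc[of h "[f, g]"] BE_simps(1)[of "[f, g]"] BE_simps(1)[of
          "[g, h]"] by simp
  next
    fix x assume "x \<in> obj ?M"
    then show "munit ?M \<odot>\<^bsub>?M\<^esub> x = x \<and> x \<odot>\<^bsub>?M\<^esub> munit ?M = x"
      using A_Cons[of x "[]"] A_snoc[of x "[]"] A_obj[of "[]"] by (simp add: A_single)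
  next
    fix f assume "f \<in> arr ?M"
    then show "ide ?M (munit ?M) \<star>\<^bsub>?M\<^esub> f = f \<and> f \<star>\<^bsub>?M\<^esub> ide ?M (munit ?M) = f"
      using BE_Cons[of f "[]"] BE_snoc[of f "[]"] B_single[of f] B_ide[of "[]"] A_obj[of "[]"]
          by simp
  qed
  then show "monoidal_category ?M" "strict_monoidal ?M" by simp_all
  show "xs \<in> lists (obj X) \<Longrightarrow> std_obj ?M xs = fobj (alg X) (OC (obj X) xs)"
    by (rule std_obj_eq_A) simp_all
  show "fs \<in> lists (arr X) \<Longrightarrow> std_arr ?M fs = farr (alg X) (AC (arr X) (eL L (length fs)) fs)"
    using B_ide[of "[]"] by (intro std_arr_eq_BE) simp_all
qed

text \<open>[g] is \<open>?B g\<close> at identity arrows, so each condition specializes an equation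
  for \<open>?B\<close>: naturality and (1) come from \<open>B_cmp\<close>, (2) and (3) from
  \<open>B_concat\<close>.\<close>

lemma incl0_weak:
  assumes X: "el_algebra L X"
  shows "weak_L_monoidal_category L (incl0 L X)"
proof -
  let ?M = "incl0 L X"
  let ?A = "\<lambda>xs. fobj (alg X) (OC (obj X) xs)" let ?B = "\<lambda>g fs. farr (alg X) (AC (arr X) g fs)"
  interpret nf_algebra L X ?A ?B by (rule el_algebra_nf) fact
  note [simp] = incl0_simps
  have w: "wact ?M (g, xs) = ?B g (map (ide X) xs)" if "xs \<in> lists (obj X)" "g \<in> el L (length xs)"
      for g xs
    using that by (intro incl0_wact) unfold_locales
  note [simp] = incl0_monoidal(3,4)[OF X]
  show ?thesis
  proof (rule strict_weakI)
    show "monoidal_category ?M" "strict_monoidal ?M" using incl0_monoidal[OF X] by simp_all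
    show "wact ?M \<in> extensional (opre L (obj ?M))" by (simp add: incl0_def Let_def)
  next
    fix xs g assume a: "xs \<in> lists (obj ?M)" "g \<in> el L (length xs)"
    then show "wact ?M (g, xs) \<in> arr ?M \<and> src ?M (wact ?M (g, xs)) = std_obj ?M xs \<and>
        tgt ?M (wact ?M (g, xs)) = std_obj ?M (lact L g xs)"
      using ide_lists[of xs] by (simp add: w B_arr src_B tgt_B map_src_ide map_tgt_ide flip:
          lact_map)
  next
    fix xs assume "xs \<in> lists (obj ?M)"
    then show "wact ?M (eL L (length xs), xs) = ide ?M (std_obj ?M xs)" by (simp add: w B_ide)
  next
    fix fs g assume a: "fs \<in> lists (arr ?M)" "g \<in> el L (length fs)"
    have i: "map (ide X \<circ> tgt X) fs \<in> lists (arr X)" "map (ide X \<circ> src X) fs \<in> lists (arr X)"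
      using a by (auto simp: in_lists_conv_set)
    have t: "map2 (\<lambda>g f. g \<cdot>\<^bsub>X\<^esub> f) (map (ide X \<circ> tgt X) fs) fs = fs" "map2 (\<lambda>g f. g \<cdot>\<^bsub>X\<^esub>
        f) fs (map (ide X \<circ> src X) fs) = fs"
      using a(1) by (auto intro!: nth_equalityI simp: in_lists_conv_set)
    have s: "map (src X) (map (ide X \<circ> tgt X) fs) = map (tgt X) fs"
        "map (tgt X) (map (ide X \<circ> src X) fs) = map (src X) fs"
      using a(1) by (auto simp: in_lists_conv_set)
    \<comment> \<open>Both composites factor the same arrow \<open>?B g fs\<close>, with identities
      placed after \<open>fs\<close> in one case and before \<open>fs\<close> in the other.\<close>
    have "wact ?M (g, map (tgt X) fs) \<cdot>\<^bsub>X\<^esub> BE fs = ?B g fs"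
      using B_cmp[of fs "map (ide X \<circ> tgt X) fs" "eL L (length fs)" g] a i t s tgt_lists[of fs]
          by (simp add: w)
    moreover have "BE (lact L g fs) \<cdot>\<^bsub>X\<^esub> wact ?M (g, map (src X) fs) = ?B g fs"
      using B_cmp[of "map (ide X \<circ> src X) fs" fs g "eL L (length fs)"] a i t s src_lists[of fs]
          by (simp add: w)
    ultimately show "wact ?M (g, map (tgt ?M) fs) \<cdot>\<^bsub>?M\<^esub> std_arr ?M fs =
        std_arr ?M (lact L g fs) \<cdot>\<^bsub>?M\<^esub> wact ?M (g, map (src ?M) fs)"
      using a by simp
  next
    fix xs g h assume a: "xs \<in> lists (obj ?M)" "g \<in> el L (length xs)" "h \<in> el L (length xs)"
    have i: "map (ide X) xs \<in> lists (arr X)" using a ide_lists by simp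
    have t: "map2 (\<lambda>g f. g \<cdot>\<^bsub>X\<^esub> f) (map (ide X) xs) (map (ide X) xs) = map (ide X) xs"
      using a(1) by (auto intro!: nth_equalityI simp: in_lists_conv_set)
    have s: "map (src X) (map (ide X) xs) = map (tgt X) (map (ide X) xs)"
      using a(1) by (auto simp: in_lists_conv_set)
    show "wact ?M (h, lact L g xs) \<cdot>\<^bsub>?M\<^esub> wact ?M (g, xs) = wact ?M (mult (length xs) h g, xs)"
      using B_cmp[of "map (ide X) xs" "map (ide X) xs" g h] i a s t by (simp add: w)
  next
    fix xss hs assume a: "xss \<in> lists (lists (obj ?M))"
        "list_all2 (\<lambda>h xs. h \<in> el L (length xs)) hs xss"
    let ?iss = "map (map (ide X)) xss"
    have len: "length hs = length xss" using a(2) by (rule list_all2_lengthD)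
    have i: "?iss \<in> lists (lists (arr X))" using a(1)
        by (intro map_in_lists[of xss "lists (obj X)"] ide_lists) simp_all
    have hs: "list_all2 (\<lambda>h fs. h \<in> el L (length fs)) hs ?iss" using a(2)
        by (simp add: list.rel_map)
    \<comment> \<open>An identity as outer element turns the operad product into \<beta>.\<close>
    have b: "?B (eL L (length xss)) (map2 ?B hs ?iss) =
        ?B (beta L (map length xss) hs) (concat ?iss)"
      using B_concat[OF i _ hs, of "eL L (length xss)"] by (simp add: beta_def comp_def)
    have m: "map2 ?B hs ?iss = map2 (\<lambda>h xs. wact ?M (h, xs)) hs xss"
    proof (rule nth_equalityI)
      fix j assume "j < length (map2 ?B hs ?iss)"
      then have j: "j < length xss" by simp
      then show "map2 ?B hs ?iss ! j = map2 (\<lambda>h xs. wact ?M (h, xs)) hs xss ! j"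
        using len nth_in_lists[OF a(1) j] list_all2_nthD2[OF a(2) j] by (simp add: w)
    qed simp
    have l: "map2 ?B hs ?iss \<in> lists (arr X)"
    proof (rule listsI_nth)
      fix j assume "j < length (map2 ?B hs ?iss)"
      then have j: "j < length xss" by simp
      then show "map2 ?B hs ?iss ! j \<in> arr X"
        using len nth_in_lists[OF i, of j] list_all2_nthD2[OF a(2) j] by (simp add: B_arr)
    qed
    have c: "concat xss \<in> lists (obj X)" using a(1) by (intro concat_in_lists) simp
    have bl: "beta L (map length xss) hs \<in> el L (length (concat xss))"
      using a(2) by (simp add: length_concat els_map_length)
    show "wact ?M (beta L (map length xss) hs, concat xss) =
        std_arr ?M (map2 (\<lambda>h xs. wact ?M (h, xs)) hs xss)"
      using b l len w[OF c bl] unfolding m by (simp add: map_concat)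
  next
    fix xss g assume a: "xss \<in> lists (lists (obj ?M))" "g \<in> el L (length xss)"
    let ?iss = "map (map (ide X)) xss" let ?vs = "map (eL L \<circ> length) xss"
    have i: "?iss \<in> lists (lists (arr X))" using a(1)
        by (intro map_in_lists[of xss "lists (obj X)"] ide_lists) simp_all
    have vs: "list_all2 (\<lambda>h fs. h \<in> el L (length fs)) ?vs ?iss"
        by (simp add: list_all2_conv_all_nth)
    \<comment> \<open>Identities as inner elements turn the operad product into \<delta>.\<close>
    have b: "?B g (map2 ?B ?vs ?iss) = ?B (delta L (map length xss) g) (concat ?iss)"
      using B_concat[OF i _ vs, of g] a by (simp add: delta_def comp_def)
    have m: "map2 ?B ?vs ?iss = map (ide X) (map (std_obj ?M) xss)"
    proof (rule nth_equalityI)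
      fix j assume "j < length (map2 ?B ?vs ?iss)"
      then have j: "j < length xss" by simp
      then show "map2 ?B ?vs ?iss ! j = map (ide X) (map (std_obj ?M) xss) ! j"
        using nth_in_lists[OF a(1) j] by (simp add: B_ide)
    qed simp
    have c: "concat xss \<in> lists (obj X)" using a(1) by (intro concat_in_lists) simp
    have dl: "delta L (map length xss) g \<in> el L (length (concat xss))"
      using a(2) by (simp add: length_concat)
    have sl: "map (std_obj ?M) xss \<in> lists (obj X)" using a(1)
        by (intro map_in_lists[of xss "lists (obj X)"]) (simp_all add: A_obj)
    show "wact ?M (delta L (map length xss) g, concat xss) = wact ?M (g, map (std_obj ?M) xss)"
      using b w[OF c dl] w[OF sl, of g] a unfolding m by (simp add: map_concat del: map_map)
  qed
qed

end

section \<open>The algebra of a strict weak \<Lambda>-monoidal category and the image on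
  objects\<close>

context strict_weak_op
begin

text \<open>\<open>inv_into\<close> reads the normal form off an orbit; this is unambiguous because
  \<open>OC\<close> and \<open>AC\<close> are injective on the indicated domains.\<close>

definition alg_of :: "('b, 'c, 'a) el_alg" where
  "alg_of = \<lparr>obj = obj M, arr = arr M, src = src M, tgt = tgt M, ide = ide M, cmp = cmp M,
     alg = \<lparr>fobj = (\<lambda>c\<in>EOb (obj M). std_obj M (inv_into (lists (obj M)) (OC (obj M)) c)),
            farr = (\<lambda>c\<in>EAr (arr M). case_prod Bw
              (inv_into {(g, fs). fs \<in> lists (arr M) \<and>
                  g \<in> el L (length fs)} (case_prod (AC (arr M))) c))\<rparr>\<rparr>"

lemma alg_of_simps [simp]: "obj alg_of = obj M" "arr alg_of = arr M" "src alg_of = src M"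
    "tgt alg_of = tgt M"
  "ide alg_of = ide M" "cmp alg_of = cmp M"
  by (simp_all add: alg_of_def)

lemma alg_of_obj [simp]:
  assumes "xs \<in> lists (obj M)" shows "fobj (alg alg_of) (OC (obj M) xs) = std_obj M xs"
proof -
  have "inj_on (OC (obj M)) (lists (obj M))" by (rule inj_onI) simp
  from inv_into_f_f[OF this assms] show ?thesis using assms by (simp add: alg_of_def)
qed

lemma alg_of_arr [simp]:
  assumes "fs \<in> lists (arr M)" "g \<in> el L (length fs)" shows "farr (alg alg_of) (AC (arr M) g fs) =
      Bw g fs"
proof -
  have "inj_on (case_prod (AC (arr M))) {(g, fs). fs \<in> lists (arr M) \<and> g \<in> el L (length fs)}"
    by (rule inj_onI) (simp add: case_prod_beta' prod_eq_iff)
  from inv_into_f_f[OF this, of "(g, fs)"] show ?thesis using assms by (simp add: alg_of_def)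
qed

lemma el_algebra_alg_of: "el_algebra L alg_of"
proof (rule nf_el_algebra)
  show "fobj (alg alg_of) \<in> extensional (EOb (obj alg_of))"
      "farr (alg alg_of) \<in> extensional (EAr (arr alg_of))"
    by (simp_all add: alg_of_def)
  interpret C: category alg_of by (rule category_cong[of M]) (simp_all, unfold_locales)
  interpret X: operad_cat L alg_of by unfold_locales
  interpret Y: operad_cat L M by unfold_locales
  show "nf_algebra L alg_of (\<lambda>xs. fobj (alg alg_of) (OC (obj alg_of) xs)) (\<lambda>g fs. farr (alg
      alg_of) (AC (arr alg_of) g fs))"
  proof
    fix xs assume "xs \<in> lists (obj alg_of)"
    then show "fobj (alg alg_of) (OC (obj alg_of) xs) \<in> obj alg_of"
      "farr (alg alg_of) (AC (arr alg_of) (eL L (length xs)) (map (ide alg_of) xs)) =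
        ide alg_of (fobj (alg alg_of) (OC (obj alg_of) xs))"
      using ide_lists[of xs] by (simp_all add: Bw_def map_tgt_ide std_arr_ide)
  next
    fix fs g assume "fs \<in> lists (arr alg_of)" "g \<in> el L (length fs)"
    then show "farr (alg alg_of) (AC (arr alg_of) g fs) \<in> arr alg_of"
      "src alg_of (farr (alg alg_of) (AC (arr alg_of) g fs)) =
          fobj (alg alg_of) (OC (obj alg_of) (map (src alg_of) fs))"
      "tgt alg_of (farr (alg alg_of) (AC (arr alg_of) g fs)) =
          fobj (alg alg_of) (OC (obj alg_of) (lact L g (map (tgt alg_of) fs)))"
      using src_lists[of fs] tgt_lists[of fs] by (simp_all del: lact_map)
  next
    fix fs gs g h assume a: "fs \<in> lists (arr alg_of)" "gs \<in> lists (arr alg_of)"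
        "map (src alg_of) gs = map (tgt alg_of) fs"
      "g \<in> el L (length fs)" "h \<in> el L (length fs)"
    then have "gs \<in> lists (arr M)" "fs \<in> lists (arr M)" "map (src M) gs = map (tgt M) fs"
        by simp_all
    from Y.map2_cmp_lists[OF this] Bw_cmp[OF this(2,1,3) a(4,5)]
    show "farr (alg alg_of) (AC (arr alg_of) (mult (length fs) h g) (map2 (\<lambda>g f. g \<cdot>\<^bsub>alg_of\<^esub>
        f) gs fs)) =
      farr (alg alg_of) (AC (arr alg_of) h (lact L g gs)) \<cdot>\<^bsub>alg_of\<^esub>
          farr (alg alg_of) (AC (arr alg_of) g fs)"
      using a by simp
  next
    fix x assume "x \<in> obj alg_of" then show "fobj (alg alg_of) (OC (obj alg_of) [x]) = x" by simp
  next
    fix f assume "f \<in> arr alg_of" then show "farr (alg alg_of) (AC (arr alg_of) (eL L 1) [f]) = f"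
      by (simp add: Bw_def)
  next
    fix xss assume "xss \<in> lists (lists (obj alg_of))"
    then have a: "xss \<in> lists (lists (obj M))" by simp
    have m: "map (\<lambda>xs. fobj (alg alg_of) (OC (obj M) xs)) xss = map (std_obj M) xss"
      using a by (simp add: in_lists_conv_set[of xss])
    show "fobj (alg alg_of) (OC (obj alg_of) (map (\<lambda>xs. fobj (alg alg_of) (OC (obj alg_of) xs))
        xss)) =
      fobj (alg alg_of) (OC (obj alg_of) (concat xss))"
      unfolding alg_of_simps m using std_obj_concat[OF a] std_obj_map_lists[OF a]
          concat_in_lists[OF a] by simp
  next
    fix fss u vs assume "fss \<in> lists (lists (arr alg_of))" and u: "u \<in> el L (length fss)"
      and vs: "list_all2 (\<lambda>v fs. v \<in> el L (length fs)) vs fss"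
    then have a: "fss \<in> lists (lists (arr M))" by simp
    have len: "length vs = length fss" using vs by (rule list_all2_lengthD)
    have m: "map2 (\<lambda>g fs. farr (alg alg_of) (AC (arr M) g fs)) vs fss = map2 Bw vs fss"
    proof (rule nth_equalityI)
      fix i assume "i < length (map2 (\<lambda>g fs. farr (alg alg_of) (AC (arr M) g fs)) vs fss)"
      then have i: "i < length fss" by simp
      then show "map2 (\<lambda>g fs. farr (alg alg_of) (AC (arr M) g fs)) vs fss ! i =
          map2 Bw vs fss ! i"
        using len nth_in_lists[OF a i] list_all2_nthD2[OF vs i] by simp
    qed simp
    have l: "map2 Bw vs fss \<in> lists (arr M)"
    proof (rule listsI_nth)
      fix i assume "i < length (map2 Bw vs fss)"
      then have i: "i < length fss" by simp
      then show "map2 Bw vs fss ! i \<in> arr M"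
        using len nth_in_lists[OF a i] list_all2_nthD2[OF vs i] by simp
    qed
    have "amu L (map length fss) u vs \<in> el L (length (concat fss))"
      using mu_closed[of u "map length fss" vs] u vs by (simp add: length_concat els_map_length)
    then show "farr (alg alg_of) (AC (arr alg_of) u (map2 (\<lambda>g fs. farr (alg alg_of) (AC (arr
        alg_of) g fs)) vs fss)) =
      farr (alg alg_of) (AC (arr alg_of) (amu L (map length fss) u vs) (concat fss))"
      using Bw_concat[OF a u vs] l u concat_in_lists[OF a] len by (simp add: m del: map_map)
  qed
qed

text \<open>All fields are extensional, so comparison on carriers suffices. \<open>Bw\<close> at e
  gives back the tensor product, \<open>Bw\<close> at identity arrows gives back
  \<open>wact\<close>, and by strictness the constraints of \<open>M\<close> are the same
  identities.\<close>

lemma incl0_alg_of: "incl0 L alg_of = M"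
proof -
  note [simp] = incl0_simps
  have "alg_tens L alg_of = tens M"
  proof (rule fctr_eqI)
    show "fobj (alg_tens L alg_of) \<in> extensional (obj M \<times> obj M)"
        "farr (alg_tens L alg_of) \<in> extensional (arr M \<times> arr M)"
      by (simp_all add: alg_tens_def)
    show "fobj (tens M) \<in> extensional (obj M \<times> obj M)"
        "farr (tens M) \<in> extensional (arr M \<times> arr M)"
      using tensor.fobj_type tensor.farr_type by (simp_all add: PiE_def)
    show "\<And>p. p \<in> obj M \<times> obj M \<Longrightarrow> fobj (alg_tens L alg_of) p = fobj (tens M) p"
      by (elim SigmaE) simp
    show "\<And>p. p \<in> arr M \<times> arr M \<Longrightarrow> farr (alg_tens L alg_of) p = farr (tens M) p"
      by (elim SigmaE) (simp add: Bw_def)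
  qed
  moreover have "massoc (incl0 L alg_of) = massoc M"
  proof (rule extensionalityI[of _ "obj M \<times> obj M \<times> obj M"])
    show "massoc (incl0 L alg_of) \<in> extensional (obj M \<times> obj M \<times> obj M)"
        by (simp add: incl0_def Let_def)
    show "massoc M \<in> extensional (obj M \<times> obj M \<times> obj M)" using massoc_type by (simp add: PiE_def)
    fix p assume "p \<in> obj M \<times> obj M \<times> obj M"
    then obtain x y z where p: "p = (x, y, z)" "x \<in> obj M" "y \<in> obj M" "z \<in> obj M"
        by (elim SigmaE) simp
    then show "massoc (incl0 L alg_of) p = massoc M p"
      using strict unfolding strict_monoidal_def by (simp add: incl0_def Let_def incl0_simps(9))
  qed
  moreover have "lunit (incl0 L alg_of) = lunit M"
    by (rule extensionalityI[of _ "obj M"])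
      (use lunit_type strict in \<open>simp_all add: incl0_def Let_def PiE_def strict_monoidal_def\<close>)
  moreover have "runit (incl0 L alg_of) = runit M"
    by (rule extensionalityI[of _ "obj M"])
      (use runit_type strict in \<open>simp_all add: incl0_def Let_def PiE_def strict_monoidal_def\<close>)
  moreover have "wact (incl0 L alg_of) = wact M"
  proof (rule extensionalityI[of _ "opre L (obj M)"])
    show "wact (incl0 L alg_of) \<in> extensional (opre L (obj M))" by (simp add: incl0_def Let_def)
    show "wact M \<in> extensional (opre L (obj M))" using wact_type by (simp add: PiE_def)
    fix p assume "p \<in> opre L (obj M)"
    then obtain g xs where p: "p = (g, xs)" "xs \<in> lists (obj M)" "g \<in> el L (length xs)"
        by (cases p) simp
    have "category alg_of" using el_algebra_alg_of by (simp add: el_algebra_def)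
    then show "wact (incl0 L alg_of) p = wact M p"
      using p incl0_wact[of alg_of xs g] ide_lists[OF p(2)]
      by (simp add: Bw_def map_tgt_ide std_arr_ide)
  qed
  ultimately show ?thesis
    by (intro wk_mon_cat.equality mon_cat.equality cat.equality) simp_all
qed

end

context action_operad
begin

text \<open>Splits (e -> g; fs) into tensor product and permutation part by \<open>B_cmp\<close>,
  which expresses the algebra structure through fields that survive in
  \<open>incl0 L X\<close>.\<close>

lemma incl0_alg_arr:
  assumes X: "el_algebra L X" and fs: "fs \<in> lists (arr X)" "g \<in> el L (length fs)"
  shows "farr (alg X) (AC (arr X) g fs) = wact (incl0 L X) (g, map (tgt X) fs) \<cdot>\<^bsub>X\<^esub>
      std_arr (incl0 L X) fs"
proof -
  interpret nf_algebra L X "\<lambda>xs. fobj (alg X) (OC (obj X) xs)"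
      "\<lambda>g fs. farr (alg X) (AC (arr X) g fs)"
    by (rule el_algebra_nf) fact
  have i: "map (ide X \<circ> tgt X) fs \<in> lists (arr X)"
    using fs by (auto simp: in_lists_conv_set)
  have t: "map2 (\<lambda>g f. g \<cdot>\<^bsub>X\<^esub> f) (map (ide X \<circ> tgt X) fs) fs = fs"
    using fs(1) by (auto intro!: nth_equalityI simp: in_lists_conv_set)
  have s: "map (src X) (map (ide X \<circ> tgt X) fs) = map (tgt X) fs"
    using fs(1) by (auto simp: in_lists_conv_set)
  show ?thesis
    using B_cmp[of fs "map (ide X \<circ> tgt X) fs" "eL L (length fs)" g] fs i t s tgt_lists[of fs]
      incl0_wact[OF category_axioms, of "map (tgt X) fs" g] incl0_monoidal(4)[OF X fs(1)]
    by simp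
qed

text \<open>The structure map is recovered from the weak structure: on objects from the iterated
  tensor product, on arrows by \<open>incl0_alg_arr\<close>.\<close>

lemma incl0_inj:
  assumes X: "el_algebra L X" and Y: "el_algebra L Y" and eq: "incl0 L X = incl0 L Y"
  shows "X = Y"
proof -
  interpret X: el_algebra L X by fact
  interpret Y: el_algebra L Y by fact
  have f: "obj X = obj Y" "arr X = arr Y" "src X = src Y" "tgt X = tgt Y" "ide X = ide Y" "cmp X =
      cmp Y"
    using arg_cong[OF eq, of obj] arg_cong[OF eq, of arr] arg_cong[OF eq, of src] arg_cong[OF eq,
        of tgt]
      arg_cong[OF eq, of ide] arg_cong[OF eq, of cmp] by (simp_all add: incl0_simps)
  have "alg X = alg Y"
  proof (rule fctr_eqI)
    show "fobj (alg X) \<in> extensional (EOb (obj X))" "fobj (alg Y) \<in> extensional (EOb (obj X))"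
      "farr (alg X) \<in> extensional (EAr (arr X))" "farr (alg Y) \<in> extensional (EAr (arr X))"
      using X.structure_map.fobj_type X.structure_map.farr_type Y.structure_map.fobj_type
          Y.structure_map.farr_type
      by (simp_all add: PiE_def f)
  next
    fix c assume "c \<in> EOb (obj X)"
    then obtain xs where xs: "xs \<in> lists (obj X)" "c = OC (obj X) xs" unfolding EOb_def
        by (elim imageE)
    then show "fobj (alg X) c = fobj (alg Y) c"
      using incl0_monoidal(3)[OF X, of xs] incl0_monoidal(3)[OF Y, of xs] by (simp add: eq f)
  next
    fix c assume "c \<in> EAr (arr X)"
    then obtain fs g where fs: "fs \<in> lists (arr X)" "g \<in> el L (length fs)" "c = AC (arr X) g fs"
        by (rule EAr_cases)
    then show "farr (alg X) c = farr (alg Y) c"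
      using incl0_alg_arr[OF X, of fs g] incl0_alg_arr[OF Y, of fs g] by (simp add: eq f)
  qed
  with f show ?thesis by (intro el_alg.equality cat.equality) simp_all
qed

lemma incl0_strict_weak: "el_algebra L X \<Longrightarrow> strict_weak_op L (incl0 L X)"
  using incl0_weak[of X] incl0_monoidal(2)[of X]
  by (simp add: strict_weak_op_def weak_op_def strict_weak_op_axioms_def action_operad_axioms)

lemma incl0_image:
  "incl0 L ` {X :: ('b, 'c, 'g) el_alg. el_algebra L X} = {M. weak_L_monoidal_category L M \<and>
      strict_monoidal M}"
proof (intro equalityI subsetI)
  fix M assume "M \<in> incl0 L ` {X. el_algebra L X}"
  then show "M \<in> {M. weak_L_monoidal_category L M \<and> strict_monoidal M}"
    using incl0_weak incl0_monoidal(2) by auto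
next
  fix M :: "('b, 'c, 'g) wk_mon_cat" assume "M \<in> {M. weak_L_monoidal_category L M \<and>
      strict_monoidal M}"
  then interpret strict_weak_op L M
    by (simp add: strict_weak_op_def weak_op_def strict_weak_op_axioms_def action_operad_axioms)
  show "M \<in> incl0 L ` {X. el_algebra L X}"
    by (rule image_eqI[of _ _ alg_of]) (simp_all add: incl0_alg_of el_algebra_alg_of)
qed

end

section \<open>The inclusion on morphisms and 2-cells\<close>

text \<open>Transports a functor between record types whose common \<open>cat\<close> and
  \<open>fctr\<close> fields coincide.\<close>

lemma cat_functor_cong:
  assumes "cat_functor C D F"
    and "obj C' = obj C" "arr C' = arr C" "src C' = src C" "tgt C' = tgt C" "ide C' = ide C"
        "cmp C' = cmp C"
    and "obj D' = obj D" "arr D' = arr D" "src D' = src D" "tgt D' = tgt D" "ide D' = ide D"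
        "cmp D' = cmp D"
    and "fobj F' = fobj F" "farr F' = farr F"
  shows "cat_functor C' D' F'"
  using assms
  unfolding cat_functor_def cat_functor_axioms_def category_def composable_def homset_def by simp

lemma nat_trans_cong:
  assumes "nat_trans C D F G t"
    and "obj C' = obj C" "arr C' = arr C" "src C' = src C" "tgt C' = tgt C" "ide C' = ide C"
        "cmp C' = cmp C"
    and "obj D' = obj D" "arr D' = arr D" "src D' = src D" "tgt D' = tgt D" "ide D' = ide D"
        "cmp D' = cmp D"
    and "fobj F' = fobj F" "farr F' = farr F" "fobj G' = fobj G" "farr G' = farr G"
  shows "nat_trans C' D' F' G' t"
proof -
  have "cat_functor C D F" "cat_functor C D G" using assms(1) by (simp_all add: nat_trans_def)
  then have "cat_functor C' D' F'" "cat_functor C' D' G'"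
    using assms(2-) by (auto intro: cat_functor_cong)
  then show ?thesis
    using assms unfolding nat_trans_def nat_trans_axioms_def homset_def by simp
qed

lemma incl1_simps [simp]: "fobj (incl1 L X Y F) = fobj F" "farr (incl1 L X Y F) = farr F"
  "x \<in> obj X \<Longrightarrow> y \<in> obj X \<Longrightarrow> mf2 (incl1 L X Y F) (x, y) = ide Y (fobj F x \<odot>\<^bsub>incl0 L Y\<^esub> fobj F y)"
  "mf0 (incl1 L X Y F) = ide Y (munit (incl0 L Y))"
  by (simp_all add: incl1_def)

context action_operad
begin

text \<open>A strict morphism preserves tensor product and unit on the nose, so identity constraints
  satisfy the monoidal axioms. The canonical isomorphisms are then identities and the remaining
  condition says that \<open>F\<close> preserves [g] strictly.\<close>

lemma incl1_weak:
  assumes F: "el_strict_morphism L X Y F"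
  shows "weak_L_monoidal_functor L (incl0 L X) (incl0 L Y) (incl1 L X Y F)"
proof -
  interpret F: el_strict_morphism L X Y F by fact
  have X: "el_algebra L X" and Y: "el_algebra L Y" by unfold_locales
  let ?M = "incl0 L X" let ?N = "incl0 L Y" let ?F = "incl1 L X Y F"
  interpret nX: nf_algebra L X "\<lambda>xs. fobj (alg X) (OC (obj X) xs)"
      "\<lambda>g fs. farr (alg X) (AC (arr X) g fs)"
    by (rule el_algebra_nf) fact
  interpret nY: nf_algebra L Y "\<lambda>xs. fobj (alg Y) (OC (obj Y) xs)"
      "\<lambda>g fs. farr (alg Y) (AC (arr Y) g fs)"
    by (rule el_algebra_nf) fact
  interpret M: strict_weak_op L ?M by (rule incl0_strict_weak) fact
  interpret N: strict_weak_op L ?N by (rule incl0_strict_weak) fact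
  have FO: "xs \<in> lists (obj X) \<Longrightarrow> fobj F (fobj (alg X) (OC (obj X) xs)) =
      fobj (alg Y) (OC (obj Y) (map (fobj F) xs))"
    and FA: "fs \<in> lists (arr X) \<Longrightarrow> g \<in> el L (length fs) \<Longrightarrow>
       farr F (farr (alg X) (AC (arr X) g fs)) = farr (alg Y) (AC (arr Y) g (map (farr F) fs))"
           for xs fs g
    using el_strict_morphism_iff[OF X Y, of F] F by blast+
  note s = incl0_simps
  interpret FF: cat_functor ?M ?N ?F
    by (rule cat_functor_cong[of X Y F]) (simp_all add: s, unfold_locales)
  have t: "fobj F (x \<odot>\<^bsub>?M\<^esub> y) = fobj F x \<odot>\<^bsub>?N\<^esub> fobj F y" if "x \<in> obj X" "y \<in> obj X" for x y
    using that FO[of "[x, y]"] by (simp add: s)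
  have ta: "farr F (f \<star>\<^bsub>?M\<^esub> g) = farr F f \<star>\<^bsub>?N\<^esub> farr F g" if "f \<in> arr X" "g \<in> arr X" for f g
    using that FA[of "[f, g]"] by (simp add: s)
  have u: "fobj F (munit ?M) = munit ?N" using FO[of "[]"] by (simp add: s)
  have o: "x \<in> obj X \<Longrightarrow> fobj F x \<in> obj Y" "x \<in> obj X \<Longrightarrow> y \<in> obj X \<Longrightarrow> x \<odot>\<^bsub>?M\<^esub> y \<in> obj X"
    "p \<in> obj Y \<Longrightarrow> q \<in> obj Y \<Longrightarrow> p \<odot>\<^bsub>?N\<^esub> q \<in> obj Y" "munit ?N \<in> obj Y" "munit ?M \<in> obj X" for x y p q
    using M.tens_obj N.tens_obj N.munit_obj M.munit_obj by (simp_all add: s(1))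
  have SM: "strict_monoidal ?M" and SN: "strict_monoidal ?N" by (fact M.strict N.strict)+
  have mon: "monoidal_functor ?M ?N ?F"
  proof
    show "mf2 ?F \<in> obj ?M \<times> obj ?M \<rightarrow>\<^sub>E arr ?N"
    proof (rule PiE_I)
      fix p assume "p \<in> obj ?M \<times> obj ?M" then show "mf2 ?F p \<in> arr ?N"
        using o by (cases p) (simp add: s(1,2))
    qed (simp add: incl1_def s(1))
  next
    fix x y assume "x \<in> obj ?M" "y \<in> obj ?M"
    then show "mf2 ?F (x, y) \<in> homset ?N (fobj ?F x \<odot>\<^bsub>?N\<^esub> fobj ?F y) (fobj ?F (x \<odot>\<^bsub>?M\<^esub> y))"
      "iso_arr ?N (mf2 ?F (x, y))"
      using o t N.iso_ide[of "fobj F x \<odot>\<^bsub>?N\<^esub> fobj F y"] by (simp_all add: s(1-6) homset_def)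
  next
    show "mf0 ?F \<in> homset ?N (munit ?N) (fobj ?F (munit ?M))" "iso_arr ?N (mf0 ?F)"
      using o u N.iso_ide[of "munit ?N"] by (simp_all add: s(1-6) homset_def)
  next
    fix f g x x' y y' assume a: "f \<in> homset ?M x x'" "g \<in> homset ?M y y'"
    then have "f \<in> arr ?M" "g \<in> arr ?M" "src ?M f = x" "tgt ?M f = x'" "src ?M g = y" "tgt ?M g =
        y'"
      by (auto simp: homset_def)
    then show "mf2 ?F (x', y') \<cdot>\<^bsub>?N\<^esub> (farr ?F f \<star>\<^bsub>?N\<^esub> farr ?F g) = farr ?F (f \<star>\<^bsub>?M\<^esub> g) \<cdot>\<^bsub>?N\<^esub>
        mf2 ?F (x, y)"
      using N.tens_arr[of "farr F f" "farr F g"] N.src_tens[of "farr F f"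
          "farr F g"] N.tgt_tens[of "farr F f" "farr F g"] ta[of f g]
      by (auto simp: s(1-6))
  next
    fix x y z assume a: "x \<in> obj ?M" "y \<in> obj ?M" "z \<in> obj ?M"
    then show "farr ?F (massoc ?M (x, y, z)) \<cdot>\<^bsub>?N\<^esub> mf2 ?F (x \<odot>\<^bsub>?M\<^esub> y, z) \<cdot>\<^bsub>?N\<^esub>
        (mf2 ?F (x, y) \<star>\<^bsub>?N\<^esub> ide ?N (fobj ?F z)) =
           mf2 ?F (x, y \<odot>\<^bsub>?M\<^esub> z) \<cdot>\<^bsub>?N\<^esub> (ide ?N (fobj ?F x) \<star>\<^bsub>?N\<^esub> mf2 ?F (y, z)) \<cdot>\<^bsub>?N\<^esub>
             massoc ?N (fobj ?F x, fobj ?F y, fobj ?F z)"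
      using SM SN o t N.tens_ide[unfolded s(1,5)] F.farr_ide unfolding strict_monoidal_def
          by (simp add: s(1-6))
  next
    fix x assume a: "x \<in> obj ?M"
    then show "farr ?F (lunit ?M x) \<cdot>\<^bsub>?N\<^esub> mf2 ?F (munit ?M, x) \<cdot>\<^bsub>?N\<^esub> (mf0 ?F \<star>\<^bsub>?N\<^esub>
        ide ?N (fobj ?F x)) = lunit ?N (fobj ?F x)"
       "farr ?F (runit ?M x) \<cdot>\<^bsub>?N\<^esub> mf2 ?F (x, munit ?M) \<cdot>\<^bsub>?N\<^esub> (ide ?N (fobj ?F x) \<star>\<^bsub>?N\<^esub> mf0 ?F) =
           runit ?N (fobj ?F x)"
      using SM SN o t u N.tens_ide[unfolded s(1,5)] F.farr_ide unfolding strict_monoidal_def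
          by (simp_all add: s(1-6))
  qed
  have mfn: "mfn ?M ?N ?F xs = ide Y (std_obj ?N (map (fobj F) xs)) \<and> fobj F (std_obj ?M xs) =
      std_obj ?N (map (fobj F) xs)"
    if "xs \<in> lists (obj X)" for xs
    using that
  proof (induction xs)
    case Nil then show ?case by (simp add: u)
  next
    case (Cons x xs)
    show ?case
    proof (cases xs)
      case Nil then show ?thesis by (simp add: s(5))
    next
      case (Cons y ys)
      have "std_obj ?M xs \<in> obj X" "std_obj ?N (map (fobj F) xs) \<in> obj Y"
        using M.std_obj_in[of xs] N.std_obj_in[of "map (fobj F) xs"] Cons.hyps F.fobj_lists[of xs]
            by (simp_all add: s(1))
      then show ?thesis
        using Cons.IH Cons.hyps Cons o N.tens_ide[unfolded s(1,5)] t by (simp add: s(1-6))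
    qed
  qed
  show ?thesis
  proof (intro weak_L_monoidal_functor.intro weak_L_monoidal_functor_axioms.intro)
    show "weak_L_monoidal_category L ?M" "weak_L_monoidal_category L ?N"
        "monoidal_functor ?M ?N ?F"
      by (rule incl0_weak[OF X] incl0_weak[OF Y] mon)+
  next
    fix xs g assume "xs \<in> lists (obj ?M)" and g: "g \<in> el L (length xs)"
    then have xs: "xs \<in> lists (obj X)" by (simp add: s(1))
    have l: "lact L g xs \<in> lists (obj X)" "map (fobj F) xs \<in> lists (obj Y)"
        using xs g F.fobj_lists[of xs] by simp_all
    have i: "map (farr F) (map (ide X) xs) = map (ide Y) (map (fobj F) xs)"
      using xs by (auto simp: in_lists_conv_set F.farr_ide)
    \<comment> \<open>[g] is the structure map at identity arrows, which \<open>F\<close>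
      preserves.\<close>
    have w: "wact ?N (g, map (fobj F) xs) = farr F (wact ?M (g, xs))"
      using xs l g FA[OF category.ide_lists[of X xs], of g] incl0_wact[of X xs g] incl0_wact[of Y
          "map (fobj F) xs" g] i
        X Y by (simp add: el_algebra_def del: map_map)
    have c: "wact ?N (g, map (fobj F) xs) \<in> arr Y" "src Y (wact ?N (g, map (fobj F) xs)) =
        std_obj ?N (map (fobj F) xs)"
      "tgt Y (wact ?N (g, map (fobj F) xs)) = std_obj ?N (lact L g (map (fobj F) xs))"
      using N.wact_simps[of "map (fobj F) xs" g] l g by (simp_all add: s(1-6))
    show "mfn ?M ?N ?F (lact L g xs) \<cdot>\<^bsub>?N\<^esub> wact ?N (g, map (fobj ?F) xs) =
        farr ?F (wact ?M (g, xs)) \<cdot>\<^bsub>?N\<^esub> mfn ?M ?N ?F xs"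
      using mfn[OF xs] mfn[OF l(1)] c w g by (simp add: s(1-6))
  qed
qed

text \<open>The algebra condition on a 2-cell, read at lists of length two and zero, gives
  compatibility with tensor product and unit.\<close>

lemma incl2_monoidal:
  assumes t: "el_two_cell L X Y F G t"
  shows "monoidal_transformation (incl0 L X) (incl0 L Y) (incl1 L X Y F) (incl1 L X Y G) t"
proof -
  interpret t: el_two_cell L X Y F G t by fact
  have F: "el_strict_morphism L X Y F" and G: "el_strict_morphism L X Y G" by unfold_locales
  have X: "el_algebra L X" and Y: "el_algebra L Y" by unfold_locales
  let ?M = "incl0 L X" let ?N = "incl0 L Y"
  interpret WF: weak_L_monoidal_functor L ?M ?N "incl1 L X Y F" by (rule incl1_weak) fact
  interpret WG: weak_L_monoidal_functor L ?M ?N "incl1 L X Y G" by (rule incl1_weak) fact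
  interpret nX: nf_algebra L X "\<lambda>xs. fobj (alg X) (OC (obj X) xs)"
      "\<lambda>g fs. farr (alg X) (AC (arr X) g fs)"
    by (rule el_algebra_nf) fact
  interpret nY: nf_algebra L Y "\<lambda>xs. fobj (alg Y) (OC (obj Y) xs)"
      "\<lambda>g fs. farr (alg Y) (AC (arr Y) g fs)"
    by (rule el_algebra_nf) fact
  interpret nt: nat_trans ?M ?N "incl1 L X Y F" "incl1 L X Y G" t
    by (rule nat_trans_cong[of X Y F G t]) (simp_all add: incl0_simps, unfold_locales)
  have T: "xs \<in> lists (obj X) \<Longrightarrow> t (fobj (alg X) (OC (obj X) xs)) =
      farr (alg Y) (AC (arr Y) (eL L (length xs)) (map t xs))" for xs
    using el_two_cell_iff[OF F G, of t] t by blast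
  have ta: "t x \<in> arr Y" "src Y (t x) = fobj F x" "tgt Y (t x) = fobj G x" if "x \<in> obj X" for x
    using t.component_homset[OF that] by (simp_all add: homset_def)
  show ?thesis
  proof
    fix x y assume "x \<in> obj ?M" "y \<in> obj ?M"
    then have xy: "x \<in> obj X" "y \<in> obj X" by (simp_all add: incl0_simps)
    have "t (x \<odot>\<^bsub>?M\<^esub> y) = t x \<star>\<^bsub>?N\<^esub> t y" using T[of "[x, y]"] xy ta by (simp add: incl0_simps)
    then show "t (x \<odot>\<^bsub>?M\<^esub> y) \<cdot>\<^bsub>?N\<^esub> mf2 (incl1 L X Y F) (x, y) = mf2 (incl1 L X Y G) (x, y) \<cdot>\<^bsub>?N\<^esub>
        (t x \<star>\<^bsub>?N\<^esub> t y)"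
      using xy ta WF.cod_wk.tens_arr[of "t x" "t y"] WF.cod_wk.src_tens[of "t x"
          "t y"] WF.cod_wk.tgt_tens[of "t x" "t y"]
      by (simp add: incl0_simps(1-6))
  next
    have "t (munit ?M) = ide Y (munit ?N)" using T[of "[]"] nY.B_ide[of "[]"]
        by (simp add: incl0_simps)
    then show "t (munit ?M) \<cdot>\<^bsub>?N\<^esub> mf0 (incl1 L X Y F) = mf0 (incl1 L X Y G)"
      using WF.cod_wk.munit_obj by (simp add: incl0_simps(1-6))
  qed
qed

end

section \<open>Composites of functors and transformations\<close>

lemma fid_simps [simp]: "x \<in> obj C \<Longrightarrow> fobj (fid C) x = x" "f \<in> arr C \<Longrightarrow> farr (fid C) f = f"
  by (simp_all add: fid_def)

lemma fcomp_simps [simp]: "x \<in> obj C \<Longrightarrow> fobj (fcomp C G F) x = fobj G (fobj F x)"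
  "f \<in> arr C \<Longrightarrow> farr (fcomp C G F) f = farr G (farr F f)"
  by (simp_all add: fcomp_def compose_def)

lemma cat_functor_fid:
  assumes "category C" shows "cat_functor C C (fid C)"
proof -
  interpret category C by fact
  show ?thesis by (rule cat_functorI) (use assms in \<open>auto simp: fid_def\<close>)
qed

lemma cat_functor_fcomp:
  assumes "cat_functor C D F" "cat_functor D E G" shows "cat_functor C E (fcomp C G F)"
proof -
  interpret F: cat_functor C D F by fact
  interpret G: cat_functor D E G by fact
  show ?thesis
    by (rule cat_functorI, unfold_locales)
      (auto simp: fcomp_def compose_def F.farr_ide G.farr_ide F.farr_comp G.farr_comp)
qed

lemma fcomp_fid_right:
  fixes F :: "('o, 'a, 'p, 'b) fctr"
  assumes "cat_functor C D F" shows "fcomp C F (fid C) = F"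
proof -
  interpret cat_functor C D F by fact
  show ?thesis
    by (rule fctr_eqI[of _ "obj C" _ "arr C"])
      (use fobj_type farr_type in \<open>simp_all add: fcomp_def fid_def PiE_def compose_def\<close>)
qed

lemma fcomp_fid_left:
  fixes F :: "('o, 'a, 'p, 'b) fctr"
  assumes "cat_functor C D F" shows "fcomp C (fid D) F = F"
proof -
  interpret cat_functor C D F by fact
  show ?thesis
    by (rule fctr_eqI[of _ "obj C" _ "arr C"])
      (use fobj_type farr_type in \<open>simp_all add: fcomp_def fid_def PiE_def compose_def\<close>)
qed

lemma fcomp_assoc:
  assumes "cat_functor C D F"
  shows "fcomp C (fcomp D H G) F = fcomp C H (fcomp C G F)"
proof -
  interpret cat_functor C D F by fact
  show ?thesis
    by (rule fctr_eqI[of _ "obj C" _ "arr C"]) (simp_all add: fcomp_def compose_def)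
qed

context nat_trans
begin

lemma comp_simps [simp]: "x \<in> obj C \<Longrightarrow> t x \<in> arr D" "x \<in> obj C \<Longrightarrow> src D (t x) = fobj F x"
  "x \<in> obj C \<Longrightarrow> tgt D (t x) = fobj G x"
  using component_homset by (simp_all add: homset_def)

lemma nat: "f \<in> arr C \<Longrightarrow> t (tgt C f) \<cdot>\<^bsub>D\<^esub> farr F f = farr G f \<cdot>\<^bsub>D\<^esub> t (src C f)"
  by (rule naturality) (simp add: homset_def)

end

lemma nat_transI:
  assumes "cat_functor C D F" "cat_functor C D G" "t \<in> extensional (obj C)"
    and "\<And>x. x \<in> obj C \<Longrightarrow> t x \<in> arr D \<and> src D (t x) = fobj F x \<and> tgt D (t x) = fobj G x"
    and "\<And>f. f \<in> arr C \<Longrightarrow> t (tgt C f) \<cdot>\<^bsub>D\<^esub> farr F f = farr G f \<cdot>\<^bsub>D\<^esub> t (src C f)"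
  shows "nat_trans C D F G t"
proof -
  interpret F: cat_functor C D F by fact
  interpret G: cat_functor C D G by fact
  show ?thesis
    by unfold_locales (use assms(3-) in \<open>auto simp: homset_def PiE_def\<close>)
qed

lemma nat_trans_id:
  assumes "cat_functor C D F" shows "nat_trans C D F F (nt_id C D F)"
proof -
  interpret cat_functor C D F by fact
  show ?thesis by (rule nat_transI) (use assms in \<open>simp_all add: nt_id_def\<close>)
qed

lemma nat_trans_vcomp:
  assumes "nat_trans C D F G t" "nat_trans C D G H s" shows "nat_trans C D F H (nt_vcomp C D s t)"
proof -
  interpret t: nat_trans C D F G t by fact
  interpret s: nat_trans C D G H s by fact
  show ?thesis
  proof (rule nat_transI)
    fix f assume f: "f \<in> arr C"
    have "(s (tgt C f) \<cdot>\<^bsub>D\<^esub> t (tgt C f)) \<cdot>\<^bsub>D\<^esub> farr F f = s (tgt C f) \<cdot>\<^bsub>D\<^esub> (farr G f \<cdot>\<^bsub>D\<^esub>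
        t (src C f))"
      using f by (simp add: t.dom_functor.cod.assoc t.nat)
    also have "\<dots> = (farr H f \<cdot>\<^bsub>D\<^esub> s (src C f)) \<cdot>\<^bsub>D\<^esub> t (src C f)"
      using f by (simp add: s.nat flip: t.dom_functor.cod.assoc)
    finally show "nt_vcomp C D s t (tgt C f) \<cdot>\<^bsub>D\<^esub> farr F f = farr H f \<cdot>\<^bsub>D\<^esub>
        nt_vcomp C D s t (src C f)"
      using f by (simp add: nt_vcomp_def t.dom_functor.cod.assoc)
  qed (unfold_locales, simp_all add: nt_vcomp_def)
qed

lemma nat_trans_hcomp:
  assumes "nat_trans C D F F' t" "nat_trans D E G G' s"
  shows "nat_trans C E (fcomp C G F) (fcomp C G' F') (nt_hcomp C E F' G s t)"
proof -
  interpret t: nat_trans C D F F' t by fact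
  interpret s: nat_trans D E G G' s by fact
  show ?thesis
  proof (rule nat_transI)
    show "cat_functor C E (fcomp C G F)" "cat_functor C E (fcomp C G' F')"
      by (rule cat_functor_fcomp; unfold_locales)+
    fix f assume f: "f \<in> arr C"
    have "(s (fobj F' (tgt C f)) \<cdot>\<^bsub>E\<^esub> farr G (t (tgt C f))) \<cdot>\<^bsub>E\<^esub> farr G (farr F f) =
      s (fobj F' (tgt C f)) \<cdot>\<^bsub>E\<^esub> farr G (t (tgt C f) \<cdot>\<^bsub>D\<^esub> farr F f)"
      using f by (simp add: s.dom_functor.cod.assoc s.dom_functor.farr_comp)
    also have "\<dots> = (s (tgt D (farr F' f)) \<cdot>\<^bsub>E\<^esub> farr G (farr F' f)) \<cdot>\<^bsub>E\<^esub> farr G (t (src C f))"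
      using f by (simp add: t.nat s.dom_functor.cod.assoc s.dom_functor.farr_comp)
    also have "\<dots> = farr G' (farr F' f) \<cdot>\<^bsub>E\<^esub> (s (fobj F' (src C f)) \<cdot>\<^bsub>E\<^esub> farr G (t (src C f)))"
      using f by (subst s.nat) (simp_all add: s.dom_functor.cod.assoc)
    finally show "nt_hcomp C E F' G s t (tgt C f) \<cdot>\<^bsub>E\<^esub> farr (fcomp C G F) f =
      farr (fcomp C G' F') f \<cdot>\<^bsub>E\<^esub> nt_hcomp C E F' G s t (src C f)"
      using f by (simp add: nt_hcomp_def)
  qed (simp_all add: nt_hcomp_def)
qed

lemma nt_vcomp_assoc:
  assumes "nat_trans C D F G t" "nat_trans C D G H s" "nat_trans C D H K r"
  shows "nt_vcomp C D (nt_vcomp C D r s) t = nt_vcomp C D r (nt_vcomp C D s t)"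
proof -
  interpret t: nat_trans C D F G t by fact
  interpret s: nat_trans C D G H s by fact
  interpret r: nat_trans C D H K r by fact
  show ?thesis unfolding nt_vcomp_def by (rule restrict_ext) (simp add: t.dom_functor.cod.assoc)
qed

lemma nt_vcomp_id:
  assumes "nat_trans C D F G t"
  shows "nt_vcomp C D t (nt_id C D F) = t" "nt_vcomp C D (nt_id C D G) t = t"
proof -
  interpret t: nat_trans C D F G t by fact
  show "nt_vcomp C D t (nt_id C D F) = t" "nt_vcomp C D (nt_id C D G) t = t"
    by (rule extensionalityI[of _ "obj C"]; use t.component_type in \<open>simp add: nt_vcomp_def
        nt_id_def PiE_def\<close>)+
qed

text \<open>\<open>H\<close> is any functor with the object map of the composite, so the statement
  serves both \<open>fcomp\<close> and \<open>mf_comp\<close>; \<open>nt_hcomp_assoc\<close> is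
  phrased in the same way.\<close>

lemma nt_hcomp_id2:
  assumes "cat_functor C D F" "cat_functor D E G"
    and "\<And>x. x \<in> obj C \<Longrightarrow> fobj H x = fobj G (fobj F x)"
  shows "nt_hcomp C E F G (nt_id D E G) (nt_id C D F) = nt_id C E H"
proof -
  interpret F: cat_functor C D F by fact
  interpret G: cat_functor D E G by fact
  show ?thesis unfolding nt_hcomp_def nt_id_def
    by (rule restrict_ext) (simp add: assms(3) G.farr_ide)
qed

text \<open>Naturality of \<open>s\<close> at the component \<open>t' x\<close> exchanges the two
  middle factors.\<close>

lemma nt_interchange:
  assumes "nat_trans C D F F' t" "nat_trans C D F' F'' t'" "nat_trans D E G G' s"
      "nat_trans D E G' G'' s'"
  shows "nt_hcomp C E F'' G (nt_vcomp D E s' s) (nt_vcomp C D t' t) =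
    nt_vcomp C E (nt_hcomp C E F'' G' s' t') (nt_hcomp C E F' G s t)"
proof -
  interpret t: nat_trans C D F F' t by fact
  interpret t': nat_trans C D F' F'' t' by fact
  interpret s: nat_trans D E G G' s by fact
  interpret s': nat_trans D E G' G'' s' by fact
  note as = s.dom_functor.cod.assoc
  have "(s' (fobj F'' x) \<cdot>\<^bsub>E\<^esub> s (fobj F'' x)) \<cdot>\<^bsub>E\<^esub> farr G (t' x \<cdot>\<^bsub>D\<^esub> t x) =
    (s' (fobj F'' x) \<cdot>\<^bsub>E\<^esub> farr G' (t' x)) \<cdot>\<^bsub>E\<^esub> (s (fobj F' x) \<cdot>\<^bsub>E\<^esub> farr G (t x))"
        if x: "x \<in> obj C" for x
  proof -
    have "(s' (fobj F'' x) \<cdot>\<^bsub>E\<^esub> s (fobj F'' x)) \<cdot>\<^bsub>E\<^esub> farr G (t' x \<cdot>\<^bsub>D\<^esub> t x) =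
       s' (fobj F'' x) \<cdot>\<^bsub>E\<^esub> (s (tgt D (t' x)) \<cdot>\<^bsub>E\<^esub> farr G (t' x)) \<cdot>\<^bsub>E\<^esub> farr G (t x)"
      using x by (simp add: as s.dom_functor.farr_comp)
    also have "\<dots> = s' (fobj F'' x) \<cdot>\<^bsub>E\<^esub> (farr G' (t' x) \<cdot>\<^bsub>E\<^esub> s (fobj F' x)) \<cdot>\<^bsub>E\<^esub> farr G (t x)"
      using x by (subst s.nat) simp_all
    finally show ?thesis using x by (simp add: as)
  qed
  then show ?thesis unfolding nt_hcomp_def nt_vcomp_def by (intro restrict_ext) simp
qed

lemma nt_hcomp_assoc:
  assumes "nat_trans A B f f' t" "nat_trans B C g g' s" "nat_trans C D h h' r"
    and "\<And>a. a \<in> arr B \<Longrightarrow> farr hg a = farr h (farr g a)"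
    and "\<And>x. x \<in> obj A \<Longrightarrow> fobj gf' x = fobj g' (fobj f' x)"
  shows "nt_hcomp A D f' hg (nt_hcomp B D g' h r s) t =
      nt_hcomp A D gf' h r (nt_hcomp A C f' g s t)"
proof -
  interpret t: nat_trans A B f f' t by fact
  interpret s: nat_trans B C g g' s by fact
  interpret r: nat_trans C D h h' r by fact
  show ?thesis unfolding nt_hcomp_def
    by (rule restrict_ext) (simp add: assms(4,5) r.dom_functor.cod.assoc r.dom_functor.farr_comp)
qed

lemma nt_hcomp_id_right:
  assumes "nat_trans A B f f' t" and "\<And>x. x \<in> obj A \<Longrightarrow> fobj I x = x"
  shows "nt_hcomp A B I f t (nt_id A A I) = t"
proof -
  interpret t: nat_trans A B f f' t by fact
  show ?thesis
    by (rule extensionalityI[of _ "obj A"])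
      (use t.component_type in \<open>simp_all add: nt_hcomp_def nt_id_def PiE_def assms(2)
          t.dom_functor.farr_ide\<close>)
qed

lemma nt_hcomp_id_left:
  assumes "nat_trans A B f f' t" and "\<And>x. x \<in> obj B \<Longrightarrow> fobj I x = x" "\<And>a. a \<in> arr B \<Longrightarrow> farr I a = a"
  shows "nt_hcomp A B f' I (nt_id B B I) t = t"
proof -
  interpret t: nat_trans A B f f' t by fact
  show ?thesis
    by (rule extensionalityI[of _ "obj A"])
      (use t.component_type in \<open>simp_all add: nt_hcomp_def nt_id_def PiE_def assms(2,3)\<close>)
qed

section \<open>The 2-category of algebras\<close>

context action_operad
begin

lemma el_algebra_category: "el_algebra L X \<Longrightarrow> category X" by (simp add: el_algebra_def)

lemma el_strict_morphismD:
  assumes "el_strict_morphism L X Y F"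
  shows "cat_functor X Y F" "el_algebra L X" "el_algebra L Y"
    and "xs \<in> lists (obj X) \<Longrightarrow> fobj F (fobj (alg X) (OC (obj X) xs)) =
        fobj (alg Y) (OC (obj Y) (map (fobj F) xs))"
    and "fs \<in> lists (arr X) \<Longrightarrow> g \<in> el L (length fs) \<Longrightarrow>
       farr F (farr (alg X) (AC (arr X) g fs)) = farr (alg Y) (AC (arr Y) g (map (farr F) fs))"
proof -
  show *: "cat_functor X Y F" "el_algebra L X" "el_algebra L Y"
    using assms by (simp_all add: el_strict_morphism_def)
  from el_strict_morphism_iff[OF *(2,3), of F] assms
  show "xs \<in> lists (obj X) \<Longrightarrow> fobj F (fobj (alg X) (OC (obj X) xs)) =
      fobj (alg Y) (OC (obj Y) (map (fobj F) xs))"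
    "fs \<in> lists (arr X) \<Longrightarrow> g \<in> el L (length fs) \<Longrightarrow>
       farr F (farr (alg X) (AC (arr X) g fs)) = farr (alg Y) (AC (arr Y) g (map (farr F) fs))"
    by blast+
qed

lemma el_two_cellD:
  assumes "el_two_cell L X Y F G t"
  shows "nat_trans X Y F G t" "el_strict_morphism L X Y F" "el_strict_morphism L X Y G"
    and "xs \<in> lists (obj X) \<Longrightarrow> t (fobj (alg X) (OC (obj X) xs)) =
        farr (alg Y) (AC (arr Y) (eL L (length xs)) (map t xs))"
proof -
  show *: "nat_trans X Y F G t" "el_strict_morphism L X Y F" "el_strict_morphism L X Y G"
    using assms by (simp_all add: el_two_cell_def)
  from el_two_cell_iff[OF *(2,3), of t] assms
  show "xs \<in> lists (obj X) \<Longrightarrow> t (fobj (alg X) (OC (obj X) xs)) =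
      farr (alg Y) (AC (arr Y) (eL L (length xs)) (map t xs))"
    by blast
qed

lemma el_strict_morphism_fid:
  assumes X: "el_algebra L X" shows "el_strict_morphism L X X (fid X)"
proof -
  interpret nf_algebra L X "\<lambda>xs. fobj (alg X) (OC (obj X) xs)"
      "\<lambda>g fs. farr (alg X) (AC (arr X) g fs)"
    by (rule el_algebra_nf) fact
  have "map (fobj (fid X)) xs = xs" if "xs \<in> lists (obj X)" for xs
    using that by (auto simp: in_lists_conv_set intro!: map_idI)
  moreover have "map (farr (fid X)) fs = fs" if "fs \<in> lists (arr X)" for fs
    using that by (auto simp: in_lists_conv_set intro!: map_idI)
  ultimately show ?thesis
    by (subst el_strict_morphism_iff[OF X X])
      (simp add: cat_functor_fid[OF el_algebra_category[OF X]] A_obj B_arr)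
qed

lemma el_strict_morphism_fcomp:
  assumes F: "el_strict_morphism L X Y F" and G: "el_strict_morphism L Y Z G"
  shows "el_strict_morphism L X Z (fcomp X G F)"
proof -
  note F = el_strict_morphismD[OF F] and G = el_strict_morphismD[OF G]
  interpret F: cat_functor X Y F by (rule F)
  interpret nf_algebra L X "\<lambda>xs. fobj (alg X) (OC (obj X) xs)"
      "\<lambda>g fs. farr (alg X) (AC (arr X) g fs)"
    by (rule el_algebra_nf) (rule F)
  have 1: "map (fobj (fcomp X G F)) xs = map (fobj G) (map (fobj F) xs)" if "xs \<in> lists (obj X)"
      for xs
    using that by (auto simp: in_lists_conv_set)
  have 2: "map (farr (fcomp X G F)) fs = map (farr G) (map (farr F) fs)" if "fs \<in> lists (arr X)"
      for fs
    using that by (auto simp: in_lists_conv_set)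
  show ?thesis
    by (subst el_strict_morphism_iff[OF F(2) G(3)])
      (simp add: cat_functor_fcomp[OF F(1) G(1)] A_obj B_arr 1 2 F(4,5) G(4,5) F.fobj_lists
          F.farr_lists del: map_map)
qed

text \<open>The algebra condition for identities is preservation of identities by the structure map,
  \<open>B_ide\<close>.\<close>

lemma el_two_cell_id:
  assumes F: "el_strict_morphism L X Y F" shows "el_two_cell L X Y F F (nt_id X Y F)"
proof -
  note F' = el_strict_morphismD[OF F]
  interpret F: cat_functor X Y F by (rule F')
  interpret X: nf_algebra L X "\<lambda>xs. fobj (alg X) (OC (obj X) xs)"
      "\<lambda>g fs. farr (alg X) (AC (arr X) g fs)"
    by (rule el_algebra_nf) (rule F')
  interpret Y: nf_algebra L Y "\<lambda>xs. fobj (alg Y) (OC (obj Y) xs)"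
      "\<lambda>g fs. farr (alg Y) (AC (arr Y) g fs)"
    by (rule el_algebra_nf) (rule F')
  have 1: "map (nt_id X Y F) xs = map (ide Y) (map (fobj F) xs)" if "xs \<in> lists (obj X)" for xs
    using that by (auto simp: in_lists_conv_set nt_id_def)
  have 2: "nt_id X Y F x = ide Y (fobj F x)" if "x \<in> obj X" for x using that
      by (simp add: nt_id_def)
  show ?thesis
  proof (subst el_two_cell_iff[OF F F], intro conjI ballI)
    show "nat_trans X Y F F (nt_id X Y F)" by (rule nat_trans_id) (rule F')
    fix xs assume xs: "xs \<in> lists (obj X)"
    show "nt_id X Y F (fobj (alg X) (OC (obj X) xs)) =
        farr (alg Y) (AC (arr Y) (eL L (length xs)) (map (nt_id X Y F) xs))"
      using Y.B_ide[OF F.fobj_lists[OF xs]] xs by (simp add: 1 2 X.A_obj F'(4) del: map_map)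
  qed
qed

lemma map2_map_same: "map2 f (map g xs) (map h xs) = map (\<lambda>x. f (g x) (h x)) xs"
  by (rule nth_equalityI) simp_all

text \<open>The algebra condition for a composite is \<open>B_cmp\<close> with both group elements
  equal to e.\<close>

lemma el_two_cell_vcomp:
  assumes t: "el_two_cell L X Y F G t" and s: "el_two_cell L X Y G H s"
  shows "el_two_cell L X Y F H (nt_vcomp X Y s t)"
proof -
  note t = el_two_cellD[OF t] and s = el_two_cellD[OF s]
  interpret t: nat_trans X Y F G t by (rule t)
  interpret s: nat_trans X Y G H s by (rule s)
  note X = el_strict_morphismD(2)[OF t(2)] and Y = el_strict_morphismD(3)[OF t(2)]
  interpret X: nf_algebra L X "\<lambda>xs. fobj (alg X) (OC (obj X) xs)"
      "\<lambda>g fs. farr (alg X) (AC (arr X) g fs)"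
    by (rule el_algebra_nf) (rule X)
  interpret Y: nf_algebra L Y "\<lambda>xs. fobj (alg Y) (OC (obj Y) xs)"
      "\<lambda>g fs. farr (alg Y) (AC (arr Y) g fs)"
    by (rule el_algebra_nf) (rule Y)
  show ?thesis
  proof (subst el_two_cell_iff[OF t(2) s(3)], intro conjI ballI)
    show "nat_trans X Y F H (nt_vcomp X Y s t)" by (rule nat_trans_vcomp[OF t(1) s(1)])
    fix xs assume xs: "xs \<in> lists (obj X)"
    have l: "map t xs \<in> lists (arr Y)" "map s xs \<in> lists (arr Y)" and m: "map (src Y) (map s xs) =
        map (tgt Y) (map t xs)"
      using xs by (auto simp: in_lists_conv_set)
    have "map (nt_vcomp X Y s t) xs = map2 (\<lambda>g f. g \<cdot>\<^bsub>Y\<^esub> f) (map s xs) (map t xs)"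
      using xs unfolding map2_map_same by (auto simp: in_lists_conv_set nt_vcomp_def)
    then show "nt_vcomp X Y s t (fobj (alg X) (OC (obj X) xs)) =
       farr (alg Y) (AC (arr Y) (eL L (length xs)) (map (nt_vcomp X Y s t) xs))"
      using Y.B_cmp[OF l m, of "eL L (length xs)" "eL L (length xs)"] xs
      by (simp add: nt_vcomp_def X.A_obj t(4) s(4) del: map_map)
  qed
qed

lemma el_two_cell_hcomp:
  assumes t: "el_two_cell L X Y F F' t" and s: "el_two_cell L Y Z G G' s"
  shows "el_two_cell L X Z (fcomp X G F) (fcomp X G' F') (nt_hcomp X Z F' G s t)"
proof -
  note t = el_two_cellD[OF t] and s = el_two_cellD[OF s]
  interpret t: nat_trans X Y F F' t by (rule t)
  interpret s: nat_trans Y Z G G' s by (rule s)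
  note X = el_strict_morphismD(2)[OF t(2)] and Z = el_strict_morphismD(3)[OF s(2)]
  note F' = el_strict_morphismD[OF t(3)] and G = el_strict_morphismD[OF s(2)]
  interpret X: nf_algebra L X "\<lambda>xs. fobj (alg X) (OC (obj X) xs)"
      "\<lambda>g fs. farr (alg X) (AC (arr X) g fs)"
    by (rule el_algebra_nf) (rule X)
  interpret Z: nf_algebra L Z "\<lambda>xs. fobj (alg Z) (OC (obj Z) xs)"
      "\<lambda>g fs. farr (alg Z) (AC (arr Z) g fs)"
    by (rule el_algebra_nf) (rule Z)
  show ?thesis
  proof (subst el_two_cell_iff[OF el_strict_morphism_fcomp[OF t(2) s(2)]
      el_strict_morphism_fcomp[OF t(3) s(3)]], intro conjI ballI)
    show "nat_trans X Z (fcomp X G F) (fcomp X G' F') (nt_hcomp X Z F' G s t)"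
        by (rule nat_trans_hcomp[OF t(1) s(1)])
    fix xs assume xs: "xs \<in> lists (obj X)"
    have l: "map (farr G) (map t xs) \<in> lists (arr Z)" "map s (map (fobj F') xs) \<in> lists (arr Z)"
      and m: "map (src Z) (map s (map (fobj F') xs)) = map (tgt Z) (map (farr G) (map t xs))"
      and lt: "map t xs \<in> lists (arr Y)" and lo: "map (fobj F') xs \<in> lists (obj Y)"
      using xs by (auto simp: in_lists_conv_set)
    have "map (nt_hcomp X Z F' G s t) xs = map2 (\<lambda>g f. g \<cdot>\<^bsub>Z\<^esub>
        f) (map s (map (fobj F') xs)) (map (farr G) (map t xs))"
      using xs unfolding map_map map2_map_same by (auto simp: in_lists_conv_set nt_hcomp_def)
    then show "nt_hcomp X Z F' G s t (fobj (alg X) (OC (obj X) xs)) =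
       farr (alg Z) (AC (arr Z) (eL L (length xs)) (map (nt_hcomp X Z F' G s t) xs))"
      using Z.B_cmp[OF l m, of "eL L (length xs)" "eL L (length xs)"] xs lt lo
      by (simp add: nt_hcomp_def X.A_obj t(4) s(4)[OF lo] F'(4) G(5)[OF lt] del: map_map)
  qed
qed

lemma LMonCat_simps:
  "A \<in> cell0 (LMonCat L) \<longleftrightarrow> el_algebra L A"
  "F \<in> cell1 (LMonCat L) A B \<longleftrightarrow> el_strict_morphism L A B F"
  "t \<in> cell2 (LMonCat L) A B F G \<longleftrightarrow> el_two_cell L A B F G t"
  "id1 (LMonCat L) = fid" "comp1 (LMonCat L) A B C G F = fcomp A G F" "id2 (LMonCat L) = nt_id"
  "vcomp (LMonCat L) = nt_vcomp" "hcomp (LMonCat L) A B C F F' G G' s t = nt_hcomp A C F' G s t"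
  by (simp_all add: LMonCat_def)

lemma two_category_LMonCat: "two_category (LMonCat L)"
proof (unfold_locales, unfold LMonCat_simps)
  fix A B C D f g h
  assume "el_algebra L A" "el_algebra L B" "el_algebra L C" "el_algebra L D"
    "el_strict_morphism L A B f" "el_strict_morphism L B C g" "el_strict_morphism L C D h"
  then show "fcomp A (fcomp B h g) f = fcomp A h (fcomp A g f)"
    using fcomp_assoc el_strict_morphismD(1) by blast
next
  fix A B C f g
  assume "el_strict_morphism L A B f" "el_strict_morphism L B C g"
  then show "nt_hcomp A C f g (nt_id B C g) (nt_id A B f) = nt_id A C (fcomp A g f)"
    by (intro nt_hcomp_id2 el_strict_morphismD(1)) simp_all
next
  fix A B C f f' f'' g g' g'' t t' s s'
  assume "el_two_cell L A B f f' t" "el_two_cell L A B f' f'' t'" "el_two_cell L B C g g' s"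
      "el_two_cell L B C g' g'' s'"
  then show "nt_hcomp A C f'' g (nt_vcomp B C s' s) (nt_vcomp A B t' t) =
    nt_vcomp A C (nt_hcomp A C f'' g' s' t') (nt_hcomp A C f' g s t)"
    by (intro nt_interchange) (rule el_two_cellD, assumption)+
next
  fix A B C D f f' g g' h h' t s r
  assume a: "el_two_cell L A B f f' t" "el_two_cell L B C g g' s" "el_two_cell L C D h h' r"
  show "nt_hcomp A D f' (fcomp B h g) (nt_hcomp B D g' h r s) t =
    nt_hcomp A D (fcomp A g' f') h r (nt_hcomp A C f' g s t)"
    using a[THEN el_two_cellD(1)] by (rule nt_hcomp_assoc) simp_all
next
  fix A B f f' t assume a: "el_two_cell L A B f f' t"
  show "nt_hcomp A B (fid A) f t (nt_id A A (fid A)) = t"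
    using el_two_cellD(1)[OF a] by (rule nt_hcomp_id_right) simp
  show "nt_hcomp A B f' (fid B) (nt_id B B (fid B)) t = t"
    using el_two_cellD(1)[OF a] by (rule nt_hcomp_id_left) simp_all
qed (rule el_strict_morphism_fid el_strict_morphism_fcomp fcomp_fid_right fcomp_fid_left
    el_two_cell_id
    el_two_cell_vcomp el_two_cell_hcomp nt_vcomp_assoc nt_vcomp_id el_strict_morphismD(1)
        el_two_cellD(1) | assumption)+

end

section \<open>The 2-category of weak monoidal categories\<close>

context cat_functor
begin

lemma inverse_farr: "inverse_arrows C f g \<Longrightarrow> inverse_arrows D (farr F f) (farr F g)"
  unfolding inverse_arrows_def by (simp add: farr_ide flip: farr_comp)

lemma iso_farr: "iso_arr C f \<Longrightarrow> iso_arr D (farr F f)"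
  unfolding iso_arr_def using inverse_farr by blast

end

context monoidal_functor
begin

lemma mf2_simps [simp]:
  assumes "x \<in> obj M" "y \<in> obj M"
  shows "mf2 F (x, y) \<in> arr N" "src N (mf2 F (x, y)) = fobj F x \<odot>\<^bsub>N\<^esub> fobj F y"
    "tgt N (mf2 F (x, y)) = fobj F (x \<odot>\<^bsub>M\<^esub> y)"
  using mf2_homset[OF assms] by (simp_all add: homset_def)

lemma mf0_simps [simp]: "mf0 F \<in> arr N" "src N (mf0 F) = munit N" "tgt N (mf0 F) =
    fobj F (munit M)"
  using mf0_homset by (simp_all add: homset_def)

lemma mf2_nat: "f \<in> arr M \<Longrightarrow> g \<in> arr M \<Longrightarrow>
   mf2 F (tgt M f, tgt M g) \<cdot>\<^bsub>N\<^esub> (farr F f \<star>\<^bsub>N\<^esub> farr F g) = farr F (f \<star>\<^bsub>M\<^esub> g) \<cdot>\<^bsub>N\<^esub>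
       mf2 F (src M f, src M g)"
  by (rule mf2_natural) (simp_all add: homset_def)

lemma mfn_Cons: "xs \<noteq> [] \<Longrightarrow> mfn M N F (x # xs) =
     mf2 F (x, std_obj M xs) \<cdot>\<^bsub>N\<^esub> (ide N (fobj F x) \<star>\<^bsub>N\<^esub> mfn M N F xs)"
  by (cases xs) simp_all

lemma mfn_simps:
  assumes "xs \<in> lists (obj M)"
  shows "mfn M N F xs \<in> arr N" "src N (mfn M N F xs) = std_obj N (map (fobj F) xs)"
    "tgt N (mfn M N F xs) = fobj F (std_obj M xs)"
proof -
  have "mfn M N F xs \<in> arr N \<and> src N (mfn M N F xs) = std_obj N (map (fobj F) xs) \<and>
    tgt N (mfn M N F xs) = fobj F (std_obj M xs)" using assms
  proof (induction xs)
    case (Cons x xs)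
    then show ?case by (cases "xs = []") (simp_all add: mfn_Cons std_obj_Cons)
  qed simp
  then show "mfn M N F xs \<in> arr N" "src N (mfn M N F xs) = std_obj N (map (fobj F) xs)"
    "tgt N (mfn M N F xs) = fobj F (std_obj M xs)" by simp_all
qed

end

lemma monoidal_functorI:
  fixes M :: "('o, 'a, 'z) mon_cat_scheme" and N :: "('o, 'a, 'y) mon_cat_scheme"
  assumes "monoidal_category M" "monoidal_category N" "cat_functor M N F"
    and "mf2 F \<in> extensional (obj M \<times> obj M)"
    and "\<And>x y. x \<in> obj M \<Longrightarrow> y \<in> obj M \<Longrightarrow> iso_arr N (mf2 F (x, y)) \<and>
      src N (mf2 F (x, y)) = fobj F x \<odot>\<^bsub>N\<^esub> fobj F y \<and> tgt N (mf2 F (x, y)) = fobj F (x \<odot>\<^bsub>M\<^esub> y)"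
    and "iso_arr N (mf0 F) \<and> src N (mf0 F) = munit N \<and> tgt N (mf0 F) = fobj F (munit M)"
    and "\<And>f g. f \<in> arr M \<Longrightarrow> g \<in> arr M \<Longrightarrow>
      mf2 F (tgt M f, tgt M g) \<cdot>\<^bsub>N\<^esub> (farr F f \<star>\<^bsub>N\<^esub> farr F g) = farr F (f \<star>\<^bsub>M\<^esub> g) \<cdot>\<^bsub>N\<^esub>
          mf2 F (src M f, src M g)"
    and "\<And>x y z. \<lbrakk>x \<in> obj M; y \<in> obj M; z \<in> obj M\<rbrakk>
       \<Longrightarrow> farr F (massoc M (x, y, z)) \<cdot>\<^bsub>N\<^esub> mf2 F (x \<odot>\<^bsub>M\<^esub> y, z) \<cdot>\<^bsub>N\<^esub> (mf2 F (x, y) \<star>\<^bsub>N\<^esub>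
           ide N (fobj F z)) =
           mf2 F (x, y \<odot>\<^bsub>M\<^esub> z) \<cdot>\<^bsub>N\<^esub> (ide N (fobj F x) \<star>\<^bsub>N\<^esub> mf2 F (y, z)) \<cdot>\<^bsub>N\<^esub>
             massoc N (fobj F x, fobj F y, fobj F z)"
    and "\<And>x. x \<in> obj M \<Longrightarrow>
         farr F (lunit M x) \<cdot>\<^bsub>N\<^esub> mf2 F (munit M, x) \<cdot>\<^bsub>N\<^esub> (mf0 F \<star>\<^bsub>N\<^esub> ide N (fobj F x)) =
             lunit N (fobj F x)"
    and "\<And>x. x \<in> obj M \<Longrightarrow>
         farr F (runit M x) \<cdot>\<^bsub>N\<^esub> mf2 F (x, munit M) \<cdot>\<^bsub>N\<^esub> (ide N (fobj F x) \<star>\<^bsub>N\<^esub> mf0 F) =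
             runit N (fobj F x)"
  shows "monoidal_functor M N F"
proof -
  interpret M: monoidal_category M by fact
  interpret N: monoidal_category N by fact
  interpret cat_functor M N F by fact
  have a: "mf2 F (x, y) \<in> arr N" if "x \<in> obj M" "y \<in> obj M" for x y
    using assms(5)[OF that] N.iso_simps(1) by blast
  have b: "mf0 F \<in> arr N" using assms(6) N.iso_simps(1) by blast
  show ?thesis
    by unfold_locales (use assms(4-) a b in \<open>auto simp: homset_def PiE_def\<close>)
qed

lemma mf_comp_simps [simp]:
  "fobj (mf_comp M P G F) = fobj (fcomp M G F)" "farr (mf_comp M P G F) = farr (fcomp M G F)"
  "x \<in> obj M \<Longrightarrow> y \<in> obj M \<Longrightarrow> mf2 (mf_comp M P G F) (x, y) = farr G (mf2 F (x, y)) \<cdot>\<^bsub>P\<^esub>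
      mf2 G (fobj F x, fobj F y)"
  "mf0 (mf_comp M P G F) = farr G (mf0 F) \<cdot>\<^bsub>P\<^esub> mf0 G"
  by (simp_all add: mf_comp_def)

lemma mf_id_simps [simp]:
  "fobj (mf_id M) = fobj (fid M)" "farr (mf_id M) = farr (fid M)"
  "x \<in> obj M \<Longrightarrow> y \<in> obj M \<Longrightarrow> mf2 (mf_id M) (x, y) = ide M (x \<odot>\<^bsub>M\<^esub> y)"
  "mf0 (mf_id M) = ide M (munit M)"
  by (simp_all add: mf_id_def)

lemma monoidal_functor_id:
  assumes "monoidal_category M" shows "monoidal_functor M M (mf_id M)"
proof -
  interpret monoidal_category M by fact
  show ?thesis
  proof (rule monoidal_functorI)
    show "cat_functor M M (mf_id M)"
      by (rule cat_functor_cong[OF cat_functor_fid[OF category_axioms]]) simp_all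
  qed (simp_all add: assms iso_ide, simp_all add: mf_id_def)
qed

locale mf_composite = F: monoidal_functor M N F + G: monoidal_functor N P G
  for M :: "('o, 'a, 'z) mon_cat_scheme" and N :: "('o, 'a, 'y) mon_cat_scheme"
      and P :: "('o, 'a, 'x) mon_cat_scheme"
    and F G :: "('o, 'a) mon_fctr"
begin

abbreviation "H \<equiv> mf_comp M P G F"

lemma cat_functor_H: "cat_functor M P H"
  by (rule cat_functor_cong[OF cat_functor_fcomp[of M N F P G]]) (simp_all, unfold_locales)

lemmas as = G.cod_mon.assoc

text \<open>In every axiom naturality of \<open>mf2 G\<close> moves the image of a constraint of
  \<open>F\<close> past it (\<open>n1\<close>, \<open>n2\<close>); then the axiom of
  \<open>F\<close> applies inside \<open>farr G\<close>, and the axiom of \<open>G\<close>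
  finishes.\<close>

lemma monoidal_functor_H: "monoidal_functor M P H"
proof (rule monoidal_functorI)
  show "cat_functor M P H" by (rule cat_functor_H)
  show "monoidal_category M" "monoidal_category P" by unfold_locales
  show "mf2 H \<in> extensional (obj M \<times> obj M)" by (simp add: mf_comp_def)
next
  fix x y assume "x \<in> obj M" "y \<in> obj M"
  then show "iso_arr P (mf2 H (x, y)) \<and>
      src P (mf2 H (x, y)) = fobj H x \<odot>\<^bsub>P\<^esub> fobj H y \<and> tgt P (mf2 H (x, y)) = fobj H (x \<odot>\<^bsub>M\<^esub> y)"
    by (simp add: G.cod_mon.iso_cmp G.mf2_iso G.iso_farr F.mf2_iso)
next
  show "iso_arr P (mf0 H) \<and> src P (mf0 H) = munit P \<and> tgt P (mf0 H) = fobj H (munit M)"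
    by (simp add: G.cod_mon.iso_cmp G.mf0_iso G.iso_farr F.mf0_iso)
next
  fix f g assume f: "f \<in> arr M" "g \<in> arr M"
  have "(farr G (mf2 F (tgt M f, tgt M g)) \<cdot>\<^bsub>P\<^esub> mf2 G (fobj F (tgt M f), fobj F (tgt M g))) \<cdot>\<^bsub>P\<^esub>
      (farr G (farr F f) \<star>\<^bsub>P\<^esub> farr G (farr F g))
    = farr G (mf2 F (tgt M f, tgt M g)) \<cdot>\<^bsub>P\<^esub> (mf2 G (tgt N (farr F f), tgt N (farr F g)) \<cdot>\<^bsub>P\<^esub>
        (farr G (farr F f) \<star>\<^bsub>P\<^esub> farr G (farr F g)))"
    using f by (simp add: as)
  also have "\<dots> = farr G (mf2 F (tgt M f, tgt M g) \<cdot>\<^bsub>N\<^esub> (farr F f \<star>\<^bsub>N\<^esub> farr F g)) \<cdot>\<^bsub>P\<^esub>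
      mf2 G (fobj F (src M f), fobj F (src M g))"
    using f by (subst G.mf2_nat) (simp_all add: as G.farr_comp)
  also have "\<dots> = farr G (farr F (f \<star>\<^bsub>M\<^esub> g)) \<cdot>\<^bsub>P\<^esub> (farr G (mf2 F (src M f, src M g)) \<cdot>\<^bsub>P\<^esub>
      mf2 G (fobj F (src M f), fobj F (src M g)))"
    using f by (subst F.mf2_nat) (simp_all add: as G.farr_comp)
  finally show "mf2 H (tgt M f, tgt M g) \<cdot>\<^bsub>P\<^esub> (farr H f \<star>\<^bsub>P\<^esub> farr H g) = farr H (f \<star>\<^bsub>M\<^esub> g) \<cdot>\<^bsub>P\<^esub>
      mf2 H (src M f, src M g)"
    using f by simp
next
  fix x y z assume o: "x \<in> obj M" "y \<in> obj M" "z \<in> obj M"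
  let ?x = "fobj F x" let ?y = "fobj F y" let ?z = "fobj F z"
  have n1: "mf2 G (fobj F (x \<odot>\<^bsub>M\<^esub> y), ?z) \<cdot>\<^bsub>P\<^esub> (farr G (mf2 F (x, y)) \<star>\<^bsub>P\<^esub> ide P (fobj G ?z)) =
     farr G (mf2 F (x, y) \<star>\<^bsub>N\<^esub> ide N ?z) \<cdot>\<^bsub>P\<^esub> mf2 G (?x \<odot>\<^bsub>N\<^esub> ?y, ?z)"
    using G.mf2_nat[of "mf2 F (x, y)" "ide N ?z"] o by (simp add: G.farr_ide)
  have n2: "mf2 G (?x, fobj F (y \<odot>\<^bsub>M\<^esub> z)) \<cdot>\<^bsub>P\<^esub> (ide P (fobj G ?x) \<star>\<^bsub>P\<^esub> farr G (mf2 F (y, z))) =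
     farr G (ide N ?x \<star>\<^bsub>N\<^esub> mf2 F (y, z)) \<cdot>\<^bsub>P\<^esub> mf2 G (?x, ?y \<odot>\<^bsub>N\<^esub> ?z)"
    using G.mf2_nat[of "ide N ?x" "mf2 F (y, z)"] o by (simp add: G.farr_ide)
  have s1: "(farr G (mf2 F (x, y)) \<cdot>\<^bsub>P\<^esub> mf2 G (?x, ?y)) \<star>\<^bsub>P\<^esub> ide P (fobj G ?z) =
    (farr G (mf2 F (x, y)) \<star>\<^bsub>P\<^esub> ide P (fobj G ?z)) \<cdot>\<^bsub>P\<^esub> (mf2 G (?x, ?y) \<star>\<^bsub>P\<^esub> ide P (fobj G ?z))"
    using o by (simp add: G.cod_mon.tens_cmp)
  have s2: "ide P (fobj G ?x) \<star>\<^bsub>P\<^esub> (farr G (mf2 F (y, z)) \<cdot>\<^bsub>P\<^esub> mf2 G (?y, ?z)) =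
    (ide P (fobj G ?x) \<star>\<^bsub>P\<^esub> farr G (mf2 F (y, z))) \<cdot>\<^bsub>P\<^esub> (ide P (fobj G ?x) \<star>\<^bsub>P\<^esub> mf2 G (?y, ?z))"
    using o by (simp add: G.cod_mon.tens_cmp)
  have "farr G (farr F (massoc M (x, y, z))) \<cdot>\<^bsub>P\<^esub> (farr G (mf2 F (x \<odot>\<^bsub>M\<^esub> y, z)) \<cdot>\<^bsub>P\<^esub>
      mf2 G (fobj F (x \<odot>\<^bsub>M\<^esub> y), ?z)) \<cdot>\<^bsub>P\<^esub>
      ((farr G (mf2 F (x, y)) \<cdot>\<^bsub>P\<^esub> mf2 G (?x, ?y)) \<star>\<^bsub>P\<^esub> ide P (fobj G ?z)) =
    farr G (farr F (massoc M (x, y, z))) \<cdot>\<^bsub>P\<^esub> farr G (mf2 F (x \<odot>\<^bsub>M\<^esub> y, z)) \<cdot>\<^bsub>P\<^esub>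
      (mf2 G (fobj F (x \<odot>\<^bsub>M\<^esub> y), ?z) \<cdot>\<^bsub>P\<^esub> (farr G (mf2 F (x, y)) \<star>\<^bsub>P\<^esub> ide P (fobj G ?z))) \<cdot>\<^bsub>P\<^esub>
          (mf2 G (?x, ?y) \<star>\<^bsub>P\<^esub> ide P (fobj G ?z))"
    unfolding s1 using o by (simp add: as)
  also have "\<dots> = farr G (farr F (massoc M (x, y, z)) \<cdot>\<^bsub>N\<^esub> mf2 F (x \<odot>\<^bsub>M\<^esub> y, z) \<cdot>\<^bsub>N\<^esub>
      (mf2 F (x, y) \<star>\<^bsub>N\<^esub> ide N ?z)) \<cdot>\<^bsub>P\<^esub>
     mf2 G (?x \<odot>\<^bsub>N\<^esub> ?y, ?z) \<cdot>\<^bsub>P\<^esub> (mf2 G (?x, ?y) \<star>\<^bsub>P\<^esub> ide P (fobj G ?z))"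
    unfolding n1 using o by (simp add: as G.farr_comp)
  also have "\<dots> = farr G (mf2 F (x, y \<odot>\<^bsub>M\<^esub> z)) \<cdot>\<^bsub>P\<^esub> farr G (ide N ?x \<star>\<^bsub>N\<^esub> mf2 F (y, z)) \<cdot>\<^bsub>P\<^esub>
     (farr G (massoc N (?x, ?y, ?z)) \<cdot>\<^bsub>P\<^esub> mf2 G (?x \<odot>\<^bsub>N\<^esub> ?y, ?z) \<cdot>\<^bsub>P\<^esub> (mf2 G (?x, ?y) \<star>\<^bsub>P\<^esub>
         ide P (fobj G ?z)))"
    unfolding F.mf_assoc[OF o] using o by (simp add: as G.farr_comp)
  also have "\<dots> = farr G (mf2 F (x, y \<odot>\<^bsub>M\<^esub> z)) \<cdot>\<^bsub>P\<^esub> (farr G (ide N ?x \<star>\<^bsub>N\<^esub> mf2 F (y, z)) \<cdot>\<^bsub>P\<^esub>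
      mf2 G (?x, ?y \<odot>\<^bsub>N\<^esub> ?z)) \<cdot>\<^bsub>P\<^esub>
     (ide P (fobj G ?x) \<star>\<^bsub>P\<^esub> mf2 G (?y, ?z)) \<cdot>\<^bsub>P\<^esub> massoc P (fobj G ?x, fobj G ?y, fobj G ?z)"
    using o by (subst G.mf_assoc) (simp_all add: as)
  also have "\<dots> = (farr G (mf2 F (x, y \<odot>\<^bsub>M\<^esub> z)) \<cdot>\<^bsub>P\<^esub> mf2 G (?x, fobj F (y \<odot>\<^bsub>M\<^esub> z))) \<cdot>\<^bsub>P\<^esub>
      (ide P (fobj G ?x) \<star>\<^bsub>P\<^esub> (farr G (mf2 F (y, z)) \<cdot>\<^bsub>P\<^esub> mf2 G (?y, ?z))) \<cdot>\<^bsub>P\<^esub>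
          massoc P (fobj G ?x, fobj G ?y, fobj G ?z)"
    unfolding n2[symmetric] s2 using o by (simp add: as)
  finally show "farr H (massoc M (x, y, z)) \<cdot>\<^bsub>P\<^esub> mf2 H (x \<odot>\<^bsub>M\<^esub> y, z) \<cdot>\<^bsub>P\<^esub> (mf2 H (x, y) \<star>\<^bsub>P\<^esub>
      ide P (fobj H z)) =
           mf2 H (x, y \<odot>\<^bsub>M\<^esub> z) \<cdot>\<^bsub>P\<^esub> (ide P (fobj H x) \<star>\<^bsub>P\<^esub> mf2 H (y, z)) \<cdot>\<^bsub>P\<^esub>
             massoc P (fobj H x, fobj H y, fobj H z)"
    using o by simp
next
  fix x assume o: "x \<in> obj M"
  let ?x = "fobj F x"
  have n1: "mf2 G (fobj F (munit M), ?x) \<cdot>\<^bsub>P\<^esub> (farr G (mf0 F) \<star>\<^bsub>P\<^esub> ide P (fobj G ?x)) =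
     farr G (mf0 F \<star>\<^bsub>N\<^esub> ide N ?x) \<cdot>\<^bsub>P\<^esub> mf2 G (munit N, ?x)"
    using G.mf2_nat[of "mf0 F" "ide N ?x"] o by (simp add: G.farr_ide)
  have s1: "(farr G (mf0 F) \<cdot>\<^bsub>P\<^esub> mf0 G) \<star>\<^bsub>P\<^esub> ide P (fobj G ?x) =
    (farr G (mf0 F) \<star>\<^bsub>P\<^esub> ide P (fobj G ?x)) \<cdot>\<^bsub>P\<^esub> (mf0 G \<star>\<^bsub>P\<^esub> ide P (fobj G ?x))"
    using o by (simp add: G.cod_mon.tens_cmp)
  have "farr G (farr F (lunit M x)) \<cdot>\<^bsub>P\<^esub> (farr G (mf2 F (munit M, x)) \<cdot>\<^bsub>P\<^esub>
      mf2 G (fobj F (munit M), ?x)) \<cdot>\<^bsub>P\<^esub>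
     ((farr G (mf0 F) \<cdot>\<^bsub>P\<^esub> mf0 G) \<star>\<^bsub>P\<^esub> ide P (fobj G ?x)) =
     farr G (farr F (lunit M x)) \<cdot>\<^bsub>P\<^esub> farr G (mf2 F (munit M, x)) \<cdot>\<^bsub>P\<^esub>
         (mf2 G (fobj F (munit M), ?x) \<cdot>\<^bsub>P\<^esub>
     (farr G (mf0 F) \<star>\<^bsub>P\<^esub> ide P (fobj G ?x))) \<cdot>\<^bsub>P\<^esub> (mf0 G \<star>\<^bsub>P\<^esub> ide P (fobj G ?x))"
    unfolding s1 using o by (simp add: as)
  also have "\<dots> = farr G (farr F (lunit M x) \<cdot>\<^bsub>N\<^esub> mf2 F (munit M, x) \<cdot>\<^bsub>N\<^esub> (mf0 F \<star>\<^bsub>N\<^esub>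
      ide N ?x)) \<cdot>\<^bsub>P\<^esub> mf2 G (munit N, ?x) \<cdot>\<^bsub>P\<^esub>
     (mf0 G \<star>\<^bsub>P\<^esub> ide P (fobj G ?x))"
    unfolding n1 using o by (simp add: as G.farr_comp)
  also have "\<dots> = lunit P (fobj G ?x)"
    unfolding F.mf_lunit[OF o] using o by (simp add: G.mf_lunit)
  finally show "farr H (lunit M x) \<cdot>\<^bsub>P\<^esub> mf2 H (munit M, x) \<cdot>\<^bsub>P\<^esub> (mf0 H \<star>\<^bsub>P\<^esub> ide P (fobj H x)) =
      lunit P (fobj H x)"
    using o by simp
next
  fix x assume o: "x \<in> obj M"
  let ?x = "fobj F x"
  have n1: "mf2 G (?x, fobj F (munit M)) \<cdot>\<^bsub>P\<^esub> (ide P (fobj G ?x) \<star>\<^bsub>P\<^esub> farr G (mf0 F)) =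
     farr G (ide N ?x \<star>\<^bsub>N\<^esub> mf0 F) \<cdot>\<^bsub>P\<^esub> mf2 G (?x, munit N)"
    using G.mf2_nat[of "ide N ?x" "mf0 F"] o by (simp add: G.farr_ide)
  have s1: "ide P (fobj G ?x) \<star>\<^bsub>P\<^esub> (farr G (mf0 F) \<cdot>\<^bsub>P\<^esub> mf0 G) =
    (ide P (fobj G ?x) \<star>\<^bsub>P\<^esub> farr G (mf0 F)) \<cdot>\<^bsub>P\<^esub> (ide P (fobj G ?x) \<star>\<^bsub>P\<^esub> mf0 G)"
    using o by (simp add: G.cod_mon.tens_cmp)
  have "farr G (farr F (runit M x)) \<cdot>\<^bsub>P\<^esub> (farr G (mf2 F (x, munit M)) \<cdot>\<^bsub>P\<^esub>
      mf2 G (?x, fobj F (munit M))) \<cdot>\<^bsub>P\<^esub>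
     (ide P (fobj G ?x) \<star>\<^bsub>P\<^esub> (farr G (mf0 F) \<cdot>\<^bsub>P\<^esub> mf0 G)) =
     farr G (farr F (runit M x)) \<cdot>\<^bsub>P\<^esub> farr G (mf2 F (x, munit M)) \<cdot>\<^bsub>P\<^esub>
         (mf2 G (?x, fobj F (munit M)) \<cdot>\<^bsub>P\<^esub>
     (ide P (fobj G ?x) \<star>\<^bsub>P\<^esub> farr G (mf0 F))) \<cdot>\<^bsub>P\<^esub> (ide P (fobj G ?x) \<star>\<^bsub>P\<^esub> mf0 G)"
    unfolding s1 using o by (simp add: as)
  also have "\<dots> = farr G (farr F (runit M x) \<cdot>\<^bsub>N\<^esub> mf2 F (x, munit M) \<cdot>\<^bsub>N\<^esub> (ide N ?x \<star>\<^bsub>N\<^esub>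
      mf0 F)) \<cdot>\<^bsub>P\<^esub> mf2 G (?x, munit N) \<cdot>\<^bsub>P\<^esub>
     (ide P (fobj G ?x) \<star>\<^bsub>P\<^esub> mf0 G)"
    unfolding n1 using o by (simp add: as G.farr_comp)
  also have "\<dots> = runit P (fobj G ?x)"
    unfolding F.mf_runit[OF o] using o by (simp add: G.mf_runit)
  finally show "farr H (runit M x) \<cdot>\<^bsub>P\<^esub> mf2 H (x, munit M) \<cdot>\<^bsub>P\<^esub> (ide P (fobj H x) \<star>\<^bsub>P\<^esub> mf0 H) =
      runit P (fobj H x)"
    using o by simp
qed

text \<open>Induction on the list, with naturality of \<open>mf2 G\<close> at an identity and the
  canonical isomorphism of \<open>F\<close> for the tail.\<close>

lemma mfn_H:
  "xs \<in> lists (obj M) \<Longrightarrow> mfn M P H xs = farr G (mfn M N F xs) \<cdot>\<^bsub>P\<^esub> mfn N P G (map (fobj F) xs)"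
proof (induction xs)
  case Nil then show ?case by simp
next
  case (Cons x xs)
  show ?case
  proof (cases "xs = []")
    case True
    then show ?thesis using Cons.prems by (simp add: G.farr_ide)
  next
    case False
    let ?x = "fobj F x" and ?u = "mfn M N F xs" and ?v = "mfn N P G (map (fobj F) xs)"
    have x: "x \<in> obj M" and xs: "xs \<in> lists (obj M)" using Cons.prems by simp_all
    note u = F.mfn_simps[OF xs] and v = G.mfn_simps[OF F.fobj_lists[OF xs]]
    have s: "std_obj M xs \<in> obj M" "std_obj N (map (fobj F) xs) \<in> obj N"
      using xs F.fobj_lists[OF xs] by simp_all
    have n: "mf2 G (?x, fobj F (std_obj M xs)) \<cdot>\<^bsub>P\<^esub> (ide P (fobj G ?x) \<star>\<^bsub>P\<^esub> farr G ?u) =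
      farr G (ide N ?x \<star>\<^bsub>N\<^esub> ?u) \<cdot>\<^bsub>P\<^esub> mf2 G (?x, std_obj N (map (fobj F) xs))"
      using G.mf2_nat[of "ide N ?x" ?u] x u by (simp add: G.farr_ide)
    have "mfn M P H (x # xs) = (farr G (mf2 F (x, std_obj M xs)) \<cdot>\<^bsub>P\<^esub>
        mf2 G (?x, fobj F (std_obj M xs))) \<cdot>\<^bsub>P\<^esub>
        ((ide P (fobj G ?x) \<star>\<^bsub>P\<^esub> farr G ?u) \<cdot>\<^bsub>P\<^esub> (ide P (fobj G ?x) \<star>\<^bsub>P\<^esub> ?v))"
      using False Cons x s u v monoidal_functor.mfn_Cons[OF monoidal_functor_H False, of x]
      by (simp add: G.cod_mon.tens_cmp)
    also have "\<dots> = farr G (mf2 F (x, std_obj M xs)) \<cdot>\<^bsub>P\<^esub> (mf2 G (?x, fobj F (std_obj M xs)) \<cdot>\<^bsub>P\<^esub>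
        (ide P (fobj G ?x) \<star>\<^bsub>P\<^esub> farr G ?u)) \<cdot>\<^bsub>P\<^esub> (ide P (fobj G ?x) \<star>\<^bsub>P\<^esub> ?v)"
      using x s u v by (simp add: as)
    also have "\<dots> = farr G (mfn M N F (x # xs)) \<cdot>\<^bsub>P\<^esub> mfn N P G (map (fobj F) (x # xs))"
      unfolding n using False x s u v by (simp add: as F.mfn_Cons G.mfn_Cons G.farr_comp)
    finally show ?thesis .
  qed
qed

end

lemma monoidal_transformation_id:
  assumes "monoidal_functor M N F" shows "monoidal_transformation M N F F (nt_id M N F)"
proof -
  interpret monoidal_functor M N F by fact
  interpret nat_trans M N F F "nt_id M N F" by (rule nat_trans_id) unfold_locales
  show ?thesis by unfold_locales (simp_all add: nt_id_def)
qed

lemma monoidal_transformation_vcomp: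
  assumes "monoidal_transformation M N F G t" "monoidal_transformation M N G H s"
  shows "monoidal_transformation M N F H (nt_vcomp M N s t)"
proof -
  interpret t: monoidal_transformation M N F G t by fact
  interpret s: monoidal_transformation M N G H s by fact
  interpret nat_trans M N F H "nt_vcomp M N s t" by (rule nat_trans_vcomp; unfold_locales)
  note as = t.dom_mf.cod_mon.assoc
  show ?thesis
  proof
    fix x y assume o: "x \<in> obj M" "y \<in> obj M"
    have "(s (x \<odot>\<^bsub>M\<^esub> y) \<cdot>\<^bsub>N\<^esub> t (x \<odot>\<^bsub>M\<^esub> y)) \<cdot>\<^bsub>N\<^esub> mf2 F (x, y) = s (x \<odot>\<^bsub>M\<^esub> y) \<cdot>\<^bsub>N\<^esub>
        (mf2 G (x, y) \<cdot>\<^bsub>N\<^esub> (t x \<star>\<^bsub>N\<^esub> t y))"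
      using o by (simp add: as t.tensor_compat)
    also have "\<dots> = (mf2 H (x, y) \<cdot>\<^bsub>N\<^esub> (s x \<star>\<^bsub>N\<^esub> s y)) \<cdot>\<^bsub>N\<^esub> (t x \<star>\<^bsub>N\<^esub> t y)"
      using o by (simp add: s.tensor_compat flip: as)
    also have "\<dots> = mf2 H (x, y) \<cdot>\<^bsub>N\<^esub> ((s x \<cdot>\<^bsub>N\<^esub> t x) \<star>\<^bsub>N\<^esub> (s y \<cdot>\<^bsub>N\<^esub> t y))"
      using o by (simp add: as t.dom_mf.cod_mon.tens_cmp)
    finally show "nt_vcomp M N s t (x \<odot>\<^bsub>M\<^esub> y) \<cdot>\<^bsub>N\<^esub> mf2 F (x, y) = mf2 H (x, y) \<cdot>\<^bsub>N\<^esub>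
        (nt_vcomp M N s t x \<star>\<^bsub>N\<^esub> nt_vcomp M N s t y)"
      using o by (simp add: nt_vcomp_def)
  next
    show "nt_vcomp M N s t (munit M) \<cdot>\<^bsub>N\<^esub> mf0 F = mf0 H"
      by (simp add: nt_vcomp_def as t.unit_compat s.unit_compat)
  qed
qed

text \<open>Tensor compatibility of \<open>t\<close> is used inside \<open>farr G\<close>,
  naturality of \<open>mf2 G\<close> moves the components of \<open>t\<close> out, naturality of
  \<open>s\<close> at the constraint of \<open>F'\<close> follows, and tensor compatibility of
  \<open>s\<close> comes last.\<close>

lemma monoidal_transformation_hcomp:
  assumes "monoidal_transformation M N F F' t" "monoidal_transformation N P G G' s"
  shows "monoidal_transformation M P (mf_comp M P G F) (mf_comp M P G' F') (nt_hcomp M P F' G s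
      t)"
proof -
  interpret t: monoidal_transformation M N F F' t by fact
  interpret s: monoidal_transformation N P G G' s by fact
  interpret FG: mf_composite M N P F G by unfold_locales
  interpret FG': mf_composite M N P F' G' by unfold_locales
  interpret H: monoidal_functor M P "mf_comp M P G F" by (rule FG.monoidal_functor_H)
  interpret H': monoidal_functor M P "mf_comp M P G' F'" by (rule FG'.monoidal_functor_H)
  interpret nat_trans M P "mf_comp M P G F" "mf_comp M P G' F'" "nt_hcomp M P F' G s t"
  proof (rule nat_trans_cong)
    show "nat_trans M P (fcomp M G F) (fcomp M G' F') (nt_hcomp M P F' G s t)"
      by (rule nat_trans_hcomp[of M N]; unfold_locales)
  qed simp_all
  note as = s.dom_mf.cod_mon.assoc
  show ?thesis
  proof
    fix x y assume o: "x \<in> obj M" "y \<in> obj M"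
    let ?s = "s (fobj F' (x \<odot>\<^bsub>M\<^esub> y))"
    have "(?s \<cdot>\<^bsub>P\<^esub> farr G (t (x \<odot>\<^bsub>M\<^esub> y))) \<cdot>\<^bsub>P\<^esub> farr G (mf2 F (x, y)) \<cdot>\<^bsub>P\<^esub>
        mf2 G (fobj F x, fobj F y) =
      ?s \<cdot>\<^bsub>P\<^esub> farr G (t (x \<odot>\<^bsub>M\<^esub> y) \<cdot>\<^bsub>N\<^esub> mf2 F (x, y)) \<cdot>\<^bsub>P\<^esub> mf2 G (fobj F x, fobj F y)"
      using o by (simp add: as s.dom_mf.farr_comp)
    also have "\<dots> = ?s \<cdot>\<^bsub>P\<^esub> farr G (mf2 F' (x, y)) \<cdot>\<^bsub>P\<^esub> (farr G (t x \<star>\<^bsub>N\<^esub> t y) \<cdot>\<^bsub>P\<^esub>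
        mf2 G (src N (t x), src N (t y)))"
      using o by (simp add: as s.dom_mf.farr_comp t.tensor_compat)
    also have "\<dots> = ?s \<cdot>\<^bsub>P\<^esub> farr G (mf2 F' (x, y)) \<cdot>\<^bsub>P\<^esub> mf2 G (fobj F' x, fobj F' y) \<cdot>\<^bsub>P\<^esub>
        (farr G (t x) \<star>\<^bsub>P\<^esub> farr G (t y))"
      using o by (subst s.dom_mf.mf2_nat[symmetric]) simp_all
    also have "\<dots> = (s (tgt N (mf2 F' (x, y))) \<cdot>\<^bsub>P\<^esub> farr G (mf2 F' (x, y))) \<cdot>\<^bsub>P\<^esub>
        mf2 G (fobj F' x, fobj F' y) \<cdot>\<^bsub>P\<^esub> (farr G (t x) \<star>\<^bsub>P\<^esub> farr G (t y))"
      using o by (simp add: as)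
    also have "\<dots> = farr G' (mf2 F' (x, y)) \<cdot>\<^bsub>P\<^esub> (s (fobj F' x \<odot>\<^bsub>N\<^esub> fobj F' y) \<cdot>\<^bsub>P\<^esub>
        mf2 G (fobj F' x, fobj F' y)) \<cdot>\<^bsub>P\<^esub> (farr G (t x) \<star>\<^bsub>P\<^esub> farr G (t y))"
      using o by (subst s.nat) (simp_all add: as)
    also have "\<dots> = farr G' (mf2 F' (x, y)) \<cdot>\<^bsub>P\<^esub> mf2 G' (fobj F' x, fobj F' y) \<cdot>\<^bsub>P\<^esub>
        ((s (fobj F' x) \<star>\<^bsub>P\<^esub> s (fobj F' y)) \<cdot>\<^bsub>P\<^esub> (farr G (t x) \<star>\<^bsub>P\<^esub> farr G (t y)))"
      using o by (subst s.tensor_compat) (simp_all add: as)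
    also have "\<dots> = farr G' (mf2 F' (x, y)) \<cdot>\<^bsub>P\<^esub> mf2 G' (fobj F' x, fobj F' y) \<cdot>\<^bsub>P\<^esub>
        ((s (fobj F' x) \<cdot>\<^bsub>P\<^esub> farr G (t x)) \<star>\<^bsub>P\<^esub> (s (fobj F' y) \<cdot>\<^bsub>P\<^esub> farr G (t y)))"
      using o by (simp add: s.dom_mf.cod_mon.tens_cmp)
    finally show "nt_hcomp M P F' G s t (x \<odot>\<^bsub>M\<^esub> y) \<cdot>\<^bsub>P\<^esub> mf2 (mf_comp M P G F) (x, y) =
      mf2 (mf_comp M P G' F') (x, y) \<cdot>\<^bsub>P\<^esub> (nt_hcomp M P F' G s t x \<star>\<^bsub>P\<^esub> nt_hcomp M P F' G s t y)"
      using o by (simp add: nt_hcomp_def as)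
  next
    let ?s = "s (fobj F' (munit M))"
    have "(?s \<cdot>\<^bsub>P\<^esub> farr G (t (munit M))) \<cdot>\<^bsub>P\<^esub> farr G (mf0 F) \<cdot>\<^bsub>P\<^esub> mf0 G = ?s \<cdot>\<^bsub>P\<^esub>
        farr G (t (munit M) \<cdot>\<^bsub>N\<^esub> mf0 F) \<cdot>\<^bsub>P\<^esub> mf0 G"
      by (simp add: as s.dom_mf.farr_comp)
    also have "\<dots> = (s (tgt N (mf0 F')) \<cdot>\<^bsub>P\<^esub> farr G (mf0 F')) \<cdot>\<^bsub>P\<^esub> mf0 G"
      by (simp add: as t.unit_compat)
    also have "\<dots> = farr G' (mf0 F') \<cdot>\<^bsub>P\<^esub> (s (munit N) \<cdot>\<^bsub>P\<^esub> mf0 G)"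
      by (subst s.nat) (simp_all add: as)
    finally show "nt_hcomp M P F' G s t (munit M) \<cdot>\<^bsub>P\<^esub> mf0 (mf_comp M P G F) =
        mf0 (mf_comp M P G' F')"
      by (simp add: nt_hcomp_def s.unit_compat)
  qed
qed

lemma mon_fctr_eqI:
  fixes F G :: "('o, 'a) mon_fctr"
  assumes "monoidal_functor M N F" "monoidal_functor M N G"
    and "\<And>x. x \<in> obj M \<Longrightarrow> fobj F x = fobj G x" "\<And>f. f \<in> arr M \<Longrightarrow> farr F f = farr G f"
    and "\<And>x y. x \<in> obj M \<Longrightarrow> y \<in> obj M \<Longrightarrow> mf2 F (x, y) = mf2 G (x, y)" "mf0 F = mf0 G"
  shows "F = G"
proof -
  interpret F: monoidal_functor M N F by fact
  interpret G: monoidal_functor M N G by fact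
  have "fobj F = fobj G" by (rule PiE_ext[OF F.fobj_type G.fobj_type assms(3)])
  moreover have "farr F = farr G" by (rule PiE_ext[OF F.farr_type G.farr_type assms(4)])
  moreover have "mf2 F = mf2 G"
    by (rule PiE_ext[OF F.mf2_type G.mf2_type]) (use assms(5) in auto)
  ultimately show ?thesis using assms(6) by simp
qed

lemma mf_comp_id:
  assumes "monoidal_functor M N F"
  shows "mf_comp M N F (mf_id M) = F" "mf_comp M N (mf_id N) F = F"
proof -
  interpret F: monoidal_functor M N F by fact
  interpret m: monoidal_functor M M "mf_id M" by (rule monoidal_functor_id) unfold_locales
  interpret n: monoidal_functor N N "mf_id N" by (rule monoidal_functor_id) unfold_locales
  interpret c: mf_composite M M N "mf_id M" F by unfold_locales
  interpret d: mf_composite M N N F "mf_id N" by unfold_locales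
  show "mf_comp M N F (mf_id M) = F"
    by (rule mon_fctr_eqI[OF c.monoidal_functor_H assms]) (simp_all add: F.farr_ide)
  show "mf_comp M N (mf_id N) F = F"
    by (rule mon_fctr_eqI[OF d.monoidal_functor_H assms]) simp_all
qed

lemma mf_comp_assoc:
  assumes "monoidal_functor M N F" "monoidal_functor N P G" "monoidal_functor P Q H"
  shows "mf_comp M Q (mf_comp N Q H G) F = mf_comp M Q H (mf_comp M P G F)"
proof -
  interpret F: monoidal_functor M N F by fact
  interpret G: monoidal_functor N P G by fact
  interpret H: monoidal_functor P Q H by fact
  interpret FG: mf_composite M N P F G by unfold_locales
  interpret GH: mf_composite N P Q G H by unfold_locales
  interpret FG': monoidal_functor M P "mf_comp M P G F" by (rule FG.monoidal_functor_H)
  interpret GH': monoidal_functor N Q "mf_comp N Q H G" by (rule GH.monoidal_functor_H)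
  interpret a: mf_composite M N Q F "mf_comp N Q H G" by unfold_locales
  interpret b: mf_composite M P Q "mf_comp M P G F" H by unfold_locales
  show ?thesis
    by (rule mon_fctr_eqI[OF a.monoidal_functor_H b.monoidal_functor_H])
      (simp_all add: H.farr_comp H.cod_mon.assoc)
qed

context action_operad
begin

lemma weak_functorD:
  assumes "weak_L_monoidal_functor L M N F"
  shows "monoidal_functor M N F" "weak_L_monoidal_category L M" "weak_L_monoidal_category L N"
      "cat_functor M N F"
  using assms by (simp_all add: weak_L_monoidal_functor_def monoidal_functor_def)

lemma weak_functor_id:
  assumes "weak_L_monoidal_category L M" shows "weak_L_monoidal_functor L M M (mf_id M)"
proof -
  interpret weak_op L M using assms action_operad_axioms by (simp add: weak_op_def)
  interpret F: monoidal_functor M M "mf_id M" by (rule monoidal_functor_id) unfold_locales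
  have m: "map (fobj (fid M)) xs = xs" if "xs \<in> lists (obj M)" for xs
    using that by (auto simp: in_lists_conv_set intro!: map_idI)
  have n: "mfn M M (mf_id M) xs = ide M (std_obj M xs)" if "xs \<in> lists (obj M)" for xs
    using that
  proof (induction xs)
    case (Cons x xs)
    then show ?case by (cases "xs = []") (simp_all add: F.mfn_Cons std_obj_Cons)
  qed simp
  show ?thesis
  proof
    fix xs g assume "xs \<in> lists (obj M)" "g \<in> el L (length xs)"
    then show "mfn M M (mf_id M) (lact L g xs) \<cdot>\<^bsub>M\<^esub> wact M (g, map (fobj (mf_id M)) xs) =
        farr (mf_id M) (wact M (g, xs)) \<cdot>\<^bsub>M\<^esub> mfn M M (mf_id M) xs"
      using n[of xs] n[of "lact L g xs"] m[of xs] by simp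
  qed
qed

text \<open>With \<open>mfn_H\<close> the square for the composite is the square of \<open>G\<close>
  at the image list pasted to the image under \<open>G\<close> of the square of
  \<open>F\<close>.\<close>

lemma weak_functor_comp:
  assumes F: "weak_L_monoidal_functor L M N F" and G: "weak_L_monoidal_functor L N P G"
  shows "weak_L_monoidal_functor L M P (mf_comp M P G F)"
proof -
  interpret F: weak_L_monoidal_functor L M N F by fact
  interpret G: weak_L_monoidal_functor L N P G by fact
  interpret M: weak_op L M using weak_functorD[OF F] action_operad_axioms
      by (simp add: weak_op_def)
  interpret N: weak_op L N using weak_functorD[OF F] action_operad_axioms
      by (simp add: weak_op_def)
  interpret P: weak_op L P using weak_functorD[OF G] action_operad_axioms
      by (simp add: weak_op_def)
  interpret FG: mf_composite M N P F G by unfold_locales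
  interpret H: monoidal_functor M P "mf_comp M P G F" by (rule FG.monoidal_functor_H)
  show ?thesis
  proof
    fix xs g assume xs: "xs \<in> lists (obj M)" and g: "g \<in> el L (length xs)"
    have l: "lact L g xs \<in> lists (obj M)" using xs g by simp
    have f: "map (fobj F) xs \<in> lists (obj N)" "map (fobj F) (lact L g xs) \<in> lists (obj N)"
      "map (fobj G) (map (fobj F) xs) \<in> lists (obj P)"
      using F.fobj_lists[OF xs] F.fobj_lists[OF l] G.fobj_lists[OF F.fobj_lists[OF xs]]
          by simp_all
    have h: "map (fobj (mf_comp M P G F)) xs = map (fobj G) (map (fobj F) xs)"
      using xs by (auto simp: in_lists_conv_set)
    note t = F.mfn_simps[OF xs] F.mfn_simps[OF l] G.mfn_simps[OF f(1)] G.mfn_simps[OF f(2)]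
    have "(farr G (mfn M N F (lact L g xs)) \<cdot>\<^bsub>P\<^esub> mfn N P G (map (fobj F) (lact L g xs))) \<cdot>\<^bsub>P\<^esub>
        wact P (g, map (fobj G) (map (fobj F) xs)) =
      farr G (mfn M N F (lact L g xs)) \<cdot>\<^bsub>P\<^esub> (mfn N P G (lact L g (map (fobj F) xs)) \<cdot>\<^bsub>P\<^esub>
          wact P (g, map (fobj G) (map (fobj F) xs)))"
      using xs g l f t by (simp add: FG.as del: map_map)
    also have "\<dots> = farr G (mfn M N F (lact L g xs) \<cdot>\<^bsub>N\<^esub> wact N (g, map (fobj F) xs)) \<cdot>\<^bsub>P\<^esub>
        mfn N P G (map (fobj F) xs)"
      using xs g l f t by (subst G.mfn_wact) (simp_all add: FG.as G.farr_comp del: map_map)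
    also have "\<dots> = farr G (farr F (wact M (g, xs))) \<cdot>\<^bsub>P\<^esub> (farr G (mfn M N F xs) \<cdot>\<^bsub>P\<^esub>
        mfn N P G (map (fobj F) xs))"
      using xs g l f t by (subst F.mfn_wact) (simp_all add: FG.as G.farr_comp del: map_map)
    finally show "mfn M P (mf_comp M P G F) (lact L g xs) \<cdot>\<^bsub>P\<^esub>
        wact P (g, map (fobj (mf_comp M P G F)) xs) =
      farr (mf_comp M P G F) (wact M (g, xs)) \<cdot>\<^bsub>P\<^esub> mfn M P (mf_comp M P G F) xs"
      unfolding h using xs g l FG.mfn_H[OF xs] FG.mfn_H[OF l] by (simp del: map_map)
  qed
qed

lemma WkLMonCat_simps:
  "A \<in> cell0 (WkLMonCat L) \<longleftrightarrow> weak_L_monoidal_category L A"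
  "F \<in> cell1 (WkLMonCat L) A B \<longleftrightarrow> weak_L_monoidal_functor L A B F"
  "t \<in> cell2 (WkLMonCat L) A B F G \<longleftrightarrow> weak_L_monoidal_functor L A B F \<and>
      weak_L_monoidal_functor L A B G \<and>
     monoidal_transformation A B F G t"
  "id1 (WkLMonCat L) = mf_id" "comp1 (WkLMonCat L) A B C G F = mf_comp A C G F"
      "id2 (WkLMonCat L) = nt_id"
  "vcomp (WkLMonCat L) = nt_vcomp" "hcomp (WkLMonCat L) A B C F F' G G' s t =
      nt_hcomp A C F' G s t"
  by (simp_all add: WkLMonCat_def)

lemma monoidal_transformation_nat: "monoidal_transformation M N F G t \<Longrightarrow> nat_trans M N F G t"
  by (simp add: monoidal_transformation_def)

lemma two_category_WkLMonCat: "two_category (WkLMonCat L)"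
proof (unfold_locales, unfold WkLMonCat_simps)
  fix A B C D f g h
  assume "weak_L_monoidal_functor L A B f" "weak_L_monoidal_functor L B C g"
      "weak_L_monoidal_functor L C D h"
  then show "mf_comp A D (mf_comp B D h g) f = mf_comp A D h (mf_comp A C g f)"
    by (intro mf_comp_assoc) (rule weak_functorD, assumption)+
next
  fix A B f g h t s
  assume "weak_L_monoidal_functor L A B f \<and> weak_L_monoidal_functor L A B g \<and>
      monoidal_transformation A B f g t"
    "weak_L_monoidal_functor L A B g \<and> weak_L_monoidal_functor L A B h \<and>
        monoidal_transformation A B g h s"
  then show "weak_L_monoidal_functor L A B f \<and> weak_L_monoidal_functor L A B h \<and>
      monoidal_transformation A B f h (nt_vcomp A B s t)"
    using monoidal_transformation_vcomp by blast
next
  fix A B C f f' g g' t s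
  assume "weak_L_monoidal_functor L A B f \<and> weak_L_monoidal_functor L A B f' \<and>
      monoidal_transformation A B f f' t"
    "weak_L_monoidal_functor L B C g \<and> weak_L_monoidal_functor L B C g' \<and>
        monoidal_transformation B C g g' s"
  then show "weak_L_monoidal_functor L A C (mf_comp A C g f) \<and>
      weak_L_monoidal_functor L A C (mf_comp A C g' f') \<and>
    monoidal_transformation A C (mf_comp A C g f) (mf_comp A C g' f') (nt_hcomp A C f' g s t)"
    using monoidal_transformation_hcomp weak_functor_comp by blast
next
  fix A B C f g
  assume "weak_L_monoidal_functor L A B f" "weak_L_monoidal_functor L B C g"
  then show "nt_hcomp A C f g (nt_id B C g) (nt_id A B f) = nt_id A C (mf_comp A C g f)"
    by (intro nt_hcomp_id2 weak_functorD(4)) simp_all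
next
  fix A B C f f' f'' g g' g'' t t' s s'
  assume "weak_L_monoidal_functor L A B f \<and> weak_L_monoidal_functor L A B f' \<and>
      monoidal_transformation A B f f' t"
    "weak_L_monoidal_functor L A B f' \<and> weak_L_monoidal_functor L A B f'' \<and>
        monoidal_transformation A B f' f'' t'"
    "weak_L_monoidal_functor L B C g \<and> weak_L_monoidal_functor L B C g' \<and>
        monoidal_transformation B C g g' s"
    "weak_L_monoidal_functor L B C g' \<and> weak_L_monoidal_functor L B C g'' \<and>
        monoidal_transformation B C g' g'' s'"
  then show "nt_hcomp A C f'' g (nt_vcomp B C s' s) (nt_vcomp A B t' t) =
    nt_vcomp A C (nt_hcomp A C f'' g' s' t') (nt_hcomp A C f' g s t)"
    by (elim conjE, intro nt_interchange) (rule monoidal_transformation_nat, assumption)+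
next
  fix A B C D f f' g g' h h' t s r
  assume a: "weak_L_monoidal_functor L A B f \<and> weak_L_monoidal_functor L A B f' \<and>
      monoidal_transformation A B f f' t"
    "weak_L_monoidal_functor L B C g \<and> weak_L_monoidal_functor L B C g' \<and>
        monoidal_transformation B C g g' s"
    "weak_L_monoidal_functor L C D h \<and> weak_L_monoidal_functor L C D h' \<and>
        monoidal_transformation C D h h' r"
  then have "nat_trans A B f f' t" "nat_trans B C g g' s" "nat_trans C D h h' r"
    using monoidal_transformation_nat by blast+
  then show "nt_hcomp A D f' (mf_comp B D h g) (nt_hcomp B D g' h r s) t =
    nt_hcomp A D (mf_comp A C g' f') h r (nt_hcomp A C f' g s t)"
    by (rule nt_hcomp_assoc) simp_all
next
  fix A B f f' t assume "weak_L_monoidal_functor L A B f \<and> weak_L_monoidal_functor L A B f' \<and>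
      monoidal_transformation A B f f' t"
  then have a: "nat_trans A B f f' t" using monoidal_transformation_nat by blast
  show "nt_hcomp A B (mf_id A) f t (nt_id A A (mf_id A)) = t"
    using a by (rule nt_hcomp_id_right) simp
  show "nt_hcomp A B f' (mf_id B) (nt_id B B (mf_id B)) t = t"
    using a by (rule nt_hcomp_id_left) simp_all
qed ((elim conjE)?, (intro conjI)?, (rule weak_functor_id weak_functor_comp mf_comp_id
    monoidal_transformation_id
    nt_vcomp_assoc nt_vcomp_id weak_functorD(1) monoidal_transformation_nat | assumption)+)+

text \<open>Injectivity on 0-cells is \<open>incl0_inj\<close>; on 1-cells \<open>incl1\<close>
  retains both maps of the functor, and 2-cells are left unchanged. The equation needing work is
  preservation of composites of 1-cells.\<close>

lemma two_functor_incl: "inclusion_two_functor (LMonCat L) (WkLMonCat L) (incl L)"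
proof (intro inclusion_two_functor.intro two_functor.intro two_category_LMonCat
    two_category_WkLMonCat
    two_functor_axioms.intro inclusion_two_functor_axioms.intro, unfold LMonCat_simps
        WkLMonCat_simps)
  fix A B :: "('o, 'c, 'g) el_alg" and f g t
  assume "el_algebra L A" "el_algebra L B"
  show "weak_L_monoidal_category L (tf0 (incl L) A)"
    using \<open>el_algebra L A\<close> by (simp add: incl_def incl0_weak)
  show "tf1 (incl L) A A (fid A) = mf_id (tf0 (incl L) A)"
  proof -
    interpret nf_algebra L A "\<lambda>xs. fobj (alg A) (OC (obj A) xs)"
        "\<lambda>g fs. farr (alg A) (AC (arr A) g fs)"
      by (rule el_algebra_nf) fact
    show ?thesis by (auto simp: incl_def incl1_def mf_id_def fid_def incl0_simps fun_eq_iff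
        restrict_def)
  qed
  show "inj_on (tf1 (incl L) A B) (cell1 (LMonCat L) A B)"
    by (rule inj_onI) (simp add: incl_def incl1_def)
  show "inj_on (tf2 (incl L) A B f g) (cell2 (LMonCat L) A B f g)"
    by (rule inj_onI) (simp add: incl_def)
  show "tf2 (incl L) A B f f (nt_id A B f) = nt_id (tf0 (incl L) A) (tf0 (incl L) B) (tf1 (incl L)
      A B f)"
    by (simp add: incl_def nt_id_def incl0_simps)
  show "tf2 (incl L) A B f h (nt_vcomp A B s t) =
    nt_vcomp (tf0 (incl L) A) (tf0 (incl L) B) (tf2 (incl L) A B g h s) (tf2 (incl L) A B f g t)"
        for h s
    by (simp add: incl_def nt_vcomp_def incl0_simps)
  assume f: "el_strict_morphism L A B f"
  then show "weak_L_monoidal_functor L (tf0 (incl L) A) (tf0 (incl L) B) (tf1 (incl L) A B f)"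
    by (simp add: incl_def incl1_weak)
  assume g: "el_strict_morphism L A B g" and t: "el_two_cell L A B f g t"
  show "weak_L_monoidal_functor L (tf0 (incl L) A) (tf0 (incl L) B) (tf1 (incl L) A B f) \<and>
      weak_L_monoidal_functor L (tf0 (incl L) A) (tf0 (incl L) B) (tf1 (incl L) A B g) \<and>
      monoidal_transformation (tf0 (incl L) A) (tf0 (incl L) B) (tf1 (incl L) A B f) (tf1 (incl L)
          A B g) (tf2 (incl L) A B f g t)"
    using f g t by (simp add: incl_def incl1_weak incl2_monoidal)
next
  show "inj_on (tf0 (incl L)) (cell0 (LMonCat L))"
    by (rule inj_onI) (simp add: incl_def LMonCat_simps incl0_inj)
next
  fix A B C :: "('o, 'c, 'g) el_alg" and f g
  assume f: "el_strict_morphism L A B f" and g: "el_strict_morphism L B C g"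
  interpret f: weak_L_monoidal_functor L "incl0 L A" "incl0 L B" "incl1 L A B f" using f
      by (rule incl1_weak)
  interpret g: weak_L_monoidal_functor L "incl0 L B" "incl0 L C" "incl1 L B C g" using g
      by (rule incl1_weak)
  interpret f': cat_functor A B f by (rule el_strict_morphismD) fact
  interpret g': cat_functor B C g by (rule el_strict_morphismD) fact
  have gf: "weak_L_monoidal_functor L (incl0 L A) (incl0 L C) (incl1 L A C (fcomp A g f))"
    by (rule incl1_weak, rule el_strict_morphism_fcomp) fact+
  have t: "fobj g (x \<odot>\<^bsub>incl0 L B\<^esub> y) = fobj g x \<odot>\<^bsub>incl0 L C\<^esub> fobj g y" "x \<odot>\<^bsub>incl0 L B\<^esub> y \<in> obj B"
      if "x \<in> obj B" "y \<in> obj B" for x y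
    using el_strict_morphismD(4)[OF g, of "[x, y]"] that f.cod_wk.tens_obj[of x y]
        by (simp_all add: incl0_simps)
  have u: "fobj g (munit (incl0 L B)) = munit (incl0 L C)" "munit (incl0 L B) \<in> obj B"
      "munit (incl0 L C) \<in> obj C"
    using el_strict_morphismD(4)[OF g, of "[]"] f.cod_wk.munit_obj g.cod_wk.munit_obj
        by (simp_all add: incl0_simps)
  have o: "x \<odot>\<^bsub>incl0 L C\<^esub> y \<in> obj C" if "x \<in> obj C" "y \<in> obj C" for x y
    using that g.cod_wk.tens_obj[of x y] by (simp add: incl0_simps(1))
  \<comment> \<open>The composite constraint is a product of identities, and since \<open>g\<close>
    preserves tensor product and unit on the nose it is again the identity prescribed by
    \<open>incl1\<close>.\<close>
  have "incl1 L A C (fcomp A g f) = mf_comp (incl0 L A) (incl0 L C) (incl1 L B C g) (incl1 L A B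
      f)"
  proof (rule mon_fctr_eqI)
    show "monoidal_functor (incl0 L A) (incl0 L C) (incl1 L A C (fcomp A g f))"
        by (rule weak_functorD) (rule gf)
    show "monoidal_functor (incl0 L A) (incl0 L C) (mf_comp (incl0 L A) (incl0 L C) (incl1 L B C
        g) (incl1 L A B f))"
      by (rule weak_functorD, rule weak_functor_comp) (rule incl1_weak, fact)+
  qed (use t u o in \<open>simp_all add: incl0_simps(1-6) g'.farr_ide\<close>)
  then show "tf1 (incl L) A C (fcomp A g f) = mf_comp (tf0 (incl L) A) (tf0 (incl L) C) (tf1 (incl
      L) B C g) (tf1 (incl L) A B f)"
    by (simp add: incl_def)
next
  show "tf2 (incl L) A C (fcomp A g f) (fcomp A g' f') (nt_hcomp A C f' g s t) =
    nt_hcomp (tf0 (incl L) A) (tf0 (incl L) C) (tf1 (incl L) A B f') (tf1 (incl L) B C g)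
      (tf2 (incl L) B C g g' s) (tf2 (incl L) A B f f' t)" for A B C f f' g g' t s
    by (simp add: incl_def nt_hcomp_def incl0_simps)
qed

end

section \<open>Coherence of concatenation\<close>

context monoidal_category
begin

text \<open>Naturality of the unit constraints expresses \<open>f\<close> through its tensor product
  with the unit, up to the invertible \<open>lunit\<close> or \<open>runit\<close>.\<close>

lemma tens_unit_faithful:
  assumes "f \<in> arr M" "g \<in> arr M" "src M f = src M g" "tgt M f = tgt M g"
  shows "ide M (munit M) \<star>\<^bsub>M\<^esub> f = ide M (munit M) \<star>\<^bsub>M\<^esub> g \<Longrightarrow> f = g"
    and "f \<star>\<^bsub>M\<^esub> ide M (munit M) = g \<star>\<^bsub>M\<^esub> ide M (munit M) \<Longrightarrow> f = g"
proof -
  assume "ide M (munit M) \<star>\<^bsub>M\<^esub> f = ide M (munit M) \<star>\<^bsub>M\<^esub> g"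
  then have "f \<cdot>\<^bsub>M\<^esub> lunit M (src M f) = g \<cdot>\<^bsub>M\<^esub> lunit M (src M f)"
    using lunit_nat[of f] lunit_nat[of g] assms by simp
  then show "f = g" using assms by (subst (asm) iso_cancel_right) (simp_all add: lunit_iso)
next
  assume "f \<star>\<^bsub>M\<^esub> ide M (munit M) = g \<star>\<^bsub>M\<^esub> ide M (munit M)"
  then have "f \<cdot>\<^bsub>M\<^esub> runit M (src M f) = g \<cdot>\<^bsub>M\<^esub> runit M (src M f)"
    using runit_nat[of f] runit_nat[of g] assms by simp
  then show "f = g" using assms by (subst (asm) iso_cancel_right) (simp_all add: runit_iso)
qed

abbreviation I where "I \<equiv> munit M"
abbreviation ten (infixr "\<odot>" 65) where "x \<odot> y \<equiv> x \<odot>\<^bsub>M\<^esub> y"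
abbreviation sta (infixr "\<star>" 65) where "f \<star> g \<equiv> f \<star>\<^bsub>M\<^esub> g"
abbreviation com (infixr "\<cdot>" 55) where "g \<cdot> f \<equiv> g \<cdot>\<^bsub>M\<^esub> f"
abbreviation "ass x y z \<equiv> massoc M (x, y, z)"
abbreviation "idm x \<equiv> ide M x"

lemma pentagon': "\<lbrakk>w \<in> obj M; x \<in> obj M; y \<in> obj M; z \<in> obj M\<rbrakk>
  \<Longrightarrow> (idm w \<star> ass x y z) \<cdot> ass w (x \<odot> y) z \<cdot> (ass w x y \<star> idm z) = ass w x (y \<odot> z) \<cdot>
      ass (w \<odot> x) y z"
  by (rule pentagon)

text \<open>
  Kelly's argument: tensoring with the unit is faithful, so each of the next three equations may
      be
  checked after tensoring with the unit, where it follows from the pentagon and the triangle.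
\<close>

lemma lunit_tens:
  assumes x: "x \<in> obj M" and y: "y \<in> obj M"
  shows "lunit M (x \<odot> y) \<cdot> ass I x y = lunit M x \<star> idm y"
proof (rule tens_unit_faithful(1))
  let ?p = "ass I (I \<odot> x) y \<cdot> (ass I I x \<star> idm y)"
  have t: "(idm I \<star> lunit M (x \<odot> y)) \<cdot> ass I I (x \<odot> y) = runit M I \<star> idm (x \<odot> y)"
    using triangle[of I "x \<odot> y"] x y by simp
  have "(idm I \<star> (lunit M (x \<odot> y) \<cdot> ass I x y)) \<cdot> ?p =
      (idm I \<star> lunit M (x \<odot> y)) \<cdot> ((idm I \<star> ass I x y) \<cdot> ass I (I \<odot> x) y \<cdot> (ass I I x \<star> idm y))"
    using x y tens_cmp[of "idm I" "ass I x y" "idm I" "lunit M (x \<odot> y)"] by (simp flip: assoc)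
  also have "\<dots> = ((idm I \<star> lunit M (x \<odot> y)) \<cdot> ass I I (x \<odot> y)) \<cdot> ass (I \<odot> I) x y"
    using x y by (simp add: pentagon' assoc)
  also have "\<dots> = ass I x y \<cdot> ((runit M I \<star> idm x) \<star> idm y)"
    using massoc_nat[of "runit M I" "idm x" "idm y"] x y by (simp add: t)
  also have "(runit M I \<star> idm x) \<star> idm y = ((idm I \<star> lunit M x) \<star> idm y) \<cdot> (ass I I x \<star> idm y)"
    using triangle[of I x] x y by (simp add: tens_cmp)
  also have "ass I x y \<cdot> \<dots> = (ass I x y \<cdot> ((idm I \<star> lunit M x) \<star> idm y)) \<cdot> (ass I I x \<star> idm y)"
    using x y by (simp add: assoc)
  also have "\<dots> = (idm I \<star> (lunit M x \<star> idm y)) \<cdot> ?p"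
    using massoc_nat[of "idm I" "lunit M x" "idm y"] x y by (simp add: assoc)
  finally show "idm I \<star> (lunit M (x \<odot> y) \<cdot> ass I x y) = idm I \<star> (lunit M x \<star> idm y)"
    using x y by (subst (asm) iso_cancel_right) (simp_all add: iso_cmp iso_tens iso_ide
        massoc_iso)
qed (use x y in simp_all)

lemma runit_tens:
  assumes x: "x \<in> obj M" and y: "y \<in> obj M"
  shows "(idm x \<star> runit M y) \<cdot> ass x y I = runit M (x \<odot> y)"
proof (rule tens_unit_faithful(2))
  have t: "(idm y \<star> lunit M I) \<cdot> ass y I I = runit M y \<star> idm I"
    using triangle[of y I] y by simp
  have "ass x y I \<cdot> (((idm x \<star> runit M y) \<cdot> ass x y I) \<star> idm I) =
      (ass x y I \<cdot> ((idm x \<star> runit M y) \<star> idm I)) \<cdot> (ass x y I \<star> idm I)"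
    using x y tens_cmp[of "ass x y I" "idm I" "idm x \<star> runit M y" "idm I"] by (simp add: assoc)
  also have "\<dots> = (idm x \<star> (runit M y \<star> idm I)) \<cdot> ass x (y \<odot> I) I \<cdot> (ass x y I \<star> idm I)"
    using massoc_nat[of "idm x" "runit M y" "idm I"] x y by (simp add: assoc)
  also have "idm x \<star> (runit M y \<star> idm I) = (idm x \<star> (idm y \<star> lunit M I)) \<cdot> (idm x \<star> ass y I I)"
    using x y by (simp add: tens_cmp t)
  also have "\<dots> \<cdot> ass x (y \<odot> I) I \<cdot> (ass x y I \<star> idm I) =
      (idm x \<star> (idm y \<star> lunit M I)) \<cdot> (idm x \<star> ass y I I) \<cdot> ass x (y \<odot> I) I \<cdot> (ass x y I \<star> idm I)"
    using x y by (simp add: assoc)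
  also have "\<dots> = ((idm x \<star> (idm y \<star> lunit M I)) \<cdot> ass x y (I \<odot> I)) \<cdot> ass (x \<odot> y) I I"
    using x y by (simp add: pentagon' assoc)
  also have "\<dots> = ass x y I \<cdot> (idm (x \<odot> y) \<star> lunit M I) \<cdot> ass (x \<odot> y) I I"
    using massoc_nat[of "idm x" "idm y" "lunit M I"] x y by (simp flip: assoc)
  also have "\<dots> = ass x y I \<cdot> (runit M (x \<odot> y) \<star> idm I)"
    using triangle[of "x \<odot> y" I] x y by simp
  finally show "((idm x \<star> runit M y) \<cdot> ass x y I) \<star> idm I = runit M (x \<odot> y) \<star> idm I"
    using x y by (subst (asm) iso_cancel_left) (simp_all add: massoc_iso)
qed (use x y in simp_all)

lemma lunit_munit: "lunit M I = runit M I"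
proof (rule tens_unit_faithful(2))
  have "lunit M I \<cdot> lunit M (I \<odot> I) = lunit M I \<cdot> (idm I \<star> lunit M I)"
    using lunit_nat[of "lunit M I"] by simp
  then have "lunit M (I \<odot> I) = idm I \<star> lunit M I"
    by (subst (asm) iso_cancel_left) (simp_all add: lunit_iso)
  then show "lunit M I \<star> idm I = runit M I \<star> idm I"
    using lunit_tens[of I I] triangle[of I I] by simp
qed simp_all

text \<open>The empty list gives a left unit constraint by definition of \<open>phi\<close>, hence
  \<open>lunit_munit\<close> at the base; the step is \<open>runit_tens\<close>. It is needed for
  the strict right unit law on arrows of the strictification.\<close>

lemma phi_unit_right: "xs \<in> lists (obj M) \<Longrightarrow> phi M xs [] = runit M (std_obj M xs)"
proof (induction xs)
  case (Cons x xs)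
  then show ?case
    by (cases "xs = []") (simp_all add: phi_Cons std_obj_Cons runit_tens)
qed (simp add: lunit_munit)

lemma phi_single: "ys \<noteq> [] \<Longrightarrow> phi M [x] ys = idm (x \<odot> std_obj M ys)"
  by (cases ys) simp_all

text \<open>The cocycle identity for reassociation, behind both strict associativity on arrows of
  the strictification and the associativity axiom of its evaluation functor. An empty
  \<open>xs\<close> needs \<open>lunit_tens\<close>, a singleton with empty \<open>ys\<close> the
  triangle, and longer \<open>xs\<close> the pentagon.\<close>

lemma phi_assoc:
  assumes "xs \<in> lists (obj M)" "ys \<in> lists (obj M)" "zs \<in> lists (obj M)"
  shows "phi M (xs @ ys) zs \<cdot> (phi M xs ys \<star> idm (std_obj M zs)) =
    phi M xs (ys @ zs) \<cdot> (idm (std_obj M xs) \<star> phi M ys zs) \<cdot>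
        ass (std_obj M xs) (std_obj M ys) (std_obj M zs)"
  using assms(1)
proof (induction xs)
  case Nil
  let ?Y = "std_obj M ys" and ?Z = "std_obj M zs"
  note [simp] = assms
  have "phi M ([] @ ys) zs \<cdot> (phi M [] ys \<star> idm ?Z) = (phi M ys zs \<cdot> lunit M (?Y \<odot> ?Z)) \<cdot>
      ass I ?Y ?Z"
    by (simp add: assoc lunit_tens)
  also have "\<dots> = (lunit M (std_obj M (ys @ zs)) \<cdot> (idm I \<star> phi M ys zs)) \<cdot> ass I ?Y ?Z"
    using lunit_nat[of "phi M ys zs"] by simp
  finally show ?case by (simp add: assoc)
next
  case (Cons x xs)
  then have x: "x \<in> obj M" and xs: "xs \<in> lists (obj M)" by simp_all
  let ?X = "std_obj M xs" and ?Y = "std_obj M ys" and ?Z = "std_obj M zs"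
  have app: "xs @ ys \<in> lists (obj M)" "ys @ zs \<in> lists (obj M)" using xs assms by auto
  note [simp] = assms(2,3) x xs app
  have s [simp]: "std_obj M (xs @ ys @ zs) \<in> obj M" using xs assms by simp
  have p [simp]: "phi M xs (ys @ zs) \<in> arr M" "src M (phi M xs (ys @ zs)) =
      ?X \<odot> std_obj M (ys @ zs)"
    "tgt M (phi M xs (ys @ zs)) = std_obj M (xs @ ys @ zs)"
    "phi M (xs @ ys) zs \<in> arr M" "src M (phi M (xs @ ys) zs) = std_obj M (xs @ ys) \<odot> ?Z"
    "tgt M (phi M (xs @ ys) zs) = std_obj M (xs @ ys @ zs)"
    using phi_simps[OF xs app(2)] phi_simps[OF app(1) assms(3)] by simp_all
  show ?case
  proof (cases "xs = []")
    case True
    show ?thesis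
    proof (cases "ys = []")
      case True
      \<comment> \<open>\<open>phi M [x] []\<close> is the right unit constraint and
        \<open>phi M [] zs\<close> the left one, so the claim is the triangle.\<close>
      then show ?thesis using \<open>xs = []\<close> triangle[of x ?Z] by simp
    next
      case False
      then show ?thesis using \<open>xs = []\<close> by (simp add: phi_single phi_Cons std_obj_Cons)
    qed
  next
    case False
    have pent: "ass x ?X (?Y \<odot> ?Z) \<cdot> ass (x \<odot> ?X) ?Y ?Z = (idm x \<star> ass ?X ?Y ?Z) \<cdot>
        ass x (?X \<odot> ?Y) ?Z \<cdot> (ass x ?X ?Y \<star> idm ?Z)"
      by (rule pentagon'[symmetric]) simp_all
    \<comment> \<open>\<open>n1\<close> and \<open>n2\<close> pull a reassociation of the tail out
      through the associator with \<open>x\<close>, so that the induction hypothesis applies under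
      tensoring with \<open>x\<close>.\<close>
    have n1: "ass x ?X (std_obj M (ys @ zs)) \<cdot> (idm (x \<odot> ?X) \<star> phi M ys zs) =
        (idm x \<star> (idm ?X \<star> phi M ys zs)) \<cdot> ass x ?X (?Y \<odot> ?Z)"
      using massoc_nat[of "idm x" "idm ?X" "phi M ys zs"] by simp
    have n2: "ass x (std_obj M (xs @ ys)) ?Z \<cdot> ((idm x \<star> phi M xs ys) \<star> idm ?Z) =
        (idm x \<star> (phi M xs ys \<star> idm ?Z)) \<cdot> ass x (?X \<odot> ?Y) ?Z"
      using massoc_nat[of "idm x" "phi M xs ys" "idm ?Z"] by simp
    have "phi M (x # xs) (ys @ zs) \<cdot> (idm (std_obj M (x # xs)) \<star> phi M ys zs) \<cdot>
        ass (std_obj M (x # xs)) ?Y ?Z =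
      (idm x \<star> phi M xs (ys @ zs)) \<cdot> (ass x ?X (std_obj M (ys @ zs)) \<cdot>
          (idm (x \<odot> ?X) \<star> phi M ys zs)) \<cdot> ass (x \<odot> ?X) ?Y ?Z"
      using False by (simp add: phi_Cons std_obj_Cons assoc)
    also have "\<dots> = (idm x \<star> phi M xs (ys @ zs)) \<cdot> (idm x \<star> (idm ?X \<star> phi M ys zs)) \<cdot>
        (ass x ?X (?Y \<odot> ?Z) \<cdot> ass (x \<odot> ?X) ?Y ?Z)"
      unfolding n1 by (simp add: assoc)
    also have "\<dots> = ((idm x \<star> phi M xs (ys @ zs)) \<cdot> (idm x \<star> (idm ?X \<star> phi M ys zs)) \<cdot>
        (idm x \<star> ass ?X ?Y ?Z)) \<cdot>
       ass x (?X \<odot> ?Y) ?Z \<cdot> (ass x ?X ?Y \<star> idm ?Z)"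
      unfolding pent by (simp add: assoc)
    also have "(idm x \<star> phi M xs (ys @ zs)) \<cdot> (idm x \<star> (idm ?X \<star> phi M ys zs)) \<cdot>
        (idm x \<star> ass ?X ?Y ?Z) =
       idm x \<star> (phi M (xs @ ys) zs \<cdot> (phi M xs ys \<star> idm ?Z))"
      using Cons.IH by (simp add: tens_cmp)
    also have "\<dots> = (idm x \<star> phi M (xs @ ys) zs) \<cdot> (idm x \<star> (phi M xs ys \<star> idm ?Z))"
      by (simp add: tens_cmp)
    also have "\<dots> \<cdot> ass x (?X \<odot> ?Y) ?Z \<cdot> (ass x ?X ?Y \<star> idm ?Z) =
       (idm x \<star> phi M (xs @ ys) zs) \<cdot> ((idm x \<star> (phi M xs ys \<star> idm ?Z)) \<cdot> ass x (?X \<odot> ?Y) ?Z) \<cdot>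
           (ass x ?X ?Y \<star> idm ?Z)"
      by (simp add: assoc)
    also have "\<dots> = ((idm x \<star> phi M (xs @ ys) zs) \<cdot> ass x (std_obj M (xs @ ys)) ?Z) \<cdot>
        (((idm x \<star> phi M xs ys) \<star> idm ?Z) \<cdot> (ass x ?X ?Y \<star> idm ?Z))"
      unfolding n2[symmetric] by (simp add: assoc)
    also have "\<dots> = phi M ((x # xs) @ ys) zs \<cdot> (phi M (x # xs) ys \<star> idm ?Z)"
      using False by (simp add: phi_Cons std_obj_Cons tens_cmp)
    finally show ?thesis ..
  qed
qed

end

context monoidal_functor
begin

text \<open>Induction using naturality of \<open>mf2\<close>. Applied to the evaluation functor
  below it becomes naturality of \<open>nest\<close>.\<close>

lemma mfn_natural:
  "fs \<in> lists (arr M) \<Longrightarrow>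
   mfn M N F (map (tgt M) fs) \<cdot>\<^bsub>N\<^esub> std_arr N (map (farr F) fs) = farr F (std_arr M fs) \<cdot>\<^bsub>N\<^esub>
       mfn M N F (map (src M) fs)"
proof (induction fs)
  case Nil then show ?case by (simp add: farr_ide)
next
  case (Cons f fs)
  then have f: "f \<in> arr M" and fs: "fs \<in> lists (arr M)" by simp_all
  show ?case
  proof (cases "fs = []")
    case True then show ?thesis using f by simp
  next
    case False
    let ?s = "std_arr M fs" and ?S = "std_arr N (map (farr F) fs)"
    let ?t = "mfn M N F (map (tgt M) fs)" and ?u = "mfn M N F (map (src M) fs)"
    have l: "map (src M) fs \<in> lists (obj M)" "map (tgt M) fs \<in> lists (obj M)"
        "map (farr F) fs \<in> lists (arr N)"
      using fs by (auto simp: in_lists_conv_set)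
    have e: "map (src N) (map (farr F) fs) = map (fobj F) (map (src M) fs)"
        "map (tgt N) (map (farr F) fs) = map (fobj F) (map (tgt M) fs)"
      using fs by (auto simp: in_lists_conv_set)
    note ty = dom_mon.std_arr_simps[OF fs] cod_mon.std_arr_simps[OF l(3), unfolded e] mfn_simps[OF
        l(1)] mfn_simps[OF l(2)]
    have o: "std_obj M (map (src M) fs) \<in> obj M" "std_obj M (map (tgt M) fs) \<in> obj M" using l
        by simp_all
    have "mfn M N F (map (tgt M) (f # fs)) \<cdot>\<^bsub>N\<^esub> std_arr N (map (farr F) (f # fs)) =
      mf2 F (tgt M f, std_obj M (map (tgt M) fs)) \<cdot>\<^bsub>N\<^esub> ((ide N (fobj F (tgt M f)) \<cdot>\<^bsub>N\<^esub>
          farr F f) \<star>\<^bsub>N\<^esub> (?t \<cdot>\<^bsub>N\<^esub> ?S))"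
      using False f ty o by (simp add: mfn_Cons std_arr_Cons cod_mon.assoc cod_mon.tens_cmp del:
          map_map)
    also have "\<dots> = (mf2 F (tgt M f, tgt M ?s) \<cdot>\<^bsub>N\<^esub> (farr F f \<star>\<^bsub>N\<^esub> farr F ?s)) \<cdot>\<^bsub>N\<^esub>
        (ide N (fobj F (src M f)) \<star>\<^bsub>N\<^esub> ?u)"
      using f ty o Cons.IH[OF fs] by (simp add: cod_mon.assoc cod_mon.tens_cmp)
    also have "\<dots> = farr F (f \<star>\<^bsub>M\<^esub> ?s) \<cdot>\<^bsub>N\<^esub> mf2 F (src M f, src M ?s) \<cdot>\<^bsub>N\<^esub>
        (ide N (fobj F (src M f)) \<star>\<^bsub>N\<^esub> ?u)"
      using f ty o by (subst mf2_nat) (simp_all add: cod_mon.assoc)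
    finally show ?thesis using False f ty by (simp add: mfn_Cons std_arr_Cons)
  qed
qed

end

section \<open>Injections of lists\<close>

text \<open>Lists of a fixed length are bounded in cardinality by the infinite type, by induction
  splitting off the head; all lists form a countable union of such sets.\<close>

lemma ex_inj_lists: "\<exists>e :: 'x::infinite list \<Rightarrow> 'x. inj e"
proof -
  let ?B = "UNIV :: 'x set"
  have inf: "\<not> finite ?B" by (rule infinite_UNIV)
  have len: "(card_of {xs :: 'x list. length xs = n}, card_of ?B) \<in> ordLeq" for n
  proof (induction n)
    case 0
    show ?case by (rule card_of_ordLeq[THEN iffD1]) (auto simp: inj_on_def)
  next
    case (Suc n)
    let ?f = "\<lambda>xs :: 'x list. (hd xs, tl xs)"
    have "inj_on ?f {xs. length xs = Suc n}"
      by (rule inj_onI) (simp, metis list.collapse list.size(3) nat.distinct(1))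
    moreover have "?f ` {xs. length xs = Suc n} \<subseteq> (SIGMA i : ?B. {xs. length xs = n})"
      by (rule image_subsetI) simp
    ultimately have "(card_of {xs :: 'x list. length xs =
        Suc n}, card_of (SIGMA i : ?B. {xs :: 'x list. length xs = n})) \<in> ordLeq"
      unfolding card_of_ordLeq[symmetric] by (intro exI[of _ ?f] conjI)
    moreover have "(card_of (SIGMA i : ?B. {xs :: 'x list. length xs = n}), card_of ?B) \<in> ordLeq"
      by (rule card_of_Sigma_ordLeq_infinite[OF inf]) (use Suc card_of_mono1 in auto)
    ultimately show ?case by (rule ordLeq_transitive)
  qed
  have "(card_of (\<Union>n \<in> (UNIV :: nat set). {xs :: 'x list. length xs = n}), card_of ?B) \<in> ordLeq"
    by (rule card_of_UNION_ordLeq_infinite[OF inf]) (use len inf in \<open>auto simp: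
        infinite_iff_card_of_nat\<close>)
  moreover have "(\<Union>n \<in> (UNIV :: nat set). {xs :: 'x list. length xs = n}) = UNIV" by auto
  ultimately have "\<exists>f :: 'x list \<Rightarrow> 'x. inj_on f UNIV \<and> f ` UNIV \<subseteq> UNIV"
    by (simp only: card_of_ordLeq)
  then show ?thesis by blast
qed

section \<open>Strictification\<close>

text \<open>
  Objects of the strictification are lists of objects of \<open>M\<close>, and an arrow from \<open>xs\<close> to \<open>ys\<close> is an
  arrow \<open>std_obj M xs \<rightarrow> std_obj M ys\<close>; \<open>enc\<close> and \<open>ea\<close> encode lists and arrows with their
  endpoints in the types that carry \<open>M\<close>.
\<close>

locale strictification = weak_op L M for L :: "'g action_operad_data"
    and M :: "('o, 'a, 'g) wk_mon_cat" +
  fixes enc :: "'o list \<Rightarrow> 'o" and ea :: "'o list \<times> 'o list \<times> 'a \<Rightarrow> 'a"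
  assumes enc_inj: "inj_on enc (lists (obj M))"
    and ea_inj: "inj_on ea {(xs, ys, f). xs \<in> lists (obj M) \<and> ys \<in> lists (obj M) \<and>
      f \<in> homset M (std_obj M xs) (std_obj M ys)}"
begin

definition hom :: "'o list \<Rightarrow> 'o list \<Rightarrow> 'a \<Rightarrow> bool" where
  "hom xs ys f \<longleftrightarrow> xs \<in> lists (obj M) \<and> ys \<in> lists (obj M) \<and>
      f \<in> homset M (std_obj M xs) (std_obj M ys)"

definition dec :: "'o \<Rightarrow> 'o list" where "dec = inv_into (lists (obj M)) enc"
definition da :: "'a \<Rightarrow> 'o list \<times> 'o list \<times> 'a" where "da = inv_into {(xs, ys, f). hom xs ys f} ea"
definition E :: "'o list \<Rightarrow> 'o list \<Rightarrow> 'a \<Rightarrow> 'a" where "E xs ys f = ea (xs, ys, f)"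

text \<open>Tensor product of arrows \<open>xs\<close> to \<open>xs'\<close> and \<open>ys\<close>
  to \<open>ys'\<close> in the strictification: the tensor product in \<open>M\<close>, conjugated
  by the reassociations to the concatenated lists.\<close>

definition bx :: "'o list \<Rightarrow> 'o list \<Rightarrow> 'o list \<Rightarrow> 'o list \<Rightarrow> 'a \<Rightarrow> 'a \<Rightarrow> 'a" where
  "bx xs xs' ys ys' f g = phi M xs' ys' \<cdot> (f \<star> g) \<cdot> inv_arr M (phi M xs ys)"

definition wd :: "'g \<Rightarrow> 'o list list \<Rightarrow> 'a" where
  "wd g xss = wact M (delta L (map length xss) g, concat xss)"

abbreviation "SO \<equiv> enc ` lists (obj M)"
abbreviation "SA \<equiv> {a. \<exists>xs ys f. a = E xs ys f \<and> hom xs ys f}"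

text \<open>Different lists may have the same tensor product, so endpoints and composability are
  read off the codes and not from the underlying arrows of \<open>M\<close>.\<close>

definition S :: "('o, 'a, 'g) wk_mon_cat" where
  "S = \<lparr>obj = SO, arr = SA,
     src = (\<lambda>a\<in>SA. enc (fst (da a))), tgt = (\<lambda>a\<in>SA. enc (fst (snd (da a)))),
     ide = (\<lambda>b\<in>SO. E (dec b) (dec b) (ide M (std_obj M (dec b)))),
     cmp = restrict (\<lambda>(b, a). E (fst (da a)) (fst (snd (da b))) (snd (snd (da b)) \<cdot>
         snd (snd (da a))))
       {(b, a). b \<in> SA \<and> a \<in> SA \<and> enc (fst (da b)) = enc (fst (snd (da a)))},
     tens = \<lparr>fobj = restrict (\<lambda>(b, c). enc (dec b @ dec c)) (SO \<times> SO),
       farr = restrict (\<lambda>(a, b). case da a of (xs, xs', f) \<Rightarrow> case da b of (ys, ys', g) \<Rightarrow>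
         E (xs @ ys) (xs' @ ys') (bx xs xs' ys ys' f g)) (SA \<times> SA)\<rparr>,
     munit = enc [],
     massoc = restrict (\<lambda>(b, c, d). E (dec b @ dec c @ dec d) (dec b @ dec c @ dec d)
       (ide M (std_obj M (dec b @ dec c @ dec d)))) (SO \<times> SO \<times> SO),
     lunit = (\<lambda>b\<in>SO. E (dec b) (dec b) (ide M (std_obj M (dec b)))),
     runit = (\<lambda>b\<in>SO. E (dec b) (dec b) (ide M (std_obj M (dec b)))),
     wact = restrict (\<lambda>(g, bs). E (concat (map dec bs)) (concat (lact L g (map dec bs))) (wd g
         (map dec bs)))
       (opre L SO)\<rparr>"

lemma dec_enc [simp]: "xs \<in> lists (obj M) \<Longrightarrow> dec (enc xs) = xs"
  unfolding dec_def by (rule inv_into_f_f[OF enc_inj])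

lemma da_E [simp]: "hom xs ys f \<Longrightarrow> da (E xs ys f) = (xs, ys, f)"
  unfolding da_def E_def hom_def by (rule inv_into_f_f[OF ea_inj]) simp

lemma homD:
  assumes "hom xs ys f"
  shows "xs \<in> lists (obj M)" "ys \<in> lists (obj M)" "f \<in> arr M" "src M f = std_obj M xs" "tgt M f =
      std_obj M ys"
  using assms by (simp_all add: hom_def homset_def)

lemma homI:
  "xs \<in> lists (obj M) \<Longrightarrow> ys \<in> lists (obj M) \<Longrightarrow> f \<in> arr M \<Longrightarrow> src M f = std_obj M xs \<Longrightarrow>
   tgt M f = std_obj M ys \<Longrightarrow> hom xs ys f"
  by (simp add: hom_def homset_def)

lemma hom_ide [simp]: "xs \<in> lists (obj M) \<Longrightarrow> hom xs xs (ide M (std_obj M xs))"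
  by (rule homI) simp_all

lemma hom_cmp: "hom xs ys f \<Longrightarrow> hom ys zs g \<Longrightarrow> hom xs zs (g \<cdot> f)"
  by (rule homI) (simp_all add: homD)

lemma obj_S: "obj S = SO" by (simp add: S_def)
lemma arr_S: "arr S = SA" by (simp add: S_def)

lemma enc_obj [simp]: "xs \<in> lists (obj M) \<Longrightarrow> enc xs \<in> obj S" by (auto simp: obj_S)
lemma E_arr [simp]: "hom xs ys f \<Longrightarrow> E xs ys f \<in> arr S" by (auto simp: arr_S)

lemma obj_cases:
  assumes "b \<in> obj S" obtains xs where "xs \<in> lists (obj M)" "b = enc xs"
  using assms unfolding obj_S by (elim imageE)

lemma arr_cases:
  assumes "a \<in> arr S" obtains xs ys f where "hom xs ys f" "a = E xs ys f"
  using assms unfolding arr_S by blast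

lemma enc_eq [simp]: "xs \<in> lists (obj M) \<Longrightarrow> ys \<in> lists (obj M) \<Longrightarrow> enc xs = enc ys \<longleftrightarrow> xs = ys"
  by (metis dec_enc)

lemma src_S [simp]: "hom xs ys f \<Longrightarrow> src S (E xs ys f) = enc xs"
  using E_arr[of xs ys f] unfolding arr_S by (simp add: S_def)
lemma tgt_S [simp]: "hom xs ys f \<Longrightarrow> tgt S (E xs ys f) = enc ys"
  using E_arr[of xs ys f] unfolding arr_S by (simp add: S_def)
lemma ide_S [simp]: "xs \<in> lists (obj M) \<Longrightarrow> ide S (enc xs) = E xs xs (ide M (std_obj M xs))"
  by (simp add: S_def)
lemma cmp_S [simp]: "hom xs ys f \<Longrightarrow> hom ys zs g \<Longrightarrow> E ys zs g \<cdot>\<^bsub>S\<^esub> E xs ys f = E xs zs (g \<cdot> f)"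
  using E_arr[of xs ys f] E_arr[of ys zs g] unfolding arr_S by (simp add: S_def)
lemma tobj_S [simp]: "xs \<in> lists (obj M) \<Longrightarrow> ys \<in> lists (obj M) \<Longrightarrow> enc xs \<odot>\<^bsub>S\<^esub> enc ys =
    enc (xs @ ys)"
  by (simp add: S_def)
lemma tarr_S [simp]: "hom xs xs' f \<Longrightarrow> hom ys ys' g \<Longrightarrow>
    E xs xs' f \<star>\<^bsub>S\<^esub> E ys ys' g = E (xs @ ys) (xs' @ ys') (bx xs xs' ys ys' f g)"
  using E_arr[of xs xs' f] E_arr[of ys ys' g] unfolding arr_S by (simp add: S_def)
lemma munit_S [simp]: "munit S = enc []" by (simp add: S_def)
lemma massoc_S [simp]: "xs \<in> lists (obj M) \<Longrightarrow> ys \<in> lists (obj M) \<Longrightarrow> zs \<in> lists (obj M) \<Longrightarrow>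
    massoc S (enc xs, enc ys, enc zs) = E (xs @ ys @ zs) (xs @ ys @ zs) (ide M (std_obj M (xs @ ys
        @ zs)))"
  by (simp add: S_def)
lemma lunit_S [simp]: "xs \<in> lists (obj M) \<Longrightarrow> lunit S (enc xs) = E xs xs (ide M (std_obj M xs))"
  by (simp add: S_def)
lemma runit_S [simp]: "xs \<in> lists (obj M) \<Longrightarrow> runit S (enc xs) = E xs xs (ide M (std_obj M xs))"
  by (simp add: S_def)

lemma map_dec_enc [simp]: "xss \<in> lists (lists (obj M)) \<Longrightarrow> map (dec \<circ> enc) xss = xss"
  by (rule map_idI) (auto simp: in_lists_conv_set[of xss])

lemma lists_obj_cases:
  assumes "bs \<in> lists (obj S)" obtains xss where "xss \<in> lists (lists (obj M))" "bs = map enc xss"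
  using assms unfolding obj_S lists_image by (elim imageE)

lemma map_enc_lists [simp]: "xss \<in> lists (lists (obj M)) \<Longrightarrow> map enc xss \<in> lists (obj S)"
  by (erule map_in_lists) simp

lemma wact_S [simp]: "xss \<in> lists (lists (obj M)) \<Longrightarrow> g \<in> el L (length xss) \<Longrightarrow>
    wact S (g, map enc xss) = E (concat xss) (concat (lact L g xss)) (wd g xss)"
  using map_enc_lists[of xss] unfolding obj_S by (simp add: S_def)

lemma phi_tens_simps:
  assumes "hom xs xs' f" "hom ys ys' g"
  shows "f \<star> g \<in> arr M" "src M (f \<star> g) = std_obj M xs \<odot> std_obj M ys" "tgt M (f \<star> g) =
      std_obj M xs' \<odot> std_obj M ys'"
    "iso_arr M (phi M xs ys)" "phi M xs ys \<in> arr M" "src M (phi M xs ys) =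
        std_obj M xs \<odot> std_obj M ys"
    "tgt M (phi M xs ys) = std_obj M (xs @ ys)"
    "phi M xs' ys' \<in> arr M" "src M (phi M xs' ys') = std_obj M xs' \<odot> std_obj M ys'"
        "tgt M (phi M xs' ys') = std_obj M (xs' @ ys')"
    "inv_arr M (phi M xs ys) \<in> arr M" "src M (inv_arr M (phi M xs ys)) = std_obj M (xs @ ys)"
    "tgt M (inv_arr M (phi M xs ys)) = std_obj M xs \<odot> std_obj M ys"
  using homD[OF assms(1)] homD[OF assms(2)] by (simp_all add: iso_simps)

lemma hom_bx [simp]: "hom xs xs' f \<Longrightarrow> hom ys ys' g \<Longrightarrow>
    hom (xs @ ys) (xs' @ ys') (bx xs xs' ys ys' f g)"
  unfolding bx_def by (rule homI) (use phi_tens_simps in \<open>simp_all add: homD\<close>)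

lemma bx_phi:
  assumes "hom xs xs' f" "hom ys ys' g"
  shows "bx xs xs' ys ys' f g \<cdot> phi M xs ys = phi M xs' ys' \<cdot> (f \<star> g)"
  unfolding bx_def using phi_tens_simps[OF assms] by (simp add: assoc iso_simps)

text \<open>\<open>phi\<close> is invertible, so its intertwining equation determines
  \<open>bx\<close>; later identities are checked this way without handling inverses.\<close>

lemma bx_unique:
  assumes "hom xs xs' f" "hom ys ys' g" "hom (xs @ ys) (xs' @ ys') h" "h \<cdot> phi M xs ys =
      phi M xs' ys' \<cdot> (f \<star> g)"
  shows "bx xs xs' ys ys' f g = h"
proof -
  have "bx xs xs' ys ys' f g \<cdot> phi M xs ys = h \<cdot> phi M xs ys" using bx_phi[OF assms(1,2)] assms(4)
      by simp
  then show ?thesis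
    using phi_tens_simps[OF assms(1,2)] homD[OF hom_bx[OF assms(1,2)]] homD[OF assms(3)]
    by (subst (asm) iso_cancel_right) simp_all
qed

text \<open>The reassociations at source and at target are rearranged by \<open>phi_assoc\<close>;
  between them naturality of the associator moves it past the three arrows.\<close>

lemma bx_assoc:
  assumes f: "hom xs xs' f" and g: "hom ys ys' g" and h: "hom zs zs' h"
  shows "bx xs xs' (ys @ zs) (ys' @ zs') f (bx ys ys' zs zs' g h) =
      bx (xs @ ys) (xs' @ ys') zs zs' (bx xs xs' ys ys' f g) h"
    (is "_ = ?h")
proof (rule bx_unique)
  note [simp] = homD[OF f] homD[OF g] homD[OF h]
  note fg = hom_bx[OF f g] and gh = hom_bx[OF g h]
  note [simp] = homD[OF fg] homD[OF gh]
  let ?X = "std_obj M xs" and ?Y = "std_obj M ys" and ?Z = "std_obj M zs"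
  let ?X' = "std_obj M xs'" and ?Y' = "std_obj M ys'" and ?Z' = "std_obj M zs'"
  show "hom (xs @ ys @ zs) (xs' @ ys' @ zs') ?h" using hom_bx[OF fg h] by simp
  note [simp] = homD[OF this]
  \<comment> \<open>Precomposing with this isomorphism produces the right-hand side of
    \<open>phi_assoc\<close>; it is cancelled at the end.\<close>
  let ?a = "(idm ?X \<star> phi M ys zs) \<cdot> ass ?X ?Y ?Z"
  have pr: "phi M xs (ys @ zs) \<in> arr M" "src M (phi M xs (ys @ zs)) = ?X \<odot> std_obj M (ys @ zs)"
    "tgt M (phi M xs (ys @ zs)) = tgt M (phi M (xs @ ys) zs)"
    "phi M xs' (ys' @ zs') \<in> arr M" "src M (phi M xs' (ys' @ zs')) = ?X' \<odot> std_obj M (ys' @ zs')"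
    "tgt M (phi M xs' (ys' @ zs')) = tgt M (phi M (xs' @ ys') zs')"
    by simp_all
  have pl: "phi M (xs @ ys) zs \<in> arr M" "src M (phi M (xs @ ys) zs) = std_obj M (xs @ ys) \<odot> ?Z"
    "phi M (xs' @ ys') zs' \<in> arr M" "src M (phi M (xs' @ ys') zs') = std_obj M (xs' @ ys') \<odot> ?Z'"
    by simp_all
  have hh: "?h \<in> arr M" "src M ?h = tgt M (phi M (xs @ ys) zs)" "tgt M ?h =
      tgt M (phi M (xs' @ ys') zs')" by simp_all
  have "(?h \<cdot> phi M xs (ys @ zs)) \<cdot> ?a = ?h \<cdot> (phi M (xs @ ys) zs \<cdot> (phi M xs ys \<star> idm ?Z))"
    using phi_assoc[of xs ys zs] pr hh by (simp add: assoc)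
  also have "\<dots> = (?h \<cdot> phi M (xs @ ys) zs) \<cdot> (phi M xs ys \<star> idm ?Z)"
    using pl hh by (simp add: assoc)
  also have "?h \<cdot> phi M (xs @ ys) zs = phi M (xs' @ ys') zs' \<cdot> (bx xs xs' ys ys' f g \<star> h)"
    by (rule bx_phi[OF fg h])
  also have "\<dots> \<cdot> (phi M xs ys \<star> idm ?Z) = phi M (xs' @ ys') zs' \<cdot> ((bx xs xs' ys ys' f g \<cdot>
      phi M xs ys) \<star> h)"
    using pl by (simp add: assoc tens_cmp)
  also have "\<dots> = (phi M (xs' @ ys') zs' \<cdot> (phi M xs' ys' \<star> idm ?Z')) \<cdot> ((f \<star> g) \<star> h)"
    unfolding bx_phi[OF f g] using pl by (simp add: assoc tens_cmp)
  also have "\<dots> = phi M xs' (ys' @ zs') \<cdot> (idm ?X' \<star> phi M ys' zs') \<cdot> (ass ?X' ?Y' ?Z' \<cdot>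
      ((f \<star> g) \<star> h))"
    using phi_assoc[of xs' ys' zs'] pr by (simp add: assoc)
  also have "ass ?X' ?Y' ?Z' \<cdot> ((f \<star> g) \<star> h) = (f \<star> (g \<star> h)) \<cdot> ass ?X ?Y ?Z"
    using massoc_nat[of f g h] by simp
  also have "phi M xs' (ys' @ zs') \<cdot> (idm ?X' \<star> phi M ys' zs') \<cdot> \<dots> = phi M xs' (ys' @ zs') \<cdot>
      (f \<star> (phi M ys' zs' \<cdot> (g \<star> h))) \<cdot> ass ?X ?Y ?Z"
    using pr by (simp add: tens_cmp flip: assoc)
  also have "\<dots> = (phi M xs' (ys' @ zs') \<cdot> (f \<star> bx ys ys' zs zs' g h)) \<cdot> ?a"
    unfolding bx_phi[OF g h, symmetric] using pr
        by (simp add: assoc) (simp add: tens_cmp flip: assoc)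
  finally show "?h \<cdot> phi M xs (ys @ zs) = phi M xs' (ys' @ zs') \<cdot> (f \<star> bx ys ys' zs zs' g h)"
    using pr hh by (subst (asm) iso_cancel_right) (simp_all add: iso_cmp iso_tens iso_ide
        massoc_iso)
qed (fact f hom_bx[OF g h])+

lemma category_S: "category S"
proof (rule categoryI)
  show "src S \<in> arr S \<rightarrow>\<^sub>E obj S"
  proof (rule PiE_I)
    fix a assume "a \<in> arr S" then show "src S a \<in> obj S" by (elim arr_cases) (simp add: homD)
  next
    fix a assume "a \<notin> arr S" then show "src S a = undefined" unfolding arr_S by (auto simp: S_def)
  qed
  show "tgt S \<in> arr S \<rightarrow>\<^sub>E obj S"
  proof (rule PiE_I)
    fix a assume "a \<in> arr S" then show "tgt S a \<in> obj S" by (elim arr_cases) (simp add: homD)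
  next
    fix a assume "a \<notin> arr S" then show "tgt S a = undefined" unfolding arr_S by (auto simp: S_def)
  qed
  show "ide S \<in> obj S \<rightarrow>\<^sub>E arr S"
  proof (rule PiE_I)
    fix b assume "b \<in> obj S" then show "ide S b \<in> arr S" by (elim obj_cases) simp
  next
    fix b assume "b \<notin> obj S" then show "ide S b = undefined" unfolding obj_S by (simp add: S_def)
  qed
  have "composable S = {(b, a). b \<in> SA \<and> a \<in> SA \<and> enc (fst (da b)) = enc (fst (snd (da a)))}"
    unfolding composable_def arr_S by (rule Collect_cong) (auto simp: homD)
  then show "cmp S \<in> extensional (composable S)" by (simp add: S_def)
next
  fix b assume "b \<in> obj S"
  then show "src S (ide S b) = b \<and> tgt S (ide S b) = b" by (elim obj_cases) simp
next
  fix b a assume "b \<in> arr S" "a \<in> arr S" "src S b = tgt S a"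
  then obtain xs ys f ys' zs g where "hom xs ys f" "a = E xs ys f" "hom ys' zs g" "b = E ys' zs g"
      "src S b = tgt S a"
    by (elim arr_cases) simp
  moreover from this have "ys' = ys" by (simp add: homD)
  ultimately show "b \<cdot>\<^bsub>S\<^esub> a \<in> arr S \<and> src S (b \<cdot>\<^bsub>S\<^esub> a) = src S a \<and> tgt S (b \<cdot>\<^bsub>S\<^esub> a) = tgt S b"
    by (simp add: hom_cmp)
next
  fix a assume "a \<in> arr S"
  then obtain xs ys f where a: "hom xs ys f" "a = E xs ys f" by (rule arr_cases)
  then show "a \<cdot>\<^bsub>S\<^esub> ide S (src S a) = a" "ide S (tgt S a) \<cdot>\<^bsub>S\<^esub> a = a"
    using homD[OF a(1)] by simp_all
next
  fix c b a assume "c \<in> arr S" "b \<in> arr S" "a \<in> arr S" "src S c = tgt S b" "src S b = tgt S a"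
  then obtain xs ys f ys' zs g zs' us h where *: "hom xs ys f" "a = E xs ys f" "hom ys' zs g" "b =
      E ys' zs g"
    "hom zs' us h" "c = E zs' us h" "src S c = tgt S b" "src S b = tgt S a"
    by (elim arr_cases) simp
  from * have e: "ys' = ys" "zs' = zs" by (simp_all add: homD)
  then show "(c \<cdot>\<^bsub>S\<^esub> b) \<cdot>\<^bsub>S\<^esub> a = c \<cdot>\<^bsub>S\<^esub> (b \<cdot>\<^bsub>S\<^esub> a)"
    using * hom_cmp[of xs ys f zs g] hom_cmp[of ys zs g us h] by (simp add: assoc homD)
qed

lemma lists_Nil: "[] \<in> lists (obj M)" by simp

text \<open>On objects the laws are those of list concatenation. On arrows each law is an instance
  of \<open>bx_unique\<close> or \<open>bx_assoc\<close>; the unit laws use naturality of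
  \<open>lunit\<close> and \<open>runit\<close>, the right one through
  \<open>phi_unit_right\<close>.\<close>

lemma monoidal_S: "monoidal_category S \<and> strict_monoidal S"
proof (rule strict_monoidal_categoryI)
  show "category S" by (rule category_S)
  show "fobj (tens S) \<in> obj S \<times> obj S \<rightarrow>\<^sub>E obj S"
  proof (rule PiE_I)
    fix p assume "p \<in> obj S \<times> obj S"
    then show "fobj (tens S) p \<in> obj S" by (elim SigmaE obj_cases) simp
  next
    fix p assume "p \<notin> obj S \<times> obj S"
    then show "fobj (tens S) p = undefined" unfolding obj_S by (simp add: S_def)
  qed
  show "farr (tens S) \<in> arr S \<times> arr S \<rightarrow>\<^sub>E arr S"
  proof (rule PiE_I)
    fix p assume "p \<in> arr S \<times> arr S"
    then show "farr (tens S) p \<in> arr S" by (elim SigmaE arr_cases) simp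
  next
    fix p assume "p \<notin> arr S \<times> arr S"
    then show "farr (tens S) p = undefined" unfolding arr_S by (auto simp: S_def)
  qed
  show "munit S \<in> obj S" by simp
  show "massoc S = restrict (\<lambda>(x, y, z). ide S (x \<odot>\<^bsub>S\<^esub> (y \<odot>\<^bsub>S\<^esub> z))) (obj S \<times> obj S \<times> obj S)"
  proof (rule extensionalityI[of _ "obj S \<times> obj S \<times> obj S"])
    show "massoc S \<in> extensional (obj S \<times> obj S \<times> obj S)" unfolding obj_S by (simp add: S_def)
    fix p assume "p \<in> obj S \<times> obj S \<times> obj S"
    then show "massoc S p = restrict (\<lambda>(x, y, z). ide S (x \<odot>\<^bsub>S\<^esub> (y \<odot>\<^bsub>S\<^esub>
        z))) (obj S \<times> obj S \<times> obj S) p"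
      by (elim SigmaE obj_cases) simp
  qed simp
  show "lunit S = (\<lambda>x\<in>obj S. ide S x)" "runit S = (\<lambda>x\<in>obj S. ide S x)"
    unfolding obj_S by (rule restrict_ext | simp add: S_def)+
next
  fix a b assume "a \<in> arr S" "b \<in> arr S"
  then show "src S (a \<star>\<^bsub>S\<^esub> b) = src S a \<odot>\<^bsub>S\<^esub> src S b \<and> tgt S (a \<star>\<^bsub>S\<^esub> b) = tgt S a \<odot>\<^bsub>S\<^esub> tgt S b"
    by (elim arr_cases) (simp add: homD)
next
  fix x y assume "x \<in> obj S" "y \<in> obj S"
  then obtain xs ys where *: "xs \<in> lists (obj M)" "x = enc xs" "ys \<in> lists (obj M)" "y = enc ys"
    by (elim obj_cases) simp
  have "bx xs xs ys ys (ide M (std_obj M xs)) (ide M (std_obj M ys)) =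
      ide M (std_obj M (xs @ ys))"
    by (rule bx_unique) (use * in simp_all)
  then show "ide S x \<star>\<^bsub>S\<^esub> ide S y = ide S (x \<odot>\<^bsub>S\<^esub> y)" using * by simp
next
  fix a b a' b' assume "a \<in> arr S" "b \<in> arr S" "a' \<in> arr S" "b' \<in> arr S" "src S a' = tgt S a"
      "src S b' = tgt S b"
  then obtain xs ys f ys' zs f' us vs g vs' ws g' where *: "hom xs ys f" "a = E xs ys f"
      "hom ys' zs f'" "a' = E ys' zs f'"
    "hom us vs g" "b = E us vs g" "hom vs' ws g'" "b' = E vs' ws g'" "src S a' = tgt S a"
        "src S b' = tgt S b"
    by (elim arr_cases) simp
  from * have e: "ys' = ys" "vs' = vs" by (simp_all add: homD)
  note h = *(1) *(5) *(3)[unfolded e] *(7)[unfolded e]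
  note hd = homD[OF h(1)] homD[OF h(2)] homD[OF h(3)] homD[OF h(4)]
  have "bx xs zs us ws (f' \<cdot> f) (g' \<cdot> g) = bx ys zs vs ws f' g' \<cdot> bx xs ys us vs f g"
  proof (rule bx_unique)
    show "hom xs zs (f' \<cdot> f)" "hom us ws (g' \<cdot> g)" using h by (auto intro: hom_cmp)
    show "hom (xs @ us) (zs @ ws) (bx ys zs vs ws f' g' \<cdot> bx xs ys us vs f g)"
      by (rule hom_cmp[OF hom_bx[OF h(1,2)] hom_bx[OF h(3,4)]])
    note p = phi_tens_simps[OF h(1,2)] phi_tens_simps[OF h(3,4)]
    have "(bx ys zs vs ws f' g' \<cdot> bx xs ys us vs f g) \<cdot> phi M xs us = bx ys zs vs ws f' g' \<cdot>
        (bx xs ys us vs f g \<cdot> phi M xs us)"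
      using p homD[OF hom_bx[OF h(1,2)]] homD[OF hom_bx[OF h(3,4)]] by (simp add: assoc)
    also have "\<dots> = (bx ys zs vs ws f' g' \<cdot> phi M ys vs) \<cdot> (f \<star> g)"
      unfolding bx_phi[OF h(1,2)] using p homD[OF hom_bx[OF h(3,4)]] by (simp add: assoc)
    also have "\<dots> = phi M zs ws \<cdot> ((f' \<cdot> f) \<star> (g' \<cdot> g))"
      unfolding bx_phi[OF h(3,4)] using p hd by (simp add: assoc tens_cmp)
    finally show "(bx ys zs vs ws f' g' \<cdot> bx xs ys us vs f g) \<cdot> phi M xs us = phi M zs ws \<cdot> ((f' \<cdot>
        f) \<star> (g' \<cdot> g))" .
  qed
  then show "(a' \<cdot>\<^bsub>S\<^esub> a) \<star>\<^bsub>S\<^esub> (b' \<cdot>\<^bsub>S\<^esub> b) = (a' \<star>\<^bsub>S\<^esub> b') \<cdot>\<^bsub>S\<^esub> (a \<star>\<^bsub>S\<^esub> b)"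
    using * h by (simp add: e hom_cmp)
next
  fix x y z assume "x \<in> obj S" "y \<in> obj S" "z \<in> obj S"
  then show "(x \<odot>\<^bsub>S\<^esub> y) \<odot>\<^bsub>S\<^esub> z = x \<odot>\<^bsub>S\<^esub> (y \<odot>\<^bsub>S\<^esub> z)" by (elim obj_cases) simp
next
  fix a b c assume "a \<in> arr S" "b \<in> arr S" "c \<in> arr S"
  then show "(a \<star>\<^bsub>S\<^esub> b) \<star>\<^bsub>S\<^esub> c = a \<star>\<^bsub>S\<^esub> (b \<star>\<^bsub>S\<^esub> c)" by (elim arr_cases) (simp add: bx_assoc)
next
  fix x assume "x \<in> obj S"
  then show "munit S \<odot>\<^bsub>S\<^esub> x = x \<and> x \<odot>\<^bsub>S\<^esub> munit S = x" by (elim obj_cases) simp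
next
  fix a assume "a \<in> arr S"
  then obtain xs ys f where a: "hom xs ys f" "a = E xs ys f" by (rule arr_cases)
  note h = homD[OF a(1)]
  have i: "hom [] [] (ide M I)" using hom_ide[OF lists_Nil] by simp
  have "bx [] [] xs ys (ide M I) f = f"
    by (rule bx_unique[OF i a(1)]) (use a h lunit_nat[of f] in simp_all)
  moreover have "bx xs ys [] [] f (ide M I) = f"
    by (rule bx_unique[OF a(1) i]) (use a h runit_nat[of f] in \<open>simp_all add: phi_unit_right\<close>)
  ultimately show "ide S (munit S) \<star>\<^bsub>S\<^esub> a = a \<and> a \<star>\<^bsub>S\<^esub> ide S (munit S) = a"
    using a i by simp
qed

end

section \<open>Evaluation of lists and the weak structure on the strictification\<close>

context strictification
begin

sublocale S: monoidal_category S using monoidal_S by simp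

text \<open>Evaluation: a list goes to its tensor product and an arrow forgets its endpoints, so
  \<open>Gf\<close> is faithful.\<close>

definition Gf :: "('o, 'a) mon_fctr" where
  "Gf = \<lparr>fobj = (\<lambda>b\<in>obj S. std_obj M (dec b)), farr = (\<lambda>a\<in>arr S. snd (snd (da a))),
     mf2 = restrict (\<lambda>(b, c). phi M (dec b) (dec c)) (obj S \<times> obj S), mf0 = ide M I\<rparr>"

lemma Gf_simps [simp]:
  "xs \<in> lists (obj M) \<Longrightarrow> fobj Gf (enc xs) = std_obj M xs"
  "hom xs ys f \<Longrightarrow> farr Gf (E xs ys f) = f"
  "xs \<in> lists (obj M) \<Longrightarrow> ys \<in> lists (obj M) \<Longrightarrow> mf2 Gf (enc xs, enc ys) = phi M xs ys"
  "mf0 Gf = ide M I"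
  by (simp_all add: Gf_def)

lemma cat_functor_Gf: "cat_functor S M Gf"
proof (rule cat_functorI)
  show "fobj Gf \<in> obj S \<rightarrow>\<^sub>E obj M"
  proof (rule PiE_I)
    fix b assume "b \<in> obj S" then show "fobj Gf b \<in> obj M" by (elim obj_cases) simp
  qed (simp add: Gf_def)
  show "farr Gf \<in> arr S \<rightarrow>\<^sub>E arr M"
  proof (rule PiE_I)
    fix a assume "a \<in> arr S" then show "farr Gf a \<in> arr M" by (elim arr_cases) (simp add: homD)
  qed (simp add: Gf_def)
next
  fix a assume "a \<in> arr S"
  then obtain xs ys f where a: "hom xs ys f" "a = E xs ys f" by (rule arr_cases)
  then show "src M (farr Gf a) = fobj Gf (src S a)" "tgt M (farr Gf a) = fobj Gf (tgt S a)"
    using homD[OF a(1)] by simp_all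
next
  fix b assume "b \<in> obj S" then show "farr Gf (ide S b) = ide M (fobj Gf b)"
      by (elim obj_cases) simp
next
  fix b a assume "b \<in> arr S" "a \<in> arr S" "src S b = tgt S a"
  then obtain xs ys f ys' zs g where *: "hom xs ys f" "a = E xs ys f" "hom ys' zs g" "b =
      E ys' zs g" "src S b = tgt S a"
    by (elim arr_cases) simp
  then have "ys' = ys" by (simp add: homD)
  then show "farr Gf (b \<cdot>\<^bsub>S\<^esub> a) = farr Gf b \<cdot>\<^bsub>M\<^esub> farr Gf a" using * hom_cmp[of xs ys f zs g]
      by simp
qed unfold_locales

text \<open>Naturality of the constraint is \<open>bx_phi\<close>, the associativity axiom is
  \<open>phi_assoc\<close>, and the right unit axiom is \<open>phi_unit_right\<close>.\<close>

lemma monoidal_functor_Gf: "monoidal_functor S M Gf"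
proof (rule monoidal_functorI)
  show "cat_functor S M Gf" by (rule cat_functor_Gf)
  show "mf2 Gf \<in> extensional (obj S \<times> obj S)" by (simp add: Gf_def)
next
  fix x y assume "x \<in> obj S" "y \<in> obj S"
  then show "iso_arr M (mf2 Gf (x, y)) \<and> src M (mf2 Gf (x, y)) = fobj Gf x \<odot>\<^bsub>M\<^esub> fobj Gf y \<and>
      tgt M (mf2 Gf (x, y)) = fobj Gf (x \<odot>\<^bsub>S\<^esub> y)"
    by (elim obj_cases) simp
next
  show "iso_arr M (mf0 Gf) \<and> src M (mf0 Gf) = munit M \<and> tgt M (mf0 Gf) = fobj Gf (munit S)"
    by (simp add: iso_ide)
next
  fix a b assume "a \<in> arr S" "b \<in> arr S"
  then obtain xs xs' f ys ys' g where *: "hom xs xs' f" "a = E xs xs' f" "hom ys ys' g" "b =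
      E ys ys' g"
    by (elim arr_cases) simp
  then show "mf2 Gf (tgt S a, tgt S b) \<cdot>\<^bsub>M\<^esub> (farr Gf a \<star>\<^bsub>M\<^esub> farr Gf b) = farr Gf (a \<star>\<^bsub>S\<^esub> b) \<cdot>\<^bsub>M\<^esub>
      mf2 Gf (src S a, src S b)"
    using homD[OF *(1)] homD[OF *(3)] bx_phi[OF *(1,3)] by simp
next
  fix x y z assume "x \<in> obj S" "y \<in> obj S" "z \<in> obj S"
  then obtain xs ys zs where *: "xs \<in> lists (obj M)" "x = enc xs" "ys \<in> lists (obj M)" "y =
      enc ys"
    "zs \<in> lists (obj M)" "z = enc zs" by (elim obj_cases) simp
  then show "farr Gf (massoc S (x, y, z)) \<cdot>\<^bsub>M\<^esub> mf2 Gf (x \<odot>\<^bsub>S\<^esub> y, z) \<cdot>\<^bsub>M\<^esub> (mf2 Gf (x, y) \<star>\<^bsub>M\<^esub>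
      ide M (fobj Gf z)) =
           mf2 Gf (x, y \<odot>\<^bsub>S\<^esub> z) \<cdot>\<^bsub>M\<^esub> (ide M (fobj Gf x) \<star>\<^bsub>M\<^esub> mf2 Gf (y, z)) \<cdot>\<^bsub>M\<^esub>
             massoc M (fobj Gf x, fobj Gf y, fobj Gf z)"
    using phi_assoc[of xs ys zs] by simp
next
  fix x assume "x \<in> obj S"
  then show "farr Gf (lunit S x) \<cdot>\<^bsub>M\<^esub> mf2 Gf (munit S, x) \<cdot>\<^bsub>M\<^esub> (mf0 Gf \<star>\<^bsub>M\<^esub> ide M (fobj Gf x)) =
      lunit M (fobj Gf x)"
    "farr Gf (runit S x) \<cdot>\<^bsub>M\<^esub> mf2 Gf (x, munit S) \<cdot>\<^bsub>M\<^esub> (ide M (fobj Gf x) \<star>\<^bsub>M\<^esub> mf0 Gf) =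
        runit M (fobj Gf x)"
    by (elim obj_cases, simp add: phi_unit_right)+
qed unfold_locales

sublocale G: monoidal_functor S M Gf by (rule monoidal_functor_Gf)

lemma std_obj_S [simp]: "xss \<in> lists (lists (obj M)) \<Longrightarrow> std_obj S (map enc xss) = enc (concat xss)"
proof (induction xss)
  case (Cons xs xss)
  then have "concat xss \<in> lists (obj M)" by (intro concat_in_lists) simp
  then show ?case using Cons by (cases "xss = []") (simp_all add: std_obj_Cons)
qed simp

text \<open>The reassociation \<open>nest\<close> is the canonical isomorphism of the evaluation
  functor, so general facts about \<open>mfn\<close> apply to it.\<close>

lemma mfn_Gf: "xss \<in> lists (lists (obj M)) \<Longrightarrow> mfn S M Gf (map enc xss) = nest M xss"
proof (induction xss)
  case (Cons xs xss)
  then have "concat xss \<in> lists (obj M)" by (intro concat_in_lists) simp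
  then show ?case using Cons by (cases "xss = []") (simp_all add: G.mfn_Cons nest_Cons)
qed simp

lemma map_fobj_Gf: "xss \<in> lists (lists (obj M)) \<Longrightarrow> map (fobj Gf) (map enc xss) =
    map (std_obj M) xss"
  by (auto simp: in_lists_conv_set[of xss])

lemma wd_simps:
  assumes "xss \<in> lists (lists (obj M))" "g \<in> el L (length xss)"
  shows "wd g xss \<in> arr M" "src M (wd g xss) = std_obj M (concat xss)" "tgt M (wd g xss) =
      std_obj M (concat (lact L g xss))"
  using concat_in_lists[OF assms(1)] assms(2) lact_delta[of g xss] unfolding wd_def
      by (simp_all add: length_concat)

lemma hom_wd [simp]:
  assumes "xss \<in> lists (lists (obj M))" "g \<in> el L (length xss)"
  shows "hom (concat xss) (concat (lact L g xss)) (wd g xss)"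
  by (rule homI) (use wd_simps[OF assms] concat_in_lists[of xss] concat_in_lists[of "lact L g
      xss"] assms in simp_all)

lemma std_map_lists: "xss \<in> lists (lists (obj M)) \<Longrightarrow> map (std_obj M) xss \<in> lists (obj M)"
  by (erule map_in_lists) simp

text \<open>Condition (3) of \<open>M\<close> with one reassociation moved to the other side. In
  view of \<open>mfn_Gf\<close> it says exactly that \<open>Gf\<close> respects [g].\<close>

lemma wd_nest:
  assumes "xss \<in> lists (lists (obj M))" "g \<in> el L (length xss)"
  shows "wd g xss \<cdot> nest M xss = nest M (lact L g xss) \<cdot> wact M (g, map (std_obj M) xss)"
proof -
  have l: "lact L g xss \<in> lists (lists (obj M))" using assms by simp
  show ?thesis
    unfolding wd_def wact_delta_nest[OF assms]
    using assms l std_map_lists[OF assms(1)] by (simp add: assoc iso_simps)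
qed

lemma S_arr_ext:
  assumes "a \<in> arr S" "b \<in> arr S" "src S a = src S b" "tgt S a = tgt S b" "farr Gf a = farr Gf b"
  shows "a = b"
proof -
  from assms(1,2) obtain xs ys f xs' ys' g where "hom xs ys f" "a = E xs ys f" "hom xs' ys' g"
      "b = E xs' ys' g"
    by (elim arr_cases) simp
  then show ?thesis using assms(3-) by (simp add: homD)
qed

text \<open>Since \<open>Gf\<close> is faithful and \<open>nest\<close> is invertible, equations between parallel arrows of the
  strictification can be checked after applying \<open>Gf\<close> and composing with \<open>nest\<close>.\<close>

lemma S_arr_ext_nest:
  assumes "a \<in> arr S" "b \<in> arr S" "src S a = enc (concat xss)" "src S b = enc (concat xss)"
      "tgt S a = tgt S b"
    and xss: "xss \<in> lists (lists (obj M))" and "farr Gf a \<cdot> nest M xss = farr Gf b \<cdot> nest M xss"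
  shows "a = b"
proof (rule S_arr_ext)
  have c: "concat xss \<in> lists (obj M)" by (rule concat_in_lists) (rule xss)
  have "farr Gf a \<in> arr M" "farr Gf b \<in> arr M" "src M (farr Gf a) = std_obj M (concat xss)"
      "src M (farr Gf b) = std_obj M (concat xss)"
    using G.farr_arr[OF assms(1)] G.farr_arr[OF assms(2)] G.src_farr[OF assms(1)] G.src_farr[OF
        assms(2)] c
    unfolding assms(3,4) by simp_all
  then show "farr Gf a = farr Gf b"
    using iso_cancel_right[of "nest M xss" "farr Gf a" "farr Gf b"] xss assms(7) by simp
qed (use assms(1-5) in simp_all)

text \<open>Naturality of canonical isomorphisms for \<open>Gf\<close>; it computes iterated tensor
  products of arrows in the strictification from those in \<open>M\<close>.\<close>

lemma std_arr_S_nest: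
  assumes "fs \<in> lists (arr S)" "xss \<in> lists (lists (obj M))" "yss \<in> lists (lists (obj M))"
    "map (src S) fs = map enc xss" "map (tgt S) fs = map enc yss"
  shows "farr Gf (std_arr S fs) \<cdot> nest M xss = nest M yss \<cdot> std_arr M (map (farr Gf) fs)"
  using G.mfn_natural[OF assms(1)] assms by (simp add: mfn_Gf)

lemma src_S_cases:
  assumes "fs \<in> lists (arr S)"
  obtains xss yss where "xss \<in> lists (lists (obj M))" "map (src S) fs = map enc xss"
    "yss \<in> lists (lists (obj M))" "map (tgt S) fs = map enc yss"
  using lists_obj_cases[OF S.src_lists[OF assms]] lists_obj_cases[OF S.tgt_lists[OF assms]]
      by metis

text \<open>After applying \<open>Gf\<close> and composing with \<open>nest\<close>,
  \<open>wd_nest\<close> and \<open>std_arr_S_nest\<close> move \<open>nest\<close> to the front of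
  both sides, where naturality of [g] in \<open>M\<close> remains.\<close>

lemma weak_S_natural:
  assumes fs: "fs \<in> lists (arr S)" and g: "g \<in> el L (length fs)"
  shows "wact S (g, map (tgt S) fs) \<cdot>\<^bsub>S\<^esub> std_arr S fs = std_arr S (lact L g fs) \<cdot>\<^bsub>S\<^esub>
      wact S (g, map (src S) fs)"
proof -
  from src_S_cases[OF fs] obtain xss yss where x: "xss \<in> lists (lists (obj M))"
      and xs: "map (src S) fs = map enc xss"
    and y: "yss \<in> lists (lists (obj M))" and ys: "map (tgt S) fs = map enc yss" .
  have len: "length xss = length fs" "length yss = length fs" using xs ys by (metis length_map)+
  have lx: "lact L g xss \<in> lists (lists (obj M))" "lact L g yss \<in> lists (lists (obj M))"
      using x y g len by simp_all
  have lf: "lact L g fs \<in> lists (arr S)" using fs g by simp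
  have ls: "map (src S) (lact L g fs) = map enc (lact L g xss)" "map (tgt S) (lact L g fs) =
      map enc (lact L g yss)"
    using xs ys g len by (simp_all flip: lact_map)
  note st = S.std_arr_simps[OF fs] S.std_arr_simps[OF lf]
  have gl: "map (farr Gf) fs \<in> lists (arr M)" by (rule G.farr_lists[OF fs])
  have "map (src M) (map (farr Gf) fs) = map (fobj Gf) (map (src S) fs)"
      "map (tgt M) (map (farr Gf) fs) = map (fobj Gf) (map (tgt S) fs)"
    using fs by (auto simp: in_lists_conv_set)
  then have gs: "map (src M) (map (farr Gf) fs) = map (std_obj M) xss"
      "map (tgt M) (map (farr Gf) fs) = map (std_obj M) yss"
    unfolding xs ys using x y by (simp_all only: map_fobj_Gf)
  note mt = std_arr_simps[OF gl, unfolded gs]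
  have wn: "wact M (g, map (std_obj M) yss) \<cdot> std_arr M (map (farr Gf) fs) =
      std_arr M (map (farr Gf) (lact L g fs)) \<cdot> wact M (g, map (std_obj M) xss)"
    using wact_natural[OF gl, of g] g unfolding gs by simp
  have mtl: "std_arr M (map (farr Gf) (lact L g fs)) \<in> arr M"
      "src M (std_arr M (map (farr Gf) (lact L g fs))) =
      std_obj M (map (std_obj M) (lact L g xss))"
    "tgt M (std_arr M (map (farr Gf) (lact L g fs))) = std_obj M (map (std_obj M) (lact L g yss))"
  proof -
    have "map (src M) (lact L g (map (farr Gf) fs)) = map (std_obj M) (lact L g xss)"
      "map (tgt M) (lact L g (map (farr Gf) fs)) = map (std_obj M) (lact L g yss)"
      using gs g len by (metis lact_map length_map)+
    moreover have "lact L g (map (farr Gf) fs) \<in> lists (arr M)"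
      using lact_in_lists[of g "map (farr Gf) fs"] gl g by (simp del: lact_map)
    ultimately show "std_arr M (map (farr Gf) (lact L g fs)) \<in> arr M"
        "src M (std_arr M (map (farr Gf) (lact L g fs))) =
        std_obj M (map (std_obj M) (lact L g xss))"
    "tgt M (std_arr M (map (farr Gf) (lact L g fs))) = std_obj M (map (std_obj M) (lact L g yss))"
      using std_arr_simps[of "lact L g (map (farr Gf) fs)"] g by simp_all
  qed
  have wx: "wact S (g, map (src S) fs) = E (concat xss) (concat (lact L g xss)) (wd g xss)"
    "wact S (g, map (tgt S) fs) = E (concat yss) (concat (lact L g yss)) (wd g yss)"
    using x y xs ys g len by (simp_all del: map_map)
  note hx = hom_wd[OF x, of g] and hy = hom_wd[OF y, of g]
  note cc = concat_in_lists[OF x] concat_in_lists[OF y] concat_in_lists[OF lx(1)]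
      concat_in_lists[OF lx(2)]
  show ?thesis
  proof (rule S_arr_ext_nest[OF _ _ _ _ _ x])
    have "farr Gf (wact S (g, map (tgt S) fs) \<cdot>\<^bsub>S\<^esub> std_arr S fs) \<cdot> nest M xss =
       wd g yss \<cdot> (farr Gf (std_arr S fs) \<cdot> nest M xss)"
      using st hy g len wx x y xs ys cc wd_simps[OF y, of g]
          by (simp add: assoc G.farr_comp del: map_map)
    also have "\<dots> = (wd g yss \<cdot> nest M yss) \<cdot> std_arr M (map (farr Gf) fs)"
      unfolding std_arr_S_nest[OF fs x y xs ys] using wd_simps[OF y, of g] g len y mt
          by (simp add: assoc)
    also have "\<dots> = nest M (lact L g yss) \<cdot> (wact M (g, map (std_obj M) yss) \<cdot>
        std_arr M (map (farr Gf) fs))"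
      using wd_nest[OF y, of g] g len y lx mt std_map_lists[OF y] by (simp add: assoc)
    also have "\<dots> = (nest M (lact L g yss) \<cdot> std_arr M (map (farr Gf) (lact L g fs))) \<cdot>
        wact M (g, map (std_obj M) xss)"
      unfolding wn using g len x lx mtl std_map_lists[OF x] by (simp add: assoc)
    also have "\<dots> = (farr Gf (std_arr S (lact L g fs)) \<cdot> nest M (lact L g xss)) \<cdot>
        wact M (g, map (std_obj M) xss)"
      using std_arr_S_nest[OF lf lx ls] by simp
    also have "\<dots> = farr Gf (std_arr S (lact L g fs)) \<cdot> (wd g xss \<cdot> nest M xss)"
      using wd_nest[OF x, of g] st g len x lx ls cc std_map_lists[OF x]
          by (simp add: assoc del: map_map)
    also have "\<dots> = farr Gf (std_arr S (lact L g fs) \<cdot>\<^bsub>S\<^esub> wact S (g, map (src S) fs)) \<cdot> nest M xss"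
      using st hx g len wx x lx ls cc wd_simps[OF x, of g]
          by (simp add: assoc G.farr_comp del: map_map)
    finally show "farr Gf (wact S (g, map (tgt S) fs) \<cdot>\<^bsub>S\<^esub> std_arr S fs) \<cdot> nest M xss =
       farr Gf (std_arr S (lact L g fs) \<cdot>\<^bsub>S\<^esub> wact S (g, map (src S) fs)) \<cdot> nest M xss" .
  qed (use st hx hy g len wx x y lx xs ys ls cc in \<open>simp_all del: map_map\<close>)
qed

lemma concat_concat: "concat (map concat xsss) = concat (concat xsss)"
  by (induction xsss) simp_all

lemma map_concat_lists: "xsss \<in> lists (lists (lists A)) \<Longrightarrow> map concat xsss \<in> lists (lists A)"
  by (erule map_in_lists) (rule concat_in_lists)

lemma lists_lists_obj_cases:
  assumes "bss \<in> lists (lists (obj S))"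
  obtains xsss where "xsss \<in> lists (lists (lists (obj M)))" "bss = map (map enc) xsss"
  using assms unfolding obj_S lists_image by (elim imageE)

text \<open>By \<open>delta_beta\<close> the left side is [\<beta>(ks)] with \<open>ks\<close> the
  \<delta>-images of \<open>hs\<close>, taken at the concatenated inner lists. Condition (2) of
  \<open>M\<close> turns it into the tensor product of the [ks_i], and these underlie the factors on
  the right.\<close>

lemma weak_S_beta:
  assumes "bss \<in> lists (lists (obj S))" "list_all2 (\<lambda>h bs. h \<in> el L (length bs)) hs bss"
  shows "wact S (beta L (map length bss) hs, concat bss) =
      std_arr S (map2 (\<lambda>h bs. wact S (h, bs)) hs bss)"
proof -
  from assms(1) obtain xsss where x: "xsss \<in> lists (lists (lists (obj M)))" and b: "bss =
      map (map enc) xsss"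
    by (rule lists_lists_obj_cases)
  have hs: "list_all2 (\<lambda>h xss. h \<in> el L (length xss)) hs xsss" using assms(2)
      by (simp add: b list.rel_map)
  have len: "length hs = length xsss" using hs by (rule list_all2_lengthD)
  have hi: "hs ! i \<in> el L (length (xsss ! i))" "xsss ! i \<in> lists (lists (obj M))"
      if "i < length xsss" for i
    using list_all2_nthD2[OF hs that] nth_in_lists[OF x that] by simp_all
  let ?lss = "map (map length) xsss"
  let ?fs = "map2 (\<lambda>h bs. wact S (h, bs)) hs bss"
  let ?beta = "beta L (map length xsss) hs"
  define yss where "yss = map concat xsss"
  define zss where "zss = map concat (map2 (lact L) hs xsss)"
  \<comment> \<open>By definition of \<open>wd\<close>, [h_i] in the strictification is the
    isomorphism of this element in \<open>M\<close>.\<close>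
  define ks where "ks = map2 (delta L) ?lss hs"
  have y: "yss \<in> lists (lists (obj M))" unfolding yss_def by (rule map_concat_lists) (rule x)
  have l: "map2 (lact L) hs xsss \<in> lists (lists (lists (obj M)))"
    by (rule listsI_nth) (use hi len in simp)
  have z: "zss \<in> lists (lists (obj M))" unfolding zss_def by (rule map_concat_lists) (rule l)
  have cx: "concat xsss \<in> lists (lists (obj M))" by (rule concat_in_lists) (rule x)
  have els: "els hs (map length xsss)" using hs by (simp add: els_map_length)
  have be: "?beta \<in> el L (length (concat xsss))" using els by (simp add: length_concat)
  have lb: "lact L ?beta (concat xsss) = concat (map2 (lact L) hs xsss)" using lact_beta[OF els]
      by simp
  have W: "wact S (beta L (map length bss) hs, concat bss) =
      E (concat (concat xsss)) (concat (lact L ?beta (concat xsss))) (wd ?beta (concat xsss))"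
    using wact_S[OF cx be] by (simp add: b comp_def map_concat)
  note hW = hom_wd[OF cx be]
  have fsi: "?fs ! i = E (concat (xsss ! i)) (concat (lact L (hs ! i) (xsss ! i))) (wd (hs ! i)
      (xsss ! i))" if "i < length xsss" for i
    using that len hi[OF that] by (simp add: b)
  have lfs: "length ?fs = length xsss" using len by (simp add: b)
  have fs: "?fs \<in> lists (arr S)"
  proof (rule listsI_nth)
    fix i assume "i < length ?fs"
    then have i: "i < length xsss" using len by (simp add: b)
    show "?fs ! i \<in> arr S" unfolding fsi[OF i]
        by (rule E_arr, rule hom_wd) (use hi[OF i] in simp_all)
  qed
  have sf: "map (src S) ?fs = map enc yss"
  proof (rule nth_equalityI)
    fix i assume "i < length (map (src S) ?fs)"
    then have i: "i < length xsss" using len by (simp add: b)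
    then show "map (src S) ?fs ! i = map enc yss ! i"
      using fsi[OF i] src_S[OF hom_wd[OF hi(2,1)[OF i]]] lfs by (simp add: yss_def)
  qed (use lfs in \<open>simp add: yss_def\<close>)
  have tf: "map (tgt S) ?fs = map enc zss"
  proof (rule nth_equalityI)
    fix i assume "i < length (map (tgt S) ?fs)"
    then have i: "i < length xsss" using len by (simp add: b)
    then show "map (tgt S) ?fs ! i = map enc zss ! i"
      using fsi[OF i] tgt_S[OF hom_wd[OF hi(2,1)[OF i]]] lfs len by (simp add: zss_def)
  qed (use lfs len in \<open>simp add: zss_def\<close>)
  have dl: "delta L (map length (concat xsss)) ?beta = beta L (map length yss) ks"
    using delta_beta[of hs ?lss] els by (simp add: ks_def yss_def comp_def length_concat
        map_concat)
  have kl: "list_all2 (\<lambda>h xs. h \<in> el L (length xs)) ks yss"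
    using hi len by (simp add: list_all2_conv_all_nth ks_def yss_def length_concat)
  have ky: "map2 (lact L) ks yss = zss"
    using hi len by (intro nth_equalityI) (simp_all add: ks_def yss_def zss_def lact_delta)
  have kw: "map2 (\<lambda>h xs. wact M (h, xs)) ks yss = map (farr Gf) ?fs"
  proof (rule nth_equalityI)
    fix i assume "i < length (map2 (\<lambda>h xs. wact M (h, xs)) ks yss)"
    then have i: "i < length xsss" by (simp add: yss_def)
    show "map2 (\<lambda>h xs. wact M (h, xs)) ks yss ! i = map (farr Gf) ?fs ! i"
      using i fsi[OF i] Gf_simps(2)[OF hom_wd[OF hi(2,1)[OF i]]] lfs len
          by (simp add: ks_def yss_def wd_def)
  qed (use lfs len in \<open>simp add: ks_def yss_def\<close>)
  have sw: "std_arr M (map (farr Gf) ?fs) \<in> arr M"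
    "src M (std_arr M (map (farr Gf) ?fs)) = std_obj M (map (std_obj M) yss)"
    "tgt M (std_arr M (map (farr Gf) ?fs)) = std_obj M (map (std_obj M) zss)"
    using std_arr_simps[OF map2_wact(1)[OF y kl]] map2_wact(2,3)[OF y kl] unfolding kw ky
        by (simp_all only:)
  \<comment> \<open>Here \<open>delta_beta\<close> enters, together with the two ways of flattening
    a triply nested list.\<close>
  have "wd ?beta (concat xsss) \<cdot> nest M yss = wact M (beta L (map length yss) ks, concat yss) \<cdot>
      nest M yss"
    unfolding wd_def dl by (simp add: yss_def concat_concat)
  also have "\<dots> = nest M zss \<cdot> std_arr M (map (farr Gf) ?fs)"
    unfolding wact_beta_nest[OF y kl] ky kw using y z sw by (simp add: assoc iso_simps)
  also have "\<dots> = farr Gf (std_arr S ?fs) \<cdot> nest M yss"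
    using std_arr_S_nest[OF fs y z sf tf] by simp
  finally have eq: "wd ?beta (concat xsss) \<cdot> nest M yss = farr Gf (std_arr S ?fs) \<cdot> nest M yss" .
  have cy: "concat yss = concat (concat xsss)" "concat zss = concat (lact L ?beta (concat xsss))"
    unfolding lb yss_def zss_def by (rule concat_concat)+
  show ?thesis
  proof (rule S_arr_ext_nest[OF _ _ _ _ _ y])
    show "wact S (beta L (map length bss) hs, concat bss) \<in> arr S" unfolding W
        by (rule E_arr) (rule hW)
    show "std_arr S ?fs \<in> arr S" by (rule S.std_arr_simps) (rule fs)
    show "src S (wact S (beta L (map length bss) hs, concat bss)) = enc (concat yss)"
        unfolding W cy using hW by simp
    show "src S (std_arr S ?fs) = enc (concat yss)" unfolding S.std_arr_simps(2)[OF fs] sf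
        by (rule std_obj_S) (rule y)
    show "tgt S (wact S (beta L (map length bss) hs, concat bss)) = tgt S (std_arr S ?fs)"
      unfolding W S.std_arr_simps(3)[OF fs] tf std_obj_S[OF z] cy using hW by simp
    show "farr Gf (wact S (beta L (map length bss) hs, concat bss)) \<cdot> nest M yss =
        farr Gf (std_arr S ?fs) \<cdot> nest M yss"
      unfolding W using hW eq by simp
  qed
qed

text \<open>Both sides unfold to [\<delta>] at the same flattened list, and the two group elements
  agree by \<open>delta_delta\<close>; the codes of the arrows are then literally equal.\<close>

lemma weak_S_delta:
  assumes "bss \<in> lists (lists (obj S))" "g \<in> el L (length bss)"
  shows "wact S (delta L (map length bss) g, concat bss) = wact S (g, map (std_obj S) bss)"
proof -
  from assms(1) obtain xsss where x: "xsss \<in> lists (lists (lists (obj M)))" and b: "bss =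
      map (map enc) xsss"
    by (rule lists_lists_obj_cases)
  have g: "g \<in> el L (length xsss)" using assms(2) by (simp add: b)
  have y: "map concat xsss \<in> lists (lists (obj M))" by (rule map_concat_lists) (rule x)
  have cx: "concat xsss \<in> lists (lists (obj M))" by (rule concat_in_lists) (rule x)
  have s: "map (std_obj S) bss = map enc (map concat xsss)"
    using x by (auto simp: b in_lists_conv_set[of xsss])
  let ?d = "delta L (map length xsss) g"
  have d: "?d \<in> el L (length (concat xsss))" using g by (simp add: length_concat)
  have ld: "lact L ?d (concat xsss) = concat (lact L g xsss)" by (rule lact_delta) (rule g)
  have dd: "delta L (map length (concat xsss)) ?d = delta L (map length (map concat xsss)) g"
    using delta_delta[of g "map (map length) xsss"] g
        by (simp add: comp_def length_concat map_concat)
  have "wact S (delta L (map length bss) g, concat bss) =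
      E (concat (concat xsss)) (concat (lact L ?d (concat xsss))) (wd ?d (concat xsss))"
    using wact_S[OF cx d] by (simp add: b comp_def map_concat)
  also have "\<dots> = E (concat (map concat xsss)) (concat (lact L g (map concat xsss))) (wd g (map
      concat xsss))"
    unfolding ld wd_def dd using g by (simp add: concat_concat)
  also have "\<dots> = wact S (g, map (std_obj S) bss)"
    unfolding s using wact_S[OF y, of g] g by (simp del: map_map)
  finally show ?thesis .
qed

lemma weak_S: "weak_L_monoidal_category L S"
proof (rule strict_weakI)
  show "monoidal_category S" "strict_monoidal S" using monoidal_S by simp_all
  show "wact S \<in> extensional (opre L (obj S))" unfolding obj_S by (simp add: S_def)
next
  fix bs g assume "bs \<in> lists (obj S)" and g: "g \<in> el L (length bs)"
  then obtain xss where x: "xss \<in> lists (lists (obj M))" "bs = map enc xss"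
      by (elim lists_obj_cases)
  then show "wact S (g, bs) \<in> arr S \<and> src S (wact S (g, bs)) = std_obj S bs \<and>
      tgt S (wact S (g, bs)) = std_obj S (lact L g bs)"
    using g hom_wd[of xss g] by simp
next
  fix bs assume "bs \<in> lists (obj S)"
  then obtain xss where x: "xss \<in> lists (lists (obj M))" "bs = map enc xss"
      by (elim lists_obj_cases)
  \<comment> \<open>\<delta>(e) = e, so [e] is an identity in the strictification because it is one
    in \<open>M\<close>.\<close>
  have "delta L (map length xss) (eL L (length xss)) = eL L (length (concat xss))"
    using amu_e[of "length xss" "map length xss"] by (simp add: delta_def length_concat)
  then have "wd (eL L (length xss)) xss = ide M (std_obj M (concat xss))"
    using concat_in_lists[OF x(1)] by (simp add: wd_def)
  then show "wact S (eL L (length bs), bs) = ide S (std_obj S bs)"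
    using x concat_in_lists[OF x(1)] by simp
next
  fix bs g h assume "bs \<in> lists (obj S)" and g: "g \<in> el L (length bs)" "h \<in> el L (length bs)"
  then obtain xss where x: "xss \<in> lists (lists (obj M))" "bs = map enc xss"
      by (elim lists_obj_cases)
  have g': "g \<in> el L (length xss)" "h \<in> el L (length xss)" using g x by simp_all
  have l: "lact L g xss \<in> lists (lists (obj M))" using x g' by simp
  let ?ks = "map length xss"
  have n: "length (concat xss) = sum_list ?ks" by (simp add: length_concat)
  have d: "delta L ?ks g \<in> el L (length (concat xss))"
      "delta L (lact L g ?ks) h \<in> el L (length (concat xss))"
    using g' n by (simp_all del: lact_map)
  have "wd h (lact L g xss) \<cdot> wd g xss = wact M (delta L (lact L g ?ks) h, lact L (delta L ?ks g)
      (concat xss)) \<cdot> wact M (delta L ?ks g, concat xss)"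
    unfolding wd_def lact_delta[OF g'(1)] using g' by simp
  also have "\<dots> = wact M (mult (length (concat xss)) (delta L (lact L g ?ks) h) (delta L ?ks g),
      concat xss)"
    by (rule wact_comp[OF concat_in_lists[OF x(1)] d])
  \<comment> \<open>Condition (1) of \<open>M\<close> gives the product of two \<delta>-elements;
    twisted multiplicativity makes it \<delta> of the product.\<close>
  also have "mult (length (concat xss)) (delta L (lact L g ?ks) h) (delta L ?ks g) =
      delta L ?ks (mult (length xss) h g)"
    unfolding n by (rule delta_mult) (use g' in simp_all)
  finally have "wd h (lact L g xss) \<cdot> wd g xss = wd (mult (length xss) h g) xss"
      unfolding wd_def .
  moreover have "hom (concat (lact L g xss)) (concat (lact L h (lact L g xss))) (wd h (lact L g
      xss))"
    by (rule hom_wd[OF l]) (use g' in simp)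
  ultimately show "wact S (h, lact L g bs) \<cdot>\<^bsub>S\<^esub> wact S (g, bs) =
      wact S (mult (length bs) h g, bs)"
    using x g' l by (simp add: lact_mult)
qed (fact weak_S_natural weak_S_beta weak_S_delta)+

lemma weak_Gf: "weak_L_monoidal_functor L S M Gf"
proof (intro weak_L_monoidal_functor.intro weak_L_monoidal_functor_axioms.intro)
  show "weak_L_monoidal_category L S" "weak_L_monoidal_category L M" "monoidal_functor S M Gf"
    by (rule weak_S weak_L_monoidal_category_axioms monoidal_functor_Gf)+
  fix bs g assume "bs \<in> lists (obj S)" and g: "g \<in> el L (length bs)"
  then obtain xss where x: "xss \<in> lists (lists (obj M))" "bs = map enc xss"
      by (elim lists_obj_cases)
  have g': "g \<in> el L (length xss)" using g x by simp
  have l: "lact L g xss \<in> lists (lists (obj M))" using x g' by simp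
  show "mfn S M Gf (lact L g bs) \<cdot>\<^bsub>M\<^esub> wact M (g, map (fobj Gf) bs) = farr Gf (wact S (g, bs)) \<cdot>\<^bsub>M\<^esub>
      mfn S M Gf bs"
    using x g' l wd_nest[OF x(1) g'] map_fobj_Gf[OF x(1)] by (simp add: mfn_Gf del: map_map)
qed

section \<open>The embedding by singletons and the equivalence\<close>

definition Ff :: "('o, 'a) mon_fctr" where
  "Ff = \<lparr>fobj = (\<lambda>x\<in>obj M. enc [x]), farr = (\<lambda>f\<in>arr M. E [src M f] [tgt M f] f),
     mf2 = restrict (\<lambda>(x, y). E [x, y] [x \<odot> y] (ide M (x \<odot> y))) (obj M \<times> obj M), mf0 =
         E [] [I] (ide M I)\<rparr>"

lemma Ff_simps [simp]:
  "x \<in> obj M \<Longrightarrow> fobj Ff x = enc [x]"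
  "f \<in> arr M \<Longrightarrow> farr Ff f = E [src M f] [tgt M f] f"
  "x \<in> obj M \<Longrightarrow> y \<in> obj M \<Longrightarrow> mf2 Ff (x, y) = E [x, y] [x \<odot> y] (ide M (x \<odot> y))"
  "mf0 Ff = E [] [I] (ide M I)"
  by (simp_all add: Ff_def)

lemma hom_single [simp]: "f \<in> arr M \<Longrightarrow> src M f = x \<Longrightarrow> tgt M f = y \<Longrightarrow> hom [x] [y] f"
  by (rule homI) auto

lemma hom_pair [simp]: "x \<in> obj M \<Longrightarrow> y \<in> obj M \<Longrightarrow> z = x \<odot> y \<Longrightarrow> hom [x, y] [z] (ide M z)"
  by (rule homI) auto

lemma hom_Nil [simp]: "hom [] [I] (ide M I)" by (rule homI) auto

lemma inverse_E:
  assumes "hom xs ys f" "hom ys xs g" "g \<cdot> f = ide M (std_obj M xs)" "f \<cdot> g =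
      ide M (std_obj M ys)"
  shows "inverse_arrows S (E xs ys f) (E ys xs g)"
  using assms homD[OF assms(1)] by (simp add: inverse_arrows_def)

lemma iso_E:
  assumes "hom xs ys f" "iso_arr M f" shows "iso_arr S (E xs ys f)"
proof -
  have "hom ys xs (inv_arr M f)" by (rule homI) (use homD[OF assms(1)] iso_simps[OF assms(2)] in
      simp_all)
  with inverse_E[OF assms(1) this] show ?thesis
    using iso_simps[OF assms(2)] homD[OF assms(1)] by (auto simp: iso_arr_def)
qed

lemma cat_functor_Ff: "cat_functor M S Ff"
proof (rule cat_functorI)
  show "fobj Ff \<in> obj M \<rightarrow>\<^sub>E obj S" by (rule PiE_I) (simp, simp add: Ff_def)
  show "farr Ff \<in> arr M \<rightarrow>\<^sub>E arr S" by (rule PiE_I) (simp, simp add: Ff_def)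
qed (unfold_locales, simp_all)

text \<open>\<open>phi\<close> at two singletons is an identity, so nothing is conjugated.\<close>

lemma bx_single:
  assumes "f \<in> arr M" "g \<in> arr M"
  shows "bx [src M f] [tgt M f] [src M g] [tgt M g] f g = f \<star> g"
  by (rule bx_unique) (use assms in \<open>auto intro!: homI\<close>)

text \<open>Each constraint is an identity of \<open>M\<close> regarded as an arrow between
  different lists. The associator and unit constraints of \<open>M\<close> reappear because
  tensoring such an arrow with another list conjugates by \<open>phi\<close>.\<close>

lemma monoidal_functor_Ff: "monoidal_functor M S Ff"
proof (rule monoidal_functorI)
  show "cat_functor M S Ff" by (rule cat_functor_Ff)
  show "mf2 Ff \<in> extensional (obj M \<times> obj M)" by (simp add: Ff_def)
next
  fix x y assume "x \<in> obj M" "y \<in> obj M"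
  then show "iso_arr S (mf2 Ff (x, y)) \<and> src S (mf2 Ff (x, y)) = fobj Ff x \<odot>\<^bsub>S\<^esub> fobj Ff y \<and>
      tgt S (mf2 Ff (x, y)) = fobj Ff (x \<odot>\<^bsub>M\<^esub> y)"
    by (simp add: iso_E iso_ide)
next
  show "iso_arr S (mf0 Ff) \<and> src S (mf0 Ff) = munit S \<and> tgt S (mf0 Ff) = fobj Ff (munit M)"
    by (simp add: iso_E iso_ide)
next
  fix f g assume f: "f \<in> arr M" "g \<in> arr M"
  have h: "hom [src M f, src M g] [tgt M f, tgt M g] (f \<star> g)" by (rule homI) (use f in auto)
  show "mf2 Ff (tgt M f, tgt M g) \<cdot>\<^bsub>S\<^esub> (farr Ff f \<star>\<^bsub>S\<^esub> farr Ff g) = farr Ff (f \<star>\<^bsub>M\<^esub> g) \<cdot>\<^bsub>S\<^esub>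
      mf2 Ff (src M f, src M g)"
    using f h by (simp add: bx_single)
next
  fix x y z assume o: "x \<in> obj M" "y \<in> obj M" "z \<in> obj M"
  have i: "iso_arr M (ass x y z)" using o by (rule massoc_iso)
  have h1: "hom [x, y, z] [x \<odot> y, z] (inv_arr M (ass x y z))"
      by (rule homI) (use o iso_simps[OF i] in auto)
  \<comment> \<open>\<open>phi M [x, y] [z]\<close> is the associator while \<open>phi\<close> at
    the two target singletons is an identity; the inverse associator that results cancels against
    the image of \<open>massoc M (x, y, z)\<close>.\<close>
  have b1: "bx [x, y] [x \<odot> y] [z] [z] (ide M (x \<odot> y)) (ide M z) = inv_arr M (ass x y z)"
    by (rule bx_unique) (use o h1 iso_simps[OF i] in simp_all)
  have h2: "hom [x, y, z] [x, y \<odot> z] (ide M (x \<odot> (y \<odot> z)))" by (rule homI) (use o in auto)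
  have b2: "bx [x] [x] [y, z] [y \<odot> z] (ide M x) (ide M (y \<odot> z)) = ide M (x \<odot> (y \<odot> z))"
    by (rule bx_unique) (use o h2 in simp_all)
  have h3: "hom [(x \<odot> y) \<odot> z] [x \<odot> (y \<odot> z)] (ass x y z)"
      "hom [x \<odot> y, z] [(x \<odot> y) \<odot> z] (ide M ((x \<odot> y) \<odot> z))"
    "hom [x, y \<odot> z] [x \<odot> (y \<odot> z)] (ide M (x \<odot> (y \<odot> z)))"
        "hom [x, y, z] [x, y, z] (ide M (x \<odot> (y \<odot> z)))"
    by (rule homI, use o in auto)+
  have h4: "hom [x, y, z] [(x \<odot> y) \<odot> z] (ide M ((x \<odot> y) \<odot> z) \<cdot> inv_arr M (ass x y z))"
      by (rule hom_cmp[OF h1 h3(2)])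
  have h5: "hom [x, y, z] [x, y \<odot> z] (ide M (x \<odot> (y \<odot> z)) \<cdot> ide M (x \<odot> (y \<odot> z)))"
      by (rule hom_cmp[OF h3(4) h2])
  have m: "massoc S (enc [x], enc [y], enc [z]) = E [x, y, z] [x, y, z] (ide M (x \<odot> (y \<odot> z)))"
    using o massoc_S[of "[x]" "[y]" "[z]"] by simp
  have L: "mf2 Ff (x \<odot> y, z) \<cdot>\<^bsub>S\<^esub> (mf2 Ff (x, y) \<star>\<^bsub>S\<^esub> ide S (fobj Ff z)) =
     E [x, y, z] [(x \<odot> y) \<odot> z] (ide M ((x \<odot> y) \<odot> z) \<cdot> inv_arr M (ass x y z))"
    using o b1 h1 h3 by simp
  have R: "(ide S (fobj Ff x) \<star>\<^bsub>S\<^esub> mf2 Ff (y, z)) \<cdot>\<^bsub>S\<^esub> massoc S (enc [x], enc [y], enc [z]) =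
     E [x, y, z] [x, y \<odot> z] (ide M (x \<odot> (y \<odot> z)) \<cdot> ide M (x \<odot> (y \<odot> z)))"
    unfolding m using o b2 h2 h3 by simp
  show "farr Ff (massoc M (x, y, z)) \<cdot>\<^bsub>S\<^esub> mf2 Ff (x \<odot>\<^bsub>M\<^esub> y, z) \<cdot>\<^bsub>S\<^esub> (mf2 Ff (x, y) \<star>\<^bsub>S\<^esub>
      ide S (fobj Ff z)) =
           mf2 Ff (x, y \<odot>\<^bsub>M\<^esub> z) \<cdot>\<^bsub>S\<^esub> (ide S (fobj Ff x) \<star>\<^bsub>S\<^esub> mf2 Ff (y, z)) \<cdot>\<^bsub>S\<^esub>
             massoc S (fobj Ff x, fobj Ff y, fobj Ff z)"
    using o L R h3 h4 h5 iso_simps[OF i] by simp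
next
  fix x assume o: "x \<in> obj M"
  have i: "iso_arr M (lunit M x)" "iso_arr M (runit M x)" using o
      by (auto intro: lunit_iso runit_iso)
  have h1: "hom [x] [I, x] (inv_arr M (lunit M x))"
      by (rule homI) (use o iso_simps[OF i(1)] in auto)
  \<comment> \<open>The source contains an empty list, whose \<open>phi\<close> is a unit
    constraint; its inverse survives the conjugation.\<close>
  have b1: "bx [] [I] [x] [x] (ide M I) (ide M x) = inv_arr M (lunit M x)"
    by (rule bx_unique) (use o h1 iso_simps[OF i(1)] in simp_all)
  have h2: "hom [x] [x, I] (inv_arr M (runit M x))"
      by (rule homI) (use o iso_simps[OF i(2)] in auto)
  have b2: "bx [x] [x] [] [I] (ide M x) (ide M I) = inv_arr M (runit M x)"
    by (rule bx_unique) (use o h2 iso_simps[OF i(2)] in simp_all)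
  have h3: "hom [I, x] [I \<odot> x] (ide M (I \<odot> x))" "hom [x, I] [x \<odot> I] (ide M (x \<odot> I))" using o
      by simp_all
  note h4 = hom_cmp[OF h1 h3(1)] hom_cmp[OF h2 h3(2)]
  have h5: "hom [I \<odot> x] [x] (lunit M x)" "hom [x \<odot> I] [x] (runit M x)" using o by simp_all
  have L: "mf2 Ff (munit M, x) \<cdot>\<^bsub>S\<^esub> (mf0 Ff \<star>\<^bsub>S\<^esub> ide S (fobj Ff x)) =
      E [x] [I \<odot> x] (ide M (I \<odot> x) \<cdot> inv_arr M (lunit M x))"
    using o b1 h1 h3 by simp
  have R: "mf2 Ff (x, munit M) \<cdot>\<^bsub>S\<^esub> (ide S (fobj Ff x) \<star>\<^bsub>S\<^esub> mf0 Ff) =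
      E [x] [x \<odot> I] (ide M (x \<odot> I) \<cdot> inv_arr M (runit M x))"
    using o b2 h2 h3 by simp
  show "farr Ff (lunit M x) \<cdot>\<^bsub>S\<^esub> mf2 Ff (munit M, x) \<cdot>\<^bsub>S\<^esub> (mf0 Ff \<star>\<^bsub>S\<^esub> ide S (fobj Ff x)) =
      lunit S (fobj Ff x)"
    unfolding L using o h4 h5 iso_simps[OF i(1)] by simp
  show "farr Ff (runit M x) \<cdot>\<^bsub>S\<^esub> mf2 Ff (x, munit M) \<cdot>\<^bsub>S\<^esub> (ide S (fobj Ff x) \<star>\<^bsub>S\<^esub> mf0 Ff) =
      runit S (fobj Ff x)"
    unfolding R using o h4 h5 iso_simps[OF i(2)] by simp
qed unfold_locales

sublocale F: monoidal_functor M S Ff by (rule monoidal_functor_Ff)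

lemma hom_std [simp]:
  assumes "xs \<in> lists (obj M)"
  shows "hom xs [std_obj M xs] (ide M (std_obj M xs))"
      "hom [std_obj M xs] xs (ide M (std_obj M xs))"
  by (rule homI; use assms in simp)+

lemma mfn_Ff: "xs \<in> lists (obj M) \<Longrightarrow> mfn M S Ff xs = E xs [std_obj M xs] (ide M (std_obj M xs))"
proof (induction xs)
  case (Cons x xs)
  then have x: "x \<in> obj M" and xs: "xs \<in> lists (obj M)" by simp_all
  show ?case
  proof (cases "xs = []")
    case False
    let ?s = "std_obj M xs"
    have h: "hom (x # xs) [x, ?s] (ide M (x \<odot> ?s))" "hom [x, ?s] [x \<odot> ?s] (ide M (x \<odot> ?s))"
      by (rule homI, use x xs False in \<open>auto simp: std_obj_Cons\<close>)+
    have "bx [x] [x] xs [?s] (ide M x) (ide M ?s) = ide M (x \<odot> ?s)"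
      by (rule bx_unique) (use x xs False h in \<open>simp_all add: phi_single\<close>)
    then show ?thesis using False Cons.IH x xs h by (simp add: F.mfn_Cons std_obj_Cons)
  qed (use x in simp)
qed simp

text \<open>All blocks have length one, so \<open>delta_ones\<close> identifies [g] at singletons
  with [g] in \<open>M\<close>. The canonical isomorphisms have identities of \<open>M\<close>
  underneath, so both sides carry the same arrow.\<close>

lemma weak_Ff: "weak_L_monoidal_functor L M S Ff"
proof (intro weak_L_monoidal_functor.intro weak_L_monoidal_functor_axioms.intro)
  show "weak_L_monoidal_category L S" "weak_L_monoidal_category L M" "monoidal_functor M S Ff"
    by (rule weak_S weak_L_monoidal_category_axioms monoidal_functor_Ff)+
  fix xs g assume xs: "xs \<in> lists (obj M)" and g: "g \<in> el L (length xs)"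
  have l: "lact L g xs \<in> lists (obj M)" using xs g by simp
  let ?xss = "map (\<lambda>x. [x]) xs"
  have x: "?xss \<in> lists (lists (obj M))" using xs by (auto simp: in_lists_conv_set)
  have m: "map (fobj Ff) xs = map enc ?xss" using xs by (auto simp: in_lists_conv_set)
  have c: "concat ?xss = xs" "concat (map (\<lambda>x. [x]) (lact L g xs)) = lact L g xs" by simp_all
  have r: "map length ?xss = replicate (length xs) 1" by (simp add: comp_def map_replicate_const)
  have w: "wd g ?xss = wact M (g, xs)" unfolding wd_def r delta_ones[OF g] c ..
  have W: "wact S (g, map (fobj Ff) xs) = E xs (lact L g xs) (wact M (g, xs))"
    unfolding m using wact_S[OF x, of g] g w by (simp del: map_map)
  have h: "hom xs (lact L g xs) (wact M (g, xs))" by (rule homI) (use xs g l in simp_all)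
  have h2: "hom [std_obj M xs] [std_obj M (lact L g xs)] (wact M (g, xs))" using xs g by simp
  show "mfn M S Ff (lact L g xs) \<cdot>\<^bsub>S\<^esub> wact S (g, map (fobj Ff) xs) = farr Ff (wact M (g, xs)) \<cdot>\<^bsub>S\<^esub>
      mfn M S Ff xs"
    unfolding W using xs g l h h2 by (simp add: mfn_Ff)
qed

text \<open>Evaluating a singleton returns its entry, and the composite constraints are identities
  since \<open>phi\<close> is one at singletons; hence the composite equals the identity functor on
  the nose.\<close>

lemma GF_eq: "mf_comp M M Gf Ff = mf_id M"
proof -
  interpret GF: mf_composite M S M Ff Gf by unfold_locales
  show ?thesis
  proof (rule mon_fctr_eqI[OF GF.monoidal_functor_H monoidal_functor_id])
    fix x y assume "x \<in> obj M" "y \<in> obj M"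
    then show "mf2 (mf_comp M M Gf Ff) (x, y) = mf2 (mf_id M) (x, y)" by simp
  qed (unfold_locales, simp_all)
qed

text \<open>The identity of the tensor product of a list, regarded as an arrow from the one-element
  list to the list itself; \<open>eta'\<close> is the same identity in the other direction.\<close>

definition eta :: "'o \<Rightarrow> 'a" where
  "eta = (\<lambda>b\<in>obj S. E [std_obj M (dec b)] (dec b) (ide M (std_obj M (dec b))))"

definition eta' :: "'o \<Rightarrow> 'a" where
  "eta' = (\<lambda>b\<in>obj S. E (dec b) [std_obj M (dec b)] (ide M (std_obj M (dec b))))"

lemma eta_simps [simp]:
  "xs \<in> lists (obj M) \<Longrightarrow> eta (enc xs) = E [std_obj M xs] xs (ide M (std_obj M xs))"
  "xs \<in> lists (obj M) \<Longrightarrow> eta' (enc xs) = E xs [std_obj M xs] (ide M (std_obj M xs))"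
  by (simp_all add: eta_def eta'_def)

abbreviation "FG \<equiv> mf_comp S S Ff Gf"

lemma FG_simps:
  assumes "xs \<in> lists (obj M)" "ys \<in> lists (obj M)"
  shows "fobj FG (enc xs) = enc [std_obj M xs]"
    and "mf2 FG (enc xs, enc ys) = E [std_obj M xs, std_obj M ys] [std_obj M (xs @ ys)] (phi M xs
        ys)"
    and "hom [std_obj M xs, std_obj M ys] [std_obj M (xs @ ys)] (phi M xs ys)"
proof -
  have h: "hom [std_obj M xs, std_obj M ys] [std_obj M xs \<odot> std_obj M ys] (ide M (std_obj M xs \<odot>
      std_obj M ys))"
    "hom [std_obj M xs \<odot> std_obj M ys] [std_obj M (xs @ ys)] (phi M xs ys)" using assms
        by simp_all
  from hom_cmp[OF this] show "hom [std_obj M xs, std_obj M ys] [std_obj M (xs @ ys)] (phi M xs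
      ys)"
    using assms by simp
  show "fobj FG (enc xs) = enc [std_obj M xs]" using assms by simp
  show "mf2 FG (enc xs, enc ys) = E [std_obj M xs, std_obj M ys] [std_obj M (xs @ ys)] (phi M xs
      ys)"
    using assms h by simp
qed

lemma FG_arr: "hom xs ys f \<Longrightarrow> farr FG (E xs ys f) = E [std_obj M xs] [std_obj M ys] f"
  by (simp add: homD)

lemma FG_mf0: "mf0 FG = E [] [I] (ide M I)"
proof -
  have "hom [I] [I] (ide M I)" by simp
  then show ?thesis by simp
qed

lemma monoidal_functor_FG: "monoidal_functor S S FG"
proof -
  interpret c: mf_composite S M S Gf Ff by unfold_locales
  show ?thesis by (rule c.monoidal_functor_H)
qed

text \<open>On the side of the two singletons \<open>phi\<close> is an identity, so tensoring two
  components of \<open>eta\<close> or \<open>eta'\<close> leaves just the reassociation of the lists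
  or its inverse. This is the tensor compatibility of both transformations.\<close>

lemma bx_std:
  assumes "xs \<in> lists (obj M)" "ys \<in> lists (obj M)"
  shows "bx [std_obj M xs] xs [std_obj M ys] ys (ide M (std_obj M xs)) (ide M (std_obj M ys)) =
      phi M xs ys" (is ?A)
    and "bx xs [std_obj M xs] ys [std_obj M ys] (ide M (std_obj M xs)) (ide M (std_obj M ys)) =
        inv_arr M (phi M xs ys)" (is ?B)
    and "hom [std_obj M xs, std_obj M ys] (xs @ ys) (phi M xs ys)"
    and "hom (xs @ ys) [std_obj M xs, std_obj M ys] (inv_arr M (phi M xs ys))"
proof -
  have i: "iso_arr M (phi M xs ys)" using assms by simp
  show h: "hom [std_obj M xs, std_obj M ys] (xs @ ys) (phi M xs ys)"
    "hom (xs @ ys) [std_obj M xs, std_obj M ys] (inv_arr M (phi M xs ys))"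
    by (rule homI; use assms iso_simps[OF i] in simp)+
  show ?A by (rule bx_unique) (use assms h in simp_all)
  show ?B by (rule bx_unique) (use assms h iso_simps[OF i] in simp_all)
qed

lemma eta_transformation: "monoidal_transformation S S FG (mf_id S) eta"
proof -
  interpret FG: monoidal_functor S S FG by (rule monoidal_functor_FG)
  interpret IS: monoidal_functor S S "mf_id S" by (rule monoidal_functor_id) unfold_locales
  interpret nat_trans S S FG "mf_id S" eta
  proof (rule nat_transI)
    fix b assume "b \<in> obj S"
    then show "eta b \<in> arr S \<and> src S (eta b) = fobj FG b \<and> tgt S (eta b) = fobj (mf_id S) b"
      by (elim obj_cases) (simp add: FG_simps del: mf_comp_simps)
  next
    fix a assume "a \<in> arr S"
    then obtain xs ys f where a: "hom xs ys f" "a = E xs ys f" by (rule arr_cases)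
    have "hom [std_obj M xs] [std_obj M ys] f" using homD[OF a(1)] by simp
    then show "eta (tgt S a) \<cdot>\<^bsub>S\<^esub> farr FG a = farr (mf_id S) a \<cdot>\<^bsub>S\<^esub> eta (src S a)"
      using a homD[OF a(1)] by (simp add: FG_arr del: mf_comp_simps)
  qed (unfold_locales, simp add: eta_def)
  show ?thesis
  proof
    fix x y assume "x \<in> obj S" "y \<in> obj S"
    then obtain xs ys where *: "xs \<in> lists (obj M)" "x = enc xs" "ys \<in> lists (obj M)" "y = enc ys"
      by (elim obj_cases) simp
    note b = bx_std[OF *(1,3)] and f = FG_simps[OF *(1,3)]
    have i: "hom [std_obj M (xs @ ys)] (xs @ ys) (ide M (std_obj M (xs @ ys)))"
        "hom (xs @ ys) (xs @ ys) (ide M (std_obj M (xs @ ys)))"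
      using * by simp_all
    show "eta (x \<odot>\<^bsub>S\<^esub> y) \<cdot>\<^bsub>S\<^esub> mf2 FG (x, y) = mf2 (mf_id S) (x, y) \<cdot>\<^bsub>S\<^esub> (eta x \<star>\<^bsub>S\<^esub> eta y)"
      using * b f i by (simp del: mf_comp_simps)
  next
    have "hom [I] [] (ide M I)" "hom [] [] (ide M I)" by (auto intro!: homI)
    then show "eta (munit S) \<cdot>\<^bsub>S\<^esub> mf0 FG = mf0 (mf_id S)"
      unfolding FG_mf0 by simp
  qed
qed

lemma eta'_transformation: "monoidal_transformation S S (mf_id S) FG eta'"
proof -
  interpret FG: monoidal_functor S S FG by (rule monoidal_functor_FG)
  interpret IS: monoidal_functor S S "mf_id S" by (rule monoidal_functor_id) unfold_locales
  interpret nat_trans S S "mf_id S" FG eta'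
  proof (rule nat_transI)
    fix b assume "b \<in> obj S"
    then show "eta' b \<in> arr S \<and> src S (eta' b) = fobj (mf_id S) b \<and> tgt S (eta' b) = fobj FG b"
      by (elim obj_cases) (simp add: FG_simps del: mf_comp_simps)
  next
    fix a assume "a \<in> arr S"
    then obtain xs ys f where a: "hom xs ys f" "a = E xs ys f" by (rule arr_cases)
    have "hom [std_obj M xs] [std_obj M ys] f" using homD[OF a(1)] by simp
    then show "eta' (tgt S a) \<cdot>\<^bsub>S\<^esub> farr (mf_id S) a = farr FG a \<cdot>\<^bsub>S\<^esub> eta' (src S a)"
      using a homD[OF a(1)] by (simp add: FG_arr del: mf_comp_simps)
  qed (unfold_locales, simp add: eta'_def)
  show ?thesis
  proof
    fix x y assume "x \<in> obj S" "y \<in> obj S"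
    then obtain xs ys where *: "xs \<in> lists (obj M)" "x = enc xs" "ys \<in> lists (obj M)" "y = enc ys"
      by (elim obj_cases) simp
    note b = bx_std[OF *(1,3)] and f = FG_simps[OF *(1,3)]
    have i: "hom (xs @ ys) [std_obj M (xs @ ys)] (ide M (std_obj M (xs @ ys)))"
        "hom (xs @ ys) (xs @ ys) (ide M (std_obj M (xs @ ys)))"
      "iso_arr M (phi M xs ys)"
      using * by simp_all
    show "eta' (x \<odot>\<^bsub>S\<^esub> y) \<cdot>\<^bsub>S\<^esub> mf2 (mf_id S) (x, y) = mf2 FG (x, y) \<cdot>\<^bsub>S\<^esub> (eta' x \<star>\<^bsub>S\<^esub> eta' y)"
      using * b f i iso_simps[OF i(3)] by (simp del: mf_comp_simps)
  next
    have "hom [] [I] (ide M I)" "hom [] [] (ide M I)" by (auto intro!: homI)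
    then show "eta' (munit S) \<cdot>\<^bsub>S\<^esub> mf0 (mf_id S) = mf0 FG"
      unfolding FG_mf0 by simp
  qed
qed

lemma equivalent_S: "equivalent (WkLMonCat L) M S"
proof -
  interpret W: two_category "WkLMonCat L" by (rule two_category_WkLMonCat)
  have M: "weak_L_monoidal_category L M" by (rule weak_L_monoidal_category_axioms)
  \<comment> \<open>By \<open>GF_eq\<close> one composite is already the identity 1-cell, so the
    identity 2-cell suffices there; \<open>eta\<close> and \<open>eta'\<close> handle the
    other.\<close>
  have idM: "iso_cell1 (WkLMonCat L) M M (mf_id M) (mf_id M)"
    unfolding iso_cell1_def WkLMonCat_simps
    using weak_functor_id[OF M] monoidal_transformation_id[OF weak_functorD(1)[OF
        weak_functor_id[OF M]]]
    by (intro bexI[of _ "nt_id M M (mf_id M)"])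
      (auto simp: WkLMonCat_simps nt_vcomp_id(1)[OF monoidal_transformation_nat])
  have FGw: "weak_L_monoidal_functor L S S FG" by (rule weak_functor_comp[OF weak_Gf weak_Ff])
  have c: "xs \<in> lists (obj M) \<Longrightarrow> hom xs [std_obj M xs] (ide M (std_obj M xs)) \<and>
      hom [std_obj M xs] xs (ide M (std_obj M xs))" for xs
    by simp
  have v1: "nt_vcomp S S eta' eta = nt_id S S FG"
    unfolding nt_vcomp_def nt_id_def
    by (rule restrict_ext, elim obj_cases) (simp add: FG_simps del: mf_comp_simps)
  have v2: "nt_vcomp S S eta eta' = nt_id S S (mf_id S)"
    unfolding nt_vcomp_def nt_id_def
    by (rule restrict_ext, elim obj_cases) simp
  have idS: "iso_cell1 (WkLMonCat L) S S FG (mf_id S)"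
    unfolding iso_cell1_def
    by (intro bexI[of _ eta] bexI[of _ eta'])
      (simp_all add: WkLMonCat_simps v1 v2 FGw weak_functor_id[OF weak_S] eta_transformation
          eta'_transformation)
  show ?thesis
    unfolding equivalent_def WkLMonCat_simps
    by (intro conjI M weak_S bexI[of _ Ff] bexI[of _ Gf])
      (simp_all add: WkLMonCat_simps GF_eq idM idS weak_Ff weak_Gf)
qed

end

text \<open>Injections of lists into the two carrier types provide the encodings. Objects cannot be
  put into the arrow type directly, so endpoints enter the arrow codes through identity
  arrows.\<close>

lemma (in action_operad) ex_strict_equivalent:
  fixes M :: "('o::infinite, 'a::infinite, 'g) wk_mon_cat"
  assumes M: "weak_L_monoidal_category L M"
  shows "\<exists>S :: ('o, 'a, 'g) wk_mon_cat. weak_L_monoidal_category L S \<and> strict_monoidal S \<and>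
      equivalent (WkLMonCat L) M S"
proof -
  interpret weak_op L M using M action_operad_axioms by (simp add: weak_op_def)
  obtain enc :: "'o list \<Rightarrow> 'o" where enc: "inj enc" using ex_inj_lists by blast
  obtain j :: "'a list \<Rightarrow> 'a" where j: "inj j" using ex_inj_lists by blast
  \<comment> \<open>The lists of identities are coded as single arrows by the inner uses of
    \<open>j\<close>, and the outer one codes the resulting list of three arrows.\<close>
  let ?ea = "\<lambda>(xs, ys, f). j [j (map (ide M) xs), j (map (ide M) ys), f]"
  interpret strictification L M enc ?ea
  proof unfold_locales
    show "inj_on enc (lists (obj M))" using enc by (rule inj_on_subset) simp
    \<comment> \<open>Taking sources recovers a list of objects from its list of identities.\<close>
    have inj: "xs = ys" if "map (ide M) xs = map (ide M) ys" "xs \<in> lists (obj M)"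
        "ys \<in> lists (obj M)" for xs ys
      using that map_src_ide[of xs] map_src_ide[of ys] by (metis map_map)
    show "inj_on ?ea {(xs, ys, f). xs \<in> lists (obj M) \<and> ys \<in> lists (obj M) \<and>
        f \<in> homset M (std_obj M xs) (std_obj M ys)}"
    proof (rule inj_onI, elim CollectE case_prodE conjE, simp only: prod.case)
      fix xs ys f xs' ys' f'
      assume l: "xs \<in> lists (obj M)" "ys \<in> lists (obj M)" "xs' \<in> lists (obj M)"
          "ys' \<in> lists (obj M)"
        and "j [j (map (ide M) xs), j (map (ide M) ys), f] =
            j [j (map (ide M) xs'), j (map (ide M) ys'), f']"
      then have "map (ide M) xs = map (ide M) xs'" "map (ide M) ys = map (ide M) ys'" "f = f'"
        using j by (simp_all add: inj_eq)
      then show "(xs, ys, f) = (xs', ys', f')" using inj l by simp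
    qed
  qed
  show ?thesis using weak_S monoidal_S equivalent_S by blast
qed

theorem theorem13p15:
  fixes L :: "'g action_operad_data"
    and K :: "(('o::infinite, 'a::infinite, 'g) el_alg, ('o, 'a, 'o, 'a) fctr, 'o \<Rightarrow> 'a) two_cat"
    and W :: "(('o, 'a, 'g) wk_mon_cat, ('o, 'a) mon_fctr, 'o \<Rightarrow> 'a) two_cat"
  assumes "action_operad L"
    and "K = LMonCat L"
    and "W = WkLMonCat L"
  shows "inclusion_two_functor K W (incl L) \<and>
         tf0 (incl L) ` cell0 K = {M \<in> cell0 W. strict_monoidal M} \<and>
         (\<forall>M \<in> cell0 W. \<exists>X \<in> cell0 K. equivalent W M (tf0 (incl L) X))"
proof -
  interpret action_operad L by fact
  have cells: "cell0 K = {X. el_algebra L X}" "cell0 W = {M. weak_L_monoidal_category L M}"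
    using assms(2,3) by (simp_all add: LMonCat_def WkLMonCat_def)
  have image: "tf0 (incl L) ` cell0 K = {M \<in> cell0 W. strict_monoidal M}"
    using incl0_image by (simp add: cells incl_def)
  moreover have "\<exists>X \<in> cell0 K. equivalent W M (tf0 (incl L) X)" if "M \<in> cell0 W" for M
  proof -
    from that have "weak_L_monoidal_category L M" by (simp add: cells)
    from ex_strict_equivalent[OF this] obtain S :: "('o, 'a, 'g) wk_mon_cat"
      where "weak_L_monoidal_category L S" "strict_monoidal S" and eq: "equivalent W M S"
      unfolding assms(3) by blast
    \<comment> \<open>Strictness places the strictification in the image described by the first
      part, which provides the algebra \<open>X\<close>.\<close>
    then have "S \<in> {M \<in> cell0 W. strict_monoidal M}" by (simp add: cells)
    then obtain X where "X \<in> cell0 K" "S = tf0 (incl L) X" unfolding image[symmetric] by blast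
    with eq show ?thesis by blast
  qed
  ultimately show ?thesis using two_functor_incl assms(2,3) by simp
qed

end
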